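(* Let $u^0\equiv0$ and $f(x,t)=t^\mu g(x,t)$ with $-1<\mu<0$, where $g\in W^{1,\infty}(0,T;L^2(\Omega))$, $\int_0^t(t-\zeta)^{\alpha-1}\zeta^\mu\|g''(\zeta)\|\,d\zeta<\infty$ and $\int_0^t\zeta^{\frac{\mu-1}{2}}\|g''(\zeta)\|\,d\zeta<\infty$ for $t\in(0,T]$. Let $u_h$ be the solution of the semidiscrete finite element problem and let $\tilde u_h^n$ be the solution of the fully discrete scheme (CN-II) with step size $\tau=T/N$ (both defined in the context). Then there is a constant $c>0$, independent of $\tau$, $n$, $h$ and $g$, such that for $1\le n\le N$ $$\|u_h(t_n)-\tilde u_h^n\|\le c\,\tau^2\Big(t_n^{\alpha+\mu-2}\|g(0)\|+t_n^{\alpha+\mu-1}\|g'(0)\|+\int_0^{t_n}(t_n-\zeta)^{\alpha-1}\zeta^\mu\|g''(\zeta)\|\,d\zeta+t_n^{\alpha+\frac{\mu-1}{2}}\int_0^{t_n}\zeta^{\frac{\mu-1}{2}}\|g''(\zeta)\|\,d\zeta\Big).$$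
   Context: Let $0<\alpha<1$, $T>0$, and let $\Omega\subset\mathbb{R}^d$ ($d=1,2$) be a bounded domain. $A$ is a self-adjoint positive definite second-order elliptic partial differential operator in $\Omega$ with homogeneous Dirichlet boundary condition, with associated bilinear form $A(\cdot,\cdot)$. $(\cdot,\cdot)$ and $\|\cdot\|$ are the inner product and norm of $L^2(\Omega)$. The underlying problem is ${}^{C}D_t^\alpha u+Au=f$ in $\Omega\times(0,T]$, $u=0$ on $\partial\Omega\times(0,T]$, $u(0)=u^0$, where ${}^{C}D_t^{\alpha}u(t)=\frac{1}{\Gamma(1-\alpha)}\int_0^t(t-\zeta)^{-\alpha}u'(\zeta)\,d\zeta$ is the Caputo derivative. Primes on $g$ denote time derivatives, and $g(t)$ abbreviates $g(\cdot,t)$; $g$ has the Taylor expansion $g(t)=g(0)+tg'(0)+\int_0^t(t-\zeta)g''(\zeta)\,d\zeta$. Semidiscrete problem. $X_h\subset H_0^1(\Omega)$ is the space of continuous piecewise linear finite elements on a regular triangulation of $\Omega$ of maximal diameter $h$; $P_h:L^2(\Omega)\to X_h$ is the $L^2$-projection; $A_h:X_h\to X_h$ is defined by $(A_h\varphi,\psi)=A(\varphi,\psi)$ for all $\varphi,\psi\in X_h$; $f_h=P_hf$. $u_h$ solves ${}^{C}D_t^\alpha u_h(t)+A_hu_h(t)=f_h(t)$ for $t>0$, $u_h(0)=P_hu^0$; when $u^0=0$ this solution is given by $u_h(t)=\int_0^tE_h(t-s)f_h(s)\,ds$, where $E_h(t)=\frac1{2\pi i}\int_{\sigma-i\infty}^{\sigma+i\infty}e^{st}(s^\alpha+A_h)^{-1}ds$,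 $\sigma>0$ (the contour may be deformed to one going to infinity along the rays $\arg s=\pm\vartheta$ for any $\vartheta\in(\pi/2,\pi)$). Scheme (CN-II). Let $N\in\mathbb{N}$, $\tau=T/N$, $t_n=n\tau$. Let $F_h(t)=\int_0^tf_h(\xi)\,d\xi$, $\tilde F_h(t)=\int_0^tF_h(\xi)\,d\xi$ and $\tilde F_h^n=\tilde F_h(t_n)$. Let $\sigma_0=1$, $\sigma_j=(1-\frac{\alpha+1}{j})\sigma_{j-1}$ for $j\ge1$, i.e. $\sum_{j\ge0}\sigma_jz^j=(1-z)^\alpha$. Let $D_\tau$ be the second-order BDF operator $D_\tau\varphi(t)=\frac1\tau\big(\frac32\varphi(t)-2\varphi(t-\tau)+\frac12\varphi(t-2\tau)\big)$, with $D_\tau\tilde F_h^n=D_\tau\tilde F_h(t_n)$; all functions (including $t^{2-\alpha}$, $\tilde F_h$, $\tilde U_h$) are taken to be $0$ for $t\le0$, so $\tilde U_h^{0}=\tilde U_h^{-1}=0$. For $n=1,\dots,N$ the scheme determines $\tilde U_h^n,\tilde u_h^n\in X_h$ by $$\tau^{-\alpha}\sum_{j=0}^{n}\sigma_j\tilde U_h^{n-j}+(1-\tfrac\alpha2)A_h\tilde U_h^n+\tfrac\alpha2A_h\tilde U_h^{n-1}=(1-\tfrac\alpha2)D_\tau\tilde F_h^n+\tfrac\alpha2D_\tau\tilde F_h^{n-1}+(1-\tfrac\alpha2)D_\tau\frac{t_n^{2-\alpha}}{\Gamma(3-\alpha)}u_h(0)+\tfrac\alpha2D_\tau\frac{t_{n-1}^{2-\alpha}}{\Gamma(3-\alpha)}u_h(0),$$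 $$\tilde u_h^n=\frac1\tau\Big(\frac32\tilde U_h^n-2\tilde U_h^{n-1}+\frac12\tilde U_h^{n-2}\Big).$$ *)

theory Defs
  imports "HOL-Complex_Analysis.Complex_Analysis"
begin

section \<open>\<open>L\<^sup>2(\<Omega>)\<close> and \<open>L\<^sup>2(\<Omega>)\<close>-valued functions of time\<close>

text \<open>Elements of \<open>L\<^sup>2(\<Omega>)\<close> are represented by functions; equality in \<open>L\<^sup>2(\<Omega>)\<close> is
  \<open>norm2 \<Omega> (v - w) = 0\<close>.\<close>

definition L2 :: "(real^'d) set \<Rightarrow> (real^'d \<Rightarrow> real) set" where
  "L2 \<Omega> = {v \<in> borel_measurable (lebesgue_on \<Omega>). integrable (lebesgue_on \<Omega>) (\<lambda>x. (v x)\<^sup>2)}"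

definition inner2 :: "(real^'d) set \<Rightarrow> (real^'d \<Rightarrow> real) \<Rightarrow> (real^'d \<Rightarrow> real) \<Rightarrow> real" where
  "inner2 \<Omega> v w = (LINT x|lebesgue_on \<Omega>. v x * w x)"

definition norm2 :: "(real^'d) set \<Rightarrow> (real^'d \<Rightarrow> real) \<Rightarrow> real" where
  "norm2 \<Omega> v = sqrt (inner2 \<Omega> v v)"

text \<open>The Bochner integral of \<open>w : [a,b] \<rightarrow> L\<^sup>2(\<Omega>)\<close>, by approximation with simple functions. This
  repeats the construction of \<open>has_bochner_integral\<close>, which is not applicable here because
  \<open>L\<^sup>2(\<Omega>)\<close> is not a type.\<close>

definition L2_simple :: "(real^'d) set \<Rightarrow> real \<Rightarrow> real \<Rightarrow> (real \<Rightarrow> real^'d \<Rightarrow> real) \<Rightarrow> bool" where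
  "L2_simple \<Omega> a b s \<longleftrightarrow> finite (s ` {a..b}) \<and> s ` {a..b} \<subseteq> L2 \<Omega> \<and>
     (\<forall>y. {t \<in> {a..b}. s t = y} \<in> sets lebesgue)"

definition L2_simple_integral :: "real \<Rightarrow> real \<Rightarrow> (real \<Rightarrow> real^'d \<Rightarrow> real) \<Rightarrow> real^'d \<Rightarrow> real" where
  "L2_simple_integral a b s x = (\<Sum>y\<in>s ` {a..b}. measure lebesgue {t \<in> {a..b}. s t = y} * y x)"

definition has_L2_integral ::
  "(real^'d) set \<Rightarrow> (real \<Rightarrow> real^'d \<Rightarrow> real) \<Rightarrow> real \<Rightarrow> real \<Rightarrow> (real^'d \<Rightarrow> real) \<Rightarrow> bool" where
  "has_L2_integral \<Omega> w a b v \<longleftrightarrow> v \<in> L2 \<Omega> \<and> (\<forall>t\<in>{a..b}. w t \<in> L2 \<Omega>) \<and>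
     (\<exists>s. (\<forall>k::nat. L2_simple \<Omega> a b (s k)) \<and>
        (\<forall>k. (\<lambda>t. norm2 \<Omega> (\<lambda>x. w t x - s k t x)) absolutely_integrable_on {a..b}) \<and>
        (\<lambda>k. integral {a..b} (\<lambda>t. norm2 \<Omega> (\<lambda>x. w t x - s k t x))) \<longlonglongrightarrow> 0 \<and>
        (\<lambda>k. norm2 \<Omega> (\<lambda>x. L2_simple_integral a b (s k) x - v x)) \<longlonglongrightarrow> 0)"

text \<open>\<open>w'\<close> is the (weak) time derivative of \<open>w\<close>, and it is Bochner integrable:
  \<open>w(t) = w(0) + \<integral>\<^sub>0\<^sup>t w'(\<zeta>) d\<zeta>\<close> on \<open>[0,T]\<close>. Thus \<open>w\<close> is the absolutely continuous
  representative of an element of \<open>W\<^sup>1\<^sup>,\<^sup>1(0,T;L\<^sup>2(\<Omega>))\<close>, and \<open>w(0)\<close> is meaningful.\<close>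

definition L2_time_deriv ::
  "(real^'d) set \<Rightarrow> real \<Rightarrow> (real \<Rightarrow> real^'d \<Rightarrow> real) \<Rightarrow> (real \<Rightarrow> real^'d \<Rightarrow> real) \<Rightarrow> bool" where
  "L2_time_deriv \<Omega> T w w' \<longleftrightarrow> (\<forall>t\<in>{0..T}. w t \<in> L2 \<Omega>) \<and>
     (\<forall>t\<in>{0..T}. has_L2_integral \<Omega> w' 0 t (\<lambda>x. w t x - w 0 x))"

text \<open>\<open>w \<in> W\<^sup>1\<^sup>,\<^sup>\<infinity>(0,T;L\<^sup>2(\<Omega>))\<close> with weak derivative \<open>w'\<close>.\<close>

definition W1inf ::
  "(real^'d) set \<Rightarrow> real \<Rightarrow> (real \<Rightarrow> real^'d \<Rightarrow> real) \<Rightarrow> (real \<Rightarrow> real^'d \<Rightarrow> real) \<Rightarrow> bool" where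
  "W1inf \<Omega> T w w' \<longleftrightarrow> L2_time_deriv \<Omega> T w w' \<and>
     (\<exists>C. AE t in lebesgue_on {0..T}. norm2 \<Omega> (w t) \<le> C \<and> norm2 \<Omega> (w' t) \<le> C)"


section \<open>\<open>H\<^sub>0\<^sup>1(\<Omega>)\<close> and the elliptic operator\<close>

definition partial :: "'d \<Rightarrow> (real^'d \<Rightarrow> real) \<Rightarrow> real^'d \<Rightarrow> real" where
  "partial i \<phi> x = frechet_derivative \<phi> (at x) (axis i 1)"

definition test_function :: "(real^'d) set \<Rightarrow> (real^'d \<Rightarrow> real) \<Rightarrow> bool" where
  "test_function \<Omega> \<phi> \<longleftrightarrow> (\<forall>is. foldr partial is \<phi> differentiable_on UNIV) \<and>
     (\<exists>K. compact K \<and> K \<subseteq> \<Omega> \<and> (\<forall>x. x \<notin> K \<longrightarrow> \<phi> x = 0))"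

text \<open>\<open>H\<^sub>0\<^sup>1(\<Omega>)\<close> is the closure of the test functions in the \<open>H\<^sup>1\<close> norm. The limit \<open>G\<close> of the
  gradients is the weak gradient of \<open>u\<close> and is unique up to null sets.\<close>

definition has_H10_gradient ::
  "(real^'d) set \<Rightarrow> (real^'d \<Rightarrow> real) \<Rightarrow> (real^'d \<Rightarrow> real^'d) \<Rightarrow> bool" where
  "has_H10_gradient \<Omega> u G \<longleftrightarrow> u \<in> L2 \<Omega> \<and> (\<forall>i. (\<lambda>x. G x $ i) \<in> L2 \<Omega>) \<and>
     (\<exists>\<phi>. (\<forall>k::nat. test_function \<Omega> (\<phi> k)) \<and>
        (\<lambda>k. norm2 \<Omega> (\<lambda>x. \<phi> k x - u x)) \<longlonglongrightarrow> 0 \<and>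
        (\<forall>i. (\<lambda>k. norm2 \<Omega> (\<lambda>x. partial i (\<phi> k) x - G x $ i)) \<longlonglongrightarrow> 0))"

definition H10 :: "(real^'d) set \<Rightarrow> (real^'d \<Rightarrow> real) set" where
  "H10 \<Omega> = {u. \<exists>G. has_H10_gradient \<Omega> u G}"

definition grad :: "(real^'d) set \<Rightarrow> (real^'d \<Rightarrow> real) \<Rightarrow> real^'d \<Rightarrow> real^'d" where
  "grad \<Omega> u = (SOME G. has_H10_gradient \<Omega> u G)"

text \<open>The bilinear form of \<open>A u = - div (a \<nabla>u) + c0 u\<close>, the general form of a formally self-adjoint
  second-order operator with real coefficients.\<close>

definition bilin ::
  "(real^'d) set \<Rightarrow> (real^'d \<Rightarrow> real^'d^'d) \<Rightarrow> (real^'d \<Rightarrow> real) \<Rightarrow>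
   (real^'d \<Rightarrow> real) \<Rightarrow> (real^'d \<Rightarrow> real) \<Rightarrow> real" where
  "bilin \<Omega> a c0 u v =
     (LINT x|lebesgue_on \<Omega>. (a x *v grad \<Omega> u x) \<bullet> grad \<Omega> v x + c0 x * u x * v x)"

definition elliptic_operator ::
  "(real^'d) set \<Rightarrow> (real^'d \<Rightarrow> real^'d^'d) \<Rightarrow> (real^'d \<Rightarrow> real) \<Rightarrow> bool" where
  "elliptic_operator \<Omega> a c0 \<longleftrightarrow>
     (\<forall>i j. (\<lambda>x. a x $ i $ j) \<in> borel_measurable (lebesgue_on \<Omega>)) \<and>
     c0 \<in> borel_measurable (lebesgue_on \<Omega>) \<and>
     (\<exists>M. \<forall>x\<in>\<Omega>. (\<forall>i j. \<bar>a x $ i $ j\<bar> \<le> M) \<and> \<bar>c0 x\<bar> \<le> M) \<and>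
     (\<forall>x\<in>\<Omega>. transpose (a x) = a x) \<and>
     (\<exists>\<theta>>0. \<forall>x\<in>\<Omega>. \<forall>\<xi>. (a x *v \<xi>) \<bullet> \<xi> \<ge> \<theta> * (norm \<xi>)\<^sup>2) \<and>
     (\<exists>\<gamma>>0. \<forall>v\<in>H10 \<Omega>. bilin \<Omega> a c0 v v \<ge> \<gamma> * (norm2 \<Omega> v)\<^sup>2)"


section \<open>The finite element space and the discrete operators\<close>

text \<open>\<^const>\<open>triangulation\<close> is a face-to-face simplicial complex. Regularity is the usual
  non-degeneracy condition: each simplex \<open>K\<close> contains a ball of radius at least
  \<open>diam K / \<kappa>\<close>, so that \<open>\<kappa>\<close> is the parameter common to a regular family.\<close>

definition regular_triangulation ::
  "real \<Rightarrow> (real^'d) set \<Rightarrow> real \<Rightarrow> (real^'d) set set \<Rightarrow> bool" where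
  "regular_triangulation \<kappa> \<Omega> h \<T> \<longleftrightarrow> triangulation \<T> \<and>
     (\<forall>K\<in>\<T>. int CARD('d) simplex K) \<and> \<Union>\<T> = closure \<Omega> \<and>
     h = Max (diameter ` \<T>) \<and>
     (\<forall>K\<in>\<T>. \<exists>x r. cball x r \<subseteq> K \<and> diameter K \<le> \<kappa> * r)"

text \<open>Finite element functions are extended by 0 to the whole space, which makes the elements of
  \<open>X\<^sub>h\<close> genuine functions (no null-set ambiguity).\<close>

definition fe_space :: "(real^'d) set \<Rightarrow> (real^'d) set set \<Rightarrow> (real^'d \<Rightarrow> real) set" where
  "fe_space \<Omega> \<T> = {v \<in> H10 \<Omega>. continuous_on UNIV v \<and> (\<forall>x. x \<notin> \<Omega> \<longrightarrow> v x = 0) \<and>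
     (\<forall>K\<in>\<T>. \<exists>p q. \<forall>x\<in>K. v x = p + q \<bullet> x)}"

definition L2_proj ::
  "(real^'d) set \<Rightarrow> (real^'d \<Rightarrow> real) set \<Rightarrow> (real^'d \<Rightarrow> real) \<Rightarrow> (real^'d \<Rightarrow> real)" where
  "L2_proj \<Omega> X v = (THE w. w \<in> X \<and> (\<forall>\<psi>\<in>X. inner2 \<Omega> w \<psi> = inner2 \<Omega> v \<psi>))"

definition discrete_op ::
  "(real^'d) set \<Rightarrow> (real^'d \<Rightarrow> real^'d^'d) \<Rightarrow> (real^'d \<Rightarrow> real) \<Rightarrow> (real^'d \<Rightarrow> real) set \<Rightarrow>
   (real^'d \<Rightarrow> real) \<Rightarrow> (real^'d \<Rightarrow> real)" where
  "discrete_op \<Omega> a c0 X \<phi> = (THE w. w \<in> X \<and> (\<forall>\<psi>\<in>X. inner2 \<Omega> w \<psi> = bilin \<Omega> a c0 \<phi> \<psi>))"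


section \<open>The semidiscrete problem\<close>

definition caputo :: "real \<Rightarrow> (real \<Rightarrow> real) \<Rightarrow> real \<Rightarrow> real" where
  "caputo \<alpha> u t =
     1 / Gamma (1 - \<alpha>) * integral {0..t} (\<lambda>\<zeta>. (t - \<zeta>) powr (- \<alpha>) * deriv u \<zeta>)"

definition caputo_solution ::
  "(real^'d \<Rightarrow> real) set \<Rightarrow> ((real^'d \<Rightarrow> real) \<Rightarrow> (real^'d \<Rightarrow> real)) \<Rightarrow> real \<Rightarrow> real \<Rightarrow>
   (real \<Rightarrow> real^'d \<Rightarrow> real) \<Rightarrow> (real^'d \<Rightarrow> real) \<Rightarrow> (real \<Rightarrow> real^'d \<Rightarrow> real) \<Rightarrow> bool" where
  "caputo_solution X Ah \<alpha> T fh uh0 u \<longleftrightarrow>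
     (\<forall>t\<in>{0..T}. u t \<in> X) \<and> u 0 = uh0 \<and>
     (\<forall>x. continuous_on {0..T} (\<lambda>t. u t x)) \<and>
     (\<forall>x. \<forall>t\<in>{0<..<T}. (\<lambda>t. u t x) differentiable (at t)) \<and>
     (\<forall>x. \<forall>t\<in>{0<..T}. (\<lambda>\<zeta>. (t - \<zeta>) powr (- \<alpha>) * deriv (\<lambda>t. u t x) \<zeta>)
        absolutely_integrable_on {0..t}) \<and>
     (\<forall>x. \<forall>t\<in>{0<..T}. caputo \<alpha> (\<lambda>t. u t x) t + Ah (u t) x = fh t x)"

text \<open>\<open>(z + A\<^sub>h)\<^sup>-\<^sup>1 \<phi>\<close> for complex \<open>z\<close>, in the complexification of \<open>X\<^sub>h\<close>.\<close>

definition resolvent ::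
  "(real^'d \<Rightarrow> real) set \<Rightarrow> ((real^'d \<Rightarrow> real) \<Rightarrow> (real^'d \<Rightarrow> real)) \<Rightarrow>
   complex \<Rightarrow> (real^'d \<Rightarrow> real) \<Rightarrow> (real^'d \<Rightarrow> complex)" where
  "resolvent X Ah z \<phi> = (THE w. (\<lambda>x. Re (w x)) \<in> X \<and> (\<lambda>x. Im (w x)) \<in> X \<and>
     (\<forall>x. z * w x + Complex (Ah (\<lambda>x. Re (w x)) x) (Ah (\<lambda>x. Im (w x)) x) = of_real (\<phi> x)))"

text \<open>\<open>E\<^sub>h(t)\<phi>\<close> as a Bromwich integral. The integral over the vertical line converges only
  conditionally, hence the symmetric limit. Its value is real by conjugate symmetry; \<^const>\<open>Re\<close>
  only changes the type.\<close>

definition E_op ::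
  "(real^'d \<Rightarrow> real) set \<Rightarrow> ((real^'d \<Rightarrow> real) \<Rightarrow> (real^'d \<Rightarrow> real)) \<Rightarrow> real \<Rightarrow> real \<Rightarrow>
   real \<Rightarrow> (real^'d \<Rightarrow> real) \<Rightarrow> (real^'d \<Rightarrow> real)" where
  "E_op X Ah \<alpha> \<sigma> t \<phi> x = Re (1 / (2 * of_real pi * \<i>) *
     Lim at_top (\<lambda>R. contour_integral (linepath (Complex \<sigma> (- R)) (Complex \<sigma> R))
       (\<lambda>s. exp (s * of_real t) * resolvent X Ah (s powr of_real \<alpha>) \<phi> x)))"

definition duhamel_solution ::
  "(real^'d \<Rightarrow> real) set \<Rightarrow> ((real^'d \<Rightarrow> real) \<Rightarrow> (real^'d \<Rightarrow> real)) \<Rightarrow> real \<Rightarrow> real \<Rightarrow>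
   (real \<Rightarrow> real^'d \<Rightarrow> real) \<Rightarrow> (real \<Rightarrow> real^'d \<Rightarrow> real) \<Rightarrow> bool" where
  "duhamel_solution X Ah \<alpha> T fh u \<longleftrightarrow>
     (\<exists>\<sigma>>0. \<forall>t\<in>{0..T}. \<forall>x. u t x = integral {0..t} (\<lambda>s. E_op X Ah \<alpha> \<sigma> (t - s) (fh s) x))"

text \<open>The solution of the semidiscrete problem. For vanishing initial value it is given by the
  representation formula. For \<open>f = t\<^sup>\<mu> g\<close> with \<open>\<alpha> + \<mu> \<le> 0\<close> that formula is in general the only
  available meaning: it behaves like \<open>t\<^sup>\<alpha>\<^sup>+\<^sup>\<mu>\<close> near 0, so it does not tend to the initial value 0.
  Both notions are therefore admitted; where a Caputo solution exists they coincide.\<close>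

definition semidiscrete_solution ::
  "(real^'d \<Rightarrow> real) set \<Rightarrow> ((real^'d \<Rightarrow> real) \<Rightarrow> (real^'d \<Rightarrow> real)) \<Rightarrow> real \<Rightarrow> real \<Rightarrow>
   (real \<Rightarrow> real^'d \<Rightarrow> real) \<Rightarrow> (real^'d \<Rightarrow> real) \<Rightarrow> (real \<Rightarrow> real^'d \<Rightarrow> real) \<Rightarrow> bool" where
  "semidiscrete_solution X Ah \<alpha> T fh uh0 u \<longleftrightarrow>
     caputo_solution X Ah \<alpha> T fh uh0 u \<or>
     (uh0 = (\<lambda>_. 0) \<and> duhamel_solution X Ah \<alpha> T fh u)"


section \<open>The fully discrete scheme\<close>

fun cq_weight :: "real \<Rightarrow> nat \<Rightarrow> real" where
  "cq_weight \<alpha> 0 = 1"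
| "cq_weight \<alpha> (Suc j) = (1 - (\<alpha> + 1) / real (Suc j)) * cq_weight \<alpha> j"

definition bdf2 :: "real \<Rightarrow> (real \<Rightarrow> real) \<Rightarrow> real \<Rightarrow> real" where
  "bdf2 \<tau> \<phi> t = 1 / \<tau> * (3/2 * \<phi> t - 2 * \<phi> (t - \<tau>) + 1/2 * \<phi> (t - 2 * \<tau>))"

text \<open>For \<open>t \<le> 0\<close> this is 0, as the interval of integration is trivial.\<close>

definition double_integral :: "(real \<Rightarrow> real^'d \<Rightarrow> real) \<Rightarrow> real^'d \<Rightarrow> real \<Rightarrow> real" where
  "double_integral fh x t = integral {0..t} (\<lambda>\<xi>. integral {0..\<xi>} (\<lambda>s. fh s x))"

definition initial_kernel :: "real \<Rightarrow> real \<Rightarrow> real" where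
  "initial_kernel \<alpha> t = (if t \<le> 0 then 0 else t powr (2 - \<alpha>) / Gamma (3 - \<alpha>))"

text \<open>\<open>U\<close> is indexed by integers, so that the values with index \<open>\<le> 0\<close> can be prescribed as 0.\<close>

definition cn2_scheme ::
  "(real^'d \<Rightarrow> real) set \<Rightarrow> ((real^'d \<Rightarrow> real) \<Rightarrow> (real^'d \<Rightarrow> real)) \<Rightarrow> real \<Rightarrow> real \<Rightarrow> nat \<Rightarrow>
   (real \<Rightarrow> real^'d \<Rightarrow> real) \<Rightarrow> (real^'d \<Rightarrow> real) \<Rightarrow>
   (int \<Rightarrow> real^'d \<Rightarrow> real) \<Rightarrow> (nat \<Rightarrow> real^'d \<Rightarrow> real) \<Rightarrow> bool" where
  "cn2_scheme X Ah \<alpha> \<tau> N fh uh0 U u \<longleftrightarrow>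
     (\<forall>m\<le>0. U m = (\<lambda>_. 0)) \<and>
     (\<forall>n\<in>{1..N}. U (int n) \<in> X \<and>
       (\<forall>x. \<tau> powr (- \<alpha>) * (\<Sum>j\<le>n. cq_weight \<alpha> j * U (int n - int j) x)
            + (1 - \<alpha>/2) * Ah (U (int n)) x + \<alpha>/2 * Ah (U (int n - 1)) x
          = (1 - \<alpha>/2) * bdf2 \<tau> (double_integral fh x) (real n * \<tau>)
            + \<alpha>/2 * bdf2 \<tau> (double_integral fh x) ((real n - 1) * \<tau>)
            + (1 - \<alpha>/2) * bdf2 \<tau> (initial_kernel \<alpha>) (real n * \<tau>) * uh0 x
            + \<alpha>/2 * bdf2 \<tau> (initial_kernel \<alpha>) ((real n - 1) * \<tau>) * uh0 x) \<and>
       (\<forall>x. u n x = 1 / \<tau> * (3/2 * U (int n) x - 2 * U (int n - 1) x + 1/2 * U (int n - 2) x)))"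

end

theory Submission
  imports Defs "HOL-Real_Asymp.Real_Asymp"
begin

text \<open>In an \<open>L\<^sup>2\<close>-orthonormal eigenbasis of \<open>A\<^sub>h\<close>, both \<open>u\<^sub>h\<close> and the scheme are scalar convolutions
  of the data with a kernel that depends on the eigenvalue \<open>la\<close>. Both kernels are contour integrals;
  deforming the contours to the branch cut shows that their difference is at most \<open>C x\<^sup>\<alpha>\<^sup>-\<^sup>3\<close> for step
  size 1, uniformly in \<open>la > 0\<close>, and the behaviour of the Laplace transforms at 0 shows that its first
  two moments vanish. Hence its antiderivatives decay as well, and integration by parts
  bounds the error for the data \<open>t\<^sup>\<mu>\<close>, \<open>t\<^sup>\<mu>\<^sup>+\<^sup>1\<close> and \<open>t\<^sup>\<mu> (t - \<zeta>)\<^sub>+\<close>. Taylor's formula for \<open>g\<close> writes the error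
  as a superposition of these three cases.\<close>

text \<open>Mode by mode the step size enters only through \<open>la * \<tau> powr \<alpha>\<close>,
  which ranges over all positive numbers as mesh and step vary. A constant independent of
  \<open>h\<close> and \<open>\<tau>\<close> therefore requires kernel bounds free of
  \<open>la\<close>; they come from rotating the denominators into the right half-plane, where the
  \<open>la\<close> term can only help. The obstacle is the diagonal s = t: x^(\<alpha>-3) is not
  integrable at 0, so the pointwise bound cannot be integrated there, while the data are singular at
  s = 0. Two vanishing moments allow the kernel to be traded for its second antiderivative, of size
  \<open>\<tau>\<close>^2 r^(\<alpha>-1), which is integrable. The moments vanish by second-order
  consistency: the weight \<alpha>/2 of the average cancels the linear term of ((1 - exp (- s)) /
  s)^\<alpha>, and z (3 - z)^2 / 4 has derivative 0 at z = 1. The weight with exponent (\<mu> - 1)/2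
  arises from splitting s^(\<mu>-1) into two equal factors, each of which is integrable at
  0.\<close>

section \<open>Complex powers and a rectangle form of Cauchy's theorem\<close>

text \<open>The contours below run along a branch cut, so \<open>f\<close> is only continuous up to
  the boundary. A continuous function on a closed convex set that is holomorphic inside has a
  primitive relative to that set, and the fundamental theorem of calculus then evaluates each
  side.\<close>

lemma Cauchy_rectangle:
  fixes f :: "complex => complex"
  assumes le: "x1 \<le> x2" "y1 \<le> y2"
    and cont: "continuous_on (cbox (Complex x1 y1) (Complex x2 y2)) f"
    and hol: "\<And>z. z \<in> box (Complex x1 y1) (Complex x2 y2) ==> f field_differentiable at z"
  shows "integral {x1..x2} (\<lambda>x. f (Complex x y1)) + \<i> * integral {y1..y2} (\<lambda>y. f (Complex x2 y))
       = integral {x1..x2} (\<lambda>x. f (Complex x y2)) + \<i> * integral {y1..y2} (\<lambda>y. f (Complex x1 y))"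
proof -
  define S where "S = cbox (Complex x1 y1) (Complex x2 y2)"
  obtain g where g: "\<And>x. x \<in> S ==> (g has_field_derivative f x) (at x within S)"
    using holomorphic_convex_primitive[of S "{}" f] cont hol unfolding S_def
    by (metis Diff_empty convex_box(1) finite.emptyI interior_cbox)
  have H: "((\<lambda>x. f (Complex x y)) has_integral g (Complex x2 y) - g (Complex x1 y)) {x1..x2}"
    if y: "y \<in> {y1..y2}" for y
  proof (rule fundamental_theorem_of_calculus[OF le(1)])
    fix x assume x: "x \<in> {x1..x2}"
    have sub: "(\<lambda>x. Complex x y) ` {x1..x2} \<subseteq> S"
      using y by (auto simp: S_def in_cbox_complex_iff)
    have c: "((\<lambda>x. Complex x y) has_vector_derivative 1) (at x within {x1..x2})"
      unfolding Complex_eq by (auto intro!: derivative_eq_intros simp: scaleR_conv_of_real has_vector_derivative_def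
          bounded_linear_of_real)
    have "Complex x y \<in> S" using sub x by auto
    from DERIV_subset[OF g[OF this] sub]
    have "(g \<circ> (\<lambda>x. Complex x y) has_vector_derivative 1 * f (Complex x y)) (at x within {x1..x2})"
      by (intro field_vector_diff_chain_within c)
    then show "((\<lambda>x. g (Complex x y)) has_vector_derivative f (Complex x y)) (at x within {x1..x2})"
      by (simp add: o_def)
  qed
  have V: "((\<lambda>y. \<i> * f (Complex x y)) has_integral g (Complex x y2) - g (Complex x y1)) {y1..y2}"
    if x: "x \<in> {x1..x2}" for x
  proof (rule fundamental_theorem_of_calculus[OF le(2)])
    fix y assume y: "y \<in> {y1..y2}"
    have sub: "(\<lambda>y. Complex x y) ` {y1..y2} \<subseteq> S"
      using x by (auto simp: S_def in_cbox_complex_iff)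
    have c: "((\<lambda>y. Complex x y) has_vector_derivative \<i>) (at y within {y1..y2})"
      unfolding Complex_eq by (auto intro!: derivative_eq_intros simp: scaleR_conv_of_real has_vector_derivative_def
          bounded_linear_of_real mult.commute)
    have "Complex x y \<in> S" using sub y by auto
    from DERIV_subset[OF g[OF this] sub]
    have "(g \<circ> (\<lambda>y. Complex x y) has_vector_derivative \<i> * f (Complex x y)) (at y within {y1..y2})"
      by (intro field_vector_diff_chain_within c)
    then show "((\<lambda>y. g (Complex x y)) has_vector_derivative \<i> * f (Complex x y)) (at y within {y1..y2})"
      by (simp add: o_def)
  qed
  have V': "\<i> * integral {y1..y2} (\<lambda>y. f (Complex x y)) = g (Complex x y2) - g (Complex x y1)"
    if x: "x \<in> {x1..x2}" for x
    using integral_unique[OF V[OF x]] by simp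
  show ?thesis
    using integral_unique[OF H[of y1]] integral_unique[OF H[of y2]] V'[of x1] V'[of x2] le by simp
qed

text \<open>Multiplication by -i carries the closed upper half-plane to the closed right half-plane,
  which avoids the cut of the principal branch. This makes the power continuous up to the negative
  axis, approached from above.\<close>

lemma powr_upper_half_plane:
  assumes "0 \<le> Im s" "0 < \<alpha>"
  shows "s powr of_real \<alpha> = exp (\<i> * of_real (\<alpha> * pi / 2)) * (- \<i> * s) powr of_real \<alpha>"
proof (cases "s = 0")
  case False
  define w where "w = - \<i> * s"
  have s: "s = \<i> * w" and w: "w \<noteq> 0" "0 \<le> Re w" using assms False by (auto simp: w_def)
  have "Ln s = Ln w + \<i> * of_real pi / 2" using Ln_times_ii[OF w(1)] w(2) by (simp add: s)
  then show ?thesis using False w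
    unfolding powr_def w_def[symmetric] by (simp add: exp_add[symmetric] algebra_simps)
qed auto

lemma continuous_on_powr_upper_half_plane:
  fixes f :: "'a::topological_space => complex"
  assumes "continuous_on A f" "\<And>x. x \<in> A ==> 0 \<le> Im (f x)" "0 < \<alpha>"
  shows "continuous_on A (\<lambda>x. f x powr of_real \<alpha>)"
proof -
  have "continuous_on {s. 0 \<le> Im s} (\<lambda>s. exp (\<i> * of_real (\<alpha> * pi / 2)) * (- \<i> * s) powr of_real \<alpha>)"
    by (intro continuous_intros) (use assms(3) in auto)
  then have "continuous_on {s. 0 \<le> Im s} (\<lambda>s. s powr of_real \<alpha>)"
    by (rule continuous_on_eq) (use powr_upper_half_plane[OF _ assms(3)] in auto)
  from continuous_on_compose2[OF this assms(1)] show ?thesis using assms(2) by auto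
qed

lemma norm_powr_of_real: "norm (z powr of_real \<alpha>) = norm z powr \<alpha>" for z :: complex
  by (subst norm_powr_real_powr') auto

text \<open>One rotation \<open>u\<close> that puts both \<open>w\<close> and \<open>b\<close> into
  the right half-plane makes the \<open>la\<close> term contribute a nonnegative real part. The
  lower bound is free of \<open>la\<close>; all uniformity in the eigenvalues rests on it.\<close>

lemma norm_add_ge_rotated:
  assumes "norm u = 1" "c * norm w \<le> Re (u * w)" "0 \<le> Re (u * b)" "0 \<le> la"
  shows "c * norm w \<le> norm (w + of_real la * b)"
proof -
  have "c * norm w \<le> Re (u * w) + la * Re (u * b)"
    using mult_nonneg_nonneg[OF assms(4,3)] assms(2) by linarith
  also have "\<dots> = Re (u * (w + of_real la * b))" by (simp add: algebra_simps)
  also have "\<dots> \<le> norm (u * (w + of_real la * b))" by (rule complex_Re_le_cmod)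
  finally show ?thesis using assms(1) by (simp add: norm_mult)
qed

text \<open>The argument of s^\<alpha> lies in [0, \<alpha> pi]. Subtracting \<alpha> pi / 2 centres
  this interval, and on it the cosine is at least \<open>cos (\<alpha> * pi / 2)\<close>.\<close>

lemma Re_rotated_powr_ge:
  assumes "0 \<le> Im s" "0 < \<alpha>" "\<alpha> < 1"
  shows "cos (\<alpha> * pi / 2) * norm (s powr of_real \<alpha>) \<le> Re (exp (- \<i> * of_real (\<alpha> * pi / 2)) * s powr of_real \<alpha>)"
proof (cases "s = 0")
  case False
  have im: "0 \<le> Im (Ln s)" "Im (Ln s) \<le> pi"
    using assms(1) False Im_Ln_pos_le[of s] by auto
  have "\<bar>\<alpha> * Im (Ln s) - \<alpha> * pi / 2\<bar> = \<alpha> * \<bar>Im (Ln s) - pi / 2\<bar>"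
    using assms(2) by (simp add: abs_mult_pos' algebra_simps abs_if)
  also have "\<dots> \<le> \<alpha> * (pi / 2)" proof (rule mult_left_mono)
    show "\<bar>Im (Ln s) - pi / 2\<bar> \<le> pi / 2" using im by linarith
  qed (use assms in simp)
  finally have "\<bar>\<alpha> * Im (Ln s) - \<alpha> * pi / 2\<bar> \<le> \<alpha> * pi / 2" by simp
  moreover have "\<alpha> * pi / 2 \<le> pi" using assms by (simp add: field_simps)
  ultimately have c: "cos (\<alpha> * pi / 2) \<le> cos (\<alpha> * Im (Ln s) - \<alpha> * pi / 2)"
    by (metis abs_ge_zero cos_abs_real cos_monotone_0_pi_le)
  have "exp (- \<i> * of_real (\<alpha> * pi / 2)) * s powr of_real \<alpha> = exp (- \<i> * of_real (\<alpha> * pi / 2) + of_real \<alpha> * Ln s)"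
    using False by (simp only: powr_def exp_add if_False)
  then have "Re (exp (- \<i> * of_real (\<alpha> * pi / 2)) * s powr of_real \<alpha>) = exp (\<alpha> * Re (Ln s)) * cos (\<alpha> * Im (Ln s) - \<alpha> * pi / 2)"
    by (simp add: Re_exp)
  moreover have "norm (s powr of_real \<alpha>) = exp (\<alpha> * Re (Ln s))" using False by (simp add: powr_def)
  ultimately show ?thesis using c by simp
qed auto

lemma Re_powr_right_half_plane_ge:
  assumes "0 \<le> Re s" "0 < \<alpha>" "\<alpha> < 1"
  shows "cos (\<alpha> * pi / 2) * norm (s powr of_real \<alpha>) \<le> Re (s powr of_real \<alpha>)"
proof (cases "s = 0")
  case False
  have "\<bar>Im (Ln s)\<bar> \<le> pi / 2" using assms(1) False Re_Ln_pos_le[of s] by auto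
  then have "\<bar>\<alpha> * Im (Ln s)\<bar> \<le> \<alpha> * (pi / 2)" using assms by (simp add: abs_mult)
  moreover have "\<alpha> * pi / 2 \<le> pi" using assms by (simp add: field_simps)
  ultimately have c: "cos (\<alpha> * pi / 2) \<le> cos (\<alpha> * Im (Ln s))"
    by (metis abs_ge_zero cos_abs_real cos_monotone_0_pi_le times_divide_eq_right)
  have "Re (s powr of_real \<alpha>) = exp (\<alpha> * Re (Ln s)) * cos (\<alpha> * Im (Ln s))"
    using False by (simp add: powr_def Re_exp)
  moreover have "norm (s powr of_real \<alpha>) = exp (\<alpha> * Re (Ln s))" using False by (simp add: powr_def)
  ultimately show ?thesis using c by simp
qed auto

lemma cos_half_pos: "0 < \<alpha> ==> \<alpha> < 1 ==> 0 < cos (\<alpha> * pi / 2)" for \<alpha> :: real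
proof (rule cos_gt_zero_pi)
  assume a: "0 < \<alpha>" "\<alpha> < 1"
  have "0 < \<alpha> * pi" "\<alpha> * pi < 1 * pi" using a by (simp_all add: mult_strict_right_mono)
  then show "- (pi / 2) < \<alpha> * pi / 2" "\<alpha> * pi / 2 < pi / 2" by linarith+
qed

lemma norm_powr_add_ge:
  assumes "0 \<le> Im s" "0 < \<alpha>" "\<alpha> < 1" "0 \<le> la"
  shows "cos (\<alpha> * pi / 2) * norm s powr \<alpha> \<le> norm (s powr of_real \<alpha> + of_real la)"
proof -
  have "0 \<le> cos (\<alpha> * pi / 2)" using cos_half_pos assms by (simp add: less_imp_le)
  then show ?thesis
    using norm_add_ge_rotated[of "exp (- \<i> * of_real (\<alpha> * pi / 2))" _ "s powr of_real \<alpha>" 1 la]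
      Re_rotated_powr_ge[OF assms(1-3)] assms(4)
    by (simp add: norm_powr_of_real Re_exp)
qed

text \<open>On the negative axis the principal logarithm takes its limit from above, so this is the
  value on the upper side of the cut.\<close>

lemma powr_of_negative_real:
  assumes "0 \<le> x" "0 < \<alpha>"
  shows "(- complex_of_real x) powr of_real \<alpha> = of_real (x powr \<alpha>) * exp (\<i> * of_real (\<alpha> * pi))"
proof (cases "x = 0")
  case False
  then have "Ln (- complex_of_real x) = of_real (ln x) + \<i> * pi"
    using assms by (simp add: Ln_of_real Ln_minus)
  then show ?thesis using False assms
    by (simp add: powr_def exp_add[symmetric] exp_of_real[symmetric] algebra_simps)
qed (use assms in auto)

section \<open>The continuous kernel\<close>

lemma integrable_dominated:
  fixes f g :: "'a => real"
  assumes "integrable M g" "f \<in> borel_measurable M" "\<And>x. \<bar>f x\<bar> \<le> g x"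
  shows "integrable M f"
proof (rule Bochner_Integration.integrable_bound[OF assms(1,2)], rule AE_I2)
  show "norm (f x) \<le> norm (g x)" for x using assms(3)[of x] by simp
qed

lemma has_bochner_integral_lborel_nonneg:
  fixes f :: "real => real"
  assumes "(f has_integral I) S" "\<And>x. x \<in> S ==> 0 \<le> f x" "(\<lambda>x. indicator S x * f x) \<in> borel_measurable borel"
  shows "has_bochner_integral lborel (\<lambda>x. indicator S x * f x) I"
proof -
  have "f absolutely_integrable_on S"
    using assms(1,2) by (intro nonnegative_absolutely_integrable_1) (auto simp: integrable_on_def)
  then have si: "set_integrable lebesgue S f" .
  have int: "integrable lborel (\<lambda>x. indicator S x * f x)"
    using si assms(3) by (simp add: set_integrable_def integrable_completion)
  have "(LINT x|lborel. indicator S x * f x) = (LINT x:S|lebesgue. f x)"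
    using assms(3) by (simp add: set_lebesgue_integral_def integral_completion)
  also have "\<dots> = I" using set_lebesgue_integral_eq_integral(2)[OF si] assms(1) by (simp add: integral_unique)
  finally show ?thesis using int by (simp add: has_bochner_integral_iff)
qed

lemma has_bochner_integral_Gamma:
  fixes p t :: real
  assumes "- 1 < p" "0 < t"
  shows "has_bochner_integral lborel (\<lambda>r. indicator {0<..} r * (r powr p * exp (- t * r))) (Gamma (p + 1) * t powr (- p - 1))"
proof -
  have "((\<lambda>r. r powr p / exp r) has_integral Gamma (p + 1)) {0..}"
    using Gamma_integral_real[of "p + 1"] assms by simp
  then have "((\<lambda>r. r powr p / exp r) has_integral Gamma (p + 1)) {0<..}"
    by (rule has_integral_spike_set_eq[THEN iffD1, rotated 2]) (auto intro: negligible_subset[of "{0}"])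
  then have "has_bochner_integral lborel (\<lambda>r. indicator {0<..} r * (r powr p / exp r)) (Gamma (p + 1))"
    by (rule has_bochner_integral_lborel_nonneg) auto
  from lborel_has_bochner_integral_real_affine_iff[THEN iffD1, OF _ this, of t 0]
  have "has_bochner_integral lborel (\<lambda>r. indicator {0<..} (t * r) * ((t * r) powr p / exp (t * r))) (Gamma (p + 1) / t)"
    using assms by (simp add: field_simps)
  from has_bochner_integral_mult_right[OF this, of "t powr (- p)"]
  have "has_bochner_integral lborel (\<lambda>r. t powr (- p) * (indicator {0<..} (t * r) * ((t * r) powr p / exp (t * r)))) (t powr (- p) * (Gamma (p + 1) / t))"
    by simp
  also have "t powr (- p) * (Gamma (p + 1) / t) = Gamma (p + 1) * t powr (- p - 1)"
    using assms by (simp add: powr_diff)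
  also have "(\<lambda>r. t powr (- p) * (indicator {0<..} (t * r) * ((t * r) powr p / exp (t * r))))
      = (\<lambda>r. indicator {0<..} r * (r powr p * exp (- t * r)))"
    using assms by (auto simp: fun_eq_iff indicator_def powr_mult powr_minus exp_minus zero_less_mult_iff field_simps)
  finally show ?thesis .
qed

text \<open>Minus 1/pi times the imaginary part of 1 / (s^\<alpha> + \<open>la\<close>) at s = -r on
  the upper side of the cut (see \<open>ml_density_eq\<close>): the density that remains when the
  inversion contour is shrunk to the cut.\<close>

definition ml_density :: "real => real => real => real" where
  "ml_density \<alpha> la r = r powr \<alpha> * sin (\<alpha> * pi) /
     (pi * ((r powr \<alpha> * cos (\<alpha> * pi) + la)\<^sup>2 + (r powr \<alpha> * sin (\<alpha> * pi))\<^sup>2))"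

text \<open>\<open>ml_kernel \<alpha> la t = t\<^sup>\<alpha>\<^sup>-\<^sup>1 E\<^sub>\<alpha>\<^sub>,\<^sub>\<alpha>(-la t\<^sup>\<alpha>)\<close> is the inverse Laplace transform of \<open>1 / (s\<^sup>\<alpha> + la)\<close>,
  written as an integral over the branch cut.\<close>

definition ml_kernel :: "real => real => real => real" where
  "ml_kernel \<alpha> la t = (LINT r|lborel. indicator {0<..} r * (exp (- t * r) * ml_density \<alpha> la r))"

lemma ml_density_eq:
  assumes "0 \<le> r" "0 < \<alpha>"
  shows "Im (1 / ((- complex_of_real r) powr of_real \<alpha> + of_real la)) = - pi * ml_density \<alpha> la r"
  unfolding powr_of_negative_real[OF assms] ml_density_def
  by (simp add: Im_divide Re_exp Im_exp power2_eq_square)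

lemma abs_ml_density_le:
  assumes "0 < r" "0 < \<alpha>" "\<alpha> < 1" "0 \<le> la"
  shows "\<bar>ml_density \<alpha> la r\<bar> \<le> r powr (- \<alpha>) / (pi * cos (\<alpha> * pi / 2))"
proof -
  let ?c = "cos (\<alpha> * pi / 2)"
  let ?w = "(- complex_of_real r) powr of_real \<alpha> + of_real la"
  have c: "0 < ?c" using cos_half_pos assms by simp
  have w: "?c * r powr \<alpha> \<le> norm ?w"
    using norm_powr_add_ge[of "- complex_of_real r" \<alpha> la] assms by simp
  have p: "0 < ?c * r powr \<alpha>" using c assms by simp
  have "pi * \<bar>ml_density \<alpha> la r\<bar> = \<bar>Im (1 / ?w)\<bar>" using ml_density_eq[of r \<alpha> la] assms by (simp add: abs_mult)
  also have "\<dots> \<le> norm (1 / ?w)" by (rule abs_Im_le_cmod)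
  also have "\<dots> = 1 / norm ?w" by (simp only: norm_divide norm_one)
  also have "\<dots> \<le> 1 / (?c * r powr \<alpha>)" by (rule divide_left_mono[OF w _ mult_pos_pos[OF less_le_trans[OF p w] p]]) simp
  finally show ?thesis using assms c by (simp add: powr_minus field_simps)
qed

lemma borel_measurable_ml_density [measurable]: "ml_density \<alpha> la \<in> borel_measurable borel"
  unfolding ml_density_def by measurable

lemma integrable_ml_density:
  assumes "0 < \<alpha>" "\<alpha> < 1" "0 \<le> la" "0 < t" "0 \<le> p"
  shows "integrable lborel (\<lambda>r. indicator {0<..} r * (r powr p * exp (- t * r) * ml_density \<alpha> la r))"
    and "(LINT r|lborel. \<bar>indicator {0<..} r * (r powr p * exp (- t * r) * ml_density \<alpha> la r)\<bar>)
         \<le> Gamma (p + 1 - \<alpha>) / (pi * cos (\<alpha> * pi / 2)) * t powr (\<alpha> - 1 - p)"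
proof -
  let ?c = "pi * cos (\<alpha> * pi / 2)"
  have G: "has_bochner_integral lborel (\<lambda>r. 1 / ?c * (indicator {0<..} r * (r powr (p - \<alpha>) * exp (- t * r))))
     (1 / ?c * (Gamma (p - \<alpha> + 1) * t powr (- (p - \<alpha>) - 1)))"
    using assms by (intro has_bochner_integral_mult_right has_bochner_integral_Gamma) auto
  have le: "\<bar>indicator {0<..} r * (r powr p * exp (- t * r) * ml_density \<alpha> la r)\<bar>
      \<le> 1 / ?c * (indicator {0<..} r * (r powr (p - \<alpha>) * exp (- t * r)))" for r
  proof (cases "0 < r")
    case True
    have "\<bar>r powr p * exp (- t * r) * ml_density \<alpha> la r\<bar> = r powr p * exp (- t * r) * \<bar>ml_density \<alpha> la r\<bar>"
      by (simp add: abs_mult)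
    also have "\<dots> \<le> r powr p * exp (- t * r) * (r powr (- \<alpha>) / ?c)"
      using abs_ml_density_le[OF True assms(1-3)] by (intro mult_left_mono) auto
    finally show ?thesis using True by (simp add: powr_diff powr_minus field_simps)
  qed auto
  show int: "integrable lborel (\<lambda>r. indicator {0<..} r * (r powr p * exp (- t * r) * ml_density \<alpha> la r))"
    by (rule integrable_dominated[OF G[unfolded has_bochner_integral_iff, THEN conjunct1] _ le]) measurable
  have "(LINT r|lborel. \<bar>indicator {0<..} r * (r powr p * exp (- t * r) * ml_density \<alpha> la r)\<bar>)
     \<le> (LINT r|lborel. 1 / ?c * (indicator {0<..} r * (r powr (p - \<alpha>) * exp (- t * r))))"
    using le by (intro integral_mono integrable_abs int G[unfolded has_bochner_integral_iff, THEN conjunct1])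
  also have "\<dots> = 1 / ?c * (Gamma (p - \<alpha> + 1) * t powr (- (p - \<alpha>) - 1))"
    using G by (rule has_bochner_integral_integral_eq)
  finally show "(LINT r|lborel. \<bar>indicator {0<..} r * (r powr p * exp (- t * r) * ml_density \<alpha> la r)\<bar>)
         \<le> Gamma (p + 1 - \<alpha>) / ?c * t powr (\<alpha> - 1 - p)"
    by (simp add: algebra_simps)
qed

lemma integrable_ml_kernel:
  assumes "0 < \<alpha>" "\<alpha> < 1" "0 \<le> la" "0 < t"
  shows "integrable lborel (\<lambda>r. indicator {0<..} r * (exp (- t * r) * ml_density \<alpha> la r))"
  using integrable_ml_density(1)[OF assms, of 0]
  by (rule Bochner_Integration.integrable_cong[THEN iffD1, rotated 2]) (auto simp: indicator_def)

definition ml_const :: "real => real => real" where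
  "ml_const \<alpha> p = Gamma (p + 1 - \<alpha>) / (pi * cos (\<alpha> * pi / 2))"

lemma ml_const_pos: "0 < \<alpha> ==> \<alpha> < 1 ==> 0 \<le> p ==> 0 < ml_const \<alpha> p"
  using cos_half_pos[of \<alpha>] by (simp add: ml_const_def Gamma_real_pos)

text \<open>A factor r^p, gained for instance from differences of exponentials, improves the bound
  by t^(-p). The cases p = 0, 1, 2 give the size, the continuity and the interpolation error of
  \<open>ml_kernel\<close>.\<close>

lemma abs_integral_ml_density_le:
  assumes "0 < \<alpha>" "\<alpha> < 1" "0 \<le> la" "0 < t" "0 \<le> p" "0 \<le> C"
    and g: "g \<in> borel_measurable borel"
    and le: "\<And>r. 0 < r ==> \<bar>g r\<bar> \<le> C * (r powr p * exp (- t * r))"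
  shows "integrable lborel (\<lambda>r. indicator {0<..} r * (g r * ml_density \<alpha> la r))"
    and "\<bar>LINT r|lborel. indicator {0<..} r * (g r * ml_density \<alpha> la r)\<bar> \<le> C * (ml_const \<alpha> p * t powr (\<alpha> - 1 - p))"
proof -
  note I = integrable_ml_density[OF assms(1-5)]
  have b: "\<bar>indicator {0<..} r * (g r * ml_density \<alpha> la r)\<bar>
     \<le> C * \<bar>indicator {0<..} r * (r powr p * exp (- t * r) * ml_density \<alpha> la r)\<bar>" for r
    using mult_right_mono[OF le, of r "\<bar>ml_density \<alpha> la r\<bar>"]
    by (cases "0 < r") (auto simp: abs_mult mult.assoc)
  show int: "integrable lborel (\<lambda>r. indicator {0<..} r * (g r * ml_density \<alpha> la r))"
    by (rule integrable_dominated[OF integrable_mult_right[OF integrable_abs[OF I(1)], of C] _ b]) (use g in measurable)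
  have "\<bar>LINT r|lborel. indicator {0<..} r * (g r * ml_density \<alpha> la r)\<bar>
     \<le> (LINT r|lborel. \<bar>indicator {0<..} r * (g r * ml_density \<alpha> la r)\<bar>)"
    by (rule integral_abs_bound)
  also have "\<dots> \<le> (LINT r|lborel. C * \<bar>indicator {0<..} r * (r powr p * exp (- t * r) * ml_density \<alpha> la r)\<bar>)"
    using b by (intro integral_mono integrable_abs int integrable_mult_right I(1))
  also have "\<dots> \<le> C * (ml_const \<alpha> p * t powr (\<alpha> - 1 - p))"
    using mult_left_mono[OF I(2) assms(6)] by (simp add: ml_const_def)
  finally show "\<bar>LINT r|lborel. indicator {0<..} r * (g r * ml_density \<alpha> la r)\<bar> \<le> C * (ml_const \<alpha> p * t powr (\<alpha> - 1 - p))" .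
qed

lemma abs_ml_kernel_le:
  assumes "0 < \<alpha>" "\<alpha> < 1" "0 \<le> la" "0 < t"
  shows "\<bar>ml_kernel \<alpha> la t\<bar> \<le> ml_const \<alpha> 0 * t powr (\<alpha> - 1)"
  using abs_integral_ml_density_le(2)[OF assms, of 0 1 "\<lambda>r. exp (- t * r)"] by (simp add: ml_kernel_def)

text \<open>Self-similarity, by the substitution r = rho / \<open>\<tau>\<close>: a general step
  size reduces to 1 at the price of a changed \<open>la\<close>. Hence the estimates for step size 1
  have to hold for every positive \<open>la\<close>.\<close>

lemma ml_kernel_scale:
  assumes "0 < \<tau>" "0 < \<alpha>"
  shows "ml_kernel \<alpha> la (\<tau> * x) = \<tau> powr (\<alpha> - 1) * ml_kernel \<alpha> (la * \<tau> powr \<alpha>) x"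
proof -
  have m: "ml_density \<alpha> la (\<rho> / \<tau>) = \<tau> powr \<alpha> * ml_density \<alpha> (la * \<tau> powr \<alpha>) \<rho>" if "0 < \<rho>" for \<rho>
  proof -
    define r q where "r = \<rho> powr \<alpha>" and "q = \<tau> powr \<alpha>"
    have q: "0 < q" "(\<rho> / \<tau>) powr \<alpha> = r / q" using assms that by (auto simp: q_def r_def powr_divide)
    have "(r / q * c + la)\<^sup>2 + (r / q * s)\<^sup>2 = ((r * c + la * q)\<^sup>2 + (r * s)\<^sup>2) / q\<^sup>2" for c s
      using q(1) by (simp add: field_simps power2_eq_square)
    then show ?thesis unfolding ml_density_def q(2) r_def[symmetric] q_def[symmetric]
      using q(1) by (simp add: field_simps power2_eq_square)
  qed
  have "ml_kernel \<alpha> la (\<tau> * x) = (LINT \<rho>|lborel. indicator {0<..} \<rho> * (exp (- (\<tau> * x) * \<rho>) * ml_density \<alpha> la \<rho>))"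
    by (simp add: ml_kernel_def)
  also have "\<dots> = 1 / \<tau> * (LINT \<rho>|lborel. indicator {0<..} (0 + 1 / \<tau> * \<rho>) *
       (exp (- (\<tau> * x) * (0 + 1 / \<tau> * \<rho>)) * ml_density \<alpha> la (0 + 1 / \<tau> * \<rho>)))"
    using assms by (subst lborel_integral_real_affine[of "1 / \<tau>" _ 0]) auto
  also have "(\<lambda>\<rho>. indicator {0<..} (0 + 1 / \<tau> * \<rho>) * (exp (- (\<tau> * x) * (0 + 1 / \<tau> * \<rho>)) * ml_density \<alpha> la (0 + 1 / \<tau> * \<rho>)))
     = (\<lambda>\<rho>. \<tau> powr \<alpha> * (indicator {0<..} \<rho> * (exp (- x * \<rho>) * ml_density \<alpha> (la * \<tau> powr \<alpha>) \<rho>)))"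
    using assms m by (auto simp: fun_eq_iff indicator_def zero_less_divide_iff)
  finally show ?thesis using assms by (simp add: ml_kernel_def powr_diff)
qed

text \<open>The error of linear interpolation in \<open>w\<close> between 0 and 1. The constant 1
  follows from 1 - x <= exp (- x) <= 1 - x + x^2/2.\<close>

lemma exp_interpolation_error:
  fixes y w :: real
  assumes "0 \<le> y" "0 \<le> w" "w \<le> 1"
  shows "\<bar>exp (- w * y) - ((1 - w) + w * exp (- y))\<bar> \<le> y\<^sup>2"
proof -
  have lo: "1 - x \<le> exp (- x)" for x :: real using exp_ge_add_one_self[of "- x"] by simp
  have up: "exp (- x) \<le> 1 - x + x\<^sup>2 / 2" if "0 \<le> x" for x :: real
  proof -
    define g where "g = (\<lambda>x::real. 1 - x + x\<^sup>2 / 2 - exp (- x))"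
    have "g 0 \<le> g x"
    proof (rule DERIV_nonneg_imp_nondecreasing[OF that])
      fix z :: real
      have "(g has_real_derivative - 1 + z + exp (- z)) (at z)"
        unfolding g_def by (auto intro!: derivative_eq_intros)
      then show "\<exists>d. (g has_real_derivative d) (at z) \<and> 0 \<le> d" using lo[of z] by auto
    qed
    then show ?thesis by (simp add: g_def)
  qed
  have "0 \<le> w * y" using assms by simp
  note u1 = up[OF this] and u2 = up[OF assms(1)]
  have sq: "(w * y)\<^sup>2 \<le> y\<^sup>2" using assms by (intro power_mono) (auto intro: mult_left_le_one_le)
  have "w * (1 - y) \<le> w * exp (- y)" "w * exp (- y) \<le> w * (1 - y + y\<^sup>2 / 2)"
    using lo[of y] u2 assms by (auto intro: mult_left_mono)
  moreover have "w * y\<^sup>2 \<le> 1 * y\<^sup>2" using assms by (intro mult_right_mono) auto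
  moreover have "0 \<le> y\<^sup>2" by simp
  ultimately show ?thesis using u1 sq lo[of "w * y"] by (simp add: algebra_simps abs_le_iff)
qed

text \<open>\<open>cq_kernel\<close> is linear between consecutive integers, so the kernels need
  only be compared at integers once \<open>ml_kernel\<close> is linear there up to
  O(t^(\<alpha>-3)). The exponent stems from the factor r^2 in the interpolation error of exp (- w
  r).\<close>

lemma ml_kernel_interpolation_error:
  assumes "0 < \<alpha>" "\<alpha> < 1" "0 \<le> la" "0 < t" "0 \<le> w" "w \<le> 1"
  shows "\<bar>ml_kernel \<alpha> la (t + w) - ((1 - w) * ml_kernel \<alpha> la t + w * ml_kernel \<alpha> la (t + 1))\<bar>
     \<le> ml_const \<alpha> 2 * t powr (\<alpha> - 3)"
proof -
  let ?g = "\<lambda>r. exp (- (t + w) * r) - ((1 - w) * exp (- t * r) + w * exp (- (t + 1) * r))"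
  have "ml_kernel \<alpha> la (t + w) - ((1 - w) * ml_kernel \<alpha> la t + w * ml_kernel \<alpha> la (t + 1))
     = (LINT r|lborel. indicator {0<..} r * (?g r * ml_density \<alpha> la r))"
    using integrable_ml_kernel[OF assms(1-3), of t] integrable_ml_kernel[OF assms(1-3), of "t + w"]
      integrable_ml_kernel[OF assms(1-3), of "t + 1"] assms
    by (simp add: ml_kernel_def algebra_simps)
  moreover have "\<bar>LINT r|lborel. indicator {0<..} r * (?g r * ml_density \<alpha> la r)\<bar> \<le> 1 * (ml_const \<alpha> 2 * t powr (\<alpha> - 1 - 2))"
  proof (rule abs_integral_ml_density_le(2))
    fix r :: real assume "0 < r"
    have "?g r = exp (- t * r) * (exp (- w * r) - ((1 - w) + w * exp (- r)))"
      by (simp add: exp_add[symmetric] algebra_simps)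
    also have "\<bar>\<dots>\<bar> \<le> exp (- t * r) * r\<^sup>2"
      unfolding abs_mult using exp_interpolation_error[of r w] \<open>0 < r\<close> assms by (intro mult_mono) auto
    finally show "\<bar>?g r\<bar> \<le> 1 * (r powr 2 * exp (- t * r))"
      using \<open>0 < r\<close> by (simp add: powr_numeral mult.commute)
  qed (use assms in auto)
  ultimately show ?thesis by simp
qed

lemma continuous_on_ml_kernel:
  assumes "0 < \<alpha>" "\<alpha> < 1" "0 \<le> la"
  shows "continuous_on {0<..} (ml_kernel \<alpha> la)"
proof -
  \<comment> \<open>A local Lipschitz bound: a difference of exponentials gains one factor of the
    integration variable, which is the case p = 1.\<close>
  have lip: "\<bar>ml_kernel \<alpha> la t - ml_kernel \<alpha> la s\<bar> \<le> \<bar>t - s\<bar> * (ml_const \<alpha> 1 * a powr (\<alpha> - 2))"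
    if "0 < a" "a \<le> t" "a \<le> s" for a t s
  proof -
    let ?g = "\<lambda>\<rho>. exp (- t * \<rho>) - exp (- s * \<rho>)"
    have "ml_kernel \<alpha> la t - ml_kernel \<alpha> la s = (LINT \<rho>|lborel. indicator {0<..} \<rho> * (?g \<rho> * ml_density \<alpha> la \<rho>))"
      using integrable_ml_kernel[OF assms, of t] integrable_ml_kernel[OF assms, of s] that
      by (simp add: ml_kernel_def algebra_simps)
    moreover have "\<bar>LINT \<rho>|lborel. indicator {0<..} \<rho> * (?g \<rho> * ml_density \<alpha> la \<rho>)\<bar> \<le> \<bar>t - s\<bar> * (ml_const \<alpha> 1 * a powr (\<alpha> - 1 - 1))"
    proof (rule abs_integral_ml_density_le(2))
      fix \<rho> :: real assume r: "0 < \<rho>"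
      have main: "\<bar>exp (- p * \<rho>) - exp (- q * \<rho>)\<bar> \<le> \<bar>p - q\<bar> * (\<rho> * exp (- a * \<rho>))" if "a \<le> q" "q \<le> p" for p q
      proof -
        have "exp (- q * \<rho>) - exp (- p * \<rho>) = exp (- q * \<rho>) * (1 - exp (- ((p - q) * \<rho>)))"
          by (simp add: exp_add[symmetric] algebra_simps)
        also have "\<dots> \<le> exp (- a * \<rho>) * ((p - q) * \<rho>)"
          using that r exp_ge_add_one_self[of "- ((p - q) * \<rho>)"]
          by (intro mult_mono) auto
        moreover have "exp (- p * \<rho>) \<le> exp (- q * \<rho>)" using that r by simp
        ultimately show ?thesis using that by (simp add: mult_ac)
      qed
      show "\<bar>?g \<rho>\<bar> \<le> \<bar>t - s\<bar> * (\<rho> powr 1 * exp (- a * \<rho>))"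
        using main[of s t] main[of t s] that r by (cases "s \<le> t") (auto simp: abs_minus_commute)
    qed (use assms that in auto)
    ultimately show ?thesis by simp
  qed
  show ?thesis
  proof (rule continuous_at_imp_continuous_on, rule ballI)
    fix t :: real assume t: "t \<in> {0<..}"
    have "((\<lambda>s. \<bar>s - t\<bar> * (ml_const \<alpha> 1 * (t/2) powr (\<alpha> - 2))) \<longlongrightarrow> \<bar>t - t\<bar> * (ml_const \<alpha> 1 * (t/2) powr (\<alpha> - 2))) (at t)"
      by (intro tendsto_intros)
    then have l: "((\<lambda>s. \<bar>s - t\<bar> * (ml_const \<alpha> 1 * (t/2) powr (\<alpha> - 2))) \<longlongrightarrow> 0) (at t)" by simp
    have "\<forall>\<^sub>F s in at t. t / 2 < s"
      using order_tendstoD(1)[OF tendsto_ident_at, of "t/2" t UNIV] t by simp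
    then have "\<forall>\<^sub>F s in at t. norm (ml_kernel \<alpha> la s - ml_kernel \<alpha> la t) \<le> \<bar>s - t\<bar> * (ml_const \<alpha> 1 * (t/2) powr (\<alpha> - 2))"
      by eventually_elim (use lip[of "t/2"] t in auto)
    from Lim_null_comparison[OF this l] show "isCont (ml_kernel \<alpha> la) t"
      by (simp add: isCont_def LIM_zero_iff)
  qed
qed

lemma borel_measurable_ml_kernel [measurable]: "ml_kernel \<alpha> la \<in> borel_measurable borel"
  unfolding ml_kernel_def by measurable

section \<open>The Bromwich integral of the continuous kernel\<close>

lemma continuous_on_rectangle_edges:
  fixes f :: "complex => 'a::topological_space"
  assumes "continuous_on (cbox (Complex x1 y1) (Complex x2 y2)) f"
  shows "y \<in> {y1..y2} ==> continuous_on {x1..x2} (\<lambda>x. f (Complex x y))"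
    and "x \<in> {x1..x2} ==> continuous_on {y1..y2} (\<lambda>y. f (Complex x y))"
  by (rule continuous_on_compose2[OF assms]; auto simp: in_cbox_complex_iff Complex_eq intro!: continuous_intros)+

text \<open>Taking imaginary parts removes the segment from 0 to \<open>\<sigma>\<close>, where
  \<open>f\<close> is real, and leaves only the cut on the bottom side. The upper half of a contour
  symmetric about the real axis suffices, because the lower half is its conjugate.\<close>

lemma rectangle_Im:
  fixes f :: "complex => complex"
  assumes "0 \<le> L" "0 \<le> \<sigma>" "0 \<le> R"
    and cont: "continuous_on (cbox (Complex (- L) 0) (Complex \<sigma> R)) f"
    and hol: "\<And>z. z \<in> box (Complex (- L) 0) (Complex \<sigma> R) ==> f field_differentiable at z"
    and real: "\<And>x. 0 \<le> x ==> x \<le> \<sigma> ==> Im (f (Complex x 0)) = 0"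
  shows "Re (integral {0..R} (\<lambda>y. f (Complex \<sigma> y)))
      = Im (integral {- L..\<sigma>} (\<lambda>x. f (Complex x R))) + Re (integral {0..R} (\<lambda>y. f (Complex (- L) y)))
        - integral {0..L} (\<lambda>r. Im (f (Complex (- r) 0)))"
proof -
  have c: "continuous_on {- L..\<sigma>} (\<lambda>x. f (Complex x 0))"
    using continuous_on_rectangle_edges(1)[OF cont, of 0] assms by simp
  have ci: "continuous_on {- L..\<sigma>} (\<lambda>x. Im (f (Complex x 0)))" by (intro continuous_intros c)
  have "Im (integral {- L..\<sigma>} (\<lambda>x. f (Complex x 0))) = integral {- L..\<sigma>} (\<lambda>x. Im (f (Complex x 0)))"
    using integral_linear[OF integrable_continuous_real[OF c] bounded_linear_Im] by (simp add: o_def)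
  also have "\<dots> = integral {- L..0} (\<lambda>x. Im (f (Complex x 0))) + integral {0..\<sigma>} (\<lambda>x. Im (f (Complex x 0)))"
    using assms integrable_continuous_real[OF ci] by (intro Henstock_Kurzweil_Integration.integral_combine[symmetric]) auto
  also have "integral {0..\<sigma>} (\<lambda>x. Im (f (Complex x 0))) = integral {0..\<sigma>} (\<lambda>x. 0)"
    by (rule integral_cong) (use real in auto)
  also have "integral {- L..0} (\<lambda>x. Im (f (Complex x 0))) = integral {0..L} (\<lambda>r. Im (f (Complex (- r) 0)))"
    using Henstock_Kurzweil_Integration.integral_reflect_real[of L 0 "\<lambda>r. Im (f (Complex (- r) 0))"] by simp
  finally have "Im (integral {- L..\<sigma>} (\<lambda>x. f (Complex x 0))) = integral {0..L} (\<lambda>r. Im (f (Complex (- r) 0)))"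
    by simp
  moreover have "Im (integral {- L..\<sigma>} (\<lambda>x. f (Complex x 0)) + \<i> * integral {0..R} (\<lambda>y. f (Complex \<sigma> y)))
     = Im (integral {- L..\<sigma>} (\<lambda>x. f (Complex x R)) + \<i> * integral {0..R} (\<lambda>y. f (Complex (- L) y)))"
    using Cauchy_rectangle[of "- L" \<sigma> 0 R f] assms by simp
  ultimately show ?thesis by simp
qed

lemma tendsto_integral_ivl_at_top:
  fixes f :: "real => real"
  assumes "integrable lborel (\<lambda>r. indicator {0<..} r * f r)"
  shows "((\<lambda>L. integral {0..L} f) \<longlongrightarrow> (LINT r|lborel. indicator {0<..} r * f r)) at_top"
proof -
  have eq: "(LINT r|lborel. indicator {..L} r * (indicator {0<..} r * f r)) = integral {0..L} f" for L
  proof -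
    have "integrable lborel (\<lambda>r. indicator {..L} r * (indicator {0<..} r * f r))"
      using integrable_mult_indicator[OF _ assms, of "{..L}"] by simp
    then have si: "set_integrable lborel {0<..L} f"
      unfolding set_integrable_def by (rule Bochner_Integration.integrable_cong[THEN iffD1, rotated 2]) (auto simp: indicator_def)
    have "(LINT r|lborel. indicator {..L} r * (indicator {0<..} r * f r)) = (LINT r:{0<..L}|lborel. f r)"
      unfolding set_lebesgue_integral_def by (rule Bochner_Integration.integral_cong) (auto simp: indicator_def)
    also have "\<dots> = integral {0<..L} f" by (rule set_borel_integral_eq_integral(2)[OF si])
    also have "\<dots> = integral {0..L} f"
      by (rule integral_spike_set) (auto intro: negligible_subset[of "{0}"])
    finally show ?thesis .
  qed
  have "((\<lambda>L. LINT r|lborel. indicator {..L} r * (indicator {0<..} r * f r)) \<longlongrightarrow> (LINT r|lborel. indicator {0<..} r * f r)) at_top"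
  proof (rule integral_dominated_convergence_at_top[where w = "\<lambda>r. \<bar>indicator {0<..} r * f r\<bar>"])
    show "AE r in lborel. ((\<lambda>L. indicator {..L} r * (indicator {0<..} r * f r)) \<longlongrightarrow> indicator {0<..} r * f r) at_top"
    proof (rule AE_I2)
      fix r :: real
      have "\<forall>\<^sub>F L in at_top. indicator {..L} r * (indicator {0<..} r * f r) = indicator {0<..} r * f r"
        using eventually_ge_at_top[of r] by eventually_elim simp
      then show "((\<lambda>L. indicator {..L} r * (indicator {0<..} r * f r)) \<longlongrightarrow> indicator {0<..} r * f r) at_top"
        by (rule tendsto_eventually)
    qed
  qed (use assms in \<open>auto intro!: always_eventually AE_I2 simp: indicator_def borel_measurable_integrable integrable_abs split: if_splits
        dest: borel_measurable_integrable\<close>)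
  then show ?thesis unfolding eq .
qed

lemma integral_exp_le:
  fixes t :: real
  assumes "0 < t" "a \<le> b"
  shows "integral {a..b} (\<lambda>x. exp (x * t)) \<le> exp (b * t) / t" "(\<lambda>x. exp (x * t)) integrable_on {a..b}"
proof -
  have "((\<lambda>x. exp (x * t)) has_integral (exp (b * t) / t - exp (a * t) / t)) {a..b}"
    using assms by (intro fundamental_theorem_of_calculus)
      (auto intro!: derivative_eq_intros simp: has_real_derivative_iff_has_vector_derivative[symmetric])
  then show "integral {a..b} (\<lambda>x. exp (x * t)) \<le> exp (b * t) / t" "(\<lambda>x. exp (x * t)) integrable_on {a..b}"
    using assms by (auto simp: integral_unique integrable_on_def)
qed

lemma Im_of_real_mult: "Im (of_real r * w) = r * Im w"
  by simp

text \<open>In the rectangle from -L to \<open>\<sigma>\<close> of height R the left side disappears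
  as L tends to infinity, thanks to exp (- L t). The top side is the error: there the integrand is
  at most exp (x t) / (c R^\<alpha>), with c the cosine in the bound, and exp (x t) is integrable up
  to \<open>\<sigma>\<close>.\<close>

lemma bromwich_half_line_error:
  fixes \<alpha> la t \<sigma> R :: real
  assumes \<alpha>: "0 < \<alpha>" "\<alpha> < 1" and la: "0 < la" and t: "0 < t" and \<sigma>: "0 < \<sigma>" and R: "0 < R"
  defines "f \<equiv> \<lambda>s::complex. exp (s * of_real t) * (1 / (s powr of_real \<alpha> + of_real la))"
  shows "\<bar>Re (integral {0..R} (\<lambda>y. f (Complex \<sigma> y))) - pi * ml_kernel \<alpha> la t\<bar>
     \<le> exp (\<sigma> * t) / (t * (cos (\<alpha> * pi / 2) * R powr \<alpha>))"
proof -
  define c where "c = cos (\<alpha> * pi / 2)"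
  have c: "0 < c" using cos_half_pos \<alpha> by (simp add: c_def)
  have low: "c * norm s powr \<alpha> \<le> norm (s powr of_real \<alpha> + of_real la)" if "0 \<le> Im s" for s
    using norm_powr_add_ge[OF that \<alpha>, of la] la by (simp add: c_def)
  have nz: "s powr of_real \<alpha> + of_real la \<noteq> 0" if "0 \<le> Im s" for s
  proof (cases "s = 0")
    case False
    then have "0 < c * norm s powr \<alpha>" using c by simp
    then show ?thesis using low[OF that] by (metis norm_zero not_less)
  qed (use la in simp)
  have nf: "norm (f s) \<le> exp (Re s * t) / (c * r powr \<alpha>)" if "0 \<le> Im s" "0 < r" "r \<le> norm s" for s r
  proof -
    have "c * r powr \<alpha> \<le> c * norm s powr \<alpha>" using that \<alpha> c by (intro mult_left_mono powr_mono2) auto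
    then have "c * r powr \<alpha> \<le> norm (s powr of_real \<alpha> + of_real la)" using low[OF that(1)] by linarith
    moreover have "0 < c * r powr \<alpha>" using c that by simp
    ultimately have "1 / norm (s powr of_real \<alpha> + of_real la) \<le> 1 / (c * r powr \<alpha>)"
      using frac_le[of 1 1 "c * r powr \<alpha>" "norm (s powr of_real \<alpha> + of_real la)"] by simp
    then have "exp (Re s * t) * (1 / norm (s powr of_real \<alpha> + of_real la)) \<le> exp (Re s * t) * (1 / (c * r powr \<alpha>))"
      by (intro mult_left_mono) auto
    then show ?thesis unfolding f_def norm_mult norm_divide by (simp add: norm_exp_eq_Re)
  qed
  have cont: "continuous_on {s. 0 \<le> Im s} f"
    unfolding f_def using nz \<alpha> by (intro continuous_intros continuous_on_powr_upper_half_plane) auto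
  have bound: "\<bar>Re (integral {0..R} (\<lambda>y. f (Complex \<sigma> y))) - pi * integral {0..L} (\<lambda>\<rho>. exp (- t * \<rho>) * ml_density \<alpha> la \<rho>)\<bar>
      \<le> exp (\<sigma> * t) / t / (c * R powr \<alpha>) + exp (- L * t) / (c * L powr \<alpha>) * R" if L: "0 < L" for L
  proof -
    have cb: "continuous_on (cbox (Complex (- L) 0) (Complex \<sigma> R)) f"
      by (rule continuous_on_subset[OF cont]) (auto simp: in_cbox_complex_iff)
    note ce = continuous_on_rectangle_edges[OF cb]
    have "Re (integral {0..R} (\<lambda>y. f (Complex \<sigma> y)))
      = Im (integral {- L..\<sigma>} (\<lambda>x. f (Complex x R))) + Re (integral {0..R} (\<lambda>y. f (Complex (- L) y)))
        - integral {0..L} (\<lambda>\<rho>. Im (f (Complex (- \<rho>) 0)))"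
    proof (rule rectangle_Im)
      show "f field_differentiable at z" if "z \<in> box (Complex (- L) 0) (Complex \<sigma> R)" for z
      proof -
        have "f holomorphic_on {z. 0 < Im z}" unfolding f_def
          by (intro holomorphic_intros) (use nz in \<open>auto simp: complex_nonpos_Reals_iff\<close>)
        then show ?thesis
          using that by (intro holomorphic_on_imp_differentiable_at[OF _ open_halfspace_Im_gt]) (auto simp: in_box_complex_iff)
      qed
      show "Im (f (Complex x 0)) = 0" if "0 \<le> x" "x \<le> \<sigma>" for x
      proof -
        have "f (Complex x 0) = of_real (exp (x * t) * (1 / (x powr \<alpha> + la)))"
          using that by (simp add: f_def complex_of_real_def[symmetric] powr_of_real exp_of_real[symmetric])
        then show ?thesis by simp
      qed
    qed (use L \<sigma> R cb in auto)
    moreover have "integral {0..L} (\<lambda>\<rho>. Im (f (Complex (- \<rho>) 0))) = integral {0..L} (\<lambda>\<rho>. - pi * (exp (- t * \<rho>) * ml_density \<alpha> la \<rho>))"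
    proof (rule integral_cong)
      fix \<rho> assume "\<rho> \<in> {0..L}"
      then have m: "Im (1 / ((- complex_of_real \<rho>) powr of_real \<alpha> + of_real la)) = - pi * ml_density \<alpha> la \<rho>"
        using ml_density_eq \<alpha> by simp
      have "f (Complex (- \<rho>) 0) = of_real (exp (- t * \<rho>)) * (1 / ((- complex_of_real \<rho>) powr of_real \<alpha> + of_real la))"
      proof -
        have "Complex (- \<rho>) 0 = - of_real \<rho>" by (simp add: complex_eq_iff)
        then show ?thesis by (simp add: f_def exp_of_real[symmetric] mult.commute)
      qed
      then show "Im (f (Complex (- \<rho>) 0)) = - pi * (exp (- t * \<rho>) * ml_density \<alpha> la \<rho>)"
        by (simp only: Im_of_real_mult m mult.left_commute)
    qed
    moreover have "\<bar>Im (integral {- L..\<sigma>} (\<lambda>x. f (Complex x R)))\<bar> \<le> exp (\<sigma> * t) / t / (c * R powr \<alpha>)"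
    proof -
      have "norm (integral {- L..\<sigma>} (\<lambda>x. f (Complex x R))) \<le> integral {- L..\<sigma>} (\<lambda>x. exp (x * t) / (c * R powr \<alpha>))"
      proof (rule integral_norm_bound_integral)
        show "(\<lambda>x. f (Complex x R)) integrable_on {- L..\<sigma>}"
          using R by (intro integrable_continuous_real ce) auto
        show "(\<lambda>x. exp (x * t) / (c * R powr \<alpha>)) integrable_on {- L..\<sigma>}"
          using integral_exp_le(2)[OF t, of "- L" \<sigma>] L \<sigma> by (auto intro: integrable_on_divide)
        show "norm (f (Complex x R)) \<le> exp (x * t) / (c * R powr \<alpha>)" for x
          using nf[of "Complex x R" R] R abs_Im_le_cmod[of "Complex x R"] by simp
      qed
      also have "\<dots> = integral {- L..\<sigma>} (\<lambda>x. exp (x * t)) / (c * R powr \<alpha>)" by simp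
      also have "\<dots> \<le> exp (\<sigma> * t) / t / (c * R powr \<alpha>)"
        using integral_exp_le(1)[OF t, of "- L" \<sigma>] L \<sigma> c by (intro divide_right_mono) auto
      finally show ?thesis using abs_Im_le_cmod order_trans by blast
    qed
    moreover have "\<bar>Re (integral {0..R} (\<lambda>y. f (Complex (- L) y)))\<bar> \<le> exp (- L * t) / (c * L powr \<alpha>) * R"
    proof -
      have "norm (integral {0..R} (\<lambda>y. f (Complex (- L) y))) \<le> exp (- L * t) / (c * L powr \<alpha>) * (R - 0)"
      proof (rule integral_bound)
        show "continuous_on {0..R} (\<lambda>y. f (Complex (- L) y))" using L \<sigma> by (intro ce) auto
        show "norm (f (Complex (- L) y)) \<le> exp (- L * t) / (c * L powr \<alpha>)" if "y \<in> {0..R}" for y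
          using nf[of "Complex (- L) y" L] L that abs_Re_le_cmod[of "Complex (- L) y"] by simp
      qed (use R in simp)
      then show ?thesis using abs_Re_le_cmod order_trans by (metis diff_zero)
    qed
    ultimately show ?thesis by (simp add: abs_le_iff)
  qed
  have "((\<lambda>L. \<bar>Re (integral {0..R} (\<lambda>y. f (Complex \<sigma> y))) - pi * integral {0..L} (\<lambda>\<rho>. exp (- t * \<rho>) * ml_density \<alpha> la \<rho>)\<bar>)
     \<longlongrightarrow> \<bar>Re (integral {0..R} (\<lambda>y. f (Complex \<sigma> y))) - pi * ml_kernel \<alpha> la t\<bar>) at_top"
    unfolding ml_kernel_def using \<alpha> la t
    by (intro tendsto_intros tendsto_integral_ivl_at_top integrable_ml_kernel) auto
  moreover have "((\<lambda>L. exp (\<sigma> * t) / t / (c * R powr \<alpha>) + exp (- L * t) / (c * L powr \<alpha>) * R) \<longlongrightarrow> exp (\<sigma> * t) / t / (c * R powr \<alpha>)) at_top"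
    using t c \<alpha> R by real_asymp
  moreover have "\<forall>\<^sub>F L in at_top. \<bar>Re (integral {0..R} (\<lambda>y. f (Complex \<sigma> y))) - pi * integral {0..L} (\<lambda>\<rho>. exp (- t * \<rho>) * ml_density \<alpha> la \<rho>)\<bar>
      \<le> exp (\<sigma> * t) / t / (c * R powr \<alpha>) + exp (- L * t) / (c * L powr \<alpha>) * R"
    using eventually_gt_at_top[of 0] by eventually_elim (use bound in blast)
  ultimately have "\<bar>Re (integral {0..R} (\<lambda>y. f (Complex \<sigma> y))) - pi * ml_kernel \<alpha> la t\<bar> \<le> exp (\<sigma> * t) / t / (c * R powr \<alpha>)"
    by (intro tendsto_le[OF trivial_limit_at_top_linorder])
  then show ?thesis by (simp add: c_def field_simps)
qed

lemma bromwich_ml_kernel: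
  assumes \<alpha>: "0 < \<alpha>" "\<alpha> < 1" and la: "0 < la" and t: "0 < t" and \<sigma>: "0 < \<sigma>"
  shows "((\<lambda>R. 1 / (2 * of_real pi * \<i>) * contour_integral (linepath (Complex \<sigma> (- R)) (Complex \<sigma> R))
      (\<lambda>s. exp (s * of_real t) * (1 / (s powr of_real \<alpha> + of_real la)))) \<longlongrightarrow> of_real (ml_kernel \<alpha> la t)) at_top"
proof -
  define f :: "complex => complex" where "f \<equiv> \<lambda>s. exp (s * of_real t) * (1 / (s powr of_real \<alpha> + of_real la))"
  define J where "J = (\<lambda>R. integral {0..R} (\<lambda>y. f (Complex \<sigma> y)))"
  have eq: "1 / (2 * of_real pi * \<i>) * contour_integral (linepath (Complex \<sigma> (- R)) (Complex \<sigma> R)) f = of_real (Re (J R) / pi)"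
    if R: "0 < R" for R
  proof -
    have nz: "s powr of_real \<alpha> + of_real la \<noteq> 0" if "0 < Re s" for s
    proof -
      have "0 \<le> Re (s powr of_real \<alpha>)"
        by (rule order_trans[OF _ Re_powr_right_half_plane_ge]) (use \<alpha> that cos_half_pos in \<open>auto simp: less_imp_le\<close>)
      then have "0 < Re (s powr of_real \<alpha> + of_real la)" using la by simp
      then show ?thesis by (metis less_irrefl zero_complex.simps(1))
    qed
    have cont: "continuous_on {s. 0 < Re s} f" unfolding f_def
      using nz \<alpha> by (intro continuous_intros) auto
    have c: "continuous_on {-R..R} (\<lambda>y. f (Complex \<sigma> y))"
      by (rule continuous_on_compose2[OF cont]) (use \<sigma> in \<open>auto simp: Complex_eq intro!: continuous_intros\<close>)
    \<comment> \<open>Conjugate symmetry: the integral over the full line is twice the real part of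
      the integral over its upper half.\<close>
    have cn: "f (Complex \<sigma> (- y)) = cnj (f (Complex \<sigma> y))" for y
    proof -
      have 1: "Complex \<sigma> (- y) = cnj (Complex \<sigma> y)" by (simp add: complex_eq_iff)
      have "cnj (Complex \<sigma> y powr of_real \<alpha>) = cnj (Complex \<sigma> y) powr of_real \<alpha>"
        by (subst cnj_powr) (use \<sigma> in auto)
      then show ?thesis unfolding f_def 1 by (simp add: exp_cnj del: complex_cnj)
    qed
    have "contour_integral (linepath (Complex \<sigma> (- R)) (Complex \<sigma> R)) f = \<i> * integral {- R..R} (\<lambda>y. f (Complex \<sigma> y))"
      by (rule contour_integral_linepath_same_Re) (use R in auto)
    also have "integral {- R..R} (\<lambda>y. f (Complex \<sigma> y)) = integral {- R..0} (\<lambda>y. f (Complex \<sigma> y)) + J R"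
      unfolding J_def using R integrable_continuous_real[OF c] by (intro Henstock_Kurzweil_Integration.integral_combine[symmetric]) auto
    also have "integral {- R..0} (\<lambda>y. f (Complex \<sigma> y)) = integral {0..R} (\<lambda>y. f (Complex \<sigma> (- y)))"
      using Henstock_Kurzweil_Integration.integral_reflect_real[of R 0 "\<lambda>y. f (Complex \<sigma> (- y))"] by simp
    also have "\<dots> = cnj (J R)" unfolding J_def cn by (rule integral_cnj[symmetric])
    also have "cnj (J R) + J R = of_real (2 * Re (J R))" using complex_add_cnj[of "J R"] by (simp add: add.commute)
    finally show ?thesis by (simp add: field_simps)
  qed
  have "((\<lambda>R. Re (J R) - pi * ml_kernel \<alpha> la t) \<longlongrightarrow> 0) at_top"
  proof (rule Lim_null_comparison)
    show "\<forall>\<^sub>F R in at_top. norm (Re (J R) - pi * ml_kernel \<alpha> la t) \<le> exp (\<sigma> * t) / (t * (cos (\<alpha> * pi / 2) * R powr \<alpha>))"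
      using eventually_gt_at_top[of 0]
      by eventually_elim (use bromwich_half_line_error[OF \<alpha> la t \<sigma>] in \<open>simp add: J_def f_def\<close>)
    show "((\<lambda>R. exp (\<sigma> * t) / (t * (cos (\<alpha> * pi / 2) * R powr \<alpha>))) \<longlongrightarrow> 0) at_top"
      using t \<alpha> cos_half_pos[OF \<alpha>] by real_asymp
  qed
  then have "((\<lambda>R. Re (J R)) \<longlongrightarrow> pi * ml_kernel \<alpha> la t) at_top" by (simp add: LIM_zero_iff)
  then have "((\<lambda>R. complex_of_real (Re (J R) / pi)) \<longlongrightarrow> of_real (pi * ml_kernel \<alpha> la t / pi)) at_top"
    by (intro tendsto_intros) auto
  moreover have "\<forall>\<^sub>F R in at_top. complex_of_real (Re (J R) / pi) = 1 / (2 * of_real pi * \<i>) * contour_integral (linepath (Complex \<sigma> (- R)) (Complex \<sigma> R)) f"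
    using eventually_gt_at_top[of 0] by eventually_elim (use eq in simp)
  ultimately show ?thesis unfolding f_def[symmetric] by (simp add: tendsto_cong)
qed

section \<open>The discrete kernel\<close>

text \<open>Generating polynomial of the average with weights 1 - \<alpha>/2 and \<alpha>/2 at the
  times n and n - 1, which the scheme applies on both sides of its equation.\<close>

definition cq_avg_fps :: "real => real fps" where
  "cq_avg_fps \<alpha> = fps_const (1 - \<alpha>/2) + fps_const (\<alpha>/2) * fps_X"

definition bdf2_fps :: "real fps" where
  "bdf2_fps = fps_const (3/2) - fps_const 2 * fps_X + fps_const (1/2) * fps_X ^ 2"

definition cq_den_fps :: "real => real => real fps" where
  "cq_den_fps \<alpha> la = Abs_fps (cq_weight \<alpha>) + fps_const la * cq_avg_fps \<alpha>"

text \<open>The factor \<open>bdf2_fps\<close> occurs twice: once from \<open>bdf2\<close> applied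
  to the double integral of the data, once from recovering the approximation from
  \<open>U\<close>.\<close>

definition cq_response :: "real => real => nat => real" where
  "cq_response \<alpha> la k = fps_nth (bdf2_fps ^ 2 * cq_avg_fps \<alpha> / cq_den_fps \<alpha> la) k"

text \<open>The response at time \<open>x\<close> of the scheme with step size 1 to a point source at time 0.\<close>

definition cq_kernel :: "real => real => real => real" where
  "cq_kernel \<alpha> la x = (\<Sum>k. cq_response \<alpha> la k * max 0 (x - real k))"

lemma cq_kernel_eq:
  assumes "x \<le> real m"
  shows "cq_kernel \<alpha> la x = (\<Sum>k<m. cq_response \<alpha> la k * max 0 (x - real k))"
  unfolding cq_kernel_def by (rule suminf_finite) (use assms in auto)

lemma cq_kernel_of_nat: "cq_kernel \<alpha> la (real n) = (\<Sum>k\<le>n. cq_response \<alpha> la k * real (n - k))"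
proof -
  have "cq_kernel \<alpha> la (real n) = (\<Sum>k\<le>n. cq_response \<alpha> la k * max 0 (real n - real k))"
    using cq_kernel_eq[of "real n" "Suc n"] by (simp only: lessThan_Suc_atMost)
  also have "\<dots> = (\<Sum>k\<le>n. cq_response \<alpha> la k * real (n - k))"
    by (rule sum.cong) (auto simp: of_nat_diff)
  finally show ?thesis .
qed

text \<open>The scheme sees the data only through their second antiderivative, so its kernel is a
  combination of ramps with corners at integers.\<close>

lemma cq_kernel_linear:
  assumes "0 \<le> w" "w \<le> 1"
  shows "cq_kernel \<alpha> la (real n + w) = (1 - w) * cq_kernel \<alpha> la (real n) + w * cq_kernel \<alpha> la (real (Suc n))"
proof -
  have "cq_kernel \<alpha> la x = (\<Sum>k\<le>n. cq_response \<alpha> la k * max 0 (x - real k))" if "x \<le> real (Suc n)" for x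
    using cq_kernel_eq[OF that] by (simp add: lessThan_Suc_atMost)
  then have e: "cq_kernel \<alpha> la x = (\<Sum>k\<le>n. cq_response \<alpha> la k * (x - real k))" if "real n \<le> x" "x \<le> real (Suc n)" for x
    using that by (auto simp: max_def intro!: sum.cong)
  show ?thesis
    using assms by (simp add: e sum_distrib_left algebra_simps sum.distrib sum_subtractf)
qed

lemma cq_weight_gbinomial: "cq_weight \<alpha> k = (- 1) ^ k * (\<alpha> gchoose k)"
proof (induction k)
  case (Suc k)
  have "(\<alpha> gchoose Suc k) * real (Suc k) = (\<alpha> - real k) * (\<alpha> gchoose k)"
    using gbinomial_mult_1[of \<alpha> k] by (simp add: algebra_simps)
  then have "(\<alpha> gchoose Suc k) = (\<alpha> - real k) * (\<alpha> gchoose k) / real (Suc k)"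
    by (simp add: field_simps del: of_nat_Suc)
  moreover have "1 - (\<alpha> + 1) / real (Suc k) = - (\<alpha> - real k) / real (Suc k)"
    by (simp add: field_simps)
  moreover have "cq_weight \<alpha> (Suc k) = (1 - (\<alpha> + 1) / real (Suc k)) * cq_weight \<alpha> k" by simp
  ultimately have "cq_weight \<alpha> (Suc k) = - (\<alpha> - real k) / real (Suc k) * ((- 1) ^ k * (\<alpha> gchoose k))"
    using Suc.IH by (simp only:)
  also have "\<dots> = (- 1) ^ Suc k * ((\<alpha> - real k) * (\<alpha> gchoose k) / real (Suc k))"
    by (simp only: power_Suc times_divide_eq_left times_divide_eq_right) (simp only: mult_ac mult_minus_left mult_minus_right minus_mult_minus mult_1_left)
  finally show ?case using \<open>(\<alpha> gchoose Suc k) = _\<close> by (simp only:)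
qed simp

lemma cq_weight_sums:
  assumes "norm (z::complex) < 1"
  shows "(\<lambda>k. of_real (cq_weight \<alpha> k) * z ^ k) sums (1 - z) powr of_real \<alpha>"
proof -
  have g: "complex_of_real (\<alpha> gchoose k) = (of_real \<alpha> gchoose k)" for k
    by (simp add: gbinomial_prod_rev)
  have "(\<lambda>k. (of_real \<alpha> gchoose k) * (- z) ^ k) sums (1 + - z) powr of_real \<alpha>"
    by (rule gen_binomial_complex) (use assms in simp)
  then show ?thesis
    by (simp add: cq_weight_gbinomial g power_minus[of z] mult_ac)
qed

definition cq_avg :: "real => complex => complex" where
  "cq_avg \<alpha> z = of_real (1 - \<alpha>/2) + of_real (\<alpha>/2) * z"

definition cq_den :: "real => real => complex => complex" where
  "cq_den \<alpha> la z = (1 - z) powr of_real \<alpha> + of_real la * cq_avg \<alpha> z"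

lemma Re_cq_avg_nonneg:
  assumes "0 \<le> \<alpha>" "\<alpha> < 1" "- 1 \<le> Re z"
  shows "0 < Re (cq_avg \<alpha> z)"
proof -
  have "\<alpha> * (1 - Re z) \<le> \<alpha> * 2" using assms by (intro mult_left_mono) auto
  then show ?thesis using assms by (simp add: cq_avg_def algebra_simps)
qed

lemma cq_den_ge_left:
  assumes "0 < \<alpha>" "\<alpha> < 1" "0 \<le> la" "Re z \<le> 1" "0 \<le> Re (cq_avg \<alpha> z)"
  shows "cos (\<alpha> * pi / 2) * norm (1 - z) powr \<alpha> \<le> norm (cq_den \<alpha> la z)"
  using norm_add_ge_rotated[of 1 "cos (\<alpha> * pi / 2)" "(1 - z) powr of_real \<alpha>" "cq_avg \<alpha> z" la]
    Re_powr_right_half_plane_ge[of "1 - z" \<alpha>] assms by (simp add: cq_den_def norm_powr_of_real)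

lemma cq_den_nonzero:
  assumes "0 < \<alpha>" "\<alpha> < 1" "0 \<le> la" "norm z < 1"
  shows "cq_den \<alpha> la z \<noteq> 0"
proof -
  have z: "Re z < 1" "- 1 \<le> Re z" "z \<noteq> 1"
    using assms abs_Re_le_cmod[of z] by auto
  have "0 < cos (\<alpha> * pi / 2) * norm (1 - z) powr \<alpha>" using z cos_half_pos assms by simp
  also have "\<dots> \<le> norm (cq_den \<alpha> la z)"
    using z assms Re_cq_avg_nonneg[of \<alpha> z] by (intro cq_den_ge_left) auto
  finally show ?thesis by simp
qed

text \<open>The scheme is an identity between real series, whereas expansions of holomorphic
  functions are complex series; this embedding connects them.\<close>

definition fps_complex :: "real fps => complex fps" where
  "fps_complex F = Abs_fps (\<lambda>n. of_real (fps_nth F n))"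

lemma fps_complex_simps:
  "fps_complex (F + G) = fps_complex F + fps_complex G"
  "fps_complex (F - G) = fps_complex F - fps_complex G"
  "fps_complex (F * G) = fps_complex F * fps_complex G"
  "fps_complex (fps_const c) = fps_const (of_real c)"
  "fps_complex fps_X = fps_X"
  by (auto simp: fps_complex_def fps_eq_iff fps_mult_nth)

lemma cq_den_fps_nth_0: "fps_nth (cq_den_fps \<alpha> la) 0 = 1 + la * (1 - \<alpha>/2)"
  by (simp add: cq_den_fps_def cq_avg_fps_def)

lemma cq_response_0:
  assumes "0 < \<alpha>" "\<alpha> < 1" "0 \<le> la"
  shows "\<bar>cq_response \<alpha> la 0\<bar> \<le> 9 / 4"
proof -
  have p: "0 \<le> la * (1 - \<alpha>/2)" using assms by simp
  have "cq_response \<alpha> la 0 = 9/4 * (1 - \<alpha>/2) / (1 + la * (1 - \<alpha>/2))"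
    unfolding cq_response_def
    by (subst fps_divide_nth_0) (use p in \<open>simp_all add: cq_den_fps_nth_0 bdf2_fps_def cq_avg_fps_def power2_eq_square add_pos_nonneg less_imp_neq[symmetric]\<close>)
  then have "\<bar>cq_response \<alpha> la 0\<bar> = \<bar>9/4 * (1 - \<alpha>/2) / (1 + la * (1 - \<alpha>/2))\<bar>" by (rule arg_cong)
  also have "\<dots> = 9/4 * (1 - \<alpha>/2) / (1 + la * (1 - \<alpha>/2))"
  proof (rule abs_of_nonneg, rule divide_nonneg_nonneg)
    show "0 \<le> 9/4 * (1 - \<alpha>/2)" using assms by simp
    show "0 \<le> 1 + la * (1 - \<alpha>/2)" using p by linarith
  qed
  also have "\<dots> \<le> 9/4 * (1 - \<alpha>/2) / 1"
  proof (rule divide_left_mono)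
    show "1 \<le> 1 + la * (1 - \<alpha>/2)" "0 < (1 + la * (1 - \<alpha>/2)) * 1" unfolding mult_1_right using p by linarith+
  qed (use assms in simp)
  finally show ?thesis using assms by simp
qed

lemma holomorphic_on_cq_den: "cq_den \<alpha> la holomorphic_on ball 0 1"
  unfolding cq_den_def cq_avg_def
proof (intro holomorphic_intros)
  fix z :: complex assume "z \<in> ball 0 1"
  then have "0 < Re (1 - z)" using abs_Re_le_cmod[of z] by auto
  then show "1 - z \<notin> \<real>\<^sub>\<le>\<^sub>0" by (auto simp: complex_nonpos_Reals_iff)
qed

text \<open>The denominator has no zero in the unit disc, so the quotient is holomorphic there. By
  uniqueness of expansions the formal quotient of series is its Taylor series, which therefore
  converges for |z| < 1.\<close>

lemma cq_response_sums:
  assumes "0 < \<alpha>" "\<alpha> < 1" "0 \<le> la" "norm z < 1"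
  shows "(\<lambda>k. of_real (cq_response \<alpha> la k) * z ^ k) sums
      ((((1 - z) * (3 - z) / 2))\<^sup>2 * cq_avg \<alpha> z / cq_den \<alpha> la z)"
    and "summable (\<lambda>k. norm (of_real (cq_response \<alpha> la k) * z ^ k))"
proof -
  define f where "f = (\<lambda>z. ((of_real (3/2) - of_real 2 * z + of_real (1/2) * z ^ 2))\<^sup>2 * cq_avg \<alpha> z / cq_den \<alpha> la z)"
  have n0: "fps_nth (cq_den_fps \<alpha> la) 0 \<noteq> 0"
    using assms mult_nonneg_nonneg[of la "1 - \<alpha>/2"] unfolding cq_den_fps_nth_0 by linarith
  have d: "cq_den \<alpha> la has_fps_expansion fps_complex (cq_den_fps \<alpha> la)"
  proof -
    have "(\<lambda>z. (1 - z) powr of_real \<alpha>) has_fps_expansion fps_complex (Abs_fps (cq_weight \<alpha>))"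
    proof (rule has_fps_expansionI)
      have "\<forall>\<^sub>F z in nhds 0. z \<in> ball (0::complex) 1" by (intro eventually_nhds_in_open) auto
      then show "\<forall>\<^sub>F u in nhds 0. (\<lambda>n. fps_nth (fps_complex (Abs_fps (cq_weight \<alpha>))) n * u ^ n) sums (1 - u) powr of_real \<alpha>"
        by eventually_elim (use cq_weight_sums in \<open>simp add: fps_complex_def\<close>)
    qed
    then show ?thesis unfolding cq_den_def[abs_def] cq_avg_def cq_den_fps_def cq_avg_fps_def fps_complex_simps
      by (intro fps_expansion_intros)
  qed
  have "f has_fps_expansion (fps_complex (bdf2_fps ^ 2 * cq_avg_fps \<alpha>) / fps_complex (cq_den_fps \<alpha> la))"
    unfolding f_def
  proof (rule has_fps_expansion_divide')
    show "(\<lambda>z. ((of_real (3/2) - of_real 2 * z + of_real (1/2) * z ^ 2))\<^sup>2 * cq_avg \<alpha> z) has_fps_expansion fps_complex (bdf2_fps ^ 2 * cq_avg_fps \<alpha>)"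
      unfolding cq_avg_def cq_avg_fps_def bdf2_fps_def fps_complex_simps power2_eq_square
      by (intro fps_expansion_intros)
  qed (use d n0 in \<open>auto simp: fps_complex_def\<close>)
  \<comment> \<open>Division passes through the embedding because the constant coefficient of the
    denominator is nonzero, so that the quotient is determined by multiplying back.\<close>
  also have "fps_complex (bdf2_fps ^ 2 * cq_avg_fps \<alpha>) / fps_complex (cq_den_fps \<alpha> la)
      = fps_complex (bdf2_fps ^ 2 * cq_avg_fps \<alpha> / cq_den_fps \<alpha> la)"
  proof -
    have "fps_complex (bdf2_fps ^ 2 * cq_avg_fps \<alpha>) = fps_complex (bdf2_fps ^ 2 * cq_avg_fps \<alpha> / cq_den_fps \<alpha> la) * fps_complex (cq_den_fps \<alpha> la)"
      unfolding fps_complex_simps(3)[symmetric] using n0 by (simp add: fps_divide_unit mult.assoc inverse_mult_eq_1)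
    moreover have "fps_complex (cq_den_fps \<alpha> la) \<noteq> 0"
      using n0 by (metis fps_complex_def fps_nth_Abs_fps fps_zero_nth of_real_eq_0_iff)
    ultimately show ?thesis by simp
  qed
  finally have e: "f has_fps_expansion fps_complex (bdf2_fps ^ 2 * cq_avg_fps \<alpha> / cq_den_fps \<alpha> la)" .
  have hol: "f holomorphic_on eball 0 1"
    unfolding f_def cq_avg_def one_ereal_def eball_ereal
    by (intro holomorphic_intros holomorphic_on_cq_den) (use cq_den_nonzero assms in auto)
  have "f has_fps_expansion fps_expansion f 0"
    by (rule has_fps_expansion_fps_expansion[of "ball 0 1"]) (use hol in \<open>auto simp: one_ereal_def\<close>)
  with e have eq: "fps_expansion f 0 = fps_complex (bdf2_fps ^ 2 * cq_avg_fps \<alpha> / cq_den_fps \<alpha> la)"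
    using fps_expansion_unique_complex by blast
  have nth: "fps_nth (fps_expansion f 0) k = of_real (cq_response \<alpha> la k)" for k
    by (simp add: eq cq_response_def fps_complex_def)
  have "1 \<le> fps_conv_radius (fps_expansion f 0)" by (rule conv_radius_fps_expansion[OF hol])
  moreover have "ereal (norm z) < 1" using assms by simp
  ultimately have r: "ereal (norm z) < fps_conv_radius (fps_expansion f 0)" by (rule less_le_trans[rotated])
  have "(\<lambda>k. of_real (cq_response \<alpha> la k) * z ^ k) sums eval_fps (fps_expansion f 0) z"
    using summable_sums[OF summable_fps[OF r]] by (simp add: nth eval_fps_def)
  also have "eval_fps (fps_expansion f 0) z = f z"
    using eval_fps_expansion'[OF hol, of z] assms by simp
  also have "f z = (((1 - z) * (3 - z) / 2))\<^sup>2 * cq_avg \<alpha> z / cq_den \<alpha> la z"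
  proof -
    have "of_real (3/2) - of_real 2 * z + of_real (1/2) * z ^ 2 = (1 - z) * (3 - z) / 2"
      by (simp add: power2_eq_square field_simps)
    then show ?thesis by (simp only: f_def)
  qed
  finally show "(\<lambda>k. of_real (cq_response \<alpha> la k) * z ^ k) sums \<dots>" .
  show "summable (\<lambda>k. norm (of_real (cq_response \<alpha> la k) * z ^ k))"
    using norm_summable_fps[OF r] by (simp add: nth)
qed

definition cq_symbol :: "real => real => complex => complex" where
  "cq_symbol \<alpha> la z = z * (3 - z)\<^sup>2 / 4 * cq_avg \<alpha> z / cq_den \<alpha> la z"

text \<open>Convolution with the sequence n multiplies the generating function by z / (1 - z)^2.
  This cancels the double zero at z = 1 of the squared BDF polynomial, so for \<open>la > 0\<close>
  no pole remains at z = 1 in \<open>cq_symbol\<close>.\<close>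

lemma cq_kernel_sums:
  assumes "0 < \<alpha>" "\<alpha> < 1" "0 \<le> la" "norm z < 1"
  shows "(\<lambda>n. of_real (cq_kernel \<alpha> la (real n)) * z ^ n) sums cq_symbol \<alpha> la z"
proof -
  note w = cq_response_sums[OF assms]
  have g: "(\<lambda>n. of_nat n * z ^ n) sums (z / (1 - z)\<^sup>2)"
  proof -
    have "(\<lambda>n. z * (of_nat (Suc n) * z ^ n)) sums (z * (1 / (1 - z)\<^sup>2))"
      by (intro sums_mult geometric_deriv_sums assms)
    then have "(\<lambda>n. of_nat (Suc n) * z ^ Suc n) sums (z / (1 - z)\<^sup>2)" by (simp add: mult_ac)
    from sums_Suc[OF this] show ?thesis by simp
  qed
  have ga: "summable (\<lambda>n. norm (of_nat n * z ^ n))"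
  proof -
    have "(\<lambda>n. (norm z) * (of_nat (Suc n) * (norm z) ^ n)) sums (norm z * (1 / (1 - norm z)\<^sup>2))"
      by (intro sums_mult geometric_deriv_sums) (use assms in simp)
    then have "summable (\<lambda>n. real (Suc n) * norm z ^ Suc n)" by (auto simp: sums_iff mult_ac)
    then show ?thesis by (subst summable_Suc_iff[symmetric]) (simp add: norm_mult norm_power del: of_nat_Suc power_Suc)
  qed
  have "(\<lambda>n. \<Sum>i\<le>n. (of_real (cq_response \<alpha> la i) * z ^ i) * (of_nat (n - i) * z ^ (n - i)))
     sums ((((1 - z) * (3 - z) / 2))\<^sup>2 * cq_avg \<alpha> z / cq_den \<alpha> la z * (z / (1 - z)\<^sup>2))"
    using Cauchy_product_sums[OF w(2) ga] w(1) g by (simp add: sums_iff)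
  also have "(\<lambda>n. \<Sum>i\<le>n. (of_real (cq_response \<alpha> la i) * z ^ i) * (of_nat (n - i) * z ^ (n - i)))
      = (\<lambda>n. of_real (cq_kernel \<alpha> la (real n)) * z ^ n)"
  proof
    fix n
    have "(of_real (cq_response \<alpha> la i) * z ^ i) * (of_nat (n - i) * z ^ (n - i))
      = of_real (cq_response \<alpha> la i * real (n - i)) * z ^ n" if "i \<le> n" for i
    proof -
      have "z ^ i * z ^ (n - i) = z ^ n" using that by (simp add: power_add[symmetric])
      then show ?thesis by (simp add: algebra_simps)
    qed
    then show "(\<Sum>i\<le>n. (of_real (cq_response \<alpha> la i) * z ^ i) * (of_nat (n - i) * z ^ (n - i)))
      = of_real (cq_kernel \<alpha> la (real n)) * z ^ n"
      unfolding cq_kernel_of_nat of_real_sum sum_distrib_right by (intro sum.cong) auto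
  qed
  also have "(((1 - z) * (3 - z) / 2))\<^sup>2 * cq_avg \<alpha> z / cq_den \<alpha> la z * (z / (1 - z)\<^sup>2) = cq_symbol \<alpha> la z"
    using assms by (auto simp: cq_symbol_def power2_eq_square divide_simps)
  finally show ?thesis .
qed

section \<open>Comparison of the two kernels\<close>

text \<open>The contour has to be pushed beyond |z| = 1 up to |z| = exp d, with a bound uniform in
  \<open>la\<close>. For Re z <= 1 both terms lie in the right half-plane. For Re z > 1 they are
  rotated by exp (- i \<alpha> pi / 2); the average survives this because z is then close to the
  real axis.\<close>

lemma eventually_cq_den_ge:
  fixes \<alpha> :: real
  assumes "0 < \<alpha>" "\<alpha> < 1"
  shows "\<forall>\<^sub>F d in at_right 0. \<forall>s la. - d \<le> Re s \<longrightarrow> 0 \<le> Im s \<longrightarrow> Im s \<le> pi \<longrightarrow> 0 \<le> la \<longrightarrow>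
     cos (\<alpha> * pi / 2) * norm (1 - exp (- s)) powr \<alpha> \<le> norm (cq_den \<alpha> la (exp (- s)))"
proof -
  define w where "w = \<alpha> * pi / 2"
  have c: "0 < cos w" using cos_half_pos assms by (simp add: w_def)
  have "0 \<le> w" "w \<le> pi" using assms by (auto simp: w_def field_simps)
  then have sn: "0 \<le> sin w" by (rule sin_ge_zero)
  have "((\<lambda>d::real. \<alpha> * exp d) \<longlongrightarrow> \<alpha> * exp 0) (at_right 0)" by (intro tendsto_intros)
  \<comment> \<open>At Re z = - exp d the average has real part 1 - \<alpha>/2 - (\<alpha>/2) exp d,
    which stays positive for small d because \<alpha> < 1.\<close>
  then have ev1: "\<forall>\<^sub>F d in at_right 0. \<alpha> * exp d < 2 - \<alpha>"
    by (rule order_tendstoD) (use assms in auto)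
  have "((\<lambda>d::real. sin w * (\<alpha>/2) * sqrt ((exp d)\<^sup>2 - 1)) \<longlongrightarrow> sin w * (\<alpha>/2) * sqrt ((exp 0)\<^sup>2 - 1)) (at_right 0)"
    by (intro tendsto_intros)
  \<comment> \<open>If Re z > 1 and |z| <= exp d, then |Im z| <= sqrt (exp (2 d) - 1). This keeps
    the rotated average in the right half-plane.\<close>
  then have ev2: "\<forall>\<^sub>F d in at_right 0. sin w * (\<alpha>/2) * sqrt ((exp d)\<^sup>2 - 1) < cos w"
    by (rule order_tendstoD) (use c in auto)
  show ?thesis using ev1 ev2
  proof (eventually_elim, intro allI impI)
    fix d :: real and s :: complex and la :: real
    assume d: "\<alpha> * exp d < 2 - \<alpha>" "sin w * (\<alpha>/2) * sqrt ((exp d)\<^sup>2 - 1) < cos w"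
      and s: "- d \<le> Re s" "0 \<le> Im s" "Im s \<le> pi" and la: "0 \<le> la"
    define z where "z = exp (- s)"
    have nz: "norm z \<le> exp d" using s by (simp add: z_def)
    have imz: "Im z \<le> 0" using sin_ge_zero[OF s(2,3)] by (simp add: z_def Im_exp)
    show "cos (\<alpha> * pi / 2) * norm (1 - exp (- s)) powr \<alpha> \<le> norm (cq_den \<alpha> la (exp (- s)))"
      unfolding z_def[symmetric]
    proof (cases "Re z \<le> 1")
      case True
      have "\<alpha> * (- Re z) \<le> \<alpha> * exp d" using abs_Re_le_cmod[of z] nz assms by (intro mult_left_mono) auto
      then have "0 \<le> Re (cq_avg \<alpha> z)" using d(1) by (simp add: cq_avg_def)
      then show "cos (\<alpha> * pi / 2) * norm (1 - z) powr \<alpha> \<le> norm (cq_den \<alpha> la z)"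
        using cq_den_ge_left[OF assms la True] by simp
    next
      case False
      have "(Im z)\<^sup>2 \<le> (exp d)\<^sup>2 - 1"
      proof -
        have "(Re z)\<^sup>2 + (Im z)\<^sup>2 = (norm z)\<^sup>2" by (simp add: cmod_power2)
        moreover have "(norm z)\<^sup>2 \<le> (exp d)\<^sup>2" using nz by (intro power_mono) auto
        moreover have "1 \<le> (Re z)\<^sup>2" using False by (intro one_le_power) auto
        ultimately show ?thesis by linarith
      qed
      then have "\<bar>Im z\<bar> \<le> sqrt ((exp d)\<^sup>2 - 1)" by (rule real_le_rsqrt[of "\<bar>Im z\<bar>", simplified])
      then have "sin w * (\<alpha>/2) * \<bar>Im z\<bar> \<le> sin w * (\<alpha>/2) * sqrt ((exp d)\<^sup>2 - 1)"
        using sn assms by (intro mult_left_mono) auto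
      then have 1: "sin w * (\<alpha>/2) * \<bar>Im z\<bar> \<le> cos w" using d(2) by linarith
      have "1 \<le> Re (cq_avg \<alpha> z)"
        using mult_left_mono[of 1 "Re z" "\<alpha>/2"] False assms by (simp add: cq_avg_def)
      then have "cos w * 1 \<le> cos w * Re (cq_avg \<alpha> z)" using c by (intro mult_left_mono) auto
      moreover have "Re (exp (- \<i> * of_real w) * cq_avg \<alpha> z) = cos w * Re (cq_avg \<alpha> z) + sin w * ((\<alpha>/2) * Im z)"
        by (simp add: cq_avg_def Re_exp Im_exp)
      ultimately have "0 \<le> Re (exp (- \<i> * of_real w) * cq_avg \<alpha> z)" using 1 imz by (simp add: mult.assoc)
      moreover have "cos w * norm ((1 - z) powr of_real \<alpha>) \<le> Re (exp (- \<i> * of_real w) * (1 - z) powr of_real \<alpha>)"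
        unfolding w_def using assms imz by (intro Re_rotated_powr_ge) auto
      moreover have "norm (exp (- \<i> * of_real w)) = 1" by simp
      ultimately show "cos (\<alpha> * pi / 2) * norm (1 - z) powr \<alpha> \<le> norm (cq_den \<alpha> la z)"
        using norm_add_ge_rotated[of "exp (- \<i> * of_real w)" "cos w" "(1 - z) powr of_real \<alpha>" "cq_avg \<alpha> z" la] la
        by (simp add: cq_den_def norm_powr_of_real w_def)
    qed
  qed
qed

text \<open>Up to the phase exp (i \<alpha> pi) this is (1 - z)^\<alpha> divided by the average at z
  = exp r, that is, at s = -r on the cut: the quantity by which the scheme replaces
  r^\<alpha>.\<close>

definition cq_omega :: "real => real => real" where
  "cq_omega \<alpha> r = (exp r - 1) powr \<alpha> / (1 - \<alpha>/2 + \<alpha>/2 * exp r)"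

text \<open>Second-order accuracy of the scheme on the branch cut.\<close>

lemma cq_omega_consistency:
  fixes \<alpha> :: real
  assumes "0 < \<alpha>" "\<alpha> < 1"
  obtains K where "0 < K"
    "\<forall>\<^sub>F r in at_right 0. \<bar>cq_omega \<alpha> r - r powr \<alpha>\<bar> \<le> K * r powr (\<alpha> + 2) \<and> r powr \<alpha> / 2 \<le> cq_omega \<alpha> r \<and>
       \<bar>exp r * (3 - exp r)\<^sup>2 / 4 - 1\<bar> \<le> K * r\<^sup>2"
proof -
  \<comment> \<open>Both (exp r - 1)^\<alpha> / r^\<alpha> and the average expand as 1 + \<alpha> r
    / 2 + O(r^2); the weight \<alpha>/2 makes the linear terms cancel in the quotient.\<close>
  have "(\<lambda>r. cq_omega \<alpha> r - r powr \<alpha>) \<in> O[at_right 0](\<lambda>r. r powr (\<alpha> + 2))"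
    unfolding cq_omega_def using assms by real_asymp
  then obtain K1 where K1: "0 < K1" "\<forall>\<^sub>F r in at_right 0. norm (cq_omega \<alpha> r - r powr \<alpha>) \<le> K1 * norm (r powr (\<alpha> + 2))"
    by (rule landau_o.bigE)
  \<comment> \<open>z (3 - z)^2 / 4 has value 1 and derivative 0 at z = 1.\<close>
  have "(\<lambda>r::real. exp r * (3 - exp r)\<^sup>2 / 4 - 1) \<in> O[at_right 0](\<lambda>r. r\<^sup>2)"
    by real_asymp
  then obtain K2 where K2: "0 < K2" "\<forall>\<^sub>F r in at_right 0. norm (exp r * (3 - exp r)\<^sup>2 / 4 - 1) \<le> K2 * norm ((r::real)\<^sup>2)"
    by (rule landau_o.bigE)
  have "((\<lambda>r. cq_omega \<alpha> r / r powr \<alpha>) \<longlongrightarrow> 1) (at_right 0)"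
    unfolding cq_omega_def using assms by real_asymp
  then have ev: "\<forall>\<^sub>F r in at_right 0. 1 / 2 < cq_omega \<alpha> r / r powr \<alpha>" by (rule order_tendstoD) simp
  have pos: "\<forall>\<^sub>F r in at_right (0::real). 0 < r" by (simp add: eventually_at_right_less)
  show ?thesis
  proof (rule that[of "max K1 K2"])
    show "\<forall>\<^sub>F r in at_right 0. \<bar>cq_omega \<alpha> r - r powr \<alpha>\<bar> \<le> max K1 K2 * r powr (\<alpha> + 2) \<and> r powr \<alpha> / 2 \<le> cq_omega \<alpha> r \<and>
       \<bar>exp r * (3 - exp r)\<^sup>2 / 4 - 1\<bar> \<le> max K1 K2 * r\<^sup>2"
      using K1(2) K2(2) ev pos
    proof eventually_elim
      case (elim r)
      have "K1 * r powr (\<alpha> + 2) \<le> max K1 K2 * r powr (\<alpha> + 2)" "K2 * r\<^sup>2 \<le> max K1 K2 * r\<^sup>2"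
        by (auto intro!: mult_right_mono)
      moreover have "r powr \<alpha> / 2 \<le> cq_omega \<alpha> r" using elim by (simp add: field_simps)
      moreover have "\<bar>cq_omega \<alpha> r - r powr \<alpha>\<bar> \<le> K1 * r powr (\<alpha> + 2)" "\<bar>exp r * (3 - exp r)\<^sup>2 / 4 - 1\<bar> \<le> K2 * r\<^sup>2"
        using elim by simp_all
      ultimately show ?case by (meson order_trans)
    qed
  qed (use K1 in auto)
qed

lemma norm_rotated_add_ge:
  assumes "0 < \<alpha>" "\<alpha> < 1" "0 \<le> la" "0 \<le> V"
  shows "cos (\<alpha> * pi / 2) * V \<le> norm (of_real V * exp (\<i> * of_real (\<alpha> * pi)) + of_real la)"
proof -
  have "V = (V powr (1 / \<alpha>)) powr \<alpha>" using assms by (simp add: powr_powr)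
  then show ?thesis
    using norm_powr_add_ge[of "- of_real (V powr (1 / \<alpha>))" \<alpha> la] powr_of_negative_real[of "V powr (1 / \<alpha>)" \<alpha>] assms
    by simp
qed

text \<open>Both denominators are at least a constant times rho^\<alpha>, uniformly in
  \<open>la\<close>. The consistency errors rho^(\<alpha>+2) and rho^2 are divided by two and by one
  of them, respectively, and both quotients have the size rho^(2-\<alpha>).\<close>

lemma branch_cut_comparison:
  assumes "0 < \<alpha>" "\<alpha> < 1" "0 \<le> la" "0 < \<rho>" "0 < K"
    and "\<bar>cq_omega \<alpha> \<rho> - \<rho> powr \<alpha>\<bar> \<le> K * \<rho> powr (\<alpha> + 2)" "\<rho> powr \<alpha> / 2 \<le> cq_omega \<alpha> \<rho>"
    and "\<bar>exp \<rho> * (3 - exp \<rho>)\<^sup>2 / 4 - 1\<bar> \<le> K * \<rho>\<^sup>2"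
  shows "norm (1 / ((- of_real \<rho>) powr of_real \<alpha> + of_real la) - cq_symbol \<alpha> la (of_real (exp \<rho>)))
     \<le> 4 * K / (cos (\<alpha> * pi / 2))\<^sup>2 * \<rho> powr (2 - \<alpha>)"
proof -
  define c where "c = cos (\<alpha> * pi / 2)"
  define \<omega> where "\<omega> = exp (\<i> * complex_of_real (\<alpha> * pi))"
  define V where "V = cq_omega \<alpha> \<rho>"
  define b where "b = 1 - \<alpha>/2 + \<alpha>/2 * exp \<rho>"
  define q where "q = exp \<rho> * (3 - exp \<rho>)\<^sup>2 / 4"
  define r where "r = \<rho> powr \<alpha>"
  have c: "0 < c" "c \<le> 1" using cos_half_pos assms by (auto simp: c_def)
  have b: "0 < b" using assms by (simp add: b_def add_pos_pos)
  have r: "0 < r" using assms by (simp add: r_def)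
  have V: "r / 2 \<le> V" using assms(7) by (simp add: r_def V_def)
  with r have "0 < V" by linarith
  note V = V this
  define A where "A = of_real r * \<omega> + of_real la"
  define B where "B = of_real V * \<omega> + of_real la"
  have A: "(- of_real \<rho>) powr of_real \<alpha> + of_real la = A"
    using powr_of_negative_real[of \<rho> \<alpha>] assms by (simp add: A_def r_def \<omega>_def)
  have nA: "c * r \<le> norm A" and nB: "c * V \<le> norm B"
    using norm_rotated_add_ge[OF assms(1-3)] r V by (auto simp: A_def B_def c_def \<omega>_def)
  have pA: "0 < norm A" and pB: "0 < norm B"
    using less_le_trans[OF mult_pos_pos nA] less_le_trans[OF mult_pos_pos nB] c r V by simp_all
  have B: "cq_symbol \<alpha> la (of_real (exp \<rho>)) = of_real q / B"
  proof -
    have "(1 - complex_of_real (exp \<rho>)) powr of_real \<alpha> = of_real (V * b) * \<omega>"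
      using powr_of_negative_real[of "exp \<rho> - 1" \<alpha>] assms b by (simp add: V_def cq_omega_def b_def \<omega>_def)
    moreover have "cq_avg \<alpha> (of_real (exp \<rho>)) = of_real b" by (simp add: cq_avg_def b_def)
    ultimately have "cq_symbol \<alpha> la (of_real (exp \<rho>)) = of_real q * of_real b / (of_real b * B)"
      by (simp add: cq_symbol_def cq_den_def q_def B_def algebra_simps)
    then show ?thesis using b by simp
  qed
  \<comment> \<open>\<open>V - r\<close> measures the consistency of the fractional difference with
    its average, \<open>q - 1\<close> that of the two BDF operators.\<close>
  have "1 / A - of_real q / B = of_real (V - r) * \<omega> / (A * B) - of_real (q - 1) / B"
  proof -
    have "A \<noteq> 0" "B \<noteq> 0" using pA pB by auto
    moreover have "B - A = of_real (V - r) * \<omega>" by (simp add: A_def B_def algebra_simps)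
    ultimately have "1 / A - 1 / B = of_real (V - r) * \<omega> / (A * B)" by (simp add: diff_frac_eq)
    moreover have "of_real q / B = 1 / B + of_real (q - 1) / B" by (simp add: add_divide_distrib[symmetric])
    ultimately show ?thesis by simp
  qed
  also have "norm \<dots> \<le> \<bar>V - r\<bar> / (norm A * norm B) + \<bar>q - 1\<bar> / norm B"
    by (rule order_trans[OF norm_triangle_ineq4])
       (simp add: norm_mult norm_divide \<omega>_def del: of_real_diff of_real_add of_real_mult)
  also have "\<dots> \<le> K * \<rho> powr (\<alpha> + 2) / ((c * r) * (c * (r / 2))) + K * \<rho>\<^sup>2 / (c * (r / 2))"
  proof (rule add_mono)
    have l: "c * (r / 2) \<le> norm B" using nB V(1) c by (meson mult_left_mono less_imp_le order_trans)
    show "\<bar>V - r\<bar> / (norm A * norm B) \<le> K * \<rho> powr (\<alpha> + 2) / ((c * r) * (c * (r / 2)))"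
      using assms(6) l nA c r by (intro frac_le mult_mono mult_pos_pos) (auto simp: V_def r_def)
    show "\<bar>q - 1\<bar> / norm B \<le> K * \<rho>\<^sup>2 / (c * (r / 2))"
      using assms(8) l c r assms(5) by (intro frac_le) (auto simp: q_def)
  qed
  also have "\<dots> = (2 * K / c\<^sup>2 + 2 * K / c) * \<rho> powr (2 - \<alpha>)"
  proof -
    have "\<rho> powr (\<alpha> + 2) = \<rho> powr (2 - \<alpha>) * (r * r)" "\<rho>\<^sup>2 = \<rho> powr (2 - \<alpha>) * r"
    proof -
      have "\<rho> powr (2 - \<alpha>) * (r * r) = \<rho> powr ((2 - \<alpha>) + (\<alpha> + \<alpha>))" "\<rho> powr (2 - \<alpha>) * r = \<rho> powr ((2 - \<alpha>) + \<alpha>)"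
        by (simp_all only: r_def powr_add)
      then show "\<rho> powr (\<alpha> + 2) = \<rho> powr (2 - \<alpha>) * (r * r)" "\<rho>\<^sup>2 = \<rho> powr (2 - \<alpha>) * r"
        using assms by (simp_all add: powr_numeral)
    qed
    then show ?thesis using c r by (simp add: field_simps power2_eq_square)
  qed
  also have "\<dots> \<le> (4 * K / c\<^sup>2) * \<rho> powr (2 - \<alpha>)"
  proof (rule mult_right_mono)
    \<comment> \<open>Since c <= 1, the term with 1/c is absorbed into the one with 1/c^2.\<close>
    have "c * c \<le> 1 * c" using c by (intro mult_right_mono) auto
    then have "1 / c \<le> 1 / c\<^sup>2" using c by (simp add: frac_le power2_eq_square)
    from mult_left_mono[OF this, of "2 * K"] show "2 * K / c\<^sup>2 + 2 * K / c \<le> 4 * K / c\<^sup>2" using assms(5) by simp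
  qed simp
  finally show ?thesis unfolding A B c_def .
qed

lemma has_integral_cos_int_multiple:
  fixes j :: int
  shows "((\<lambda>y. cos (of_int j * y)) has_integral (if j = 0 then pi else 0)) {0..pi}"
proof (cases "j = 0")
  case True
  then show ?thesis using has_integral_const_real[of "1::real" 0 pi] by simp
next
  case False
  have "((\<lambda>y. cos (of_int j * y)) has_integral (sin (of_int j * pi) / of_int j - sin (of_int j * 0) / of_int j)) {0..pi}"
    using False by (intro fundamental_theorem_of_calculus)
      (auto intro!: derivative_eq_intros simp: has_real_derivative_iff_has_vector_derivative[symmetric])
  moreover have "sin (of_int j * pi) = 0" by (metis mult.commute sin_int_2pin sin_zero_iff_int2 mult.commute)
  ultimately show ?thesis using False by simp
qed

text \<open>Extraction of a coefficient on the circle |z| = exp (- \<open>\<sigma>\<close>). The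
  coefficients are real, so the real part of the integral over half a period suffices, and the
  cosines of integer multiples are orthogonal to 1 on [0, pi].\<close>

lemma cq_kernel_half_period:
  assumes "0 < \<alpha>" "\<alpha> < 1" "0 \<le> la" "0 < \<sigma>"
    and int: "(\<lambda>y. exp (of_nat n * Complex \<sigma> y) * cq_symbol \<alpha> la (exp (- Complex \<sigma> y))) integrable_on {0..pi}"
  shows "Re (integral {0..pi} (\<lambda>y. exp (of_nat n * Complex \<sigma> y) * cq_symbol \<alpha> la (exp (- Complex \<sigma> y)))) = pi * cq_kernel \<alpha> la (real n)"
proof -
  let ?F = "\<lambda>y. exp (of_nat n * Complex \<sigma> y) * cq_symbol \<alpha> la (exp (- Complex \<sigma> y))"
  define a where "a = (\<lambda>k. cq_kernel \<alpha> la (real k))"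
  define g where "g = (\<lambda>k y. a k * exp (\<sigma> * (real n - real k)) * cos (of_int (int n - int k) * y))"
  have sums: "(\<lambda>k. g k y) sums Re (?F y)" for y
  proof -
    let ?z = "exp (- Complex \<sigma> y)"
    have "norm ?z < 1" using assms by simp
    from sums_mult[OF cq_kernel_sums[OF assms(1-3) this], of "exp (of_nat n * Complex \<sigma> y)"]
    have "(\<lambda>k. Re (exp (of_nat n * Complex \<sigma> y) * (of_real (a k) * ?z ^ k))) sums Re (?F y)"
      by (intro sums_Re) (simp add: a_def)
    moreover have "Re (exp (of_nat n * Complex \<sigma> y) * (of_real (a k) * ?z ^ k)) = g k y" for k
    proof -
      have "exp (of_nat n * Complex \<sigma> y) * ?z ^ k = exp (of_real (real n - real k) * Complex \<sigma> y)"
        by (simp add: exp_of_nat_mult[symmetric] exp_add[symmetric] algebra_simps)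
      then have "exp (of_nat n * Complex \<sigma> y) * (of_real (a k) * ?z ^ k) = of_real (a k) * exp (of_real (real n - real k) * Complex \<sigma> y)"
        by (simp only: mult.left_commute)
      from arg_cong[OF this, of Re] show ?thesis by (simp add: g_def Re_exp algebra_simps del: exp_of_nat_mult)
    qed
    ultimately show ?thesis by simp
  qed
  have summ: "summable (\<lambda>k. \<bar>a k\<bar> * exp (\<sigma> * (real n - real k)))"
  proof -
    \<comment> \<open>Convergence at the larger radius exp (- \<open>\<sigma>\<close> / 2) yields
      absolute convergence at exp (- \<open>\<sigma>\<close>), hence a majorant for the series in
      y.\<close>
    have "summable (\<lambda>k. complex_of_real (a k) * of_real (exp (- \<sigma> / 2)) ^ k)"
      using cq_kernel_sums[OF assms(1-3), of "of_real (exp (- \<sigma> / 2))"] assms by (simp add: sums_iff a_def)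
    from powser_insidea[OF this, of "of_real (exp (- \<sigma>))"]
    have "summable (\<lambda>k. \<bar>a k\<bar> * exp (- \<sigma>) ^ k)" using assms by (simp add: norm_mult norm_power)
    from summable_mult[OF this, of "exp (\<sigma> * real n)"]
    show ?thesis
      by (rule summable_cong[THEN iffD1, rotated])
         (simp add: exp_of_nat_mult[symmetric] exp_add[symmetric] algebra_simps exp_diff exp_minus field_simps)
  qed
  have "uniform_limit {0..pi} (\<lambda>m y. \<Sum>k<m. g k y) (\<lambda>y. \<Sum>k. g k y) sequentially"
    by (rule Weierstrass_m_test[OF _ summ]) (auto simp: g_def abs_mult mult_left_le)
  then obtain I J where I: "\<And>m. ((\<lambda>y. \<Sum>k<m. g k y) has_integral I m) {0..pi}"
    and J: "((\<lambda>y. \<Sum>k. g k y) has_integral J) {0..pi}" and lim: "I \<longlonglongrightarrow> J"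
    by (rule uniform_limit_integral) (auto simp: g_def intro!: continuous_intros)
  have "I m = pi * a n" if "n < m" for m
  proof -
    have "((\<lambda>y. \<Sum>k<m. g k y) has_integral (\<Sum>k<m. a k * exp (\<sigma> * (real n - real k)) * (if int n - int k = 0 then pi else 0))) {0..pi}"
      unfolding g_def by (intro has_integral_sum has_integral_mult_right has_integral_cos_int_multiple) auto
    moreover have "(\<Sum>k<m. a k * exp (\<sigma> * (real n - real k)) * (if int n - int k = 0 then pi else 0)) = (\<Sum>k<m. if k = n then pi * a n else 0)"
      by (rule sum.cong) auto
    ultimately show ?thesis using has_integral_unique[OF I] that by simp
  qed
  then have "I \<longlonglongrightarrow> pi * a n"
    by (intro tendsto_eventually) (auto intro!: eventually_mono[OF eventually_gt_at_top[of n]])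
  then have "J = pi * a n" using lim LIMSEQ_unique by blast
  moreover have "(\<lambda>y. \<Sum>k. g k y) = (\<lambda>y. Re (?F y))" using sums by (simp add: sums_iff)
  ultimately have "integral {0..pi} (\<lambda>y. Re (?F y)) = pi * a n" using J by (simp add: integral_unique)
  moreover have "Re (integral {0..pi} ?F) = integral {0..pi} (\<lambda>y. Re (?F y))"
    using integral_linear[OF int bounded_linear_Re] by (simp add: o_def)
  ultimately show ?thesis by (simp add: a_def)
qed

text \<open>The comparison of symbols is available only near the branch point, so the integral over
  the cut is truncated at \<open>d\<close>. Beyond \<open>d\<close> one has 1 <= rho^2 / d^2, and
  the factor rho^2 yields the decay t^(\<alpha>-3).\<close>

lemma ml_kernel_tail:
  assumes "0 < \<alpha>" "\<alpha> < 1" "0 \<le> la" "0 < t" "0 < d"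
  shows "\<bar>ml_kernel \<alpha> la t - integral {0..d} (\<lambda>\<rho>. exp (- t * \<rho>) * ml_density \<alpha> la \<rho>)\<bar>
      \<le> 1 / d\<^sup>2 * (ml_const \<alpha> 2 * t powr (\<alpha> - 3))"
    and "(\<lambda>\<rho>. exp (- t * \<rho>) * ml_density \<alpha> la \<rho>) integrable_on {0..d}"
proof -
  let ?f = "\<lambda>\<rho>. exp (- t * \<rho>) * ml_density \<alpha> la \<rho>"
  note I = integrable_ml_kernel[OF assms(1-4)]
  have i1: "integrable lborel (\<lambda>\<rho>. indicator {..d} \<rho> * (indicator {0<..} \<rho> * ?f \<rho>))"
    using integrable_mult_indicator[OF _ I, of "{..d}"] by simp
  then have si: "set_integrable lborel {0<..d} ?f"
    unfolding set_integrable_def by (rule Bochner_Integration.integrable_cong[THEN iffD1, rotated 2]) (auto simp: indicator_def)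
  have e1: "(LINT \<rho>|lborel. indicator {..d} \<rho> * (indicator {0<..} \<rho> * ?f \<rho>)) = integral {0..d} ?f"
  proof -
    have "(LINT \<rho>|lborel. indicator {..d} \<rho> * (indicator {0<..} \<rho> * ?f \<rho>)) = (LINT \<rho>:{0<..d}|lborel. ?f \<rho>)"
      unfolding set_lebesgue_integral_def by (rule Bochner_Integration.integral_cong) (auto simp: indicator_def)
    also have "\<dots> = integral {0<..d} ?f" by (rule set_borel_integral_eq_integral(2)[OF si])
    also have "\<dots> = integral {0..d} ?f" by (rule integral_spike_set) (auto intro: negligible_subset[of "{0}"])
    finally show ?thesis .
  qed
  have "?f integrable_on {0<..d}" by (rule set_borel_integral_eq_integral(1)[OF si])
  then show "?f integrable_on {0..d}"
    by (rule integrable_spike_set) (auto intro: negligible_subset[of "{0}"])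
  have "ml_kernel \<alpha> la t - integral {0..d} ?f
    = (LINT \<rho>|lborel. indicator {0<..} \<rho> * ?f \<rho> - indicator {..d} \<rho> * (indicator {0<..} \<rho> * ?f \<rho>))"
    unfolding e1[symmetric] ml_kernel_def using I i1 by simp
  also have "\<dots> = (LINT \<rho>|lborel. indicator {0<..} \<rho> * ((indicator {d<..} \<rho> * exp (- t * \<rho>)) * ml_density \<alpha> la \<rho>))"
    by (rule Bochner_Integration.integral_cong) (auto simp: indicator_def)
  finally have "ml_kernel \<alpha> la t - integral {0..d} ?f = \<dots>" .
  moreover have "\<bar>\<dots>\<bar> \<le> 1 / d\<^sup>2 * (ml_const \<alpha> 2 * t powr (\<alpha> - 1 - 2))"
  proof (rule abs_integral_ml_density_le(2))
    fix \<rho> :: real assume r: "0 < \<rho>"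
    show "\<bar>indicator {d<..} \<rho> * exp (- t * \<rho>)\<bar> \<le> 1 / d\<^sup>2 * (\<rho> powr 2 * exp (- t * \<rho>))"
    proof (cases "d < \<rho>")
      case True
      then have "d\<^sup>2 \<le> \<rho>\<^sup>2" using assms by (intro power_mono) auto
      then have "1 \<le> \<rho>\<^sup>2 / d\<^sup>2" using assms by simp
      from mult_right_mono[OF this, of "exp (- t * \<rho>)"] show ?thesis using True r by (simp add: powr_numeral)
    qed (use r in auto)
  qed (use assms in auto)
  ultimately show "\<bar>ml_kernel \<alpha> la t - integral {0..d} ?f\<bar> \<le> 1 / d\<^sup>2 * (ml_const \<alpha> 2 * t powr (\<alpha> - 3))" by simp
qed

lemma integral_powr_exp_le:
  fixes p t :: real
  assumes "- 1 < p" "0 < t" "0 < d"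
  shows "(\<lambda>r. r powr p * exp (- t * r)) integrable_on {0..d}"
    and "integral {0..d} (\<lambda>r. r powr p * exp (- t * r)) \<le> Gamma (p + 1) * t powr (- p - 1)"
proof -
  let ?g = "\<lambda>r. r powr p * exp (- t * r)"
  note G = has_bochner_integral_Gamma[OF assms(1,2)]
  have "((\<lambda>r. indicator {0<..} r * ?g r) has_integral Gamma (p + 1) * t powr (- p - 1)) UNIV"
    using has_integral_integral_lborel[of "\<lambda>r. indicator {0<..} r * ?g r"] G by (simp add: has_bochner_integral_iff)
  moreover have "(\<lambda>r. indicator {0<..} r * ?g r) = (\<lambda>r. if r \<in> {0<..} then ?g r else 0)" by (auto simp: indicator_def)
  ultimately have H: "(?g has_integral Gamma (p + 1) * t powr (- p - 1)) {0<..}" by (simp only: has_integral_restrict_UNIV)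
  then have H: "(?g has_integral Gamma (p + 1) * t powr (- p - 1)) {0..}"
    by (rule has_integral_spike_set_eq[THEN iffD1, rotated 2]) (auto intro: negligible_subset[of "{0}"])
  have "?g absolutely_integrable_on {0..}" using H by (intro nonnegative_absolutely_integrable_1) auto
  then have "?g absolutely_integrable_on {0..d}" by (rule set_integrable_subset) auto
  then show i: "?g integrable_on {0..d}" by (rule set_lebesgue_integral_eq_integral(1))
  have "integral {0..d} ?g \<le> integral {0..} ?g" by (rule integral_subset_le) (use i H in auto)
  then show "integral {0..d} ?g \<le> Gamma (p + 1) * t powr (- p - 1)" using H by (simp add: integral_unique)
qed

lemma exp_decay_bound:
  fixes d :: real
  assumes "0 < d"
  obtains K where "0 < K" "\<And>n::nat. 1 \<le> n ==> exp (- d * real n) \<le> K * real n powr p"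
proof -
  have "(\<lambda>n. exp (- d * real n) / real n powr p) \<longlonglongrightarrow> 0" using assms by real_asymp
  then have "Bseq (\<lambda>n. exp (- d * real n) / real n powr p)" using convergentI convergent_imp_Bseq by blast
  then obtain K where K: "0 < K" "\<And>n. norm (exp (- d * real n) / real n powr p) \<le> K" by (auto simp: Bseq_def)
  show ?thesis
  proof (rule that[OF K(1)])
    fix n :: nat assume "1 \<le> n"
    then show "exp (- d * real n) \<le> K * real n powr p" using K(2)[of n] by (simp add: field_simps)
  qed
qed

text \<open>Negative \<open>r\<close> is included on purpose: it covers z = exp (- s) on the line Im
  s = pi, as well as z in (0, 1] on the positive axis.\<close>

lemma Im_cq_symbol_real:
  assumes "r \<le> 1"
  shows "Im (cq_symbol \<alpha> la (of_real r)) = 0"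
proof -
  have p: "(1 - complex_of_real r) powr of_real \<alpha> = of_real ((1 - r) powr \<alpha>)"
    using powr_of_real[of "1 - r" \<alpha>, symmetric] assms by (simp only: of_real_diff of_real_1 diff_ge_0_iff_ge)
  have "cq_symbol \<alpha> la (of_real r) = of_real (r * (3 - r)\<^sup>2 / 4 * (1 - \<alpha>/2 + \<alpha>/2 * r) / ((1 - r) powr \<alpha> + la * (1 - \<alpha>/2 + \<alpha>/2 * r)))"
    by (simp only: cq_symbol_def cq_avg_def cq_den_def p of_real_mult of_real_divide of_real_add of_real_diff of_real_power of_real_numeral of_real_1)
  then show ?thesis by (simp only: Im_complex_of_real)
qed

lemma exp_Complex_0: "exp (Complex x 0) = of_real (exp x)"
  by (auto simp: complex_eq_iff Re_exp Im_exp)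

lemma exp_Complex_pi: "exp (Complex x pi) = of_real (- exp x)" "exp (- Complex x pi) = of_real (- exp (- x))"
  by (auto simp: complex_eq_iff Re_exp Im_exp)

text \<open>With z = exp (- s) the coefficient integral has period 2 pi i, so the rectangle has
  height pi. Its right side yields \<open>cq_kernel\<close>, its top side is real, its left side is
  exponentially small in n, and the cut on its bottom side is compared with the integral that
  represents \<open>ml_kernel\<close>. A defect rho^(2-\<alpha>) integrated against exp (- n rho)
  becomes n^(\<alpha>-3).\<close>

lemma kernel_difference_nat:
  fixes \<alpha> :: real
  assumes \<alpha>: "0 < \<alpha>" "\<alpha> < 1"
  obtains C where "0 < C"
    "\<And>la n. 0 < la ==> 1 \<le> n ==> \<bar>ml_kernel \<alpha> la (real n) - cq_kernel \<alpha> la (real n)\<bar> \<le> C * real n powr (\<alpha> - 3)"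
proof -
  define c where "c = cos (\<alpha> * pi / 2)"
  have c: "0 < c" using cos_half_pos \<alpha> by (simp add: c_def)
  obtain K where K: "0 < K" and evK: "\<forall>\<^sub>F \<rho> in at_right 0. \<bar>cq_omega \<alpha> \<rho> - \<rho> powr \<alpha>\<bar> \<le> K * \<rho> powr (\<alpha> + 2) \<and> \<rho> powr \<alpha> / 2 \<le> cq_omega \<alpha> \<rho> \<and>
       \<bar>exp \<rho> * (3 - exp \<rho>)\<^sup>2 / 4 - 1\<bar> \<le> K * \<rho>\<^sup>2"
    using cq_omega_consistency[OF \<alpha>] .
  obtain b1 where b1: "0 < b1" "\<And>\<rho>. 0 < \<rho> ==> \<rho> < b1 ==> \<bar>cq_omega \<alpha> \<rho> - \<rho> powr \<alpha>\<bar> \<le> K * \<rho> powr (\<alpha> + 2) \<and> \<rho> powr \<alpha> / 2 \<le> cq_omega \<alpha> \<rho> \<and>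
       \<bar>exp \<rho> * (3 - exp \<rho>)\<^sup>2 / 4 - 1\<bar> \<le> K * \<rho>\<^sup>2"
    using evK unfolding eventually_at_right_field by blast
  obtain b2 where b2: "0 < b2" "\<And>d. 0 < d ==> d < b2 ==> (\<forall>s la. - d \<le> Re s \<longrightarrow> 0 \<le> Im s \<longrightarrow> Im s \<le> pi \<longrightarrow> 0 \<le> la \<longrightarrow>
     c * norm (1 - exp (- s)) powr \<alpha> \<le> norm (cq_den \<alpha> la (exp (- s))))"
    using eventually_cq_den_ge[OF \<alpha>] unfolding eventually_at_right_field c_def by blast
  \<comment> \<open>Small enough both for consistency on the cut up to \<open>d\<close> and for the
    lower bound of the denominator left of the imaginary axis.\<close>
  define d where "d = min b1 b2 / 2"
  have d: "0 < d" "d < b1" "d < b2" using b1(1) b2(1) by (auto simp: d_def)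
  have den: "c * norm (1 - exp (- s)) powr \<alpha> \<le> norm (cq_den \<alpha> la (exp (- s)))"
    if "- d \<le> Re s" "0 \<le> Im s" "Im s \<le> pi" "0 \<le> la" for s la
    using b2(2)[OF d(1,3)] that by blast
  define K' where "K' = 4 * K / c\<^sup>2"
  \<comment> \<open>Bounds \<open>cq_symbol\<close> on the side Re s = - d, where |z| = exp d and |1
    - z| >= exp d - 1.\<close>
  define M where "M = exp d * (3 + exp d)\<^sup>2 / 4 * (1 + exp d) / (c * (exp d - 1) powr \<alpha>)"
  obtain D where D: "0 < D" "\<And>n::nat. 1 \<le> n ==> exp (- d * real n) \<le> D * real n powr (\<alpha> - 3)"
    using exp_decay_bound[OF d(1), of "\<alpha> - 3"] by blast
  have M: "0 \<le> M" using c d by (simp add: M_def)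
  define C where "C = (K' * Gamma (3 - \<alpha>) + pi * M * D) / pi + 1 / d\<^sup>2 * ml_const \<alpha> 2"
  have main: "\<bar>ml_kernel \<alpha> la (real n) - cq_kernel \<alpha> la (real n)\<bar> \<le> C * real n powr (\<alpha> - 3)"
    if la: "0 < la" and n: "1 \<le> n" for la n
  proof -
    define F where "F = (\<lambda>s. exp (of_nat n * s) * cq_symbol \<alpha> la (exp (- s)))"
    \<comment> \<open>The abscissa 1 of the right side stands for any positive number: it
      corresponds to a circle inside the unit disc.\<close>
    define R where "R = cbox (Complex (- d) 0) (Complex 1 pi)"
    have im: "0 \<le> Im (1 - exp (- s))" if "0 \<le> Im s" "Im s \<le> pi" for s
      using sin_ge_zero[OF that] by (simp add: Im_exp)
    have nz: "cq_den \<alpha> la (exp (- s)) \<noteq> 0" if "- d \<le> Re s" "0 \<le> Im s" "Im s \<le> pi" for s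
    proof (cases "exp (- s) = 1")
      case True
      then show ?thesis using la by (simp add: cq_den_def cq_avg_def flip: of_real_add)
    next
      case False
      then have "0 < c * norm (1 - exp (- s)) powr \<alpha>" using c by simp
      then show ?thesis using den[OF that, of la] la by auto
    qed
    have cont: "continuous_on R F"
      unfolding F_def cq_symbol_def cq_avg_def R_def
    proof (intro continuous_intros)
      show "continuous_on (cbox (Complex (- d) 0) (Complex 1 pi)) (\<lambda>s. cq_den \<alpha> la (exp (- s)))"
        unfolding cq_den_def cq_avg_def
        by (intro continuous_intros continuous_on_powr_upper_half_plane im) (use \<alpha> in \<open>auto simp: in_cbox_complex_iff\<close>)
    qed (use nz in \<open>auto simp: in_cbox_complex_iff\<close>)
    have hol: "F field_differentiable at s" if s: "s \<in> box (Complex (- d) 0) (Complex 1 pi)" for s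
    proof (rule holomorphic_on_imp_differentiable_at[OF _ open_box s])
      have r: "1 - exp (- s) \<notin> \<real>\<^sub>\<le>\<^sub>0" if "s \<in> box (Complex (- d) 0) (Complex 1 pi)" for s
        using that sin_gt_zero[of "Im s"] by (auto simp: complex_nonpos_Reals_iff Im_exp in_box_complex_iff)
      have n: "cq_den \<alpha> la (exp (- s)) \<noteq> 0" if "s \<in> box (Complex (- d) 0) (Complex 1 pi)" for s
        using that nz by (auto simp: in_box_complex_iff)
      show "F holomorphic_on box (Complex (- d) 0) (Complex 1 pi)"
        using n r unfolding F_def cq_symbol_def cq_avg_def cq_den_def by (intro holomorphic_intros) auto
    qed
    note ce = continuous_on_rectangle_edges[OF cont[unfolded R_def]]
    have rect: "Re (integral {0..pi} (\<lambda>y. F (Complex 1 y)))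
      = Im (integral {- d..1} (\<lambda>x. F (Complex x pi))) + Re (integral {0..pi} (\<lambda>y. F (Complex (- d) y)))
        - integral {0..d} (\<lambda>\<rho>. Im (F (Complex (- \<rho>) 0)))"
    proof (rule rectangle_Im[OF _ _ _ cont[unfolded R_def] hol])
      show "Im (F (Complex x 0)) = 0" if "0 \<le> x" "x \<le> 1" for x
      proof -
        have "- Complex x 0 = Complex (- x) 0" by (simp add: complex_eq_iff)
        then have "F (Complex x 0) = of_real (exp (real n * x)) * cq_symbol \<alpha> la (of_real (exp (- x)))"
          by (simp add: F_def exp_of_nat_mult exp_Complex_0)
        then show ?thesis using Im_cq_symbol_real[of "exp (- x)" \<alpha> la] that by (simp only: Im_of_real_mult) simp
      qed
    qed (use d in auto)
    \<comment> \<open>On Im s = pi both exp (n s) and the symbol at z = - exp (- x) are real, so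
      this side drops out of the imaginary part.\<close>
    have top: "Im (integral {- d..1} (\<lambda>x. F (Complex x pi))) = 0"
    proof -
      have z: "Im (F (Complex x pi)) = 0" for x
      proof -
        have "F (Complex x pi) = of_real ((- exp x) ^ n) * cq_symbol \<alpha> la (of_real (- exp (- x)))"
          by (simp add: F_def exp_of_nat_mult exp_Complex_pi)
        moreover have "Im (cq_symbol \<alpha> la (of_real (- exp (- x)))) = 0"
          by (rule Im_cq_symbol_real) (use exp_gt_zero[of "- x"] in linarith)
        ultimately show ?thesis by (simp only: Im_of_real_mult mult_zero_right)
      qed
      have "(\<lambda>x. F (Complex x pi)) integrable_on {- d..1}" by (intro integrable_continuous_real ce) auto
      from integral_linear[OF this bounded_linear_Im] show ?thesis by (simp add: o_def z)
    qed
    have S: "Re (integral {0..pi} (\<lambda>y. F (Complex 1 y))) = pi * cq_kernel \<alpha> la (real n)"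
      unfolding F_def
    proof (rule cq_kernel_half_period[OF \<alpha>])
      show "(\<lambda>y. exp (of_nat n * Complex 1 y) * cq_symbol \<alpha> la (exp (- Complex 1 y))) integrable_on {0..pi}"
        using integrable_continuous_real[OF ce(2)[of 1]] d by (simp add: F_def)
    qed (use la in auto)
    have left: "\<bar>Re (integral {0..pi} (\<lambda>y. F (Complex (- d) y)))\<bar> \<le> pi * M * D * real n powr (\<alpha> - 3)"
    proof -
      have "norm (integral {0..pi} (\<lambda>y. F (Complex (- d) y))) \<le> exp (- d * real n) * M * (pi - 0)"
      proof (rule integral_bound)
        fix y assume y: "y \<in> {0..pi}"
        define z where "z = exp (- Complex (- d) y)"
        have z: "norm z = exp d" by (simp add: z_def)
        have "norm (cq_symbol \<alpha> la z) = norm z * norm (3 - z)^2 / 4 * norm (cq_avg \<alpha> z) / norm (cq_den \<alpha> la z)"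
          by (simp add: cq_symbol_def norm_mult norm_divide norm_power)
        also have "\<dots> \<le> M" unfolding M_def
        proof (intro frac_le mult_mono divide_right_mono power_mono)
          show "norm (3 - z) \<le> 3 + exp d" using norm_triangle_ineq4[of 3 z] z by simp
          have "norm (cq_avg \<alpha> z) \<le> norm (complex_of_real (1 - \<alpha>/2)) + norm (of_real (\<alpha>/2) * z)"
            unfolding cq_avg_def by (rule norm_triangle_ineq)
          also have "\<dots> = (1 - \<alpha>/2) + \<alpha>/2 * exp d" using z \<alpha> by (simp add: norm_mult del: of_real_diff of_real_divide)
          also have "\<dots> \<le> 1 + 1 * exp d" using \<alpha> by (intro add_mono mult_right_mono) auto
          finally show "norm (cq_avg \<alpha> z) \<le> 1 + exp d" by simp
          have "exp d - 1 \<le> norm (1 - z)" using norm_triangle_ineq2[of z 1] z by (simp add: norm_minus_commute)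
          then have "c * (exp d - 1) powr \<alpha> \<le> c * norm (1 - z) powr \<alpha>"
            using c d \<alpha> by (intro mult_left_mono powr_mono2) auto
          also have "\<dots> \<le> norm (cq_den \<alpha> la z)" unfolding z_def by (rule den) (use y la in auto)
          finally show "c * (exp d - 1) powr \<alpha> \<le> norm (cq_den \<alpha> la z)" .
        qed (use z c d in auto)
        finally have "norm (cq_symbol \<alpha> la z) \<le> M" .
        then show "norm (F (Complex (- d) y)) \<le> exp (- d * real n) * M"
          by (simp add: F_def norm_mult z_def mult.commute)
      qed (use d in \<open>auto intro!: ce\<close>)
      also have "\<dots> \<le> (D * real n powr (\<alpha> - 3)) * M * (pi - 0)"
        using D(2)[OF n] M by (intro mult_right_mono) auto
      finally show ?thesis by (intro order_trans[OF abs_Re_le_cmod]) (simp add: mult_ac)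
    qed
    define A where "A = (\<lambda>\<rho>. Im (1 / ((- complex_of_real \<rho>) powr of_real \<alpha> + of_real la)))"
    define B where "B = (\<lambda>\<rho>. Im (cq_symbol \<alpha> la (of_real (exp \<rho>))))"
    have FB: "Im (F (Complex (- \<rho>) 0)) = exp (- real n * \<rho>) * B \<rho>" for \<rho>
    proof -
      have "- Complex (- \<rho>) 0 = Complex \<rho> 0" by (simp add: complex_eq_iff)
      then have "F (Complex (- \<rho>) 0) = of_real (exp (- real n * \<rho>)) * cq_symbol \<alpha> la (of_real (exp \<rho>))"
        by (simp add: F_def exp_of_nat_mult exp_Complex_0 exp_minus power_inverse)
      then show ?thesis by (simp only: Im_of_real_mult B_def)
    qed
    note tail = ml_kernel_tail[OF \<alpha> less_imp_le[OF la] _ d(1), of "real n"]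
    have iA: "(\<lambda>\<rho>. exp (- real n * \<rho>) * A \<rho>) integrable_on {0..d}"
      and eA: "integral {0..d} (\<lambda>\<rho>. exp (- real n * \<rho>) * A \<rho>) = - pi * integral {0..d} (\<lambda>\<rho>. exp (- real n * \<rho>) * ml_density \<alpha> la \<rho>)"
    proof -
      have e: "exp (- real n * \<rho>) * A \<rho> = - pi * (exp (- real n * \<rho>) * ml_density \<alpha> la \<rho>)" if "\<rho> \<in> {0..d}" for \<rho>
        using ml_density_eq[of \<rho> \<alpha> la] that \<alpha> unfolding A_def by simp
      have "(\<lambda>\<rho>. - pi * (exp (- real n * \<rho>) * ml_density \<alpha> la \<rho>)) integrable_on {0..d}"
        using integrable_cmul[OF tail(2), of "- pi"] n by simp
      then show "(\<lambda>\<rho>. exp (- real n * \<rho>) * A \<rho>) integrable_on {0..d}"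
        by (rule integrable_eq) (use e in simp)
      have "integral {0..d} (\<lambda>\<rho>. exp (- real n * \<rho>) * A \<rho>) = integral {0..d} (\<lambda>\<rho>. - pi * (exp (- real n * \<rho>) * ml_density \<alpha> la \<rho>))"
        by (rule integral_cong) (rule e)
      then show "integral {0..d} (\<lambda>\<rho>. exp (- real n * \<rho>) * A \<rho>) = - pi * integral {0..d} (\<lambda>\<rho>. exp (- real n * \<rho>) * ml_density \<alpha> la \<rho>)"
        by simp
    qed
    have iB: "(\<lambda>\<rho>. exp (- real n * \<rho>) * B \<rho>) integrable_on {0..d}"
    proof -
      have "continuous_on {0..d} (\<lambda>\<rho>. Im (F (Complex (- \<rho>) 0)))"
        by (intro continuous_intros continuous_on_compose2[OF ce(1)[of 0], of _ uminus]) auto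
      then show ?thesis unfolding FB by (rule integrable_continuous_real)
    qed
    have diff: "\<bar>integral {0..d} (\<lambda>\<rho>. exp (- real n * \<rho>) * B \<rho>) - integral {0..d} (\<lambda>\<rho>. exp (- real n * \<rho>) * A \<rho>)\<bar>
        \<le> K' * Gamma (3 - \<alpha>) * real n powr (\<alpha> - 3)"
    proof -
      note ip = integral_powr_exp_le[of "2 - \<alpha>" "real n", OF _ _ d(1)]
      have "norm (integral {0..d} (\<lambda>\<rho>. exp (- real n * \<rho>) * B \<rho> - exp (- real n * \<rho>) * A \<rho>)) \<le> integral {0..d} (\<lambda>\<rho>. K' * (\<rho> powr (2 - \<alpha>) * exp (- real n * \<rho>)))"
      proof (rule integral_norm_bound_integral)
        show "(\<lambda>\<rho>. K' * (\<rho> powr (2 - \<alpha>) * exp (- real n * \<rho>))) integrable_on {0..d}"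
          using integrable_cmul[OF ip(1), of K'] \<alpha> n by simp
        fix \<rho> assume r: "\<rho> \<in> {0..d}"
        have "\<bar>B \<rho> - A \<rho>\<bar> \<le> K' * \<rho> powr (2 - \<alpha>)"
        proof (cases "\<rho> = 0")
          \<comment> \<open>At the branch point both symbols are real.\<close>
          case True
          then show ?thesis by (simp add: A_def B_def cq_symbol_def cq_den_def cq_avg_def flip: of_real_add)
        next
          case False
          then have "norm (1 / ((- of_real \<rho>) powr of_real \<alpha> + of_real la) - cq_symbol \<alpha> la (of_real (exp \<rho>))) \<le> K' * \<rho> powr (2 - \<alpha>)"
            unfolding K'_def c_def using b1(2)[of \<rho>] r d la K by (intro branch_cut_comparison \<alpha>) auto
          then show ?thesis unfolding A_def B_def by (metis (no_types) abs_Im_le_cmod abs_minus_commute minus_complex.simps(2) order_trans)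
        qed
        from mult_left_mono[OF this, of "exp (- real n * \<rho>)"]
        show "norm (exp (- real n * \<rho>) * B \<rho> - exp (- real n * \<rho>) * A \<rho>) \<le> K' * (\<rho> powr (2 - \<alpha>) * exp (- real n * \<rho>))"
          by (subst right_diff_distrib[symmetric]) (simp add: abs_mult mult.commute mult.left_commute)
      qed (intro integrable_diff iA iB)
      also have "\<dots> \<le> K' * (Gamma (2 - \<alpha> + 1) * real n powr (- (2 - \<alpha>) - 1))"
        using ip(2) \<alpha> n K by (simp add: K'_def divide_right_mono mult_left_mono)
      finally show ?thesis using integral_diff[OF iB iA] by (simp add: algebra_simps)
    qed
    have "pi * (integral {0..d} (\<lambda>\<rho>. exp (- real n * \<rho>) * ml_density \<alpha> la \<rho>) - cq_kernel \<alpha> la (real n))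
      = (integral {0..d} (\<lambda>\<rho>. exp (- real n * \<rho>) * B \<rho>) - integral {0..d} (\<lambda>\<rho>. exp (- real n * \<rho>) * A \<rho>))
         - Re (integral {0..pi} (\<lambda>y. F (Complex (- d) y)))"
      using rect top S eA by (simp add: FB algebra_simps)
    then have "pi * \<bar>integral {0..d} (\<lambda>\<rho>. exp (- real n * \<rho>) * ml_density \<alpha> la \<rho>) - cq_kernel \<alpha> la (real n)\<bar>
       \<le> (K' * Gamma (3 - \<alpha>) + pi * M * D) * real n powr (\<alpha> - 3)"
      using diff left by (simp add: abs_mult[symmetric, of pi, simplified] abs_le_iff algebra_simps)
    then have "\<bar>integral {0..d} (\<lambda>\<rho>. exp (- real n * \<rho>) * ml_density \<alpha> la \<rho>) - cq_kernel \<alpha> la (real n)\<bar>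
       \<le> (K' * Gamma (3 - \<alpha>) + pi * M * D) / pi * real n powr (\<alpha> - 3)"
      by (simp add: field_simps)
    with tail(1) n show ?thesis by (simp add: C_def algebra_simps abs_le_iff)
  qed
  show ?thesis
  proof (rule that[OF _ main])
    have "0 < 1 / d\<^sup>2 * ml_const \<alpha> 2" using d ml_const_pos \<alpha> by simp
    moreover have "0 \<le> (K' * Gamma (3 - \<alpha>) + pi * M * D) / pi"
      using K c M D \<alpha> by (intro divide_nonneg_pos add_nonneg_nonneg) (auto simp: K'_def Gamma_real_pos less_imp_le)
    ultimately show "0 < C" by (simp add: C_def)
  qed auto
qed

definition kernel_error :: "real => real => real => real" where
  "kernel_error \<alpha> la x = ml_kernel \<alpha> la x - cq_kernel \<alpha> la x"

text \<open>For x >= 1 both kernels are compared with their linear interpolants between the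
  neighbouring integers. For x <= 1 they are estimated separately: x^(\<alpha>-3) is not integrable
  at 0, and x^(\<alpha>-1) is the bound that can be integrated there.\<close>

lemma kernel_error_bound:
  fixes \<alpha> :: real
  assumes \<alpha>: "0 < \<alpha>" "\<alpha> < 1"
  obtains C where "0 < C"
    "\<And>la x. 0 < la ==> 0 < x ==> \<bar>kernel_error \<alpha> la x\<bar> \<le> C * x powr (\<alpha> - 3)"
    "\<And>la x. 0 < la ==> 0 < x ==> \<bar>kernel_error \<alpha> la x\<bar> \<le> C * x powr (\<alpha> - 1)"
proof -
  obtain C0 where C0: "0 < C0" and nat: "\<And>la n. 0 < la ==> 1 \<le> n ==> \<bar>ml_kernel \<alpha> la (real n) - cq_kernel \<alpha> la (real n)\<bar> \<le> C0 * real n powr (\<alpha> - 3)"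
    using kernel_difference_nat[OF \<alpha>] by blast
  have mc: "0 < ml_const \<alpha> 0" "0 < ml_const \<alpha> 2" using ml_const_pos \<alpha> by auto
  \<comment> \<open>8 bounds 2^(3-\<alpha>), the price of replacing n by its lower bound x /
    2.\<close>
  define C1 where "C1 = 8 * (ml_const \<alpha> 2 + C0)"
  \<comment> \<open>9/4 bounds |\<open>cq_response \<alpha> la 0\<close>|, the slope of the discrete
    kernel on [0, 1] in absolute value.\<close>
  define C2 where "C2 = ml_const \<alpha> 0 + 9/4"
  have C: "0 < C1" "0 < C2" using mc C0 by (auto simp: C1_def C2_def add_pos_pos)
  have large: "\<bar>kernel_error \<alpha> la x\<bar> \<le> C1 * x powr (\<alpha> - 3)" if "0 < la" "1 \<le> x" for la x
  proof -
    define n where "n = nat \<lfloor>x\<rfloor>"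
    define w where "w = x - real n"
    have n: "1 \<le> n" using that by (simp add: n_def le_nat_iff le_floor_iff)
    have w: "0 \<le> w" "w \<le> 1" using that by (simp_all add: w_def n_def) linarith+
    have x: "x = real n + w" by (simp add: w_def)
    have e: "kernel_error \<alpha> la x = (ml_kernel \<alpha> la (real n + w) - ((1 - w) * ml_kernel \<alpha> la (real n) + w * ml_kernel \<alpha> la (real n + 1)))
       + ((1 - w) * (ml_kernel \<alpha> la (real n) - cq_kernel \<alpha> la (real n)) + w * (ml_kernel \<alpha> la (real (Suc n)) - cq_kernel \<alpha> la (real (Suc n))))"
      unfolding kernel_error_def x cq_kernel_linear[OF w] by (simp add: algebra_simps)
    have 1: "\<bar>ml_kernel \<alpha> la (real n + w) - ((1 - w) * ml_kernel \<alpha> la (real n) + w * ml_kernel \<alpha> la (real n + 1))\<bar> \<le> ml_const \<alpha> 2 * real n powr (\<alpha> - 3)"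
      using ml_kernel_interpolation_error[OF \<alpha> _ _ w, of la "real n"] that n by simp
    have 2: "\<bar>ml_kernel \<alpha> la (real n) - cq_kernel \<alpha> la (real n)\<bar> \<le> C0 * real n powr (\<alpha> - 3)" using nat that n by simp
    have "C0 * real (Suc n) powr (\<alpha> - 3) \<le> C0 * real n powr (\<alpha> - 3)"
      using n \<alpha> C0 by (intro mult_left_mono powr_mono2') auto
    then have 3: "\<bar>ml_kernel \<alpha> la (real (Suc n)) - cq_kernel \<alpha> la (real (Suc n))\<bar> \<le> C0 * real n powr (\<alpha> - 3)"
      using nat[of la "Suc n"] that by linarith
    have "\<bar>kernel_error \<alpha> la x\<bar> \<le> ml_const \<alpha> 2 * real n powr (\<alpha> - 3) + ((1 - w) * (C0 * real n powr (\<alpha> - 3)) + w * (C0 * real n powr (\<alpha> - 3)))"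
      unfolding e using w
      by (intro order_trans[OF abs_triangle_ineq] add_mono 1) (auto simp: abs_mult intro!: mult_left_mono 2 3[simplified])
    also have "\<dots> = (ml_const \<alpha> 2 + C0) * real n powr (\<alpha> - 3)" by (simp add: algebra_simps)
    also have "\<dots> \<le> (ml_const \<alpha> 2 + C0) * (8 * x powr (\<alpha> - 3))"
    proof (rule mult_left_mono)
      have "x / 2 \<le> real n" using w n x by simp
      then have "real n powr (\<alpha> - 3) \<le> (x / 2) powr (\<alpha> - 3)" using that \<alpha> by (intro powr_mono2') auto
      also have "\<dots> = 2 powr (3 - \<alpha>) * x powr (\<alpha> - 3)" using that by (simp add: powr_divide powr_minus_divide[symmetric] powr_diff field_simps)
      also have "\<dots> \<le> 2 powr 3 * x powr (\<alpha> - 3)" using \<alpha> by (intro mult_right_mono powr_mono) auto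
      finally show "real n powr (\<alpha> - 3) \<le> 8 * x powr (\<alpha> - 3)" by simp
    qed (use mc C0 in simp)
    finally show ?thesis by (simp add: C1_def algebra_simps)
  qed
  have small: "\<bar>kernel_error \<alpha> la x\<bar> \<le> C2 * x powr (\<alpha> - 1)" if "0 < la" "0 < x" "x \<le> 1" for la x
  proof -
    have "cq_kernel \<alpha> la x = cq_response \<alpha> la 0 * x" using cq_kernel_eq[of x 1] that by simp
    then have "\<bar>cq_kernel \<alpha> la x\<bar> = \<bar>cq_response \<alpha> la 0\<bar> * x powr 1" using that by (simp add: abs_mult)
    also have "\<dots> \<le> 9/4 * x powr (\<alpha> - 1)"
      using cq_response_0[of \<alpha> la] \<alpha> that by (intro mult_mono powr_mono') auto
    finally have "\<bar>cq_kernel \<alpha> la x\<bar> \<le> 9/4 * x powr (\<alpha> - 1)" .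
    moreover have "\<bar>ml_kernel \<alpha> la x\<bar> \<le> ml_const \<alpha> 0 * x powr (\<alpha> - 1)" using abs_ml_kernel_le \<alpha> that by simp
    ultimately show ?thesis by (simp add: kernel_error_def C2_def algebra_simps)
  qed
  show ?thesis
  proof (rule that[of "C1 + C2"])
    fix la x :: real assume h: "0 < la" "0 < x"
    have "x powr (\<alpha> - 1) \<le> x powr (\<alpha> - 3)" if "x \<le> 1" using h that by (intro powr_mono') auto
    moreover have "x powr (\<alpha> - 3) \<le> x powr (\<alpha> - 1)" if "1 \<le> x" using that by (intro powr_mono) auto
    ultimately have *: "C2 * x powr (\<alpha> - 1) \<le> C2 * x powr (\<alpha> - 3)" if "x \<le> 1" using that C by simp
    have **: "C1 * x powr (\<alpha> - 3) \<le> C1 * x powr (\<alpha> - 1)" if "1 \<le> x" using that C \<open>1 \<le> x ==> _\<close> by simp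
    have nn: "0 \<le> C1 * x powr p" "0 \<le> C2 * x powr p" for p using C by auto
    show "\<bar>kernel_error \<alpha> la x\<bar> \<le> (C1 + C2) * x powr (\<alpha> - 3)"
    proof (cases "x \<le> 1")
      case True
      show ?thesis using small[OF h True] *[OF True] nn(1)[of "\<alpha> - 3"] unfolding distrib_right by linarith
    next
      case False
      then show ?thesis using large[OF h(1), of x] nn(2)[of "\<alpha> - 3"] unfolding distrib_right by linarith
    qed
    show "\<bar>kernel_error \<alpha> la x\<bar> \<le> (C1 + C2) * x powr (\<alpha> - 1)"
    proof (cases "x \<le> 1")
      case True
      show ?thesis using small[OF h True] nn(1)[of "\<alpha> - 1"] unfolding distrib_right by linarith
    next
      case False
      then show ?thesis using large[OF h(1), of x] ** nn(2)[of "\<alpha> - 1"] unfolding distrib_right by linarith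
    qed
  qed (use C in simp)
qed

section \<open>Laplace transforms of the kernels\<close>

definition cq_gen :: "real => real => real => real" where
  "cq_gen \<alpha> la z = ((1 - z) * (3 - z) / 2)\<^sup>2 * (1 - \<alpha>/2 + \<alpha>/2 * z) / ((1 - z) powr \<alpha> + la * (1 - \<alpha>/2 + \<alpha>/2 * z))"

lemma cq_response_real_sums:
  assumes "0 < \<alpha>" "\<alpha> < 1" "0 \<le> la" "0 \<le> z" "z < 1"
  shows "(\<lambda>k. cq_response \<alpha> la k * z ^ k) sums cq_gen \<alpha> la z"
    and "summable (\<lambda>k. \<bar>cq_response \<alpha> la k\<bar> * z ^ k)"
proof -
  have n: "norm (complex_of_real z) < 1" using assms by simp
  have p: "(1 - complex_of_real z) powr of_real \<alpha> = of_real ((1 - z) powr \<alpha>)"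
    using powr_of_real[of "1 - z" \<alpha>, symmetric] assms by (simp only: of_real_diff of_real_1 diff_ge_0_iff_ge less_imp_le)
  have "(((1 - complex_of_real z) * (3 - of_real z) / 2))\<^sup>2 * cq_avg \<alpha> (of_real z) / cq_den \<alpha> la (of_real z) = of_real (cq_gen \<alpha> la z)"
    by (simp only: cq_gen_def cq_avg_def cq_den_def p of_real_mult of_real_divide of_real_add of_real_diff of_real_power of_real_numeral of_real_1)
  with cq_response_sums(1)[OF assms(1-3) n]
  have "(\<lambda>k. complex_of_real (cq_response \<alpha> la k * z ^ k)) sums of_real (cq_gen \<alpha> la z)"
    by simp
  then show "(\<lambda>k. cq_response \<alpha> la k * z ^ k) sums cq_gen \<alpha> la z" by (simp only: sums_of_real_iff)
  show "summable (\<lambda>k. \<bar>cq_response \<alpha> la k\<bar> * z ^ k)"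
    using cq_response_sums(2)[OF assms(1-3) n] assms by (simp add: norm_mult norm_power)
qed

text \<open>The ramp starting at k has Laplace transform exp (- k s) / s^2, and summation over k
  produces the generating function at exp (- s).\<close>

lemma laplace_cq_kernel:
  assumes \<alpha>: "0 < \<alpha>" "\<alpha> < 1" and la: "0 \<le> la" and s: "0 < s"
  shows "has_bochner_integral lborel (\<lambda>x. indicator {0<..} x * (exp (- s * x) * cq_kernel \<alpha> la x)) (cq_gen \<alpha> la (exp (- s)) / s\<^sup>2)"
proof -
  define h where "h = (\<lambda>k x. indicator {0<..} x * (exp (- s * x) * max 0 (x - real k)))"
  have g2: "Gamma (2::real) = 1" by (simp add: Gamma_numeral)
  have h: "has_bochner_integral lborel (h k) (exp (- s) ^ k / s\<^sup>2)" for k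
  proof -
    have "has_bochner_integral lborel (\<lambda>r. indicator {0<..} r * (r powr 1 * exp (- s * r))) (Gamma (1 + 1) * s powr (- 1 - 1))"
      by (rule has_bochner_integral_Gamma) (use s in auto)
    from lborel_has_bochner_integral_real_affine_iff[THEN iffD1, OF _ this, of 1 "- real k"]
    have "has_bochner_integral lborel (\<lambda>x. indicator {0<..} (- real k + 1 * x) * ((- real k + 1 * x) powr 1 * exp (- s * (- real k + 1 * x)))) (1 / s\<^sup>2)"
      using s g2 by (simp add: powr_minus_divide powr_numeral)
    from has_bochner_integral_mult_right[OF this, of "exp (- s) ^ k"]
    have "has_bochner_integral lborel (\<lambda>x. exp (- s) ^ k * (indicator {0<..} (- real k + 1 * x) * ((- real k + 1 * x) powr 1 * exp (- s * (- real k + 1 * x))))) (exp (- s) ^ k / s\<^sup>2)"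
      by simp
    also have "(\<lambda>x. exp (- s) ^ k * (indicator {0<..} (- real k + 1 * x) * ((- real k + 1 * x) powr 1 * exp (- s * (- real k + 1 * x))))) = h k"
      by (auto simp: h_def fun_eq_iff indicator_def exp_of_nat_mult[symmetric] exp_add[symmetric] algebra_simps)
    finally show ?thesis .
  qed
  have hi: "integrable lborel (h k)" and hv: "integral\<^sup>L lborel (h k) = exp (- s) ^ k / s\<^sup>2" for k
    using h by (auto simp: has_bochner_integral_iff)
  have hn: "0 \<le> h k x" for k x by (auto simp: h_def)
  let ?f = "\<lambda>k x. cq_response \<alpha> la k * h k x"
  have fi: "integrable lborel (?f k)" for k using hi by simp
  have fin: "\<exists>m. \<forall>k\<ge>m. h k x = 0" for x
    by (rule exI[of _ "nat \<lceil>x\<rceil>"]) (auto simp: h_def nat_le_iff ceiling_le_iff)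
  have ae: "AE x in lborel. summable (\<lambda>k. norm (?f k x))"
  proof (rule AE_I2)
    fix x
    obtain m where m: "\<And>k. k \<ge> m ==> h k x = 0" using fin by blast
    show "summable (\<lambda>k. norm (?f k x))"
      by (rule summable_finite[of "{..<m}"]) (use m in auto)
  qed
  have z: "0 \<le> exp (- s)" "exp (- s) < 1" using s by auto
  note w = cq_response_real_sums[OF \<alpha> la z]
  have "summable (\<lambda>k. \<bar>cq_response \<alpha> la k\<bar> * exp (- s) ^ k / s\<^sup>2)" by (intro summable_divide w(2))
  moreover have nf: "(LINT x|lborel. norm (?f k x)) = \<bar>cq_response \<alpha> la k\<bar> * exp (- s) ^ k / s\<^sup>2" for k
    using hn by (simp add: abs_mult hv)
  \<comment> \<open>Absolute convergence of the generating series at exp (- s) < 1 licenses the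
    exchange of sum and integral.\<close>
  ultimately have sn: "summable (\<lambda>k. LINT x|lborel. norm (?f k x))" by simp
  note R = integrable_suminf[OF fi ae sn] sums_integral[OF fi ae sn]
  have e: "(\<lambda>x. \<Sum>k. ?f k x) = (\<lambda>x. indicator {0<..} x * (exp (- s * x) * cq_kernel \<alpha> la x))"
  proof
    fix x :: real
    have "summable (\<lambda>k. cq_response \<alpha> la k * max 0 (x - real k))"
      by (rule summable_finite[of "{..<nat \<lceil>x\<rceil>}"]) (auto simp: nat_le_iff ceiling_le_iff not_less)
    from suminf_mult[OF this, of "indicator {0<..} x * exp (- s * x)"]
    show "(\<Sum>k. ?f k x) = indicator {0<..} x * (exp (- s * x) * cq_kernel \<alpha> la x)"
      by (simp add: h_def cq_kernel_def mult_ac)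
  qed
  have "(\<lambda>k. integral\<^sup>L lborel (?f k)) sums (cq_gen \<alpha> la (exp (- s)) / s\<^sup>2)"
    using sums_divide[OF w(1), of "s\<^sup>2"] by (simp add: hv)
  with R show ?thesis unfolding e has_bochner_integral_iff using sums_unique2 by blast
qed

lemma borel_measurable_cq_kernel [measurable]: "cq_kernel \<alpha> la \<in> borel_measurable borel"
  unfolding cq_kernel_def by measurable

lemma borel_measurable_kernel_error [measurable]: "kernel_error \<alpha> la \<in> borel_measurable borel"
  unfolding kernel_error_def by measurable

lemma filterlim_inverse_Suc_at_right_0: "filterlim (\<lambda>n. 1 / real (Suc n)) (at_right 0) sequentially"
  by real_asymp

text \<open>The continuous kernel is the limit of the rescaled discrete ones, whose Laplace transforms are explicit.\<close>

lemma laplace_ml_kernel: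
  assumes \<alpha>: "0 < \<alpha>" "\<alpha> < 1" and la: "0 < la" and s: "0 < s"
  shows "has_bochner_integral lborel (\<lambda>x. indicator {0<..} x * (exp (- s * x) * ml_kernel \<alpha> la x)) (1 / (s powr \<alpha> + la))"
proof -
  obtain C where C: "0 < C" "\<And>la x. 0 < la ==> 0 < x ==> \<bar>kernel_error \<alpha> la x\<bar> \<le> C * x powr (\<alpha> - 3)"
    "\<And>la x. 0 < la ==> 0 < x ==> \<bar>kernel_error \<alpha> la x\<bar> \<le> C * x powr (\<alpha> - 1)"
    using kernel_error_bound[OF \<alpha>] by blast
  \<comment> \<open>The kernel of the scheme with step size \<open>\<tau>\<close> for the original
    \<open>la\<close>; it tends to \<open>ml_kernel\<close> as \<open>\<tau>\<close> tends to
    0.\<close>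
  define e where "e = (\<lambda>\<tau> x. \<tau> powr (\<alpha> - 1) * cq_kernel \<alpha> (la * \<tau> powr \<alpha>) (x / \<tau>))"
  define G where "G = (\<lambda>\<tau>. \<tau> powr \<alpha> * (cq_gen \<alpha> (la * \<tau> powr \<alpha>) (exp (- (s * \<tau>))) / (s * \<tau>)\<^sup>2))"
  have he: "has_bochner_integral lborel (\<lambda>x. indicator {0<..} x * (exp (- s * x) * e \<tau> x)) (G \<tau>)" if \<tau>: "0 < \<tau>" for \<tau>
  proof -
    have "has_bochner_integral lborel (\<lambda>x. indicator {0<..} x * (exp (- (s * \<tau>) * x) * cq_kernel \<alpha> (la * \<tau> powr \<alpha>) x)) (cq_gen \<alpha> (la * \<tau> powr \<alpha>) (exp (- (s * \<tau>))) / (s * \<tau>)\<^sup>2)"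
      by (rule laplace_cq_kernel[OF \<alpha>]) (use la s \<tau> in auto)
    from lborel_has_bochner_integral_real_affine_iff[THEN iffD1, OF _ this, of "1 / \<tau>" 0]
    have "has_bochner_integral lborel (\<lambda>x. indicator {0<..} (0 + 1 / \<tau> * x) * (exp (- (s * \<tau>) * (0 + 1 / \<tau> * x)) * cq_kernel \<alpha> (la * \<tau> powr \<alpha>) (0 + 1 / \<tau> * x))) (\<tau> * (cq_gen \<alpha> (la * \<tau> powr \<alpha>) (exp (- (s * \<tau>))) / (s * \<tau>)\<^sup>2))"
      using \<tau> by (simp add: mult.commute)
    from has_bochner_integral_mult_right[OF this, of "\<tau> powr (\<alpha> - 1)"]
    have "has_bochner_integral lborel (\<lambda>x. \<tau> powr (\<alpha> - 1) * (indicator {0<..} (0 + 1 / \<tau> * x) * (exp (- (s * \<tau>) * (0 + 1 / \<tau> * x)) * cq_kernel \<alpha> (la * \<tau> powr \<alpha>) (0 + 1 / \<tau> * x))))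
       (\<tau> powr (\<alpha> - 1) * (\<tau> * (cq_gen \<alpha> (la * \<tau> powr \<alpha>) (exp (- (s * \<tau>))) / (s * \<tau>)\<^sup>2)))" by simp
    also have "(\<lambda>x. \<tau> powr (\<alpha> - 1) * (indicator {0<..} (0 + 1 / \<tau> * x) * (exp (- (s * \<tau>) * (0 + 1 / \<tau> * x)) * cq_kernel \<alpha> (la * \<tau> powr \<alpha>) (0 + 1 / \<tau> * x))))
       = (\<lambda>x. indicator {0<..} x * (exp (- s * x) * e \<tau> x))"
      using \<tau> by (auto simp: fun_eq_iff e_def indicator_def zero_less_divide_iff)
    also have "\<tau> powr (\<alpha> - 1) * (\<tau> * (cq_gen \<alpha> (la * \<tau> powr \<alpha>) (exp (- (s * \<tau>))) / (s * \<tau>)\<^sup>2)) = G \<tau>"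
      using \<tau> by (simp add: G_def powr_diff)
    finally show ?thesis .
  qed
  have scale: "ml_kernel \<alpha> la x - e \<tau> x = \<tau> powr (\<alpha> - 1) * kernel_error \<alpha> (la * \<tau> powr \<alpha>) (x / \<tau>)" if "0 < \<tau>" for \<tau> x
    using ml_kernel_scale[of \<tau> \<alpha> la "x / \<tau>"] that \<alpha> by (simp add: e_def kernel_error_def algebra_simps)
  \<comment> \<open>Of the two bounds on \<open>kernel_error\<close>, x^(\<alpha>-3) gives pointwise
    convergence of order \<open>\<tau>\<close>^2, while x^(\<alpha>-1) is invariant under the
    scaling and gives the majorant for dominated convergence.\<close>
  let ?d = "\<lambda>x. (ml_const \<alpha> 0 + C) * (indicator {0<..} x * (x powr (\<alpha> - 1) * exp (- s * x)))"
  have d: "integrable lborel ?d"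
    using has_bochner_integral_Gamma[of "\<alpha> - 1" s] \<alpha> s by (simp add: has_bochner_integral_iff)
  have lim: "(\<lambda>n. LINT x|lborel. indicator {0<..} x * (exp (- s * x) * e (1 / real (Suc n)) x)) \<longlonglongrightarrow> (LINT x|lborel. indicator {0<..} x * (exp (- s * x) * ml_kernel \<alpha> la x))"
    and int: "integrable lborel (\<lambda>x. indicator {0<..} x * (exp (- s * x) * ml_kernel \<alpha> la x))"
  proof -
    have ae: "AE x in lborel. (\<lambda>n. indicator {0<..} x * (exp (- s * x) * e (1 / real (Suc n)) x)) \<longlonglongrightarrow> indicator {0<..} x * (exp (- s * x) * ml_kernel \<alpha> la x)"
    proof (rule AE_I2)
      fix x :: real
      show "(\<lambda>n. indicator {0<..} x * (exp (- s * x) * e (1 / real (Suc n)) x)) \<longlonglongrightarrow> indicator {0<..} x * (exp (- s * x) * ml_kernel \<alpha> la x)"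
      proof (cases "0 < x")
        case True
        have "(\<lambda>n. ml_kernel \<alpha> la x - e (1 / real (Suc n)) x) \<longlonglongrightarrow> 0"
        proof (rule Lim_null_comparison)
          show "\<forall>\<^sub>F n in sequentially. norm (ml_kernel \<alpha> la x - e (1 / real (Suc n)) x) \<le> C * x powr (\<alpha> - 3) * (1 / real (Suc n))\<^sup>2"
          proof (rule always_eventually, rule allI)
            fix n
            define \<tau> where "\<tau> = 1 / real (Suc n)"
            have \<tau>: "0 < \<tau>" by (simp add: \<tau>_def)
            have "norm (ml_kernel \<alpha> la x - e \<tau> x) \<le> \<tau> powr (\<alpha> - 1) * (C * (x / \<tau>) powr (\<alpha> - 3))"
              unfolding scale[OF \<tau>] using C(2)[of "la * \<tau> powr \<alpha>" "x / \<tau>"] \<tau> la True by (simp add: abs_mult mult_left_mono)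
            also have "\<dots> = C * x powr (\<alpha> - 3) * (\<tau> powr (\<alpha> - 1) / \<tau> powr (\<alpha> - 3))" using True \<tau> by (simp add: powr_divide)
            also have "\<tau> powr (\<alpha> - 1) / \<tau> powr (\<alpha> - 3) = \<tau>\<^sup>2" using \<tau> by (simp add: powr_diff[symmetric] powr_numeral)
            finally show "norm (ml_kernel \<alpha> la x - e (1 / real (Suc n)) x) \<le> C * x powr (\<alpha> - 3) * (1 / real (Suc n))\<^sup>2"
              by (simp add: \<tau>_def)
          qed
          show "(\<lambda>n. C * x powr (\<alpha> - 3) * (1 / real (Suc n))\<^sup>2) \<longlonglongrightarrow> 0" by real_asymp
        qed
        then have "(\<lambda>n. ml_kernel \<alpha> la x - (ml_kernel \<alpha> la x - e (1 / real (Suc n)) x)) \<longlonglongrightarrow> ml_kernel \<alpha> la x - 0"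
          by (intro tendsto_intros)
        then show ?thesis by (intro tendsto_intros) simp
      qed simp
    qed
    have b: "AE x in lborel. norm (indicator {0<..} x * (exp (- s * x) * e (1 / real (Suc n)) x)) \<le> ?d x" for n
    proof (rule AE_I2)
      fix x :: real
      show "norm (indicator {0<..} x * (exp (- s * x) * e (1 / real (Suc n)) x)) \<le> ?d x"
      proof (cases "0 < x")
        case True
        define \<tau> where "\<tau> = 1 / real (Suc n)"
        have \<tau>: "0 < \<tau>" by (simp add: \<tau>_def)
        have "\<bar>ml_kernel \<alpha> la x - e \<tau> x\<bar> \<le> \<tau> powr (\<alpha> - 1) * (C * (x / \<tau>) powr (\<alpha> - 1))"
          unfolding scale[OF \<tau>] using C(3)[of "la * \<tau> powr \<alpha>" "x / \<tau>"] \<tau> la True by (simp add: abs_mult mult_left_mono)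
        also have "\<dots> = C * x powr (\<alpha> - 1)" using True \<tau> by (simp add: powr_divide)
        finally have "\<bar>e \<tau> x\<bar> \<le> (ml_const \<alpha> 0 + C) * x powr (\<alpha> - 1)"
          using abs_ml_kernel_le[OF \<alpha> _ True, of la] la by (simp add: algebra_simps abs_le_iff)
        from mult_left_mono[OF this, of "exp (- s * x)"] True show ?thesis by (simp add: abs_mult \<tau>_def mult_ac)
      qed simp
    qed
    have m: "(\<lambda>x. indicator {0<..} x * (exp (- s * x) * e \<tau> x)) \<in> borel_measurable lborel" for \<tau> unfolding e_def by measurable
    show "(\<lambda>n. LINT x|lborel. indicator {0<..} x * (exp (- s * x) * e (1 / real (Suc n)) x)) \<longlonglongrightarrow> (LINT x|lborel. indicator {0<..} x * (exp (- s * x) * ml_kernel \<alpha> la x))"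
      by (rule integral_dominated_convergence[OF _ m d ae b]) measurable
    show "integrable lborel (\<lambda>x. indicator {0<..} x * (exp (- s * x) * ml_kernel \<alpha> la x))"
      by (rule integrable_dominated_convergence[OF _ m d ae b]) measurable
  qed
  have "(G \<longlongrightarrow> 1 / (s powr \<alpha> + la)) (at_right 0)"
  proof (rule tendsto_eq_rhs[OF Lim_transform_eventually])
    \<comment> \<open>Written in terms of (1 - exp (- s \<open>\<tau>\<close>)) /
      \<open>\<tau>\<close>, which tends to s, the transform contains no further powers of
      \<open>\<tau>\<close>.\<close>
    let ?E = "\<lambda>\<tau>. exp (- (s * \<tau>))"
    let ?b = "\<lambda>\<tau>. 1 - \<alpha>/2 + \<alpha>/2 * ?E \<tau>"
    have E: "(?E \<longlongrightarrow> 1) (at_right 0)" and D: "((\<lambda>\<tau>. (1 - ?E \<tau>) / \<tau>) \<longlongrightarrow> s) (at_right 0)"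
      using s by real_asymp+
    have "0 < s powr \<alpha> + la" using la by (simp add: add_nonneg_pos)
    then show "((\<lambda>\<tau>. ((1 - ?E \<tau>) / \<tau> / s)\<^sup>2 * ((3 - ?E \<tau>) / 2)\<^sup>2 * ?b \<tau> / (((1 - ?E \<tau>) / \<tau>) powr \<alpha> + la * ?b \<tau>))
       \<longlongrightarrow> (s / s)\<^sup>2 * ((3 - 1) / 2)\<^sup>2 * (1 - \<alpha>/2 + \<alpha>/2 * 1) / (s powr \<alpha> + la * (1 - \<alpha>/2 + \<alpha>/2 * 1))) (at_right 0)"
      using s by (intro tendsto_intros E D) auto
    show "\<forall>\<^sub>F \<tau> in at_right 0. ((1 - ?E \<tau>) / \<tau> / s)\<^sup>2 * ((3 - ?E \<tau>) / 2)\<^sup>2 * ?b \<tau> / (((1 - ?E \<tau>) / \<tau>) powr \<alpha> + la * ?b \<tau>) = G \<tau>"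
      using eventually_at_right_less
    proof eventually_elim
      case (elim \<tau>)
      define y where "y = 1 - ?E \<tau>"
      have y: "0 \<le> y" using elim s by (simp add: y_def)
      have q: "0 < \<tau> powr \<alpha>" using elim by simp
      have "((y / \<tau>) powr \<alpha> + la * ?b \<tau>) = (y powr \<alpha> + (la * \<tau> powr \<alpha>) * ?b \<tau>) / \<tau> powr \<alpha>"
        using elim y q by (simp add: powr_divide add_divide_distrib)
      then show ?case unfolding G_def cq_gen_def y_def[symmetric]
        using elim by (simp add: power_divide power_mult_distrib) (simp add: algebra_simps)
    qed
    show "(s / s)\<^sup>2 * ((3 - 1) / 2)\<^sup>2 * (1 - \<alpha>/2 + \<alpha>/2 * 1) / (s powr \<alpha> + la * (1 - \<alpha>/2 + \<alpha>/2 * 1)) = 1 / (s powr \<alpha> + la)"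
      using s by simp
  qed
  from filterlim_compose[OF this filterlim_inverse_Suc_at_right_0]
  have "(\<lambda>n. G (1 / real (Suc n))) \<longlonglongrightarrow> 1 / (s powr \<alpha> + la)" .
  moreover have "(LINT x|lborel. indicator {0<..} x * (exp (- s * x) * e (1 / real (Suc n)) x)) = G (1 / real (Suc n))" for n
    using he[of "1 / real (Suc n)"] by (simp add: has_bochner_integral_iff)
  ultimately have "(LINT x|lborel. indicator {0<..} x * (exp (- s * x) * ml_kernel \<alpha> la x)) = 1 / (s powr \<alpha> + la)"
    using lim LIMSEQ_unique by simp
  with int show ?thesis by (simp add: has_bochner_integral_iff)
qed

section \<open>Moments and antiderivatives of the kernel error\<close>

lemma has_bochner_integral_powr_tail:
  fixes p a :: real
  assumes "p < - 1" "0 < a"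
  shows "has_bochner_integral lborel (\<lambda>x. indicator {a<..} x * x powr p) (a powr (p + 1) / (- p - 1))"
proof -
  have "((\<lambda>x. x powr p) has_integral (- (a powr (p + 1)) / (p + 1))) {a..}"
    by (rule has_integral_powr_to_inf[OF assms])
  then have "((\<lambda>x. x powr p) has_integral (- (a powr (p + 1)) / (p + 1))) {a<..}"
    by (rule has_integral_spike_set_eq[THEN iffD1, rotated 2]) (auto intro: negligible_subset[of "{a}"])
  moreover have "- (a powr (p + 1)) / (p + 1) = a powr (p + 1) / (- p - 1)"
    using assms minus_divide_divide[of "a powr (p + 1)" "p + 1"] by simp
  ultimately show ?thesis by (intro has_bochner_integral_lborel_nonneg) auto
qed

lemma has_bochner_integral_powr_from_0:
  fixes p c :: real
  assumes "- 1 < p" "0 \<le> c"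
  shows "has_bochner_integral lborel (\<lambda>x. indicator {0<..c} x * x powr p) (c powr (p + 1) / (p + 1))"
proof -
  have "((\<lambda>x. x powr p) has_integral (c powr (p + 1) / (p + 1))) {0..c}"
    by (rule has_integral_powr_from_0[OF assms])
  then have "((\<lambda>x. x powr p) has_integral (c powr (p + 1) / (p + 1))) {0<..c}"
    by (rule has_integral_spike_set_eq[THEN iffD1, rotated 2]) (auto intro: negligible_subset[of "{0}"])
  then show ?thesis by (intro has_bochner_integral_lborel_nonneg) auto
qed

lemma integral_lborel_split:
  fixes f :: "real => real"
  assumes i: "integrable lborel (\<lambda>y. indicator {0<..} y * f y)" and "0 \<le> x"
  shows "integrable lborel (\<lambda>y. indicator {x<..} y * f y)"
    and "f integrable_on {0..x}"
    and "integral {0..x} f + (LINT y|lborel. indicator {x<..} y * f y) = (LINT y|lborel. indicator {0<..} y * f y)"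
proof -
  have i1: "integrable lborel (\<lambda>y. indicator {x<..} y *\<^sub>R (indicator {0<..} y * f y))"
    by (rule integrable_mult_indicator[OF _ i]) simp
  have e1: "(\<lambda>y. indicator {x<..} y *\<^sub>R (indicator {0<..} y * f y)) = (\<lambda>y. indicator {x<..} y * f y)"
    using assms by (auto simp: indicator_def)
  show I1: "integrable lborel (\<lambda>y. indicator {x<..} y * f y)" using i1 unfolding e1 .
  have i2: "integrable lborel (\<lambda>y. indicator {..x} y *\<^sub>R (indicator {0<..} y * f y))"
    by (rule integrable_mult_indicator[OF _ i]) simp
  have e2: "(\<lambda>y. indicator {..x} y *\<^sub>R (indicator {0<..} y * f y)) = (\<lambda>y. indicator {0<..x} y *\<^sub>R f y)"
    by (auto simp: indicator_def)
  have si: "set_integrable lborel {0<..x} f" using i2 unfolding e2 set_integrable_def .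
  have "f integrable_on {0<..x}" by (rule set_borel_integral_eq_integral(1)[OF si])
  then show "f integrable_on {0..x}"
    by (rule integrable_spike_set) (auto intro: negligible_subset[of "{0}"])
  have "integral {0..x} f = integral {0<..x} f"
    by (rule integral_spike_set) (auto intro: negligible_subset[of "{0}"])
  also have "\<dots> = (LINT y|lborel. indicator {0<..x} y *\<^sub>R f y)"
    using set_borel_integral_eq_integral(2)[OF si] by (simp add: set_lebesgue_integral_def)
  finally have "integral {0..x} f + (LINT y|lborel. indicator {x<..} y * f y)
      = (LINT y|lborel. indicator {0<..x} y *\<^sub>R f y + indicator {x<..} y * f y)"
    using si I1 by (simp add: set_integrable_def)
  also have "(\<lambda>y. indicator {0<..x} y *\<^sub>R f y + indicator {x<..} y * f y) = (\<lambda>y. indicator {0<..} y * f y)"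
    using assms by (auto simp: indicator_def)
  finally show "integral {0..x} f + (LINT y|lborel. indicator {x<..} y * f y) = (LINT y|lborel. indicator {0<..} y * f y)" .
qed

text \<open>Near 0 the bound x^(\<alpha>-1) is used, near infinity x^(\<alpha>-3). With the extra
  factor x the exponent at infinity is \<alpha> - 2 < -1, so the first moment still exists.\<close>

lemma integrable_kernel_error:
  assumes \<alpha>: "0 < \<alpha>" "\<alpha> < 1" and la: "0 < la"
  shows "integrable lborel (\<lambda>x. indicator {0<..} x * kernel_error \<alpha> la x)"
    and "integrable lborel (\<lambda>x. indicator {0<..} x * (x * kernel_error \<alpha> la x))"
proof -
  obtain C where C: "0 < C" "\<And>la x. 0 < la ==> 0 < x ==> \<bar>kernel_error \<alpha> la x\<bar> \<le> C * x powr (\<alpha> - 3)"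
    "\<And>la x. 0 < la ==> 0 < x ==> \<bar>kernel_error \<alpha> la x\<bar> \<le> C * x powr (\<alpha> - 1)"
    using kernel_error_bound[OF \<alpha>] by blast
  let ?g = "\<lambda>p q x. C * (indicator {0<..1} x * x powr p + indicator {1<..} x * x powr q)"
  have g: "integrable lborel (?g p q)" if "- 1 < p" "q < - 1" for p q
    using has_bochner_integral_powr_from_0[OF that(1), of 1] has_bochner_integral_powr_tail[OF that(2), of 1]
    by (simp add: has_bochner_integral_iff)
  show "integrable lborel (\<lambda>x. indicator {0<..} x * kernel_error \<alpha> la x)"
  proof (rule integrable_dominated[OF g[of "\<alpha> - 1" "\<alpha> - 3"]])
    show "\<bar>indicator {0<..} x * kernel_error \<alpha> la x\<bar> \<le> ?g (\<alpha> - 1) (\<alpha> - 3) x" for x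
      using C(2)[OF la, of x] C(3)[OF la, of x] by (cases "x \<le> 1") (auto simp: indicator_def)
  qed (use \<alpha> in auto)
  show "integrable lborel (\<lambda>x. indicator {0<..} x * (x * kernel_error \<alpha> la x))"
  proof (rule integrable_dominated[OF g[of "\<alpha>" "\<alpha> - 2"]])
    show "\<bar>indicator {0<..} x * (x * kernel_error \<alpha> la x)\<bar> \<le> ?g \<alpha> (\<alpha> - 2) x" for x
    proof (cases "0 < x")
      case True
      have p: "x * x powr q = x powr (q + 1)" for q using True by (simp add: powr_add)
      have "\<bar>x * kernel_error \<alpha> la x\<bar> \<le> C * x powr \<alpha>" "\<bar>x * kernel_error \<alpha> la x\<bar> \<le> C * x powr (\<alpha> - 2)"
        using mult_left_mono[OF C(2)[OF la True], of x] mult_left_mono[OF C(3)[OF la True], of x] True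
          p[of "\<alpha> - 3"] p[of "\<alpha> - 1"] by (simp_all add: abs_mult mult.left_commute)
      then show ?thesis using True by (cases "x \<le> 1") (auto simp: indicator_def)
    qed simp
  qed (use \<alpha> in auto)
qed

text \<open>The moments of order 0 and 1 are the limit of \<open>H\<close> at 0 and minus the limit
  of its difference quotient there, where \<open>H\<close> is the Laplace transform of the kernel
  error. Both vanish because H(s) = o(s).\<close>

lemma kernel_error_moments:
  assumes \<alpha>: "0 < \<alpha>" "\<alpha> < 1" and la: "0 < la"
  shows "(LINT x|lborel. indicator {0<..} x * kernel_error \<alpha> la x) = 0"
    and "(LINT x|lborel. indicator {0<..} x * (x * kernel_error \<alpha> la x)) = 0"
proof -
  let ?k = "kernel_error \<alpha> la"
  note I = integrable_kernel_error[OF \<alpha> la]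
  define H where "H = (\<lambda>s. 1 / (s powr \<alpha> + la) - cq_gen \<alpha> la (exp (- s)) / s\<^sup>2)"
  have L: "has_bochner_integral lborel (\<lambda>x. indicator {0<..} x * (exp (- s * x) * ?k x)) (H s)" if "0 < s" for s
  proof -
    have "(\<lambda>x. indicator {0<..} x * (exp (- s * x) * ?k x))
      = (\<lambda>x. indicator {0<..} x * (exp (- s * x) * ml_kernel \<alpha> la x) - indicator {0<..} x * (exp (- s * x) * cq_kernel \<alpha> la x))"
      by (simp add: kernel_error_def fun_eq_iff algebra_simps)
    then show ?thesis unfolding H_def
      using laplace_ml_kernel[OF \<alpha> la that] laplace_cq_kernel[OF \<alpha> less_imp_le[OF la] that] by (simp add: has_bochner_integral_diff)
  qed
  have H: "((\<lambda>s. H s / s) \<longlongrightarrow> 0) (at_right 0)"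
  proof (rule tendsto_eq_rhs[OF Lim_transform_eventually])
    \<comment> \<open>\<open>V\<close> is the symbol that replaces s^\<alpha>, with error
      O(s^(\<alpha>+2)), and q - 1 = O(s^2). Both errors are o(s), and \<open>la > 0\<close> keeps
      the denominators away from 0.\<close>
    define V where "V = (\<lambda>s::real. (1 - exp (- s)) powr \<alpha> / (1 - \<alpha>/2 + \<alpha>/2 * exp (- s)))"
    define q where "q = (\<lambda>s::real. ((1 - exp (- s)) * (3 - exp (- s)) / 2)\<^sup>2 / s\<^sup>2)"
    have l: "((\<lambda>s. (V s - s powr \<alpha>) / s) \<longlongrightarrow> 0) (at_right 0)" "(V \<longlongrightarrow> 0) (at_right 0)" "((\<lambda>s. s powr \<alpha>) \<longlongrightarrow> 0) (at_right 0)"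
      "((\<lambda>s. (q s - 1) / s) \<longlongrightarrow> 0) (at_right 0)"
      unfolding V_def q_def using \<alpha> by real_asymp+
    show "((\<lambda>s. ((V s - s powr \<alpha>) / s) / ((s powr \<alpha> + la) * (V s + la)) - ((q s - 1) / s) / (V s + la)) \<longlongrightarrow> 0 / ((0 + la) * (0 + la)) - 0 / (0 + la)) (at_right 0)"
      using la by (intro tendsto_intros l) auto
    show "\<forall>\<^sub>F s in at_right 0. ((V s - s powr \<alpha>) / s) / ((s powr \<alpha> + la) * (V s + la)) - ((q s - 1) / s) / (V s + la) = H s / s"
      using eventually_at_right_less
    proof eventually_elim
      case (elim s)
      define b where "b = 1 - \<alpha>/2 + \<alpha>/2 * exp (- s)"
      have b: "0 < b" using \<alpha> by (simp add: b_def add_pos_pos)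
      have V: "V s = (1 - exp (- s)) powr \<alpha> / b" by (simp add: V_def b_def)
      have V0: "0 \<le> V s" using b by (simp add: V)
      have "cq_gen \<alpha> la (exp (- s)) / s\<^sup>2 = q s * (b / ((1 - exp (- s)) powr \<alpha> + la * b))"
        by (simp add: cq_gen_def q_def b_def)
      also have "b / ((1 - exp (- s)) powr \<alpha> + la * b) = 1 / (V s + la)"
        using b by (simp add: V field_simps)
      finally have e: "H s = 1 / (s powr \<alpha> + la) - q s * (1 / (V s + la))" by (simp add: H_def)
      have n: "s powr \<alpha> + la \<noteq> 0" "V s + la \<noteq> 0" using V0 la by (auto simp: add_nonneg_eq_0_iff)
      have "1 / A - Q * (1 / B) = (B - A) / (A * B) - (Q - 1) / B" if "A \<noteq> 0" "B \<noteq> 0" for A B Q :: real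
        using that by (simp add: field_simps)
      from this[OF n, of "q s"] have "H s = (V s - s powr \<alpha>) / ((s powr \<alpha> + la) * (V s + la)) - (q s - 1) / (V s + la)"
        unfolding e by (simp only: add_diff_add diff_self add_0_right)
      moreover have "(x / s) / c - (y / s) / d = (x / c - y / d) / s" for x y c d :: real
        by (simp add: diff_divide_distrib mult.commute)
      ultimately show ?case by (simp only:)
    qed
  qed (use la in simp)
  have "((\<lambda>s. H s / s * s) \<longlongrightarrow> 0 * 0) (at_right 0)" by (intro tendsto_intros H)
  moreover have "\<forall>\<^sub>F s in at_right 0. H s / s * s = H s" using eventually_at_right_less by eventually_elim auto
  ultimately have H0: "(H \<longlongrightarrow> 0) (at_right 0)" by (simp add: tendsto_cong)
  let ?s = "\<lambda>n. 1 / real (Suc n)"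
  have 1: "(\<lambda>n. LINT x|lborel. indicator {0<..} x * (exp (- ?s n * x) * ?k x)) \<longlonglongrightarrow> (LINT x|lborel. indicator {0<..} x * ?k x)"
  proof (rule integral_dominated_convergence[OF _ _ integrable_abs[OF I(1)]])
    show "AE x in lborel. (\<lambda>n. indicator {0<..} x * (exp (- ?s n * x) * ?k x)) \<longlonglongrightarrow> indicator {0<..} x * ?k x"
    proof (rule AE_I2)
      fix x :: real
      have "(\<lambda>n. exp (- ?s n * x)) \<longlonglongrightarrow> 1" by real_asymp
      from tendsto_mult[OF tendsto_const[of "indicator {0<..} x * ?k x"] this]
      show "(\<lambda>n. indicator {0<..} x * (exp (- ?s n * x) * ?k x)) \<longlonglongrightarrow> indicator {0<..} x * ?k x" by (simp add: mult_ac)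
    qed
    show "AE x in lborel. norm (indicator {0<..} x * (exp (- ?s n * x) * ?k x)) \<le> \<bar>indicator {0<..} x * ?k x\<bar>" for n
      by (rule AE_I2) (auto simp: abs_mult indicator_def intro!: mult_left_le_one_le)
  qed measurable
  have e: "(LINT x|lborel. indicator {0<..} x * (exp (- ?s n * x) * ?k x)) = H (?s n)" for n
    using L[of "?s n"] by (simp add: has_bochner_integral_iff)
  have "(\<lambda>n. H (?s n)) \<longlonglongrightarrow> 0" by (rule filterlim_compose[OF H0 filterlim_inverse_Suc_at_right_0])
  then show z: "(LINT x|lborel. indicator {0<..} x * ?k x) = 0"
    using 1 unfolding e by (rule LIMSEQ_unique[rotated])
  \<comment> \<open>The first moment is reached through the difference quotient (H(0) - H(s)) / s
    instead of a derivative: the factor (1 - exp (- s x)) / s lies between 0 and x, which gives the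
    majorant.\<close>
  have 2: "(\<lambda>n. LINT x|lborel. indicator {0<..} x * ((1 - exp (- ?s n * x)) / ?s n * ?k x)) \<longlonglongrightarrow> (LINT x|lborel. indicator {0<..} x * (x * ?k x))"
  proof (rule integral_dominated_convergence[OF _ _ integrable_abs[OF I(2)]])
    show "AE x in lborel. (\<lambda>n. indicator {0<..} x * ((1 - exp (- ?s n * x)) / ?s n * ?k x)) \<longlonglongrightarrow> indicator {0<..} x * (x * ?k x)"
    proof (rule AE_I2)
      fix x :: real
      have "(\<lambda>n. (1 - exp (- ?s n * x)) / ?s n) \<longlonglongrightarrow> x" by real_asymp
      from tendsto_mult[OF tendsto_const[of "indicator {0<..} x * ?k x"] this]
      show "(\<lambda>n. indicator {0<..} x * ((1 - exp (- ?s n * x)) / ?s n * ?k x)) \<longlonglongrightarrow> indicator {0<..} x * (x * ?k x)" by (simp add: mult_ac)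
    qed
    show "AE x in lborel. norm (indicator {0<..} x * ((1 - exp (- ?s n * x)) / ?s n * ?k x)) \<le> \<bar>indicator {0<..} x * (x * ?k x)\<bar>" for n
    proof (rule AE_I2)
      fix x :: real
      show "norm (indicator {0<..} x * ((1 - exp (- ?s n * x)) / ?s n * ?k x)) \<le> \<bar>indicator {0<..} x * (x * ?k x)\<bar>"
      proof (cases "0 < x")
        case True
        define s where "s = ?s n"
        have s: "0 < s" by (simp add: s_def)
        have "0 \<le> (1 - exp (- s * x)) / s" using s True by simp
        moreover have "(1 - exp (- s * x)) / s \<le> x" using s exp_ge_add_one_self[of "- s * x"] by (simp add: field_simps)
        ultimately have "\<bar>(1 - exp (- s * x)) / s\<bar> \<le> \<bar>x\<bar>" by simp
        from mult_right_mono[OF this, of "\<bar>?k x\<bar>"] True show ?thesis by (simp add: abs_mult s_def)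
      qed simp
    qed
  qed measurable
  have e2: "(LINT x|lborel. indicator {0<..} x * ((1 - exp (- ?s n * x)) / ?s n * ?k x)) = - (H (?s n) / ?s n)" for n
  proof -
    define s where "s = ?s n"
    have s: "0 < s" by (simp add: s_def)
    have "has_bochner_integral lborel (\<lambda>x. (indicator {0<..} x * ?k x - indicator {0<..} x * (exp (- s * x) * ?k x)) / s) ((0 - H s) / s)"
      using I(1) z L[OF s] s by (intro has_bochner_integral_divide has_bochner_integral_diff) (auto simp: has_bochner_integral_iff)
    moreover have "(\<lambda>x. (indicator {0<..} x * ?k x - indicator {0<..} x * (exp (- s * x) * ?k x)) / s) = (\<lambda>x. indicator {0<..} x * ((1 - exp (- s * x)) / s * ?k x))"
      by (auto simp: fun_eq_iff algebra_simps diff_divide_distrib)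
    ultimately have "has_bochner_integral lborel (\<lambda>x. indicator {0<..} x * ((1 - exp (- s * x)) / s * ?k x)) ((0 - H s) / s)"
      by (simp only:)
    then have "(LINT x|lborel. indicator {0<..} x * ((1 - exp (- s * x)) / s * ?k x)) = (0 - H s) / s"
      by (rule has_bochner_integral_integral_eq)
    then show ?thesis unfolding s_def[symmetric] by simp
  qed
  have "(\<lambda>n. - (H (?s n) / ?s n)) \<longlonglongrightarrow> - 0" by (rule tendsto_minus[OF filterlim_compose[OF H filterlim_inverse_Suc_at_right_0]])
  then show "(LINT x|lborel. indicator {0<..} x * (x * ?k x)) = 0"
    using 2 unfolding e2 using LIMSEQ_unique by fastforce
qed

definition kernel_error1 :: "real => real => real => real" where
  "kernel_error1 \<alpha> la x = integral {0..x} (kernel_error \<alpha> la)"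

definition kernel_error2 :: "real => real => real => real" where
  "kernel_error2 \<alpha> la x = integral {0..x} (kernel_error1 \<alpha> la)"

lemma continuous_on_cq_kernel: "continuous_on UNIV (cq_kernel \<alpha> la)"
proof (rule continuous_at_imp_continuous_on, rule ballI)
  fix x :: real
  define m where "m = nat \<lceil>x\<rceil> + 1"
  have "x < real m" unfolding m_def by linarith
  then have "\<forall>\<^sub>F y in nhds x. y \<in> {..<real m}" by (intro eventually_nhds_in_open) auto
  then have "\<forall>\<^sub>F y in nhds x. (\<Sum>k<m. cq_response \<alpha> la k * max 0 (y - real k)) = cq_kernel \<alpha> la y"
    by eventually_elim (simp add: cq_kernel_eq[of _ m])
  moreover have "isCont (\<lambda>y. \<Sum>k<m. cq_response \<alpha> la k * max 0 (y - real k)) x" by (intro continuous_intros)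
  ultimately show "isCont (cq_kernel \<alpha> la) x" by (rule isCont_cong[THEN iffD1])
qed

lemma continuous_on_kernel_error:
  assumes "0 < \<alpha>" "\<alpha> < 1" "0 \<le> la"
  shows "continuous_on {0<..} (kernel_error \<alpha> la)"
  unfolding kernel_error_def
  by (intro continuous_intros continuous_on_ml_kernel assms continuous_on_subset[OF continuous_on_cq_kernel]) auto

text \<open>\<open>f\<close> may be singular at 0, so the antiderivative is differentiated only at
  positive points.\<close>

lemma antiderivative_from_0:
  fixes f :: "real => real"
  assumes "\<And>x. 0 \<le> x ==> f integrable_on {0..x}" "continuous_on {0<..} f" "0 < x"
  shows "((\<lambda>x. integral {0..x} f) has_real_derivative f x) (at x)"
proof -
  have "isCont f x" using assms(2,3) continuous_on_eq_continuous_at[of "{0<..}" f] by auto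
  then have "continuous (at x within {0..x + 1}) f" by (rule continuous_at_imp_continuous_at_within)
  then have "((\<lambda>u. integral {0..u} f) has_vector_derivative f x) (at x within ({0..x + 1} - {}))"
    using integral_has_vector_derivative_continuous_at[of f 0 "x + 1" x "{}"] assms by simp
  moreover have "at x within {0..x + 1} = at x" using assms(3) by (intro at_within_interior) (simp add: interior_atLeastAtMost_real)
  ultimately show ?thesis by (simp add: has_real_derivative_iff_has_vector_derivative)
qed

lemma kernel_error1_deriv:
  assumes "0 < \<alpha>" "\<alpha> < 1" "0 < la"
  shows "0 < x ==> (kernel_error1 \<alpha> la has_real_derivative kernel_error \<alpha> la x) (at x)"
    and "continuous_on {0..a} (kernel_error1 \<alpha> la)"
proof -
  have i: "kernel_error \<alpha> la integrable_on {0..x}" if "0 \<le> x" for x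
    by (rule integral_lborel_split(2)[OF integrable_kernel_error(1)[OF assms] that])
  show "0 < x ==> (kernel_error1 \<alpha> la has_real_derivative kernel_error \<alpha> la x) (at x)"
    unfolding kernel_error1_def[abs_def]
    by (intro antiderivative_from_0 i continuous_on_kernel_error) (use assms in auto)
  show "continuous_on {0..a} (kernel_error1 \<alpha> la)"
    unfolding kernel_error1_def[abs_def] using i[of a]
    by (cases "0 \<le> a") (auto intro!: indefinite_integral_continuous_1)
qed

lemma kernel_error2_deriv:
  assumes "0 < \<alpha>" "\<alpha> < 1" "0 < la"
  shows "0 < x ==> (kernel_error2 \<alpha> la has_real_derivative kernel_error1 \<alpha> la x) (at x)"
    and "continuous_on {0..a} (kernel_error2 \<alpha> la)"
proof -
  note c = kernel_error1_deriv(2)[OF assms]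
  have i: "kernel_error1 \<alpha> la integrable_on {0..x}" for x by (rule integrable_continuous_real[OF c])
  show "0 < x ==> (kernel_error2 \<alpha> la has_real_derivative kernel_error1 \<alpha> la x) (at x)"
    unfolding kernel_error2_def[abs_def]
  proof (rule antiderivative_from_0[OF i])
    show "continuous_on {0<..} (kernel_error1 \<alpha> la)"
      by (rule continuous_at_imp_continuous_on) (auto intro!: DERIV_isCont kernel_error1_deriv(1)[OF assms])
  qed
  show "continuous_on {0..a} (kernel_error2 \<alpha> la)"
    unfolding kernel_error2_def[abs_def] by (rule indefinite_integral_continuous_1[OF i])
qed

text \<open>Integration by parts expresses the second antiderivative through the truncated moments
  of order 0 and 1, whose limits at infinity vanish.\<close>

lemma kernel_error2_eq:
  assumes "0 < \<alpha>" "\<alpha> < 1" "0 < la" "0 \<le> x"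
  shows "kernel_error2 \<alpha> la x = x * kernel_error1 \<alpha> la x - integral {0..x} (\<lambda>y. y * kernel_error \<alpha> la y)"
proof -
  let ?m = "\<lambda>x. integral {0..x} (\<lambda>y. y * kernel_error \<alpha> la y)"
  have i: "(\<lambda>y. y * kernel_error \<alpha> la y) integrable_on {0..x}" if "0 \<le> x" for x
    by (rule integral_lborel_split(2)[OF integrable_kernel_error(2)[OF assms(1-3)] that])
  have "(kernel_error1 \<alpha> la has_integral ((x * kernel_error1 \<alpha> la x - ?m x) - (0 * kernel_error1 \<alpha> la 0 - ?m 0))) {0..x}"
  proof (rule fundamental_theorem_of_calculus_interior[OF assms(4)])
    show "continuous_on {0..x} (\<lambda>x. x * kernel_error1 \<alpha> la x - ?m x)"
      by (intro continuous_intros kernel_error1_deriv(2) assms indefinite_integral_continuous_1 i)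
    fix y assume y: "y \<in> {0<..<x}"
    have "(?m has_real_derivative y * kernel_error \<alpha> la y) (at y)"
      by (rule antiderivative_from_0) (use i y assms in \<open>auto intro!: continuous_intros continuous_on_kernel_error\<close>)
    moreover have "(kernel_error1 \<alpha> la has_real_derivative kernel_error \<alpha> la y) (at y)"
      by (rule kernel_error1_deriv(1)) (use y assms in auto)
    ultimately have "((\<lambda>x. x * kernel_error1 \<alpha> la x - ?m x) has_real_derivative kernel_error1 \<alpha> la y) (at y)"
      by (auto intro!: derivative_eq_intros)
    then show "((\<lambda>x. x * kernel_error1 \<alpha> la x - ?m x) has_vector_derivative kernel_error1 \<alpha> la y) (at y)"
      by (simp add: has_real_derivative_iff_has_vector_derivative)
  qed
  then show ?thesis by (simp add: kernel_error2_def integral_unique)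
qed

lemma tail_integral_bound:
  fixes f :: "real => real"
  assumes "integrable lborel (\<lambda>y. indicator {x<..} y * f y)" "0 < x" "p < - 1"
    and "\<And>y. x < y ==> \<bar>f y\<bar> \<le> C * y powr p"
  shows "\<bar>LINT y|lborel. indicator {x<..} y * f y\<bar> \<le> C * (x powr (p + 1) / (- p - 1))"
proof -
  note t = has_bochner_integral_powr_tail[OF assms(3,2)]
  have "norm (LINT y|lborel. indicator {x<..} y * f y) \<le> (LINT y|lborel. C * (indicator {x<..} y * y powr p))"
    by (rule Bochner_Integration.integral_norm_bound_integral[OF assms(1)])
       (use t assms(4) in \<open>auto simp: has_bochner_integral_iff indicator_def\<close>)
  also have "\<dots> = C * (x powr (p + 1) / (- p - 1))" using t by (simp add: has_bochner_integral_iff)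
  finally show ?thesis by simp
qed

text \<open>Since the moments vanish, an integral from 0 to x is minus the integral over the tail
  beyond x. There the bound x^(\<alpha>-3) can be integrated, with an additional factor x for the
  first moment.\<close>

lemma kernel_error_bounds:
  fixes \<alpha> :: real
  assumes \<alpha>: "0 < \<alpha>" "\<alpha> < 1"
  obtains C where "0 < C"
    "\<And>la x. 0 < la ==> 0 < x ==> \<bar>kernel_error \<alpha> la x\<bar> \<le> C * x powr (\<alpha> - 3)"
    "\<And>la x. 0 < la ==> 0 < x ==> \<bar>kernel_error \<alpha> la x\<bar> \<le> C * x powr (\<alpha> - 1)"
    "\<And>la x. 0 < la ==> 0 < x ==> \<bar>kernel_error1 \<alpha> la x\<bar> \<le> C * x powr (\<alpha> - 2)"
    "\<And>la x. 0 < la ==> 0 < x ==> \<bar>kernel_error2 \<alpha> la x\<bar> \<le> C * x powr (\<alpha> - 1)"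
proof -
  obtain C where C: "0 < C" "\<And>la x. 0 < la ==> 0 < x ==> \<bar>kernel_error \<alpha> la x\<bar> \<le> C * x powr (\<alpha> - 3)"
    "\<And>la x. 0 < la ==> 0 < x ==> \<bar>kernel_error \<alpha> la x\<bar> \<le> C * x powr (\<alpha> - 1)"
    using kernel_error_bound[OF \<alpha>] by blast
  have k1: "\<bar>kernel_error1 \<alpha> la x\<bar> \<le> C / (2 - \<alpha>) * x powr (\<alpha> - 2)" if "0 < la" "0 < x" for la x
  proof -
    note s = integral_lborel_split[OF integrable_kernel_error(1)[OF \<alpha> that(1)] less_imp_le[OF that(2)]]
    have "kernel_error1 \<alpha> la x = - (LINT y|lborel. indicator {x<..} y * kernel_error \<alpha> la y)"
      using s(3) kernel_error_moments(1)[OF \<alpha> that(1)] by (simp add: kernel_error1_def)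
    moreover have "\<bar>LINT y|lborel. indicator {x<..} y * kernel_error \<alpha> la y\<bar> \<le> C * (x powr ((\<alpha> - 3) + 1) / (- (\<alpha> - 3) - 1))"
      by (rule tail_integral_bound[OF s(1) that(2)]) (use C(2) that \<alpha> in auto)
    ultimately show ?thesis by (simp add: algebra_simps)
  qed
  have k2: "\<bar>kernel_error2 \<alpha> la x\<bar> \<le> (C / (2 - \<alpha>) + C / (1 - \<alpha>)) * x powr (\<alpha> - 1)" if "0 < la" "0 < x" for la x
  proof -
    note s = integral_lborel_split[OF integrable_kernel_error(2)[OF \<alpha> that(1)] less_imp_le[OF that(2)]]
    have p: "y * y powr q = y powr (q + 1)" if "0 < y" for y q :: real using that by (simp add: powr_add)
    have "integral {0..x} (\<lambda>y. y * kernel_error \<alpha> la y) = - (LINT y|lborel. indicator {x<..} y * (y * kernel_error \<alpha> la y))"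
      using s(3) kernel_error_moments(2)[OF \<alpha> that(1)] by simp
    moreover have "\<bar>LINT y|lborel. indicator {x<..} y * (y * kernel_error \<alpha> la y)\<bar> \<le> C * (x powr ((\<alpha> - 2) + 1) / (- (\<alpha> - 2) - 1))"
    proof (rule tail_integral_bound[OF s(1) that(2)])
      fix y assume y: "x < y"
      then have "y * \<bar>kernel_error \<alpha> la y\<bar> \<le> y * (C * y powr (\<alpha> - 3))" using C(2)[of la y] that by (intro mult_left_mono) auto
      then show "\<bar>y * kernel_error \<alpha> la y\<bar> \<le> C * y powr (\<alpha> - 2)"
        using p[of y "\<alpha> - 3"] y that by (simp add: abs_mult mult.left_commute)
    qed (use \<alpha> in simp)
    ultimately have "\<bar>integral {0..x} (\<lambda>y. y * kernel_error \<alpha> la y)\<bar> \<le> C / (1 - \<alpha>) * x powr (\<alpha> - 1)"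
      by (simp add: algebra_simps)
    moreover have "\<bar>x * kernel_error1 \<alpha> la x\<bar> \<le> C / (2 - \<alpha>) * x powr (\<alpha> - 1)"
      using mult_left_mono[OF k1[OF that], of x] that p[of x "\<alpha> - 2"] by (simp add: abs_mult mult.left_commute)
    ultimately show ?thesis using kernel_error2_eq[OF \<alpha> that(1), of x] that by (simp add: distrib_right abs_le_iff)
  qed
  have d: "0 < C / (2 - \<alpha>)" "0 < C / (1 - \<alpha>)" using C \<alpha> by auto
  define D where "D = C + C / (2 - \<alpha>) + C / (1 - \<alpha>)"
  have D: "C \<le> D" "C / (2 - \<alpha>) \<le> D" "C / (2 - \<alpha>) + C / (1 - \<alpha>) \<le> D" "0 < D" using d C(1) by (auto simp: D_def)
  show ?thesis
  proof (rule that[OF D(4)])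
    fix la x :: real assume h: "0 < la" "0 < x"
    show "\<bar>kernel_error \<alpha> la x\<bar> \<le> D * x powr (\<alpha> - 3)" by (rule order_trans[OF C(2)[OF h] mult_right_mono[OF D(1)]]) simp
    show "\<bar>kernel_error \<alpha> la x\<bar> \<le> D * x powr (\<alpha> - 1)" by (rule order_trans[OF C(3)[OF h] mult_right_mono[OF D(1)]]) simp
    show "\<bar>kernel_error1 \<alpha> la x\<bar> \<le> D * x powr (\<alpha> - 2)" by (rule order_trans[OF k1[OF h] mult_right_mono[OF D(2)]]) simp
    show "\<bar>kernel_error2 \<alpha> la x\<bar> \<le> D * x powr (\<alpha> - 1)" by (rule order_trans[OF k2[OF h] mult_right_mono[OF D(3)]]) simp
  qed
qed

section \<open>Iterated integrals over a triangle\<close>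

lemma integral_Icc_eq_lborel:
  fixes f :: "real => real"
  assumes "integrable lborel (\<lambda>x. indicator {a<..<b} x * f x)"
  shows "f absolutely_integrable_on {a..b}"
    and "integral {a..b} f = (LINT x|lborel. indicator {a<..<b} x * f x)"
proof -
  have si: "set_integrable lborel {a<..<b} f" using assms by (simp add: set_integrable_def)
  then have "f absolutely_integrable_on {a<..<b}"
    unfolding set_integrable_def by (rule integrable_completion[THEN iffD2, rotated]) (use si in \<open>auto simp: set_integrable_def\<close>)
  then show "f absolutely_integrable_on {a..b}"
    by (simp add: absolutely_integrable_on_Icc_iff_Ioo)
  have "integral {a..b} f = integral {a<..<b} f" by (rule integral_spike_set) (auto intro: negligible_subset[of "{a, b}"])
  also have "\<dots> = (LINT x|lborel. indicator {a<..<b} x * f x)"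
    using set_borel_integral_eq_integral(2)[OF si] by (simp add: set_lebesgue_integral_def)
  finally show "integral {a..b} f = (LINT x|lborel. indicator {a<..<b} x * f x)" .
qed

lemma AE_lborel_negligible:
  assumes "AE x in lborel. P (x::real)"
  shows "negligible {x. \<not> P x}"
  using AE_completion[OF assms] by (simp add: completion.AE_iff_null_sets negligible_iff_null_sets)

lemma has_bochner_integral_Beta:
  fixes p q t :: real
  assumes "- 1 < p" "- 1 < q" "0 < t"
  shows "has_bochner_integral lborel (\<lambda>s. indicator {0<..<t} s * ((t - s) powr p * s powr q)) (t powr (p + q + 1) * Beta (q + 1) (p + 1))"
proof -
  have "((\<lambda>x. x powr q * (1 - x) powr p) has_integral Beta (q + 1) (p + 1)) {0..1}"
    using has_integral_Beta_real[of "q + 1" "p + 1"] assms by simp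
  then have "((\<lambda>x. x powr q * (1 - x) powr p) has_integral Beta (q + 1) (p + 1)) {0<..<1}"
    by (simp add: has_integral_Icc_iff_Ioo)
  then have "has_bochner_integral lborel (\<lambda>x. indicator {0<..<1} x * (x powr q * (1 - x) powr p)) (Beta (q + 1) (p + 1))"
    by (rule has_bochner_integral_lborel_nonneg) auto
  from lborel_has_bochner_integral_real_affine_iff[THEN iffD1, OF _ this, of "1 / t" 0]
  have "has_bochner_integral lborel (\<lambda>x. indicator {0<..<1} (0 + 1 / t * x) * ((0 + 1 / t * x) powr q * (1 - (0 + 1 / t * x)) powr p)) (t * Beta (q + 1) (p + 1))"
    using assms by (simp add: mult.commute)
  from has_bochner_integral_mult_right[OF this, of "t powr (p + q)"]
  have "has_bochner_integral lborel (\<lambda>x. t powr (p + q) * (indicator {0<..<1} (0 + 1 / t * x) * ((0 + 1 / t * x) powr q * (1 - (0 + 1 / t * x)) powr p))) (t powr (p + q) * (t * Beta (q + 1) (p + 1)))"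
    by simp
  also have "t powr (p + q) * (t * Beta (q + 1) (p + 1)) = t powr (p + q + 1) * Beta (q + 1) (p + 1)"
    using assms by (simp add: powr_add)
  also have "(\<lambda>x. t powr (p + q) * (indicator {0<..<1} (0 + 1 / t * x) * ((0 + 1 / t * x) powr q * (1 - (0 + 1 / t * x)) powr p)))
     = (\<lambda>s. indicator {0<..<t} s * ((t - s) powr p * s powr q))"
  proof
    fix x :: real
    show "t powr (p + q) * (indicator {0<..<1} (0 + 1 / t * x) * ((0 + 1 / t * x) powr q * (1 - (0 + 1 / t * x)) powr p)) = indicator {0<..<t} x * ((t - x) powr p * x powr q)"
    proof (cases "0 < x \<and> x < t")
      case True
      have "1 - x / t = (t - x) / t" using assms by (simp add: diff_divide_distrib)
      then show ?thesis using True assms by (simp add: powr_divide powr_add)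
    next
      case False
      then show ?thesis using assms by (auto simp: indicator_def zero_less_divide_iff divide_less_eq_1)
    qed
  qed
  finally show ?thesis .
qed

text \<open>The integrable bound \<open>M\<close> on the inner absolute integrals makes the integral
  over the triangle 0 < z < s < t absolutely convergent. Joint Borel measurability is what the
  theorem of Fubini on the product measure asks for.\<close>

lemma triangle_Fubini_borel:
  fixes h :: "real => real => real"
  assumes hm: "(\<lambda>(s, z). h s z) \<in> borel_measurable (borel \<Otimes>\<^sub>M borel)"
    and int: "\<And>z. 0 < z ==> z < t ==> integrable lborel (\<lambda>s. indicator {z<..<t} s * h s z)"
    and le: "\<And>z. 0 < z ==> z < t ==> (LINT s|lborel. \<bar>indicator {z<..<t} s * h s z\<bar>) \<le> M z"
    and M: "integrable lborel (\<lambda>z. indicator {0<..<t} z * M z)"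
  shows "integral {0..t} (\<lambda>s. integral {0..s} (h s)) = integral {0..t} (\<lambda>z. integral {z..t} (\<lambda>s. h s z))"
    and "(\<lambda>s. integral {0..s} (h s)) absolutely_integrable_on {0..t}"
    and "(\<lambda>z. integral {z..t} (\<lambda>s. h s z)) absolutely_integrable_on {0..t}"
    and "negligible {s. \<not> (s \<in> {0<..<t} \<longrightarrow> h s absolutely_integrable_on {0..s})}"
proof -
  define F where "F = (\<lambda>z s. if 0 < z \<and> z < s \<and> s < t then h s z else 0)"
  have [measurable]: "(\<lambda>x. h (snd x) (fst x)) \<in> borel_measurable (borel \<Otimes>\<^sub>M borel)"
  proof -
    have "(\<lambda>x. (snd x, fst x)) \<in> borel \<Otimes>\<^sub>M borel \<rightarrow>\<^sub>M borel \<Otimes>\<^sub>M (borel :: real measure)" by measurable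
    from measurable_compose[OF this hm] show ?thesis by simp
  qed
  have Fm: "case_prod F \<in> borel_measurable (lborel \<Otimes>\<^sub>M lborel)"
    unfolding F_def case_prod_beta' by measurable
  have F1: "F z = (\<lambda>s. indicator {z<..<t} s * h s z)" if "0 < z" "z < t" for z
    using that by (auto simp: F_def indicator_def)
  have F0: "F z = (\<lambda>_. 0)" if "\<not> (0 < z \<and> z < t)" for z
    using that by (auto simp: F_def)
  have F2: "(\<lambda>z. F z s) = (\<lambda>z. indicator {0<..<s} z * h s z)" if "0 < s" "s < t" for s
    using that by (auto simp: F_def indicator_def)
  have F3: "(\<lambda>z. F z s) = (\<lambda>_. 0)" if "\<not> (0 < s \<and> s < t)" for s
    using that by (auto simp: F_def)
  have Fi: "integrable lborel (F z)" for z
    using int[of z] F1[of z] F0[of z] by (cases "0 < z \<and> z < t") auto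
  have prod: "integrable (lborel \<Otimes>\<^sub>M lborel) (case_prod F)"
  proof (rule lborel_pair.Fubini_integrable[OF Fm])
    show "integrable lborel (\<lambda>z. LINT s|lborel. norm (case_prod F (z, s)))"
    proof (rule integrable_dominated[OF M])
      show "(\<lambda>z. LINT s|lborel. norm (case_prod F (z, s))) \<in> borel_measurable lborel"
        using Fm by measurable
      show "\<bar>LINT s|lborel. norm (case_prod F (z, s))\<bar> \<le> indicator {0<..<t} z * M z" for z
        using le[of z] F1[of z] F0[of z] by (cases "0 < z \<and> z < t") (auto simp: indicator_def)
    qed
    show "AE z in lborel. integrable lborel (\<lambda>s. case_prod F (z, s))" using Fi by (intro AE_I2) simp
  qed
  note fub = lborel_pair.Fubini_integral[OF prod]
  have in1: "integrable lborel (\<lambda>z. LINT s|lborel. F z s)" by (rule lborel_pair.integrable_fst[OF prod])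
  have in2: "integrable lborel (\<lambda>s. LINT z|lborel. F z s)" by (rule lborel_pair.integrable_snd[OF prod])
  have ae: "AE s in lborel. integrable lborel (\<lambda>z. F z s)" by (rule lborel_pair.AE_integrable_snd[OF prod])
  have o1: "(\<lambda>z. LINT s|lborel. F z s) = (\<lambda>z. indicator {0<..<t} z * integral {z..t} (\<lambda>s. h s z))"
  proof
    fix z
    show "(LINT s|lborel. F z s) = indicator {0<..<t} z * integral {z..t} (\<lambda>s. h s z)"
      using F1[of z] F0[of z] integral_Icc_eq_lborel(2)[OF int[of z]] by (cases "0 < z \<and> z < t") auto
  qed
  show third: "(\<lambda>z. integral {z..t} (\<lambda>s. h s z)) absolutely_integrable_on {0..t}"
    using in1 unfolding o1 by (rule integral_Icc_eq_lborel(1))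
  have e1: "integral {0..t} (\<lambda>z. integral {z..t} (\<lambda>s. h s z)) = (LINT z|lborel. LINT s|lborel. F z s)"
    using in1 unfolding o1 by (rule integral_Icc_eq_lborel(2))
  \<comment> \<open>The inner integral over z exists only for almost every s; the exceptional set is
    carried along as a null set.\<close>
  define B where "B = {s. \<not> integrable lborel (\<lambda>z. F z s)}"
  have B: "negligible B" unfolding B_def by (rule AE_lborel_negligible[OF ae])
  have good: "h s absolutely_integrable_on {0..s}" "integral {0..s} (h s) = (LINT z|lborel. F z s)"
    if "s \<in> {0<..<t}" "s \<notin> B" for s
  proof -
    have "integrable lborel (\<lambda>z. indicator {0<..<s} z * h s z)" using that F2[of s] by (simp add: B_def)
    from integral_Icc_eq_lborel[OF this] F2[of s] that
    show "h s absolutely_integrable_on {0..s}" "integral {0..s} (h s) = (LINT z|lborel. F z s)" by auto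
  qed
  show "negligible {s. \<not> (s \<in> {0<..<t} \<longrightarrow> h s absolutely_integrable_on {0..s})}"
    by (rule negligible_subset[OF B]) (use good in blast)
  have i3: "(\<lambda>s. LINT z|lborel. F z s) = (\<lambda>s. indicator {0<..<t} s * (LINT z|lborel. F z s))"
  proof
    fix s
    show "(LINT z|lborel. F z s) = indicator {0<..<t} s * (LINT z|lborel. F z s)"
      using F3[of s] by (cases "0 < s \<and> s < t") auto
  qed
  have in3: "integrable lborel (\<lambda>s. indicator {0<..<t} s * (LINT z|lborel. F z s))"
    using in2 i3 by simp
  note H = integral_Icc_eq_lborel[OF in3]
  have sp: "(LINT z|lborel. F z s) = integral {0..s} (h s)" if "s \<in> {0..t} - (B \<union> {0, t})" for s
    using good(2)[of s] that by auto
  have neg: "negligible (B \<union> {0, t})" using B by simp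
  show "(\<lambda>s. integral {0..s} (h s)) absolutely_integrable_on {0..t}"
    by (rule absolutely_integrable_spike[OF H(1) neg]) (use sp in auto)
  have "integral {0..t} (\<lambda>s. integral {0..s} (h s)) = integral {0..t} (\<lambda>s. LINT z|lborel. F z s)"
    by (rule integral_spike[OF neg]) (use sp in auto)
  also have "\<dots> = (LINT s|lborel. LINT z|lborel. F z s)" using H(2) i3 by simp
  also have "\<dots> = integral {0..t} (\<lambda>z. integral {z..t} (\<lambda>s. h s z))" unfolding e1 by (rule fub)
  finally show "integral {0..t} (\<lambda>s. integral {0..s} (h s)) = integral {0..t} (\<lambda>z. integral {z..t} (\<lambda>s. h s z))" .
qed

text \<open>A Lebesgue measurable density does not meet the Borel measurability required on the
  product space; altering it on a null set repairs this without changing any integral.\<close>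

lemma absolutely_integrable_ex_borel:
  fixes b :: "real => real"
  assumes "b absolutely_integrable_on {0..t}"
  obtains b' N where "b' \<in> borel_measurable borel" "negligible N" "\<And>x. x \<notin> N ==> b' x = (if x \<in> {0..t} then b x else 0)"
    "integrable lborel b'"
proof -
  have i: "integrable lebesgue (\<lambda>x. if x \<in> {0..t} then b x else 0)"
    using assms unfolding set_integrable_def indicator_scaleR_eq_if .
  then have "(\<lambda>x. if x \<in> {0..t} then b x else 0) \<in> borel_measurable (completion lborel)"
    using borel_measurable_integrable by blast
  from completion_ex_borel_measurable_real[OF this]
  obtain b' where b': "b' \<in> borel_measurable lborel" "AE x in lborel. (if x \<in> {0..t} then b x else 0) = b' x" by blast
  define N where "N = {x. \<not> ((if x \<in> {0..t} then b x else 0) = b' x)}"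
  have N: "negligible N" unfolding N_def by (rule AE_lborel_negligible[OF b'(2)])
  have "AE x in lebesgue. (if x \<in> {0..t} then b x else 0) = b' x" using b'(2) by (simp add: AE_completion)
  then have "integrable lebesgue b'"
    using i b'(1) by (intro Bochner_Integration.integrable_cong_AE[THEN iffD1, OF _ _ _ i]) (auto intro: measurable_completion borel_measurable_integrable)
  then have "integrable lborel b'" using b'(1) by (simp add: integrable_completion)
  with N b'(1) show ?thesis by (intro that[of b' N]) (auto simp: N_def)
qed

text \<open>The kernel \<open>c\<close> may be singular on the diagonal; the density \<open>b\<close> is only Lebesgue measurable.\<close>

lemma triangle_Fubini:
  fixes c :: "real => real => real" and b :: "real => real"
  assumes b: "b absolutely_integrable_on {0..t}"
    and cm: "(\<lambda>(s, z). c s z) \<in> borel_measurable (borel \<Otimes>\<^sub>M borel)"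
    and int: "\<And>z. 0 < z ==> z < t ==> integrable lborel (\<lambda>s. indicator {z<..<t} s * c s z)"
    and le: "\<And>z. 0 < z ==> z < t ==> (LINT s|lborel. \<bar>indicator {z<..<t} s * c s z\<bar>) \<le> M"
  shows "integral {0..t} (\<lambda>s. integral {0..s} (\<lambda>z. c s z * b z)) = integral {0..t} (\<lambda>z. integral {z..t} (\<lambda>s. c s z) * b z)"
    and "(\<lambda>s. integral {0..s} (\<lambda>z. c s z * b z)) absolutely_integrable_on {0..t}"
    and "(\<lambda>z. integral {z..t} (\<lambda>s. c s z) * b z) absolutely_integrable_on {0..t}"
    and "negligible {s. \<not> (s \<in> {0<..<t} \<longrightarrow> (\<lambda>z. c s z * b z) absolutely_integrable_on {0..s})}"
proof -
  obtain b' N where b': "b' \<in> borel_measurable borel" "negligible N" "\<And>x. x \<notin> N ==> b' x = (if x \<in> {0..t} then b x else 0)"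
    "integrable lborel b'"
    using absolutely_integrable_ex_borel[OF b] by blast
  let ?h = "\<lambda>s z. c s z * b' z"
  have eq: "b z = b' z" if "z \<in> {0..t} - N" for z using b'(3) that by auto
  have hm: "(\<lambda>(s, z). ?h s z) \<in> borel_measurable (borel \<Otimes>\<^sub>M borel)"
      using cm b'(1) unfolding case_prod_beta' by measurable
  have hi: "integrable lborel (\<lambda>s. indicator {z<..<t} s * ?h s z)" if "0 < z" "z < t" for z
      using integrable_mult_left[OF int[OF that], of "b' z"] by (simp add: mult.assoc)
  have hl: "(LINT s|lborel. \<bar>indicator {z<..<t} s * ?h s z\<bar>) \<le> M * \<bar>b' z\<bar>" if "0 < z" "z < t" for z
    proof -
      have "(LINT s|lborel. \<bar>indicator {z<..<t} s * ?h s z\<bar>) = (LINT s|lborel. \<bar>indicator {z<..<t} s * c s z\<bar> * \<bar>b' z\<bar>)"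
        by (simp add: abs_mult mult.assoc)
      also have "\<dots> = (LINT s|lborel. \<bar>indicator {z<..<t} s * c s z\<bar>) * \<bar>b' z\<bar>" by simp
      also have "\<dots> \<le> M * \<bar>b' z\<bar>" using le[OF that] by (rule mult_right_mono) simp
      finally show ?thesis .
    qed
    have "integrable lborel (\<lambda>z. indicator {0<..<t} z *\<^sub>R (M * \<bar>b' z\<bar>))"
      using b'(4) by (intro integrable_mult_indicator integrable_mult_right integrable_abs) auto
    then have Mi: "integrable lborel (\<lambda>z. indicator {0<..<t} z * (M * \<bar>b' z\<bar>))" by simp
  have T1: "integral {0..t} (\<lambda>s. integral {0..s} (?h s)) = integral {0..t} (\<lambda>z. integral {z..t} (\<lambda>s. ?h s z))"
    by (rule triangle_Fubini_borel(1)[OF hm hi hl Mi])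
  have T2: "(\<lambda>s. integral {0..s} (?h s)) absolutely_integrable_on {0..t}"
    by (rule triangle_Fubini_borel(2)[OF hm hi hl Mi])
  have T3: "(\<lambda>z. integral {z..t} (\<lambda>s. ?h s z)) absolutely_integrable_on {0..t}"
    by (rule triangle_Fubini_borel(3)[OF hm hi hl Mi])
  have T4: "negligible {s. \<not> (s \<in> {0<..<t} \<longrightarrow> ?h s absolutely_integrable_on {0..s})}"
    by (rule triangle_Fubini_borel(4)[OF hm hi hl Mi])
  have in1: "integral {0..s} (\<lambda>z. c s z * b z) = integral {0..s} (?h s)" if "s \<in> {0..t}" for s
    by (rule integral_spike[OF b'(2)]) (use eq that in auto)
  have in2: "integral {z..t} (\<lambda>s. ?h s z) = integral {z..t} (\<lambda>s. c s z) * b z" if "z \<in> {0..t} - N" for z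
    using eq[OF that] by simp
  have o1: "integral {0..t} (\<lambda>s. integral {0..s} (\<lambda>z. c s z * b z)) = integral {0..t} (\<lambda>s. integral {0..s} (?h s))"
    by (rule integral_cong) (rule in1)
  have o2: "integral {0..t} (\<lambda>z. integral {z..t} (\<lambda>s. c s z) * b z) = integral {0..t} (\<lambda>z. integral {z..t} (\<lambda>s. ?h s z))"
    by (rule integral_spike[OF b'(2) in2])
  show "integral {0..t} (\<lambda>s. integral {0..s} (\<lambda>z. c s z * b z)) = integral {0..t} (\<lambda>z. integral {z..t} (\<lambda>s. c s z) * b z)"
    unfolding o1 o2 by (rule T1)
  show "(\<lambda>s. integral {0..s} (\<lambda>z. c s z * b z)) absolutely_integrable_on {0..t}"
    by (rule absolutely_integrable_spike[OF T2 negligible_empty]) (use in1 in auto)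
  show "(\<lambda>z. integral {z..t} (\<lambda>s. c s z) * b z) absolutely_integrable_on {0..t}"
    using absolutely_integrable_spike[OF T3 b'(2), of "\<lambda>z. integral {z..t} (\<lambda>s. c s z) * b z"] in2 by metis
  show "negligible {s. \<not> (s \<in> {0<..<t} \<longrightarrow> (\<lambda>z. c s z * b z) absolutely_integrable_on {0..s})}"
  proof (rule negligible_subset[OF T4], rule subsetI)
    fix s assume "s \<in> {s. \<not> (s \<in> {0<..<t} \<longrightarrow> (\<lambda>z. c s z * b z) absolutely_integrable_on {0..s})}"
    then have s: "s \<in> {0<..<t}" and n: "\<not> (\<lambda>z. c s z * b z) absolutely_integrable_on {0..s}" by auto
    have "\<not> ?h s absolutely_integrable_on {0..s}"
    proof
      assume H: "?h s absolutely_integrable_on {0..s}"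
      have "(\<lambda>z. c s z * b z) absolutely_integrable_on {0..s}"
        by (rule absolutely_integrable_spike[OF H b'(2)]) (use eq s in auto)
      with n show False by blast
    qed
    then show "s \<in> {s. \<not> (s \<in> {0<..<t} \<longrightarrow> ?h s absolutely_integrable_on {0..s})}" using s by auto
  qed
qed

section \<open>The scalar error functional\<close>

text \<open>The continuous kernel minus the kernel of the scheme with step size
  \<open>\<tau>\<close>. The exponents \<alpha> - 1, \<alpha> and \<alpha> + 1 in
  \<open>err0\<close>, \<open>err1\<close> and \<open>err2\<close> make each the derivative of the
  next, since the chain rule costs a factor 1 / \<open>\<tau>\<close>.\<close>

definition err0 :: "real => real => real => real => real" where
  "err0 \<alpha> la \<tau> r = \<tau> powr (\<alpha> - 1) * kernel_error \<alpha> (la * \<tau> powr \<alpha>) (r / \<tau>)"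

definition err1 :: "real => real => real => real => real" where
  "err1 \<alpha> la \<tau> r = \<tau> powr \<alpha> * kernel_error1 \<alpha> (la * \<tau> powr \<alpha>) (r / \<tau>)"

definition err2 :: "real => real => real => real => real" where
  "err2 \<alpha> la \<tau> r = \<tau> powr (\<alpha> + 1) * kernel_error2 \<alpha> (la * \<tau> powr \<alpha>) (r / \<tau>)"

lemma borel_measurable_err0 [measurable]: "err0 \<alpha> la \<tau> \<in> borel_measurable borel"
  unfolding err0_def by measurable

definition err_const :: "real => real => bool" where
  "err_const \<alpha> C \<longleftrightarrow> 0 < C \<and> (\<forall>la \<tau> r. 0 < la \<longrightarrow> 0 < \<tau> \<longrightarrow> 0 < r \<longrightarrow>
     \<bar>err0 \<alpha> la \<tau> r\<bar> \<le> C * \<tau>\<^sup>2 * r powr (\<alpha> - 3) \<and> \<bar>err0 \<alpha> la \<tau> r\<bar> \<le> C * r powr (\<alpha> - 1) \<and>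
     \<bar>err1 \<alpha> la \<tau> r\<bar> \<le> C * \<tau>\<^sup>2 * r powr (\<alpha> - 2) \<and> \<bar>err2 \<alpha> la \<tau> r\<bar> \<le> C * \<tau>\<^sup>2 * r powr (\<alpha> - 1))"

text \<open>The order of convergence is born here: scaling turns
  \<open>\<tau> powr (\<alpha> - 1)\<close> times (r / \<open>\<tau>\<close>)^(\<alpha>-3) into
  \<open>\<tau>\<close>^2 r^(\<alpha>-3), and similarly for the two antiderivatives.\<close>

lemma err_bounds:
  fixes \<alpha> :: real
  assumes \<alpha>: "0 < \<alpha>" "\<alpha> < 1"
  obtains C where "err_const \<alpha> C"
proof -
  obtain C where C: "0 < C"
    "\<And>la x. 0 < la ==> 0 < x ==> \<bar>kernel_error \<alpha> la x\<bar> \<le> C * x powr (\<alpha> - 3)"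
    "\<And>la x. 0 < la ==> 0 < x ==> \<bar>kernel_error \<alpha> la x\<bar> \<le> C * x powr (\<alpha> - 1)"
    "\<And>la x. 0 < la ==> 0 < x ==> \<bar>kernel_error1 \<alpha> la x\<bar> \<le> C * x powr (\<alpha> - 2)"
    "\<And>la x. 0 < la ==> 0 < x ==> \<bar>kernel_error2 \<alpha> la x\<bar> \<le> C * x powr (\<alpha> - 1)"
    using kernel_error_bounds[OF \<alpha>] by blast
  have scale: "\<bar>\<tau> powr p * k\<bar> \<le> C * \<tau> powr (p - q) * r powr q"
    if "\<bar>k\<bar> \<le> C * (r / \<tau>) powr q" "0 < \<tau>" "0 < r" for k p q \<tau> r :: real
  proof -
    have "\<bar>\<tau> powr p * k\<bar> \<le> \<tau> powr p * (C * (r / \<tau>) powr q)" using that(1) by (simp add: abs_mult mult_left_mono)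
    also have "\<dots> = C * \<tau> powr (p - q) * r powr q" using that(2,3) by (simp add: powr_divide powr_diff)
    finally show ?thesis .
  qed
  have two: "\<tau> powr 2 = \<tau>\<^sup>2" if "0 < \<tau>" for \<tau> :: real using that by (simp add: powr_numeral)
  show ?thesis
  proof (rule that[of C], unfold err_const_def, intro conjI allI impI C(1))
    fix la \<tau> r :: real assume h: "0 < la" "0 < \<tau>" "0 < r"
    then have p: "0 < la * \<tau> powr \<alpha>" "0 < r / \<tau>" by auto
    show "\<bar>err0 \<alpha> la \<tau> r\<bar> \<le> C * \<tau>\<^sup>2 * r powr (\<alpha> - 3)"
      using scale[OF C(2)[OF p] h(2,3), of "\<alpha> - 1"] two[OF h(2)] by (simp add: err0_def)
    show "\<bar>err0 \<alpha> la \<tau> r\<bar> \<le> C * r powr (\<alpha> - 1)"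
      using scale[OF C(3)[OF p] h(2,3), of "\<alpha> - 1"] h by (simp add: err0_def)
    show "\<bar>err1 \<alpha> la \<tau> r\<bar> \<le> C * \<tau>\<^sup>2 * r powr (\<alpha> - 2)"
      using scale[OF C(4)[OF p] h(2,3), of "\<alpha>"] two[OF h(2)] by (simp add: err1_def)
    show "\<bar>err2 \<alpha> la \<tau> r\<bar> \<le> C * \<tau>\<^sup>2 * r powr (\<alpha> - 1)"
      using scale[OF C(5)[OF p] h(2,3), of "\<alpha> + 1"] two[OF h(2)] by (simp add: err2_def)
  qed
qed

lemma err_deriv:
  assumes \<alpha>: "0 < \<alpha>" "\<alpha> < 1" and h: "0 < la" "0 < \<tau>"
  shows "0 < r ==> (err1 \<alpha> la \<tau> has_real_derivative err0 \<alpha> la \<tau> r) (at r)"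
    and "0 < r ==> (err2 \<alpha> la \<tau> has_real_derivative err1 \<alpha> la \<tau> r) (at r)"
    and "continuous_on {0..a} (err1 \<alpha> la \<tau>)" "continuous_on {0..a} (err2 \<alpha> la \<tau>)"
    and "err1 \<alpha> la \<tau> 0 = 0" "err2 \<alpha> la \<tau> 0 = 0"
proof -
  have p: "0 < la * \<tau> powr \<alpha>" using h by simp
  note d1 = kernel_error1_deriv[OF \<alpha> p] and d2 = kernel_error2_deriv[OF \<alpha> p]
  have pw: "\<tau> powr \<alpha> / \<tau> = \<tau> powr (\<alpha> - 1)" "\<tau> powr (\<alpha> + 1) / \<tau> = \<tau> powr \<alpha>" using h by (simp_all add: powr_diff powr_add)
  have ch: "((\<lambda>r. c * F (r / \<tau>)) has_real_derivative c / \<tau> * F' (r / \<tau>)) (at r)"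
    if "(F has_real_derivative F' (r / \<tau>)) (at (r / \<tau>))" for F F' :: "real => real" and c r
  proof -
    have "((\<lambda>r. r / \<tau>) has_real_derivative 1 / \<tau>) (at r)" using h by (auto intro!: derivative_eq_intros)
    from DERIV_cmult[OF DERIV_chain2[OF that this], of c] show ?thesis by (simp add: mult_ac)
  qed
  show "(err1 \<alpha> la \<tau> has_real_derivative err0 \<alpha> la \<tau> r) (at r)" if "0 < r"
    using ch[where F = "kernel_error1 \<alpha> (la * \<tau> powr \<alpha>)" and F' = "kernel_error \<alpha> (la * \<tau> powr \<alpha>)" and c = "\<tau> powr \<alpha>" and r = r, OF d1(1)] that h
    by (simp add: err1_def[abs_def] err0_def pw)
  show "(err2 \<alpha> la \<tau> has_real_derivative err1 \<alpha> la \<tau> r) (at r)" if "0 < r"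
    using ch[where F = "kernel_error2 \<alpha> (la * \<tau> powr \<alpha>)" and F' = "kernel_error1 \<alpha> (la * \<tau> powr \<alpha>)" and c = "\<tau> powr (\<alpha> + 1)" and r = r, OF d2(1)] that h
    by (simp add: err2_def[abs_def] err1_def pw)
  show "continuous_on {0..a} (err1 \<alpha> la \<tau>)"
    unfolding err1_def[abs_def]
    by (intro continuous_intros continuous_on_compose2[OF d1(2)[of "a / \<tau>"]]) (use h in \<open>auto simp: divide_right_mono\<close>)
  show "continuous_on {0..a} (err2 \<alpha> la \<tau>)"
    unfolding err2_def[abs_def]
    by (intro continuous_intros continuous_on_compose2[OF d2(2)[of "a / \<tau>"]]) (use h in \<open>auto simp: divide_right_mono\<close>)
  show "err1 \<alpha> la \<tau> 0 = 0" "err2 \<alpha> la \<tau> 0 = 0"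
    by (simp_all add: err1_def err2_def kernel_error1_def kernel_error2_def)
qed

text \<open>Two integrations by parts move the derivatives from the kernel to \<open>f\<close>; at s
  = t the boundary terms vanish because \<open>err1\<close> and \<open>err2\<close> are 0 at 0.
  Keeping both integrands in one integral allows a single primitive, so that neither part has to be
  integrable beforehand.\<close>

lemma err_by_parts:
  fixes f f' f'' :: "real => real"
  assumes \<alpha>: "0 < \<alpha>" "\<alpha> < 1" and h: "0 < la" "0 < \<tau>" and a: "a \<le> t"
    and f: "\<And>s. s \<in> {a..t} ==> (f has_real_derivative f' s) (at s)"
    and f': "\<And>s. s \<in> {a..t} ==> (f' has_real_derivative f'' s) (at s)"
  shows "((\<lambda>s. err0 \<alpha> la \<tau> (t - s) * f s - err2 \<alpha> la \<tau> (t - s) * f'' s) has_integral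
     (err1 \<alpha> la \<tau> (t - a) * f a + err2 \<alpha> la \<tau> (t - a) * f' a)) {a..t}"
proof -
  note d = err_deriv[OF \<alpha> h]
  let ?H = "\<lambda>s. - err1 \<alpha> la \<tau> (t - s) * f s - err2 \<alpha> la \<tau> (t - s) * f' s"
  have "((\<lambda>s. err0 \<alpha> la \<tau> (t - s) * f s - err2 \<alpha> la \<tau> (t - s) * f'' s) has_integral (?H t - ?H a)) {a..t}"
  proof (rule fundamental_theorem_of_calculus_interior[OF a])
    have "continuous_on {a..t} f" "continuous_on {a..t} f'"
      using f f' by (meson DERIV_isCont continuous_at_imp_continuous_on)+
    then show "continuous_on {a..t} ?H"
      by (intro continuous_intros continuous_on_compose2[OF d(3)[of "t - a"]] continuous_on_compose2[OF d(4)[of "t - a"]]) auto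
    fix s assume s: "s \<in> {a<..<t}"
    have ts: "((\<lambda>s. t - s) has_real_derivative - 1) (at s)" by (auto intro!: derivative_eq_intros)
    have 1: "((\<lambda>s. err1 \<alpha> la \<tau> (t - s)) has_real_derivative - err0 \<alpha> la \<tau> (t - s)) (at s)"
      using DERIV_chain2[OF d(1)[of "t - s"] ts] s by simp
    have 2: "((\<lambda>s. err2 \<alpha> la \<tau> (t - s)) has_real_derivative - err1 \<alpha> la \<tau> (t - s)) (at s)"
      using DERIV_chain2[OF d(2)[of "t - s"] ts] s by simp
    have "(?H has_real_derivative err0 \<alpha> la \<tau> (t - s) * f s - err2 \<alpha> la \<tau> (t - s) * f'' s) (at s)"
      by (rule derivative_eq_intros 1 2 f f' refl | use s in \<open>simp; fail\<close>)+
    then show "(?H has_vector_derivative err0 \<alpha> la \<tau> (t - s) * f s - err2 \<alpha> la \<tau> (t - s) * f'' s) (at s)"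
      by (simp add: has_real_derivative_iff_has_vector_derivative)
  qed
  then show ?thesis by (simp add: d(5,6) add.commute)
qed

lemma has_integral_powr_to_right:
  fixes p a t :: real
  assumes "- 1 < p" "a \<le> t"
  shows "((\<lambda>s. (t - s) powr p) has_integral ((t - a) powr (p + 1) / (p + 1))) {a..t}"
proof -
  have "((\<lambda>s. (t - s) powr p) has_integral (- ((t - t) powr (p + 1)) / (p + 1) - (- ((t - a) powr (p + 1)) / (p + 1)))) {a..t}"
  proof (rule fundamental_theorem_of_calculus_interior[OF assms(2)])
    show "continuous_on {a..t} (\<lambda>s. - ((t - s) powr (p + 1)) / (p + 1))"
      by (intro continuous_intros continuous_on_powr') (use assms in auto)
    fix s assume s: "s \<in> {a<..<t}"
    have ts: "((\<lambda>s. t - s) has_real_derivative - 1) (at s)" by (auto intro!: derivative_eq_intros)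
    have "((\<lambda>s. (t - s) powr (p + 1)) has_real_derivative (p + 1) * (t - s) powr (p + 1 - 1) * - 1) (at s)"
      using DERIV_chain2[OF has_real_derivative_powr[of "t - s" "p + 1"] ts] s by simp
    from DERIV_cmult[OF this, of "- 1 / (p + 1)"]
    have "((\<lambda>s. - ((t - s) powr (p + 1)) / (p + 1)) has_real_derivative (t - s) powr p) (at s)"
      using assms by simp
    then show "((\<lambda>s. - ((t - s) powr (p + 1)) / (p + 1)) has_vector_derivative (t - s) powr p) (at s)"
      by (simp add: has_real_derivative_iff_has_vector_derivative)
  qed
  then show ?thesis by simp
qed

lemma integrable_err0_power:
  assumes \<alpha>: "0 < \<alpha>" "\<alpha> < 1" and h: "0 < la" "0 < \<tau>" and "0 < t" "- 1 < \<nu>"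
  shows "integrable lborel (\<lambda>s. indicator {0<..<t} s * (err0 \<alpha> la \<tau> (t - s) * s powr \<nu>))"
proof -
  obtain C where "err_const \<alpha> C" using err_bounds[OF \<alpha>] .
  then have C: "0 < C" "\<And>la \<tau> r. 0 < la ==> 0 < \<tau> ==> 0 < r ==> \<bar>err0 \<alpha> la \<tau> r\<bar> \<le> C * r powr (\<alpha> - 1)"
    by (auto simp: err_const_def)
  show ?thesis
  proof (rule integrable_dominated)
    show "integrable lborel (\<lambda>s. C * (indicator {0<..<t} s * ((t - s) powr (\<alpha> - 1) * s powr \<nu>)))"
      using has_bochner_integral_Beta[of "\<alpha> - 1" \<nu> t] assms by (simp add: has_bochner_integral_iff)
    show "\<bar>indicator {0<..<t} s * (err0 \<alpha> la \<tau> (t - s) * s powr \<nu>)\<bar> \<le> C * (indicator {0<..<t} s * ((t - s) powr (\<alpha> - 1) * s powr \<nu>))" for s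
      using mult_right_mono[OF C(2)[OF h, of "t - s"], of "s powr \<nu>"] by (auto simp: indicator_def abs_mult mult.assoc)
  qed measurable
qed

text \<open>The two singularities are separated at t / 2. On the left half the kernel is bounded by
  \<open>\<tau>\<close>^2 (t/2)^(\<alpha>-3) and s^\<open>\<nu>\<close> is integrated; on the right
  half the power is smooth and two integrations by parts replace the kernel by the integrable
  \<open>err2\<close>.\<close>

lemma err0_power_bound:
  fixes \<alpha> \<nu> :: real
  assumes \<alpha>: "0 < \<alpha>" "\<alpha> < 1" and \<nu>: "- 1 < \<nu>" "\<nu> \<le> 1"
  obtains C where "0 < C" "\<And>la \<tau> t. 0 < la ==> 0 < \<tau> ==> 0 < t ==>
     \<bar>integral {0..t} (\<lambda>s. err0 \<alpha> la \<tau> (t - s) * s powr \<nu>)\<bar> \<le> C * \<tau>\<^sup>2 * t powr (\<alpha> + \<nu> - 2)"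
proof -
  obtain C where "err_const \<alpha> C" using err_bounds[OF \<alpha>] .
  then have C: "0 < C"
    "\<And>la \<tau> r. 0 < la ==> 0 < \<tau> ==> 0 < r ==> \<bar>err0 \<alpha> la \<tau> r\<bar> \<le> C * \<tau>\<^sup>2 * r powr (\<alpha> - 3)"
    "\<And>la \<tau> r. 0 < la ==> 0 < \<tau> ==> 0 < r ==> \<bar>err1 \<alpha> la \<tau> r\<bar> \<le> C * \<tau>\<^sup>2 * r powr (\<alpha> - 2)"
    "\<And>la \<tau> r. 0 < la ==> 0 < \<tau> ==> 0 < r ==> \<bar>err2 \<alpha> la \<tau> r\<bar> \<le> C * \<tau>\<^sup>2 * r powr (\<alpha> - 1)"
    by (auto simp: err_const_def)
  \<comment> \<open>The summands belong, in this order, to the left half, the two boundary terms at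
    t / 2, and the integral that remains on the right half.\<close>
  define D where "D = 1 / (\<nu> + 1) + (1 + \<bar>\<nu>\<bar> + \<bar>\<nu> * (\<nu> - 1)\<bar> / \<alpha>)"
  have "0 < 1 / (\<nu> + 1)" "0 \<le> \<bar>\<nu> * (\<nu> - 1)\<bar> / \<alpha>" using \<nu> \<alpha> by auto
  then have D: "0 < D" unfolding D_def by linarith
  show ?thesis
  proof (rule that[of "C * D * 2 powr (2 - \<alpha> - \<nu>)"])
    fix la \<tau> t :: real assume h: "0 < la" "0 < \<tau>" and t: "0 < t"
    define a where "a = t / 2"
    have a: "0 < a" "a \<le> t" "t - a = a" using t by (auto simp: a_def)
    let ?K = "\<lambda>s. err0 \<alpha> la \<tau> (t - s) * s powr \<nu>"
    have pa: "a powr p * a powr q = a powr (p + q)" for p q by (simp add: powr_add)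
    have i: "?K integrable_on {0..t}"
      using integral_Icc_eq_lborel(1)[OF integrable_err0_power[OF \<alpha> h t \<nu>(1)]] by (rule set_lebesgue_integral_eq_integral(1))
    have i1: "?K integrable_on {0..a}" and i2: "?K integrable_on {a..t}"
      using integrable_on_subinterval[OF i] a by auto
    have 1: "\<bar>integral {0..a} ?K\<bar> \<le> C * \<tau>\<^sup>2 * a powr (\<alpha> + \<nu> - 2) * (1 / (\<nu> + 1))"
    proof -
      have g: "((\<lambda>s. C * \<tau>\<^sup>2 * a powr (\<alpha> - 3) * s powr \<nu>) has_integral C * \<tau>\<^sup>2 * a powr (\<alpha> - 3) * (a powr (\<nu> + 1) / (\<nu> + 1))) {0..a}"
        using a \<nu> by (intro has_integral_mult_right has_integral_powr_from_0) auto
      have "norm (integral {0..a} ?K) \<le> integral {0..a} (\<lambda>s. C * \<tau>\<^sup>2 * a powr (\<alpha> - 3) * s powr \<nu>)"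
      proof (rule integral_norm_bound_integral[OF i1])
        fix s assume s: "s \<in> {0..a}"
        have "\<bar>err0 \<alpha> la \<tau> (t - s)\<bar> \<le> C * \<tau>\<^sup>2 * (t - s) powr (\<alpha> - 3)" using C(2)[OF h] s a by simp
        also have "\<dots> \<le> C * \<tau>\<^sup>2 * a powr (\<alpha> - 3)" using s a \<alpha> C(1) by (intro mult_left_mono powr_mono2') auto
        finally show "norm (?K s) \<le> C * \<tau>\<^sup>2 * a powr (\<alpha> - 3) * s powr \<nu>"
          by (simp add: abs_mult mult_right_mono)
      qed (use g in \<open>auto simp: integrable_on_def\<close>)
      also have "\<dots> = C * \<tau>\<^sup>2 * (a powr (\<alpha> - 3) * a powr (\<nu> + 1)) * (1 / (\<nu> + 1))" by (subst integral_unique[OF g]) simp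
      also have "a powr (\<alpha> - 3) * a powr (\<nu> + 1) = a powr (\<alpha> + \<nu> - 2)" by (simp add: pa algebra_simps)
      finally show ?thesis by simp
    qed
    let ?f = "\<lambda>s. s powr \<nu>" and ?f' = "\<lambda>s. \<nu> * s powr (\<nu> - 1)" and ?f'' = "\<lambda>s. \<nu> * (\<nu> - 1) * s powr (\<nu> - 2)"
    have B: "((\<lambda>s. err0 \<alpha> la \<tau> (t - s) * ?f s - err2 \<alpha> la \<tau> (t - s) * ?f'' s) has_integral
       (err1 \<alpha> la \<tau> (t - a) * ?f a + err2 \<alpha> la \<tau> (t - a) * ?f' a)) {a..t}"
      by (rule err_by_parts[OF \<alpha> h a(2)]) (use a in \<open>auto intro!: derivative_eq_intros\<close>)
    have c2: "(\<lambda>s. err2 \<alpha> la \<tau> (t - s) * ?f'' s) integrable_on {a..t}"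
      by (intro integrable_continuous_real continuous_intros continuous_on_compose2[OF err_deriv(4)[OF \<alpha> h, of "t - a"]])
         (use a in auto)
    have "integral {a..t} ?K = integral {a..t} (\<lambda>s. (err0 \<alpha> la \<tau> (t - s) * ?f s - err2 \<alpha> la \<tau> (t - s) * ?f'' s) + err2 \<alpha> la \<tau> (t - s) * ?f'' s)"
      by simp
    also have "\<dots> = (err1 \<alpha> la \<tau> a * ?f a + err2 \<alpha> la \<tau> a * ?f' a) + integral {a..t} (\<lambda>s. err2 \<alpha> la \<tau> (t - s) * ?f'' s)"
      using B c2 a by (subst integral_add) (auto simp: integral_unique integrable_on_def)
    finally have e2: "integral {a..t} ?K = \<dots>" .
    have b1: "\<bar>err1 \<alpha> la \<tau> a * ?f a\<bar> \<le> C * \<tau>\<^sup>2 * a powr (\<alpha> + \<nu> - 2)"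
    proof -
      have "\<bar>err1 \<alpha> la \<tau> a * ?f a\<bar> \<le> (C * \<tau>\<^sup>2 * a powr (\<alpha> - 2)) * a powr \<nu>"
        using C(3)[OF h a(1)] by (simp add: abs_mult mult_right_mono)
      also have "\<dots> = C * \<tau>\<^sup>2 * (a powr (\<alpha> - 2) * a powr \<nu>)" by simp
      finally show ?thesis unfolding pa by (simp add: algebra_simps)
    qed
    have b2: "\<bar>err2 \<alpha> la \<tau> a * ?f' a\<bar> \<le> C * \<tau>\<^sup>2 * a powr (\<alpha> + \<nu> - 2) * \<bar>\<nu>\<bar>"
    proof -
      have "\<bar>err2 \<alpha> la \<tau> a * ?f' a\<bar> \<le> (C * \<tau>\<^sup>2 * a powr (\<alpha> - 1)) * (\<bar>\<nu>\<bar> * a powr (\<nu> - 1))"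
        using C(4)[OF h a(1)] by (simp add: abs_mult mult_right_mono)
      also have "\<dots> = C * \<tau>\<^sup>2 * (a powr (\<alpha> - 1) * a powr (\<nu> - 1)) * \<bar>\<nu>\<bar>" by simp
      finally show ?thesis unfolding pa by (simp add: algebra_simps)
    qed
    have b3: "\<bar>integral {a..t} (\<lambda>s. err2 \<alpha> la \<tau> (t - s) * ?f'' s)\<bar> \<le> C * \<tau>\<^sup>2 * a powr (\<alpha> + \<nu> - 2) * (\<bar>\<nu> * (\<nu> - 1)\<bar> / \<alpha>)"
    proof -
      let ?c = "C * \<tau>\<^sup>2 * (\<bar>\<nu> * (\<nu> - 1)\<bar> * a powr (\<nu> - 2))"
      have g: "((\<lambda>s. ?c * (t - s) powr (\<alpha> - 1)) has_integral ?c * ((t - a) powr (\<alpha> - 1 + 1) / (\<alpha> - 1 + 1))) {a..t}"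
        using a \<alpha> by (intro has_integral_mult_right has_integral_powr_to_right) auto
      have "norm (integral {a..t} (\<lambda>s. err2 \<alpha> la \<tau> (t - s) * ?f'' s)) \<le> integral {a..t} (\<lambda>s. ?c * (t - s) powr (\<alpha> - 1))"
      proof (rule integral_norm_bound_integral[OF c2])
        fix s assume s: "s \<in> {a..t}"
        have e: "\<bar>err2 \<alpha> la \<tau> (t - s)\<bar> \<le> C * \<tau>\<^sup>2 * (t - s) powr (\<alpha> - 1)"
          using C(4)[OF h, of "t - s"] err_deriv(6)[OF \<alpha> h] s by (cases "s = t") auto
        have "s powr (\<nu> - 2) \<le> a powr (\<nu> - 2)" using s a \<nu> by (intro powr_mono2') auto
        then have "\<bar>err2 \<alpha> la \<tau> (t - s)\<bar> * (\<bar>\<nu> * (\<nu> - 1)\<bar> * s powr (\<nu> - 2)) \<le> (C * \<tau>\<^sup>2 * (t - s) powr (\<alpha> - 1)) * (\<bar>\<nu> * (\<nu> - 1)\<bar> * a powr (\<nu> - 2))"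
          using C(1) by (intro mult_mono e mult_left_mono) auto
        then show "norm (err2 \<alpha> la \<tau> (t - s) * ?f'' s) \<le> ?c * (t - s) powr (\<alpha> - 1)"
          by (simp add: abs_mult mult_ac)
      qed (use g in \<open>auto simp: integrable_on_def\<close>)
      also have "\<dots> = C * \<tau>\<^sup>2 * (a powr (\<nu> - 2) * a powr \<alpha>) * (\<bar>\<nu> * (\<nu> - 1)\<bar> / \<alpha>)" using a by (subst integral_unique[OF g]) simp
      also have "a powr (\<nu> - 2) * a powr \<alpha> = a powr (\<alpha> + \<nu> - 2)" by (simp add: pa algebra_simps)
      finally show ?thesis by simp
    qed
    have "integral {0..t} ?K = integral {0..a} ?K + integral {a..t} ?K"
      using i a by (intro Henstock_Kurzweil_Integration.integral_combine[symmetric]) auto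
    then have "\<bar>integral {0..t} ?K\<bar> \<le> C * \<tau>\<^sup>2 * a powr (\<alpha> + \<nu> - 2) * (1 / (\<nu> + 1)) + (C * \<tau>\<^sup>2 * a powr (\<alpha> + \<nu> - 2) +
        C * \<tau>\<^sup>2 * a powr (\<alpha> + \<nu> - 2) * \<bar>\<nu>\<bar> + C * \<tau>\<^sup>2 * a powr (\<alpha> + \<nu> - 2) * (\<bar>\<nu> * (\<nu> - 1)\<bar> / \<alpha>))"
      using 1 e2 b1 b2 b3 by linarith
    also have "\<dots> = C * \<tau>\<^sup>2 * a powr (\<alpha> + \<nu> - 2) * D" by (simp only: D_def distrib_left mult_1_right)
    also have "a powr (\<alpha> + \<nu> - 2) = 2 powr (2 - \<alpha> - \<nu>) * t powr (\<alpha> + \<nu> - 2)"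
    proof -
      have "a powr (\<alpha> + \<nu> - 2) = t powr (\<alpha> + \<nu> - 2) / 2 powr (\<alpha> + \<nu> - 2)" using t by (simp add: a_def powr_divide)
      also have "\<dots> = t powr (\<alpha> + \<nu> - 2) * 2 powr (- (\<alpha> + \<nu> - 2))" by (simp only: powr_minus divide_inverse)
      also have "- (\<alpha> + \<nu> - 2) = 2 - \<alpha> - \<nu>" by simp
      finally show ?thesis by (simp only: mult.commute)
    qed
    finally show "\<bar>integral {0..t} ?K\<bar> \<le> C * D * 2 powr (2 - \<alpha> - \<nu>) * \<tau>\<^sup>2 * t powr (\<alpha> + \<nu> - 2)" by (simp only: mult_ac)
  qed (use C D in simp)
qed

text \<open>The ramp vanishes at \<open>\<zeta>\<close>, so only the boundary term with
  \<open>err2\<close> survives and gives the first weight. The remaining integrand is at most a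
  constant times (t - s)^(\<alpha>-1) s^(\<mu>-1); the second weight comes from distributing
  s^(\<mu>-1) between \<open>\<zeta>\<close> and a Beta integral.\<close>

lemma err0_ramp_bound:
  fixes \<alpha> \<mu> :: real
  assumes \<alpha>: "0 < \<alpha>" "\<alpha> < 1" and \<mu>: "- 1 < \<mu>" "\<mu> < 0"
  obtains C where "0 < C" "\<And>la \<tau> \<zeta> t. 0 < la ==> 0 < \<tau> ==> 0 < \<zeta> ==> \<zeta> < t ==>
     \<bar>integral {\<zeta>..t} (\<lambda>s. err0 \<alpha> la \<tau> (t - s) * (s powr \<mu> * (s - \<zeta>)))\<bar>
       \<le> C * \<tau>\<^sup>2 * ((t - \<zeta>) powr (\<alpha> - 1) * \<zeta> powr \<mu> + t powr (\<alpha> + (\<mu> - 1) / 2) * \<zeta> powr ((\<mu> - 1) / 2))"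
proof -
  obtain C where "err_const \<alpha> C" using err_bounds[OF \<alpha>] .
  then have C: "0 < C"
    "\<And>la \<tau> r. 0 < la ==> 0 < \<tau> ==> 0 < r ==> \<bar>err2 \<alpha> la \<tau> r\<bar> \<le> C * \<tau>\<^sup>2 * r powr (\<alpha> - 1)"
    by (auto simp: err_const_def)
  \<comment> \<open>s^(\<mu>-1) is not integrable at 0, but its square root is. Freezing the other
    square root at \<open>\<zeta>\<close> leaves a Beta integral over (0, t) that does not depend on
    \<open>\<zeta>\<close>.\<close>
  define q where "q = (\<mu> - 1) / 2"
  have q: "- 1 < q" "q + q = \<mu> - 1" using \<mu> by (auto simp: q_def)
  define B where "B = Beta (q + 1) (\<alpha> - 1 + 1)"
  have B: "0 < B" using q \<alpha> by (auto simp: B_def Beta_def intro!: divide_pos_pos mult_pos_pos Gamma_real_pos)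
  show ?thesis
  proof (rule that[of "C * (1 + 3 * B)"])
    fix la \<tau> \<zeta> t :: real assume h: "0 < la" "0 < \<tau>" and z: "0 < \<zeta>" "\<zeta> < t"
    let ?f = "\<lambda>s. s powr \<mu> * (s - \<zeta>)" and ?f' = "\<lambda>s. \<mu> * s powr (\<mu> - 1) * (s - \<zeta>) + s powr \<mu>"
      and ?f'' = "\<lambda>s. \<mu> * (\<mu> - 1) * s powr (\<mu> - 2) * (s - \<zeta>) + 2 * \<mu> * s powr (\<mu> - 1)"
    have P: "((\<lambda>s. err0 \<alpha> la \<tau> (t - s) * ?f s - err2 \<alpha> la \<tau> (t - s) * ?f'' s) has_integral
       (err1 \<alpha> la \<tau> (t - \<zeta>) * ?f \<zeta> + err2 \<alpha> la \<tau> (t - \<zeta>) * ?f' \<zeta>)) {\<zeta>..t}"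
      by (rule err_by_parts[OF \<alpha> h less_imp_le[OF z(2)]]) (use z in \<open>auto intro!: derivative_eq_intros simp: algebra_simps\<close>)
    have c2: "(\<lambda>s. err2 \<alpha> la \<tau> (t - s) * ?f'' s) integrable_on {\<zeta>..t}"
      by (intro integrable_continuous_real continuous_intros continuous_on_compose2[OF err_deriv(4)[OF \<alpha> h, of "t - \<zeta>"]])
         (use z in auto)
    have "integral {\<zeta>..t} (\<lambda>s. err0 \<alpha> la \<tau> (t - s) * ?f s) = integral {\<zeta>..t} (\<lambda>s. (err0 \<alpha> la \<tau> (t - s) * ?f s - err2 \<alpha> la \<tau> (t - s) * ?f'' s) + err2 \<alpha> la \<tau> (t - s) * ?f'' s)"
      by simp
    also have "\<dots> = err2 \<alpha> la \<tau> (t - \<zeta>) * \<zeta> powr \<mu> + integral {\<zeta>..t} (\<lambda>s. err2 \<alpha> la \<tau> (t - s) * ?f'' s)"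
      using P c2 by (subst integral_add) (auto simp: integral_unique integrable_on_def)
    finally have e: "integral {\<zeta>..t} (\<lambda>s. err0 \<alpha> la \<tau> (t - s) * ?f s) = \<dots>" .
    have b1: "\<bar>err2 \<alpha> la \<tau> (t - \<zeta>) * \<zeta> powr \<mu>\<bar> \<le> C * \<tau>\<^sup>2 * ((t - \<zeta>) powr (\<alpha> - 1) * \<zeta> powr \<mu>)"
      using C(2)[OF h, of "t - \<zeta>"] z by (simp add: abs_mult mult_right_mono mult.assoc[symmetric])
    have b2: "\<bar>integral {\<zeta>..t} (\<lambda>s. err2 \<alpha> la \<tau> (t - s) * ?f'' s)\<bar> \<le> C * \<tau>\<^sup>2 * 3 * \<zeta> powr q * (t powr (\<alpha> + q) * B)"
    proof -
      let ?c = "C * \<tau>\<^sup>2 * 3 * \<zeta> powr q" and ?g = "\<lambda>s. (t - s) powr (\<alpha> - 1) * s powr q"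
      have "has_bochner_integral lborel (\<lambda>s. indicator {0<..<t} s * ?g s) (t powr (\<alpha> - 1 + q + 1) * B)"
        unfolding B_def using \<alpha> q z by (intro has_bochner_integral_Beta) auto
      then have gi: "integrable lborel (\<lambda>s. indicator {0<..<t} s * ?g s)" and gv: "(LINT s|lborel. indicator {0<..<t} s * ?g s) = t powr (\<alpha> + q) * B"
        by (auto simp: has_bochner_integral_iff)
      note G = integral_Icc_eq_lborel[OF gi]
      have g0: "?g integrable_on {0..t}" using G(1) by (rule set_lebesgue_integral_eq_integral(1))
      have g1: "?g integrable_on {\<zeta>..t}" using integrable_on_subinterval[OF g0] z by auto
      have "integral {\<zeta>..t} ?g \<le> integral {0..t} ?g" by (rule integral_subset_le[OF _ g1 g0]) (use z in auto)
      then have gl: "integral {\<zeta>..t} ?g \<le> t powr (\<alpha> + q) * B" using G(2) gv by simp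
      have "norm (integral {\<zeta>..t} (\<lambda>s. err2 \<alpha> la \<tau> (t - s) * ?f'' s)) \<le> integral {\<zeta>..t} (\<lambda>s. ?c * ?g s)"
      proof (rule integral_norm_bound_integral[OF c2])
        show "(\<lambda>s. ?c * ?g s) integrable_on {\<zeta>..t}" using integrable_cmul[OF g1, of ?c] by simp
        fix s assume s: "s \<in> {\<zeta>..t}"
        have s0: "0 < s" using s z by auto
        have e: "\<bar>err2 \<alpha> la \<tau> (t - s)\<bar> \<le> C * \<tau>\<^sup>2 * (t - s) powr (\<alpha> - 1)"
          using C(2)[OF h, of "t - s"] err_deriv(6)[OF \<alpha> h] s by (cases "s = t") auto
        \<comment> \<open>The ramp factor absorbs one power of s: s^(\<mu>-2) (s -
          \<open>\<zeta>\<close>) = s^(\<mu>-1) w with w in [0, 1].\<close>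
        define w where "w = (s - \<zeta>) / s"
        have w: "0 \<le> w" "w \<le> 1" using s z by (auto simp: w_def)
        have "s powr (\<mu> - 2) * (s - \<zeta>) = s powr (\<mu> - 1) * w"
          using s0 by (simp add: w_def powr_diff powr_numeral field_simps power2_eq_square)
        then have "?f'' s = (\<mu> * (\<mu> - 1) * w + 2 * \<mu>) * s powr (\<mu> - 1)" by (simp add: algebra_simps)
        moreover have "\<bar>\<mu> * (\<mu> - 1) * w + 2 * \<mu>\<bar> \<le> 3"
        proof -
          have "\<mu> * (\<mu> - 1) = (- \<mu>) * (1 - \<mu>)" by (simp add: algebra_simps)
          moreover have "(- \<mu>) * (1 - \<mu>) \<le> 1 * 2" using \<mu> by (intro mult_mono) auto
          moreover have "0 \<le> (- \<mu>) * (1 - \<mu>)" using \<mu> by (intro mult_nonneg_nonneg) auto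
          ultimately have m: "0 \<le> \<mu> * (\<mu> - 1)" "\<mu> * (\<mu> - 1) \<le> 2" by linarith+
          have "0 \<le> \<mu> * (\<mu> - 1) * w" using m w by simp
          moreover have "\<mu> * (\<mu> - 1) * w \<le> 2 * 1" using m w by (intro mult_mono) auto
          ultimately show ?thesis using \<mu> by (simp add: abs_le_iff)
        qed
        ultimately have f2: "\<bar>?f'' s\<bar> \<le> 3 * s powr (\<mu> - 1)" by (simp add: abs_mult mult_right_mono)
        \<comment> \<open>Since s >= \<open>\<zeta>\<close> and q < 0, one factor s^q may be
          replaced by its value at \<open>\<zeta>\<close>.\<close>
        have "s powr (\<mu> - 1) = s powr q * s powr q" by (simp add: powr_add[symmetric] q(2))
        also have "\<dots> \<le> \<zeta> powr q * s powr q" using s z q \<mu> by (intro mult_right_mono powr_mono2') (auto simp: q_def)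
        finally have "\<bar>?f'' s\<bar> \<le> 3 * (\<zeta> powr q * s powr q)" using f2 by linarith
        with e have "\<bar>err2 \<alpha> la \<tau> (t - s)\<bar> * \<bar>?f'' s\<bar> \<le> (C * \<tau>\<^sup>2 * (t - s) powr (\<alpha> - 1)) * (3 * (\<zeta> powr q * s powr q))"
          using C(1) by (intro mult_mono) auto
        then show "norm (err2 \<alpha> la \<tau> (t - s) * ?f'' s) \<le> ?c * ?g s" unfolding real_norm_def abs_mult by (simp only: mult_ac)
      qed
      also have "\<dots> = ?c * integral {\<zeta>..t} ?g" by simp
      also have "\<dots> \<le> ?c * (t powr (\<alpha> + q) * B)" using gl C(1) by (intro mult_left_mono) auto
      finally show ?thesis by simp
    qed
    have nn: "0 \<le> C * \<tau>\<^sup>2 * ((t - \<zeta>) powr (\<alpha> - 1) * \<zeta> powr \<mu>) * (3 * B)" "0 \<le> C * \<tau>\<^sup>2 * (\<zeta> powr q * t powr (\<alpha> + q))"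
      using C(1) B by simp_all
    have "\<bar>integral {\<zeta>..t} (\<lambda>s. err0 \<alpha> la \<tau> (t - s) * ?f s)\<bar> \<le> C * \<tau>\<^sup>2 * ((t - \<zeta>) powr (\<alpha> - 1) * \<zeta> powr \<mu>) + C * \<tau>\<^sup>2 * 3 * \<zeta> powr q * (t powr (\<alpha> + q) * B)"
      unfolding e using b1 b2 by linarith
    also have "\<dots> \<le> C * (1 + 3 * B) * \<tau>\<^sup>2 * ((t - \<zeta>) powr (\<alpha> - 1) * \<zeta> powr \<mu> + t powr (\<alpha> + q) * \<zeta> powr q)"
      using nn by (simp add: algebra_simps)
    finally show "\<bar>integral {\<zeta>..t} (\<lambda>s. err0 \<alpha> la \<tau> (t - s) * ?f s)\<bar>
       \<le> C * (1 + 3 * B) * \<tau>\<^sup>2 * ((t - \<zeta>) powr (\<alpha> - 1) * \<zeta> powr \<mu> + t powr (\<alpha> + (\<mu> - 1) / 2) * \<zeta> powr ((\<mu> - 1) / 2))"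
      by (simp only: q_def)
  qed (use C B in simp)
qed

section \<open>The Volterra identity and Caputo solutions\<close>

text \<open>Weierstrass approximation in \<open>x = exp (- t)\<close>; the factor
  \<open>x (1 - x)\<close> makes the transformed function continuous up to both end points.\<close>

lemma laplace_unique_zero:
  fixes h :: "real => real"
  assumes hm [measurable]: "h \<in> borel_measurable borel" and hc: "continuous_on {0<..} h"
    and hb: "\<And>t. 0 < t ==> \<bar>h t\<bar> \<le> A + B * t" and AB: "0 \<le> A" "0 \<le> B"
    and L: "\<And>n::nat. 1 \<le> n ==> (LINT t|lborel. indicator {0<..} t * (exp (- real n * t) * h t)) = 0"
    and t: "0 < t"
  shows "h t = 0"
proof -
  define \<phi> where "\<phi> = (\<lambda>x. if 0 < x \<and> x < 1 then x * (1 - x) * h (- ln x) else 0)"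
  have \<phi>e: "\<phi> (exp (- t)) = exp (- t) * (1 - exp (- t)) * h t" if "0 < t" for t
    using that by (simp add: \<phi>_def)
  have pb: "\<bar>\<phi> x\<bar> \<le> x * (1 - x) * (A + B * (- ln x))" if "0 < x" "x < 1" for x
    using hb[of "- ln x"] that by (simp add: \<phi>_def abs_mult mult_left_mono)
  have cont: "continuous_on {0..1} \<phi>"
  proof (rule continuous_on_eq_continuous_within[THEN iffD2], rule ballI)
    fix x :: real assume x: "x \<in> {0..1}"
    consider "x = 0" | "0 < x" "x < 1" | "x = 1" using x by fastforce
    then show "continuous (at x within {0..1}) \<phi>"
    proof cases
      case 1
      have "(\<phi> \<longlongrightarrow> 0) (at_right 0)"
      proof (rule Lim_null_comparison)
        have "\<forall>\<^sub>F x::real in at_right 0. 0 < x \<and> x < 1" using eventually_at_right_real[of 0 1] by simp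
        then show "\<forall>\<^sub>F x in at_right 0. norm (\<phi> x) \<le> x * (1 - x) * (A + B * (- ln x))"
          by eventually_elim (use pb in simp)
        show "((\<lambda>x. x * (1 - x) * (A + B * (- ln x))) \<longlongrightarrow> 0) (at_right 0)" by real_asymp
      qed
      then have "(\<phi> \<longlongrightarrow> \<phi> 0) (at 0 within {0..1})"
        using at_within_Icc_at_right[of 0 "1::real"] by (simp add: \<phi>_def)
      then show ?thesis using 1 by (simp add: continuous_within)
    next
      case 3
      have "(\<phi> \<longlongrightarrow> 0) (at_left 1)"
      proof (rule Lim_null_comparison)
        have "\<forall>\<^sub>F x::real in at_left 1. 0 < x \<and> x < 1" using eventually_at_left_real[of 0 1] by simp
        then show "\<forall>\<^sub>F x in at_left 1. norm (\<phi> x) \<le> x * (1 - x) * (A + B * (- ln x))"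
          by eventually_elim (use pb in simp)
        show "((\<lambda>x. x * (1 - x) * (A + B * (- ln x))) \<longlongrightarrow> 0) (at_left 1)" by (auto intro!: tendsto_eq_intros)
      qed
      then have "(\<phi> \<longlongrightarrow> \<phi> 1) (at 1 within {0..1})"
        using at_within_Icc_at_left[of 0 "1::real"] by (simp add: \<phi>_def)
      then show ?thesis using 3 by (simp add: continuous_within)
    next
      case 2
      have "continuous_on {0<..<1} (\<lambda>x. x * (1 - x) * h (- ln x))"
        by (intro continuous_intros continuous_on_compose2[OF hc]) auto
      then have "continuous_on {0<..<1} \<phi>" by (rule continuous_on_eq) (simp add: \<phi>_def)
      then have "isCont \<phi> x" using 2 continuous_on_eq_continuous_at[of "{0<..<1}" \<phi>] by auto
      then show ?thesis by (rule continuous_at_imp_continuous_at_within)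
    qed
  qed
  let ?I = "\<lambda>g. LINT t|lborel. indicator {0<..} t * (exp (- t) * h t * g t)"
  have base: "integrable lborel (\<lambda>t. indicator {0<..} t * (exp (- t) * h t))"
  proof (rule integrable_dominated)
    have "integrable lborel (\<lambda>t. A * (indicator {0<..} t * (t powr 0 * exp (- 1 * t))) + B * (indicator {0<..} t * (t powr 1 * exp (- 1 * t))))"
      using has_bochner_integral_Gamma[of 0 1] has_bochner_integral_Gamma[of 1 1]
      by (intro Bochner_Integration.integrable_add integrable_mult_right) (auto simp: has_bochner_integral_iff)
    then show "integrable lborel (\<lambda>t. A * (indicator {0<..} t * (t powr 0 * exp (- 1 * t))) + B * (indicator {0<..} t * (t powr 1 * exp (- 1 * t))))" .
    show "\<bar>indicator {0<..} t * (exp (- t) * h t)\<bar> \<le> A * (indicator {0<..} t * (t powr 0 * exp (- 1 * t))) + B * (indicator {0<..} t * (t powr 1 * exp (- 1 * t)))" for t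
      using mult_left_mono[OF hb, of t "exp (- t)"] by (auto simp: indicator_def abs_mult algebra_simps)
  qed measurable
  define D where "D = (LINT t|lborel. \<bar>indicator {0<..} t * (exp (- t) * h t)\<bar>)"
  have D: "0 \<le> D" by (simp add: D_def)
  have gi: "integrable lborel (\<lambda>t. indicator {0<..} t * (exp (- t) * h t * g t))" if [measurable]: "g \<in> borel_measurable borel" and "\<And>t. 0 < t ==> \<bar>g t\<bar> \<le> C" for g C
  proof (rule integrable_dominated[OF integrable_mult_right[OF integrable_abs[OF base], of C]])
    show "\<bar>indicator {0<..} t * (exp (- t) * h t * g t)\<bar> \<le> C * \<bar>indicator {0<..} t * (exp (- t) * h t)\<bar>" for t
      using mult_right_mono[OF that(2)[of t], of "\<bar>exp (- t) * h t\<bar>"] by (auto simp: indicator_def abs_mult mult_ac)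
  qed measurable
  have \<phi>m [measurable]: "\<phi> \<in> borel_measurable borel" unfolding \<phi>_def by measurable
  have \<phi>bd: "\<exists>C. \<forall>x\<in>{0..1}. \<bar>\<phi> x\<bar> \<le> C"
  proof -
    have "compact (\<phi> ` {0..1})" by (rule compact_continuous_image[OF cont]) simp
    from compact_imp_bounded[OF this] show ?thesis by (auto simp: bounded_iff)
  qed
  then obtain C where C: "\<And>x. x \<in> {0..1} ==> \<bar>\<phi> x\<bar> \<le> C" by blast
  have Zi: "integrable lborel (\<lambda>t. indicator {0<..} t * (exp (- t) * h t * \<phi> (exp (- t))))"
    by (rule gi[of _ C]) (auto intro: C)
  have small: "\<bar>?I (\<lambda>t. \<phi> (exp (- t)))\<bar> \<le> e * D" if e: "0 < e" for e
  proof -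
    obtain p where p: "real_polynomial_function p" "\<And>x. x \<in> {0..1} ==> \<bar>\<phi> x - p x\<bar> < e"
      using Stone_Weierstrass_real_polynomial_function[of "{0..1}" \<phi> e] cont e by auto
    obtain a n where pa: "p = (\<lambda>x. \<Sum>i\<le>n. a i * x ^ i)"
      using p(1) real_polynomial_function_iff_sum by blast
    have trm: "integrable lborel (\<lambda>t. indicator {0<..} t * (exp (- t) * h t * (a i * exp (- t) ^ i)))" for i
      by (rule gi[of _ "\<bar>a i\<bar>"]) (auto simp: abs_mult power_le_one intro!: mult_left_le)
    \<comment> \<open>The monomial x^i at x = exp (- t), together with the weight exp (- t), is the
      Laplace kernel at i + 1; this is why transforms at n >= 1 suffice.\<close>
    have t0: "?I (\<lambda>t. a i * exp (- t) ^ i) = 0" for i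
    proof -
      have "?I (\<lambda>t. a i * exp (- t) ^ i) = (LINT t|lborel. a i * (indicator {0<..} t * (exp (- real (Suc i) * t) * h t)))"
        by (rule Bochner_Integration.integral_cong) (auto simp: exp_of_nat_mult[symmetric] exp_add[symmetric] algebra_simps)
      also have "\<dots> = 0" using L[of "Suc i"] by simp
      finally show ?thesis .
    qed
    have "?I (\<lambda>t. p (exp (- t))) = (LINT t|lborel. (\<Sum>i\<le>n. indicator {0<..} t * (exp (- t) * h t * (a i * exp (- t) ^ i))))"
      by (simp add: pa sum_distrib_left)
    also have "\<dots> = (\<Sum>i\<le>n. ?I (\<lambda>t. a i * exp (- t) ^ i))" by (rule Bochner_Integration.integral_sum) (rule trm)
    also have "\<dots> = 0" by (simp only: t0 sum.neutral_const)
    finally have p0: "?I (\<lambda>t. p (exp (- t))) = 0" .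
    have pm [measurable]: "p \<in> borel_measurable borel" unfolding pa by measurable
    have pi: "integrable lborel (\<lambda>t. indicator {0<..} t * (exp (- t) * h t * p (exp (- t))))"
    proof (rule gi[of _ "C + e"])
      fix t :: real assume "0 < t"
      then show "\<bar>p (exp (- t))\<bar> \<le> C + e" using p(2)[of "exp (- t)"] C[of "exp (- t)"] by auto
    qed measurable
    have "?I (\<lambda>t. \<phi> (exp (- t))) = (LINT t|lborel. indicator {0<..} t * (exp (- t) * h t * \<phi> (exp (- t))) - indicator {0<..} t * (exp (- t) * h t * p (exp (- t))))"
      using Zi pi p0 by simp
    then have "\<bar>?I (\<lambda>t. \<phi> (exp (- t)))\<bar> = \<bar>LINT t|lborel. indicator {0<..} t * (exp (- t) * h t * \<phi> (exp (- t))) - indicator {0<..} t * (exp (- t) * h t * p (exp (- t)))\<bar>"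
      by (rule arg_cong)
    also have "\<dots> \<le> (LINT t|lborel. e * \<bar>indicator {0<..} t * (exp (- t) * h t)\<bar>)"
      unfolding real_norm_def[symmetric]
    proof (rule Bochner_Integration.integral_norm_bound_integral)
      fix t :: real
      show "norm (indicator {0<..} t * (exp (- t) * h t * \<phi> (exp (- t))) - indicator {0<..} t * (exp (- t) * h t * p (exp (- t)))) \<le> e * norm (indicator {0<..} t * (exp (- t) * h t))"
      proof (cases "0 < t")
        case True
        then have "\<bar>\<phi> (exp (- t)) - p (exp (- t))\<bar> \<le> e" using p(2)[of "exp (- t)"] by simp
        then have "\<bar>exp (- t) * h t\<bar> * \<bar>\<phi> (exp (- t)) - p (exp (- t))\<bar> \<le> \<bar>exp (- t) * h t\<bar> * e"
          by (rule mult_left_mono) simp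
        moreover have "\<bar>X * u - X * v\<bar> = \<bar>X\<bar> * \<bar>u - v\<bar>" for X u v :: real
          by (simp only: right_diff_distrib[symmetric] abs_mult)
        ultimately show ?thesis using True by (simp only: indicator_simps greaterThan_iff mult_1 real_norm_def mult.commute[of e])
      qed simp
    qed (use Zi pi base in auto)
    finally show ?thesis by (simp add: D_def)
  qed
  have "?I (\<lambda>t. \<phi> (exp (- t))) = 0"
  proof (rule ccontr)
    let ?z = "\<bar>?I (\<lambda>t. \<phi> (exp (- t)))\<bar>"
    assume "?I (\<lambda>t. \<phi> (exp (- t))) \<noteq> 0"
    then have z: "0 < ?z" by simp
    have "?z \<le> (?z / (2 * (D + 1))) * D" by (rule small) (use z D in simp)
    also have "\<dots> < ?z"
    proof -
      have "D / (2 * (D + 1)) < 1" using D by (simp add: divide_less_eq)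
      from mult_strict_left_mono[OF this z] show ?thesis by simp
    qed
    finally show False by simp
  qed
  \<comment> \<open>The integrand equals (exp (- t) h(t))^2 (1 - exp (- t)), which is nonnegative,
    so the vanishing integral forces it to vanish almost everywhere.\<close>
  then have "AE t in lborel. indicator {0<..} t * (exp (- t) * h t * \<phi> (exp (- t))) = 0"
  proof (subst (asm) integral_nonneg_eq_0_iff_AE[OF Zi])
    show "AE t in lborel. 0 \<le> indicator {0<..} t * (exp (- t) * h t * \<phi> (exp (- t)))"
    proof (rule AE_I2)
      fix t :: real
      show "0 \<le> indicator {0<..} t * (exp (- t) * h t * \<phi> (exp (- t)))"
      proof (cases "0 < t")
        case True
        have "exp (- t) * h t * \<phi> (exp (- t)) = (exp (- t) * h t)\<^sup>2 * (1 - exp (- t))"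
          unfolding \<phi>e[OF True] by (simp add: power2_eq_square algebra_simps)
        also have "0 \<le> \<dots>" using True by (intro mult_nonneg_nonneg) auto
        finally show ?thesis using True by simp
      qed simp
    qed
  qed
  from AE_lborel_negligible[OF this]
  have "negligible ({0<..} \<inter> h -` (- {0}))"
    by (rule negligible_subset) (auto simp: \<phi>e)
  \<comment> \<open>By continuity the set where \<open>h\<close> does not vanish is open, and an
    open null set is empty.\<close>
  moreover have "open ({0<..} \<inter> h -` (- {0}))"
    using hc by (auto simp: continuous_on_open_vimage[of "{0<..}"] Int_commute)
  ultimately have "{0<..} \<inter> h -` (- {0}) = {}" using open_not_negligible by blast
  with t show ?thesis by auto
qed

section \<open>Convolutions with the continuous kernel\<close>

definition conv :: "(real => real) => (real => real) => real => real" where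
  "conv a b t = (LINT y|lborel. indicator {0<..<t} y * (a (t - y) * b y))"

lemma borel_measurable_conv [measurable]:
  assumes [measurable]: "a \<in> borel_measurable borel" "b \<in> borel_measurable borel"
  shows "conv a b \<in> borel_measurable borel"
proof -
  have "conv a b = (\<lambda>t. LINT y|lborel. (if 0 < y \<and> y < t then a (t - y) * b y else 0))"
    by (auto simp: conv_def fun_eq_iff indicator_def intro!: Bochner_Integration.integral_cong)
  then show ?thesis by simp
qed

lemma laplace_conv:
  fixes a b :: "real => real"
  assumes [measurable]: "a \<in> borel_measurable borel" "b \<in> borel_measurable borel"
    and a: "has_bochner_integral lborel (\<lambda>x. indicator {0<..} x * (exp (- s * x) * a x)) La"
    and b: "has_bochner_integral lborel (\<lambda>x. indicator {0<..} x * (exp (- s * x) * b x)) Lb"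
  shows "has_bochner_integral lborel (\<lambda>t. indicator {0<..} t * (exp (- s * t) * conv a b t)) (La * Lb)"
proof -
  let ?a = "\<lambda>x. indicator {0<..} x * (exp (- s * x) * a x)" and ?b = "\<lambda>x. indicator {0<..} x * (exp (- s * x) * b x)"
  define F where "F = (\<lambda>y t. ?b y * ?a (t - y))"
  have sh: "has_bochner_integral lborel (\<lambda>t. ?a (t - y)) La" for y
    using lborel_has_bochner_integral_real_affine_iff[THEN iffD1, OF _ a, of 1 "- y"] by simp
  have sha: "(LINT t|lborel. \<bar>?a (t - y)\<bar>) = (LINT t|lborel. \<bar>?a t\<bar>)" for y
    using lborel_integral_real_affine[of 1 "\<lambda>t. \<bar>?a t\<bar>" "- y"] by simp
  have prod: "integrable (lborel \<Otimes>\<^sub>M lborel) (case_prod F)"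
  proof (rule lborel_pair.Fubini_integrable)
    show "case_prod F \<in> borel_measurable (lborel \<Otimes>\<^sub>M lborel)" unfolding F_def case_prod_beta' by measurable
    have "(LINT t|lborel. norm (F y t)) = \<bar>?b y\<bar> * (LINT t|lborel. \<bar>?a t\<bar>)" for y
      unfolding F_def using sha[of y] by (simp add: abs_mult)
    then show "integrable lborel (\<lambda>y. LINT t|lborel. norm (case_prod F (y, t)))"
      using b by (simp add: has_bochner_integral_iff)
    show "AE y in lborel. integrable lborel (\<lambda>t. case_prod F (y, t))"
      using sh by (intro AE_I2) (auto simp: F_def has_bochner_integral_iff intro!: integrable_mult_right)
  qed
  have c: "(LINT y|lborel. F y t) = indicator {0<..} t * (exp (- s * t) * conv a b t)" for t
  proof -
    have "F y t = indicator {0<..} t * exp (- s * t) * (indicator {0<..<t} y * (a (t - y) * b y))" for y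
      by (auto simp: F_def indicator_def exp_add[symmetric] algebra_simps)
    then show ?thesis by (simp add: conv_def mult.assoc)
  qed
  have "(LINT t|lborel. LINT y|lborel. F y t) = (LINT y|lborel. LINT t|lborel. F y t)" by (rule lborel_pair.Fubini_integral[OF prod])
  also have "\<dots> = (LINT y|lborel. ?b y * La)"
    unfolding F_def using sh by (simp add: has_bochner_integral_iff)
  also have "\<dots> = La * Lb" using b by (simp add: has_bochner_integral_iff)
  finally show ?thesis
    using lborel_pair.integrable_snd[OF prod] unfolding c by (simp add: has_bochner_integral_iff)
qed

lemma conv_ml_kernel_power:
  assumes \<alpha>: "0 < \<alpha>" "\<alpha> < 1" and la: "0 \<le> la" and p: "- 1 < p" and t: "0 < t"
  shows "integrable lborel (\<lambda>y. indicator {0<..<t} y * (ml_kernel \<alpha> la (t - y) * y powr p))"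
    and "(LINT y|lborel. \<bar>indicator {0<..<t} y * (ml_kernel \<alpha> la (t - y) * y powr p)\<bar>) \<le> ml_const \<alpha> 0 * Beta (p + 1) \<alpha> * t powr (\<alpha> + p)"
proof -
  have B: "has_bochner_integral lborel (\<lambda>y. ml_const \<alpha> 0 * (indicator {0<..<t} y * ((t - y) powr (\<alpha> - 1) * y powr p))) (ml_const \<alpha> 0 * (t powr (\<alpha> - 1 + p + 1) * Beta (p + 1) (\<alpha> - 1 + 1)))"
    using assms by (intro has_bochner_integral_mult_right has_bochner_integral_Beta) auto
  have le: "\<bar>indicator {0<..<t} y * (ml_kernel \<alpha> la (t - y) * y powr p)\<bar> \<le> ml_const \<alpha> 0 * (indicator {0<..<t} y * ((t - y) powr (\<alpha> - 1) * y powr p))" for y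
    using mult_right_mono[OF abs_ml_kernel_le[OF \<alpha> la, of "t - y"], of "y powr p"] by (auto simp: indicator_def abs_mult mult.assoc)
  have Bi: "integrable lborel (\<lambda>y. ml_const \<alpha> 0 * (indicator {0<..<t} y * ((t - y) powr (\<alpha> - 1) * y powr p)))"
    using B unfolding has_bochner_integral_iff by blast
  show i: "integrable lborel (\<lambda>y. indicator {0<..<t} y * (ml_kernel \<alpha> la (t - y) * y powr p))"
    by (rule integrable_dominated[OF Bi _ le]) measurable
  have "(LINT y|lborel. \<bar>indicator {0<..<t} y * (ml_kernel \<alpha> la (t - y) * y powr p)\<bar>) \<le> (LINT y|lborel. ml_const \<alpha> 0 * (indicator {0<..<t} y * ((t - y) powr (\<alpha> - 1) * y powr p)))"
    by (rule integral_mono[OF integrable_abs[OF i] Bi le])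
  also have "\<dots> = ml_const \<alpha> 0 * (t powr (\<alpha> - 1 + p + 1) * Beta (p + 1) (\<alpha> - 1 + 1))"
    using B by (rule has_bochner_integral_integral_eq)
  finally show "(LINT y|lborel. \<bar>indicator {0<..<t} y * (ml_kernel \<alpha> la (t - y) * y powr p)\<bar>) \<le> ml_const \<alpha> 0 * Beta (p + 1) \<alpha> * t powr (\<alpha> + p)"
    by (simp add: mult_ac)
qed

text \<open>The substitution y = t v moves the dependence on t from the domain into the integrand.
  After extraction of a power of t the integrand \<open>G\<close> has a majorant independent of t,
  so dominated convergence applies.\<close>

lemma continuous_on_conv_ml_kernel_power:
  assumes \<alpha>: "0 < \<alpha>" "\<alpha> < 1" and la: "0 \<le> la" and p: "- 1 < p"
  shows "continuous_on {0<..} (conv (ml_kernel \<alpha> la) (\<lambda>y. y powr p))"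
proof -
  define G where "G = (\<lambda>t v. t powr (1 - \<alpha>) * (indicator {0<..<1} v * (ml_kernel \<alpha> la (t * (1 - v)) * v powr p)))"
  have e: "conv (ml_kernel \<alpha> la) (\<lambda>y. y powr p) t = t powr (\<alpha> + p) * (LINT v|lborel. G t v)" if t: "0 < t" for t
  proof -
    have "conv (ml_kernel \<alpha> la) (\<lambda>y. y powr p) t = t * (LINT v|lborel. indicator {0<..<t} (0 + t * v) * (ml_kernel \<alpha> la (t - (0 + t * v)) * (0 + t * v) powr p))"
      unfolding conv_def using t by (subst lborel_integral_real_affine[of t _ 0]) auto
    also have "(\<lambda>v. indicator {0<..<t} (0 + t * v) * (ml_kernel \<alpha> la (t - (0 + t * v)) * (0 + t * v) powr p)) = (\<lambda>v. t powr (p + \<alpha> - 1) * G t v)"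
      using t by (auto simp: fun_eq_iff G_def indicator_def zero_less_mult_iff powr_mult algebra_simps powr_add[symmetric])
    also have "t * (LINT v|lborel. t powr (p + \<alpha> - 1) * G t v) = t powr (\<alpha> + p) * (LINT v|lborel. G t v)"
      using t by (simp add: powr_diff add.commute)
    finally show ?thesis .
  qed
  have Gc: "continuous_on {0<..} (\<lambda>t. LINT v|lborel. G t v)"
  proof (rule continuous_at_imp_continuous_on, rule ballI, unfold isCont_def tendsto_at_iff_sequentially, intro allI impI)
    fix t :: real and X :: "nat => real"
    assume t: "t \<in> {0<..}" and X: "\<forall>i. X i \<in> UNIV - {t}" "X \<longlonglongrightarrow> t"
    \<comment> \<open>Clipping at t / 2 makes every member of the sequence positive; eventually
      nothing is changed.\<close>
    define Y where "Y = (\<lambda>i. max (t / 2) (X i))"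
    have Y: "0 < Y i" for i using t by (simp add: Y_def less_max_iff_disj)
    have ev: "\<forall>\<^sub>F i in sequentially. Y i = X i"
    proof -
      have "\<forall>\<^sub>F i in sequentially. t / 2 < X i" using order_tendstoD(1)[OF X(2), of "t / 2"] t by simp
      then show ?thesis by eventually_elim (simp add: Y_def)
    qed
    have Yl: "Y \<longlonglongrightarrow> t" using X(2) ev by (simp add: tendsto_cong)
    have "(\<lambda>i. LINT v|lborel. G (Y i) v) \<longlonglongrightarrow> (LINT v|lborel. G t v)"
    proof (rule integral_dominated_convergence)
      show "integrable lborel (\<lambda>v. ml_const \<alpha> 0 * (indicator {0<..<1} v * ((1 - v) powr (\<alpha> - 1) * v powr p)))"
        using has_bochner_integral_Beta[of "\<alpha> - 1" p 1] \<alpha> p by (simp add: has_bochner_integral_iff)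
      show "AE v in lborel. (\<lambda>i. G (Y i) v) \<longlonglongrightarrow> G t v"
      proof (rule AE_I2)
        fix v :: real
        show "(\<lambda>i. G (Y i) v) \<longlonglongrightarrow> G t v"
        proof (cases "0 < v \<and> v < 1")
          case True
          have tv: "t * (1 - v) \<in> {0<..}" using True t by simp
          have "isCont (ml_kernel \<alpha> la) (t * (1 - v))"
            using continuous_on_ml_kernel[OF \<alpha> la] continuous_on_eq_continuous_at[of "{0<..}" "ml_kernel \<alpha> la"] tv by auto
          moreover have "(\<lambda>i. Y i * (1 - v)) \<longlonglongrightarrow> t * (1 - v)" by (intro tendsto_intros Yl)
          ultimately have "(\<lambda>i. ml_kernel \<alpha> la (Y i * (1 - v))) \<longlonglongrightarrow> ml_kernel \<alpha> la (t * (1 - v))"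
            by (rule isCont_tendsto_compose)
          then show ?thesis unfolding G_def using t by (intro tendsto_intros Yl) auto
        qed (auto simp: G_def)
      qed
      show "AE v in lborel. norm (G (Y i) v) \<le> ml_const \<alpha> 0 * (indicator {0<..<1} v * ((1 - v) powr (\<alpha> - 1) * v powr p))" for i
      proof (rule AE_I2)
        fix v :: real
        show "norm (G (Y i) v) \<le> ml_const \<alpha> 0 * (indicator {0<..<1} v * ((1 - v) powr (\<alpha> - 1) * v powr p))"
        proof (cases "0 < v \<and> v < 1")
          case True
          have "\<bar>ml_kernel \<alpha> la (Y i * (1 - v))\<bar> \<le> ml_const \<alpha> 0 * (Y i * (1 - v)) powr (\<alpha> - 1)"
            using True Y[of i] by (intro abs_ml_kernel_le \<alpha> la) simp
          also have "\<dots> = ml_const \<alpha> 0 * (1 - v) powr (\<alpha> - 1) * Y i powr (\<alpha> - 1)" using True Y[of i] by (simp add: powr_mult)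
          finally have "Y i powr (1 - \<alpha>) * \<bar>ml_kernel \<alpha> la (Y i * (1 - v))\<bar> \<le> Y i powr (1 - \<alpha>) * (ml_const \<alpha> 0 * (1 - v) powr (\<alpha> - 1) * Y i powr (\<alpha> - 1))"
            by (rule mult_left_mono) simp
          also have "\<dots> = ml_const \<alpha> 0 * (1 - v) powr (\<alpha> - 1) * (Y i powr (1 - \<alpha>) * Y i powr (\<alpha> - 1))" by (simp only: mult_ac)
          also have "Y i powr (1 - \<alpha>) * Y i powr (\<alpha> - 1) = 1" using Y[of i] by (simp add: powr_add[symmetric])
          finally have "Y i powr (1 - \<alpha>) * \<bar>ml_kernel \<alpha> la (Y i * (1 - v))\<bar> \<le> ml_const \<alpha> 0 * (1 - v) powr (\<alpha> - 1)" by simp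
          from mult_right_mono[OF this, of "v powr p"] True show ?thesis by (simp add: G_def abs_mult mult.assoc)
        qed (auto simp: G_def)
      qed
    qed (auto simp: G_def)
    moreover have "\<forall>\<^sub>F i in sequentially. (LINT v|lborel. G (Y i) v) = ((\<lambda>t. LINT v|lborel. G t v) \<circ> X) i"
      using ev by eventually_elim simp
    ultimately show "((\<lambda>t. LINT v|lborel. G t v) \<circ> X) \<longlonglongrightarrow> (LINT v|lborel. G t v)"
      by (rule Lim_transform_eventually)
  qed
  have "continuous_on {0<..} (\<lambda>t. t powr (\<alpha> + p) * (LINT v|lborel. G t v))"
    by (intro continuous_intros Gc) auto
  then show ?thesis by (rule continuous_on_eq) (use e in simp)
qed

text \<open>On the Laplace side this is (s^(\<alpha>-1) + \<open>la\<close> / s) / (s^\<alpha> +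
  \<open>la\<close>) = 1 / s. The difference of the two sides is continuous with at most linear
  growth, so uniqueness of the Laplace transform applies. The constant 1 is written as
  \<open>y powr 0\<close> so that one lemma on powers serves both convolutions.\<close>

lemma volterra_identity:
  assumes \<alpha>: "0 < \<alpha>" "\<alpha> < 1" and la: "0 < la" and t: "0 < t"
  shows "conv (ml_kernel \<alpha> la) (\<lambda>y. y powr (- \<alpha>)) t / Gamma (1 - \<alpha>) + la * conv (ml_kernel \<alpha> la) (\<lambda>y. y powr 0) t = 1"
proof -
  let ?E = "ml_kernel \<alpha> la"
  let ?R = "conv ?E (\<lambda>y. y powr (- \<alpha>))" and ?S = "conv ?E (\<lambda>y. y powr 0)"
  define h where "h = (\<lambda>t. ?R t / Gamma (1 - \<alpha>) + la * ?S t - 1)"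
  have G: "0 < Gamma (1 - \<alpha>)" using \<alpha> by (simp add: Gamma_real_pos)
  have G0: "Gamma (1 - \<alpha>) \<noteq> 0" using G by linarith
  have la': "0 \<le> la" using la by simp
  define A where "A = ml_const \<alpha> 0 * Beta (- \<alpha> + 1) \<alpha> / Gamma (1 - \<alpha>) + la * (ml_const \<alpha> 0 * Beta (0 + 1) \<alpha>) + 1"
  define B where "B = la * (ml_const \<alpha> 0 * Beta (0 + 1) \<alpha>)"
  have mc: "0 < ml_const \<alpha> 0" using ml_const_pos \<alpha> by simp
  have bp: "0 < Beta (- \<alpha> + 1) \<alpha>" "0 < Beta (0 + 1) \<alpha>" using \<alpha> by (auto simp: Beta_def Gamma_real_pos)
  have "h t = 0"
  proof (rule laplace_unique_zero[where h = h and A = A and B = B and t = t])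
    show "h \<in> borel_measurable borel" unfolding h_def by measurable
    show "continuous_on {0<..} h" unfolding h_def
      by (intro continuous_intros continuous_on_conv_ml_kernel_power \<alpha> la') (use \<alpha> G0 in auto)
    show "0 \<le> A" "0 \<le> B" using mc bp la G by (auto simp: A_def B_def)
    fix t :: real assume t: "0 < t"
    have b: "\<bar>conv ?E (\<lambda>y. y powr p) t\<bar> \<le> ml_const \<alpha> 0 * Beta (p + 1) \<alpha> * t powr (\<alpha> + p)" if "- 1 < p" for p
      unfolding conv_def
      by (rule order_trans[OF integral_abs_bound conv_ml_kernel_power(2)[OF \<alpha> la' that t]])
    have 1: "\<bar>?R t / Gamma (1 - \<alpha>)\<bar> \<le> ml_const \<alpha> 0 * Beta (- \<alpha> + 1) \<alpha> / Gamma (1 - \<alpha>)"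
      using divide_right_mono[OF b[of "- \<alpha>"], of "Gamma (1 - \<alpha>)"] \<alpha> G t by simp
    have "t powr \<alpha> \<le> 1 + t"
    proof (cases "t \<le> 1")
      case True
      then have "t powr \<alpha> \<le> 1 powr \<alpha>" using t \<alpha> by (intro powr_mono2) auto
      then show ?thesis using t by simp
    next
      case False
      then have "t powr \<alpha> \<le> t powr 1" using \<alpha> by (intro powr_mono) auto
      then show ?thesis using t by simp
    qed
    then have "ml_const \<alpha> 0 * Beta (0 + 1) \<alpha> * t powr \<alpha> \<le> ml_const \<alpha> 0 * Beta (0 + 1) \<alpha> * (1 + t)"
      using mc bp by (intro mult_left_mono) auto
    then have "\<bar>?S t\<bar> \<le> ml_const \<alpha> 0 * Beta (0 + 1) \<alpha> * (1 + t)" using b[of 0] by simp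
    from mult_left_mono[OF this la'] have 2: "\<bar>la * ?S t\<bar> \<le> la * (ml_const \<alpha> 0 * Beta (0 + 1) \<alpha> * (1 + t))" using la by (simp add: abs_mult)
    have "\<bar>h t\<bar> \<le> \<bar>?R t / Gamma (1 - \<alpha>)\<bar> + \<bar>la * ?S t\<bar> + 1" unfolding h_def by linarith
    also have "\<dots> \<le> A + B * t" using 1 2 unfolding A_def B_def by (simp add: algebra_simps)
    finally show "\<bar>h t\<bar> \<le> A + B * t" .
  next
    fix n :: nat assume "1 \<le> n"
    define s where "s = real n"
    have s: "0 < s" using \<open>1 \<le> n\<close> by (simp add: s_def)
    have P: "has_bochner_integral lborel (\<lambda>x. indicator {0<..} x * (exp (- s * x) * x powr p)) (Gamma (p + 1) * s powr (- p - 1))" if "- 1 < p" for p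
      using has_bochner_integral_Gamma[OF that s] by (simp add: mult.commute)
    have C: "has_bochner_integral lborel (\<lambda>t. indicator {0<..} t * (exp (- s * t) * conv ?E (\<lambda>y. y powr p) t)) (1 / (s powr \<alpha> + la) * (Gamma (p + 1) * s powr (- p - 1)))" if "- 1 < p" for p
      by (rule laplace_conv[OF _ _ laplace_ml_kernel[OF \<alpha> la s] P[OF that]]) auto
    let ?L = "\<lambda>f t. indicator {0<..} t * (exp (- s * t) * f t)"
    have "has_bochner_integral lborel (\<lambda>t. ?L ?R t / Gamma (1 - \<alpha>) + la * ?L ?S t - ?L (\<lambda>x. x powr 0) t)
       (1 / (s powr \<alpha> + la) * (Gamma (- \<alpha> + 1) * s powr (- (- \<alpha>) - 1)) / Gamma (1 - \<alpha>) + la * (1 / (s powr \<alpha> + la) * (Gamma (0 + 1) * s powr (- 0 - 1))) - Gamma (0 + 1) * s powr (- 0 - 1))"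
      using \<alpha> by (intro has_bochner_integral_diff has_bochner_integral_add has_bochner_integral_divide has_bochner_integral_mult_right C P) auto
    then have "(LINT t|lborel. ?L ?R t / Gamma (1 - \<alpha>) + la * ?L ?S t - ?L (\<lambda>x. x powr 0) t)
      = 1 / (s powr \<alpha> + la) * (Gamma (- \<alpha> + 1) * s powr (- (- \<alpha>) - 1)) / Gamma (1 - \<alpha>) + la * (1 / (s powr \<alpha> + la) * (Gamma (0 + 1) * s powr (- 0 - 1))) - Gamma (0 + 1) * s powr (- 0 - 1)"
      by (rule has_bochner_integral_integral_eq)
    also have "\<dots> = 0"
    proof -
      have d: "s powr \<alpha> + la \<noteq> 0" using la by (metis add_nonneg_pos less_irrefl powr_ge_zero)
      have "s powr (\<alpha> - 1) = s powr \<alpha> / s" "s powr (- 1) = 1 / s" using s by (auto simp: powr_diff powr_minus_divide)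
      moreover have "1 / D * (g * (P / s)) / g + e * (1 / D * (1 * (1 / s))) - 1 * (1 / s) = 0"
        if "P + e = D" "D \<noteq> 0" "g \<noteq> 0" "s \<noteq> 0" for D g P e s :: real
      proof -
        have "1 / D * (g * (P / s)) / g = P / (D * s)" "e * (1 / D * (1 * (1 / s))) = e / (D * s)" "1 * (1 / s) = D / (D * s)"
          using that by simp_all
        then show ?thesis using that(1) by (simp only: add_divide_distrib[symmetric] diff_divide_distrib[symmetric]) simp
      qed
      from this[OF refl d G0, of s] have "1 / (s powr \<alpha> + la) * (Gamma (1 - \<alpha>) * (s powr \<alpha> / s)) / Gamma (1 - \<alpha>) + la * (1 / (s powr \<alpha> + la) * (1 * (1 / s))) - 1 * (1 / s) = 0"
        using s by simp
      ultimately show ?thesis by (simp add: Gamma_1)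
    qed
    also have "(\<lambda>t. ?L ?R t / Gamma (1 - \<alpha>) + la * ?L ?S t - ?L (\<lambda>x. x powr 0) t) = (\<lambda>t. indicator {0<..} t * (exp (- real n * t) * h t))"
      by (auto simp: fun_eq_iff h_def s_def indicator_def algebra_simps diff_divide_distrib)
    finally show "(LINT t|lborel. indicator {0<..} t * (exp (- real n * t) * h t)) = 0" .
  qed (rule t)
  then show ?thesis by (simp add: h_def)
qed

lemma absolutely_integrable_mult_continuous:
  fixes f g :: "real => real"
  assumes "continuous_on {a..b} f" "g absolutely_integrable_on {a..b}"
  shows "(\<lambda>x. f x * g x) absolutely_integrable_on {a..b}"
proof (rule absolutely_integrable_bounded_measurable_product_real[OF _ _ _ assms(2)])
  show "f \<in> borel_measurable (lebesgue_on {a..b})"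
    by (rule continuous_imp_measurable_on_sets_lebesgue[OF assms(1)]) simp
  show "bounded (f ` {a..b})"
    by (rule compact_imp_bounded[OF compact_continuous_image[OF assms(1)]]) simp
qed simp

text \<open>The equation is convolved with \<open>ml_kernel\<close> and the order of integration
  exchanged. By \<open>volterra_identity\<close> the total kernel in front of u' equals 1, and the
  integral of u' is u(t) because u(0) = 0.\<close>

lemma caputo_scalar:
  fixes u F :: "real => real"
  assumes \<alpha>: "0 < \<alpha>" "\<alpha> < 1" and la: "0 < la"
    and uc: "continuous_on {0..T} u" and u0: "u 0 = 0"
    and ud: "\<And>t. 0 < t ==> t < T ==> u differentiable (at t)"
    and ai: "\<And>t. 0 < t ==> t \<le> T ==> (\<lambda>\<zeta>. (t - \<zeta>) powr (- \<alpha>) * deriv u \<zeta>) absolutely_integrable_on {0..t}"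
    and eq: "\<And>t. 0 < t ==> t \<le> T ==> caputo \<alpha> u t + la * u t = F t"
    and t: "0 < t" "t \<le> T"
  shows "u t = integral {0..t} (\<lambda>s. ml_kernel \<alpha> la (t - s) * F s)"
proof -
  let ?E = "ml_kernel \<alpha> la"
  define w where "w = deriv u"
  define G where "G = Gamma (1 - \<alpha>)"
  have G: "0 < G" using \<alpha> by (simp add: G_def Gamma_real_pos)
  \<comment> \<open>The assumption concerns u' with the weight (t - z)^(- \<alpha>); multiplication
    by the continuous function (t - z)^\<alpha> removes the weight.\<close>
  have wi: "w absolutely_integrable_on {0..t}"
  proof -
    have "(\<lambda>\<zeta>. (t - \<zeta>) powr \<alpha> * ((t - \<zeta>) powr (- \<alpha>) * w \<zeta>)) absolutely_integrable_on {0..t}"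
    proof (rule absolutely_integrable_mult_continuous)
      show "continuous_on {0..t} (\<lambda>\<zeta>. (t - \<zeta>) powr \<alpha>)"
        by (rule continuous_on_powr') (use \<alpha> in \<open>auto intro!: continuous_intros\<close>)
      show "(\<lambda>\<zeta>. (t - \<zeta>) powr (- \<alpha>) * w \<zeta>) absolutely_integrable_on {0..t}"
        unfolding w_def by (rule ai[OF t])
    qed
    then show ?thesis
      by (rule absolutely_integrable_spike[of _ _ "{t}"]) (auto simp: powr_minus)
  qed
  have W: "(w has_integral u s) {0..s}" if "0 \<le> s" "s \<le> T" for s
  proof -
    have "(w has_integral u s - u 0) {0..s}"
    proof (rule fundamental_theorem_of_calculus_interior[OF that(1)])
      show "continuous_on {0..s} u" by (rule continuous_on_subset[OF uc]) (use that in auto)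
      fix x assume x: "x \<in> {0<..<s}"
      then have "(u has_real_derivative w x) (at x)"
        using ud[of x] that unfolding w_def by (metis DERIV_deriv_iff_real_differentiable greaterThanLessThan_iff less_le_trans)
      then show "(u has_vector_derivative w x) (at x)" by (simp add: has_real_derivative_iff_has_vector_derivative)
    qed
    then show ?thesis by (simp add: u0)
  qed
  let ?c = "\<lambda>s \<zeta>. ?E (t - s) * ((s - \<zeta>) powr (- \<alpha>) / G + la)"
  have cm: "(\<lambda>(s, \<zeta>). ?c s \<zeta>) \<in> borel_measurable (borel \<Otimes>\<^sub>M borel)"
    unfolding case_prod_beta' by measurable
  \<comment> \<open>After the shift y = s - \<open>\<zeta>\<close> the inner integral depends on t -
    \<open>\<zeta>\<close> only and is the left-hand side of the Volterra identity.\<close>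
  define g where "g = (\<lambda>y. y powr (- \<alpha>) / G + la * y powr 0)"
  have g: "indicator {\<zeta><..<t} s * ?c s \<zeta> = indicator {0<..<t - \<zeta>} (s - \<zeta>) * (?E ((t - \<zeta>) - (s - \<zeta>)) * g (s - \<zeta>))" for s \<zeta>
    by (auto simp: indicator_def g_def)
  have gi: "integrable lborel (\<lambda>y. indicator {0<..<r} y * (?E (r - y) * g y))"
    and gv: "(LINT y|lborel. indicator {0<..<r} y * (?E (r - y) * g y)) = 1"
    and ga: "(LINT y|lborel. \<bar>indicator {0<..<r} y * (?E (r - y) * g y)\<bar>) \<le> ml_const \<alpha> 0 * Beta (- \<alpha> + 1) \<alpha> / G + la * (ml_const \<alpha> 0 * Beta (0 + 1) \<alpha> * t powr \<alpha>)"
    if r: "0 < r" "r \<le> t" for r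
  proof -
    let ?k = "\<lambda>p y. indicator {0<..<r} y * (?E (r - y) * y powr p)"
    have e: "(\<lambda>y. indicator {0<..<r} y * (?E (r - y) * g y)) = (\<lambda>y. ?k (- \<alpha>) y / G + la * ?k 0 y)"
      by (simp add: g_def fun_eq_iff algebra_simps)
    have a: "- 1 < - \<alpha>" "- 1 < (0::real)" using \<alpha> by auto
    note K = conv_ml_kernel_power[OF \<alpha> less_imp_le[OF la] _ r(1)]
    show "integrable lborel (\<lambda>y. indicator {0<..<r} y * (?E (r - y) * g y))"
      unfolding e using K(1)[OF a(1)] K(1)[OF a(2)] by (intro Bochner_Integration.integrable_add integrable_divide integrable_mult_right)
    have "(LINT y|lborel. ?k (- \<alpha>) y / G + la * ?k 0 y) = (LINT y|lborel. ?k (- \<alpha>) y) / G + la * (LINT y|lborel. ?k 0 y)"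
      using K(1)[OF a(1)] K(1)[OF a(2)] by (subst Bochner_Integration.integral_add) (auto intro: integrable_divide integrable_mult_right)
    also have "\<dots> = 1" using volterra_identity[OF \<alpha> la r(1)] by (simp add: conv_def G_def)
    finally show "(LINT y|lborel. indicator {0<..<r} y * (?E (r - y) * g y)) = 1" unfolding e .
    have "(LINT y|lborel. \<bar>?k (- \<alpha>) y / G + la * ?k 0 y\<bar>) \<le> (LINT y|lborel. \<bar>?k (- \<alpha>) y\<bar> / G + la * \<bar>?k 0 y\<bar>)"
    proof (rule integral_mono)
      show "integrable lborel (\<lambda>y. \<bar>?k (- \<alpha>) y / G + la * ?k 0 y\<bar>)"
        by (intro Bochner_Integration.integrable_add integrable_divide integrable_mult_right integrable_abs K(1)[OF a(1)] K(1)[OF a(2)])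
      show "integrable lborel (\<lambda>y. \<bar>?k (- \<alpha>) y\<bar> / G + la * \<bar>?k 0 y\<bar>)"
        by (intro Bochner_Integration.integrable_add integrable_divide integrable_mult_right integrable_abs K(1)[OF a(1)] K(1)[OF a(2)])
      show "\<bar>?k (- \<alpha>) y / G + la * ?k 0 y\<bar> \<le> \<bar>?k (- \<alpha>) y\<bar> / G + la * \<bar>?k 0 y\<bar>" for y
        using abs_triangle_ineq[of "?k (- \<alpha>) y / G" "la * ?k 0 y"] G la by (simp only: abs_mult abs_divide abs_of_pos)
    qed
    also have "\<dots> = (LINT y|lborel. \<bar>?k (- \<alpha>) y\<bar>) / G + la * (LINT y|lborel. \<bar>?k 0 y\<bar>)"
      using K(1)[OF a(1)] K(1)[OF a(2)] by (subst Bochner_Integration.integral_add) (auto intro: integrable_divide integrable_mult_right integrable_abs)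
    also have "\<dots> \<le> ml_const \<alpha> 0 * Beta (- \<alpha> + 1) \<alpha> / G + la * (ml_const \<alpha> 0 * Beta (0 + 1) \<alpha> * t powr \<alpha>)"
    proof (intro add_mono divide_right_mono mult_left_mono)
      show "(LINT y|lborel. \<bar>?k (- \<alpha>) y\<bar>) \<le> ml_const \<alpha> 0 * Beta (- \<alpha> + 1) \<alpha>"
        using K(2)[OF a(1)] r by simp
      have "ml_const \<alpha> 0 * Beta (0 + 1) \<alpha> * r powr \<alpha> \<le> ml_const \<alpha> 0 * Beta (0 + 1) \<alpha> * t powr \<alpha>"
        using r \<alpha> ml_const_pos[OF \<alpha>, of 0]
        by (intro mult_left_mono powr_mono2) (auto simp: Beta_def Gamma_real_pos less_imp_le)
      then show "(LINT y|lborel. \<bar>?k 0 y\<bar>) \<le> ml_const \<alpha> 0 * Beta (0 + 1) \<alpha> * t powr \<alpha>"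
        using K(2)[OF a(2)] by simp
    qed (use G la in auto)
    finally show "(LINT y|lborel. \<bar>indicator {0<..<r} y * (?E (r - y) * g y)\<bar>) \<le> ml_const \<alpha> 0 * Beta (- \<alpha> + 1) \<alpha> / G + la * (ml_const \<alpha> 0 * Beta (0 + 1) \<alpha> * t powr \<alpha>)"
      unfolding fun_cong[OF e] .
  qed
  have int: "integrable lborel (\<lambda>s. indicator {\<zeta><..<t} s * ?c s \<zeta>)" and val: "(LINT s|lborel. indicator {\<zeta><..<t} s * ?c s \<zeta>) = 1"
    and le: "(LINT s|lborel. \<bar>indicator {\<zeta><..<t} s * ?c s \<zeta>\<bar>) \<le> ml_const \<alpha> 0 * Beta (- \<alpha> + 1) \<alpha> / G + la * (ml_const \<alpha> 0 * Beta (0 + 1) \<alpha> * t powr \<alpha>)"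
    if z: "0 < \<zeta>" "\<zeta> < t" for \<zeta>
  proof -
    let ?h = "\<lambda>y. indicator {0<..<t - \<zeta>} y * (?E ((t - \<zeta>) - y) * g y)"
    have r: "0 < t - \<zeta>" "t - \<zeta> \<le> t" using z by auto
    have e: "(\<lambda>s. indicator {\<zeta><..<t} s * ?c s \<zeta>) = (\<lambda>s. ?h (- \<zeta> + 1 * s))" using g by (auto simp: fun_eq_iff)
    show "integrable lborel (\<lambda>s. indicator {\<zeta><..<t} s * ?c s \<zeta>)" unfolding e
      by (rule lborel_integrable_real_affine[OF gi[OF r]]) simp
    show "(LINT s|lborel. indicator {\<zeta><..<t} s * ?c s \<zeta>) = 1" unfolding e
      using gv[OF r] lborel_integral_real_affine[of 1 ?h "- \<zeta>"] by simp
    have "(LINT s|lborel. \<bar>indicator {\<zeta><..<t} s * ?c s \<zeta>\<bar>) = (LINT s|lborel. \<bar>?h (- \<zeta> + 1 * s)\<bar>)"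
      by (simp only: fun_cong[OF e])
    also have "\<dots> = (LINT s|lborel. \<bar>?h s\<bar>)"
      using lborel_integral_real_affine[of 1 "\<lambda>y. \<bar>?h y\<bar>" "- \<zeta>"] by simp
    finally have "(LINT s|lborel. \<bar>indicator {\<zeta><..<t} s * ?c s \<zeta>\<bar>) = (LINT s|lborel. \<bar>?h s\<bar>)" .
    then show "(LINT s|lborel. \<bar>indicator {\<zeta><..<t} s * ?c s \<zeta>\<bar>) \<le> ml_const \<alpha> 0 * Beta (- \<alpha> + 1) \<alpha> / G + la * (ml_const \<alpha> 0 * Beta (0 + 1) \<alpha> * t powr \<alpha>)"
      using ga[OF r] by simp
  qed
  have "integral {0..t} (\<lambda>s. ?E (t - s) * F s) = integral {0..t} (\<lambda>s. integral {0..s} (\<lambda>\<zeta>. ?c s \<zeta> * w \<zeta>))"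
  proof (rule integral_spike[of "{0, t}"])
    fix s assume s: "s \<in> {0..t} - {0, t}"
    then have s': "0 < s" "s \<le> T" "0 \<le> s" using t by auto
    have i1: "(\<lambda>\<zeta>. (s - \<zeta>) powr (- \<alpha>) * w \<zeta>) integrable_on {0..s}"
      using ai[OF s'(1,2)] unfolding w_def by (rule set_lebesgue_integral_eq_integral(1))
    have "((\<lambda>\<zeta>. ?E (t - s) * (1 / G * ((s - \<zeta>) powr (- \<alpha>) * w \<zeta>) + la * w \<zeta>)) has_integral ?E (t - s) * (1 / G * integral {0..s} (\<lambda>\<zeta>. (s - \<zeta>) powr (- \<alpha>) * w \<zeta>) + la * u s)) {0..s}"
      by (intro has_integral_mult_right has_integral_add integrable_integral i1 W s')
    also have "1 / G * integral {0..s} (\<lambda>\<zeta>. (s - \<zeta>) powr (- \<alpha>) * w \<zeta>) + la * u s = F s"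
      using eq[OF s'(1,2)] by (simp add: caputo_def G_def w_def)
    also have "(\<lambda>\<zeta>. ?E (t - s) * (1 / G * ((s - \<zeta>) powr (- \<alpha>) * w \<zeta>) + la * w \<zeta>)) = (\<lambda>\<zeta>. ?c s \<zeta> * w \<zeta>)"
      by (simp add: fun_eq_iff algebra_simps)
    finally show "integral {0..s} (\<lambda>\<zeta>. ?c s \<zeta> * w \<zeta>) = ?E (t - s) * F s" by (rule integral_unique)
  qed simp
  also have "\<dots> = integral {0..t} (\<lambda>\<zeta>. integral {\<zeta>..t} (\<lambda>s. ?c s \<zeta>) * w \<zeta>)"
    by (rule triangle_Fubini(1)[OF wi cm int le])
  also have "\<dots> = integral {0..t} w"
  proof (rule integral_spike[of "{0, t}"])
    fix \<zeta> assume z: "\<zeta> \<in> {0..t} - {0, t}"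
    then have "0 < \<zeta>" "\<zeta> < t" by auto
    from integral_Icc_eq_lborel(2)[OF int[OF this]] val[OF this] show "w \<zeta> = integral {\<zeta>..t} (\<lambda>s. ?c s \<zeta>) * w \<zeta>" by simp
  qed simp
  also have "\<dots> = u t" using W[of t] t by (simp add: integral_unique)
  finally show ?thesis by simp
qed

section \<open>The scheme as a discrete convolution\<close>

lemma fps_nth_inverse_mult:
  fixes D U R :: "real fps"
  assumes "\<And>n. n \<le> N ==> fps_nth (D * U) n = fps_nth R n" "fps_nth D 0 \<noteq> 0" "n \<le> N"
  shows "fps_nth U n = fps_nth (inverse D * R) n"
proof -
  have "inverse D * D = 1" by (rule inverse_mult_eq_1[OF assms(2)])
  then have "U = inverse D * (D * U)" by (simp add: mult.assoc[symmetric])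
  then have "fps_nth U n = fps_nth (inverse D * (D * U)) n" by (rule arg_cong)
  \<comment> \<open>The coefficient of order n involves only coefficients up to n <= N, so series
    inversion is legitimate although the equations stop at N.\<close>
  also have "\<dots> = fps_nth (inverse D * R) n"
    unfolding fps_mult_nth[of "inverse D"] by (intro sum.cong refl) (use assms(1,3) in simp)
  finally show ?thesis .
qed

text \<open>In generating functions the equations read \<open>\<tau> powr (- \<alpha>) * D * Uf = b
  * bdf2_fps * Ff / \<tau>\<close> up to order N. Solving for \<open>Uf\<close> and applying
  \<open>bdf2_fps / \<tau>\<close> yields the response series, and the powers of the step size
  combine to \<open>\<tau> powr (\<alpha> - 2)\<close>.\<close>

lemma cn2_scheme_scalar:
  fixes U :: "int => real" and \<phi> :: "real => real"
  assumes \<alpha>: "0 < \<alpha>" "\<alpha> < 1" and la: "0 \<le> la" and \<tau>: "0 < \<tau>"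
    and U0: "\<And>m. m \<le> 0 ==> U m = 0" and \<phi>0: "\<And>t. t \<le> 0 ==> \<phi> t = 0"
    and eq: "\<And>n. 1 \<le> n ==> n \<le> N ==> \<tau> powr (- \<alpha>) * (\<Sum>j\<le>n. cq_weight \<alpha> j * U (int n - int j))
            + la * ((1 - \<alpha>/2) * U (int n) + \<alpha>/2 * U (int n - 1))
          = (1 - \<alpha>/2) * bdf2 \<tau> \<phi> (real n * \<tau>) + \<alpha>/2 * bdf2 \<tau> \<phi> ((real n - 1) * \<tau>)"
    and n: "1 \<le> n" "n \<le> N"
  shows "1 / \<tau> * (3/2 * U (int n) - 2 * U (int n - 1) + 1/2 * U (int n - 2))
     = (\<Sum>i\<le>n. \<tau> powr (\<alpha> - 2) * cq_response \<alpha> (la * \<tau> powr \<alpha>) i * \<phi> (real (n - i) * \<tau>))"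
proof -
  define Uf where "Uf = Abs_fps (\<lambda>n. U (int n))"
  define Ff where "Ff = Abs_fps (\<lambda>n. \<phi> (real n * \<tau>))"
  define b where "b = cq_avg_fps \<alpha>"
  define D where "D = cq_den_fps \<alpha> (la * \<tau> powr \<alpha>)"
  have avg: "fps_nth (b * H) n = (1 - \<alpha>/2) * fps_nth H n + \<alpha>/2 * (if n = 0 then 0 else fps_nth H (n - 1))" for H :: "real fps" and n
    by (cases n) (simp_all add: b_def cq_avg_fps_def algebra_simps)
  have bdf: "fps_nth (bdf2_fps * H) n = 3/2 * fps_nth H n - 2 * (if n = 0 then 0 else fps_nth H (n - 1)) + 1/2 * (if n < 2 then 0 else fps_nth H (n - 2))" for H :: "real fps" and n
  proof -
    have "bdf2_fps * H = fps_const (3/2) * H - fps_const 2 * (fps_X * H) + fps_const (1/2) * (fps_X ^ 2 * H)"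
      by (simp add: bdf2_fps_def algebra_simps)
    then show ?thesis by (simp add: fps_X_power_mult_nth del: fps_const_mult_left)
  qed
  have U1: "fps_nth (bdf2_fps * Uf) n = 3/2 * U (int n) - 2 * U (int n - 1) + 1/2 * U (int n - 2)" for n
    unfolding bdf using U0 by (auto simp: Uf_def of_nat_diff)
  have F1: "1 / \<tau> * fps_nth (bdf2_fps * Ff) n = bdf2 \<tau> \<phi> (real n * \<tau>)" for n
  proof -
    have "\<phi> (real n * \<tau> - \<tau>) = (if n = 0 then 0 else \<phi> (real (n - 1) * \<tau>))"
      using \<phi>0[of "real n * \<tau> - \<tau>"] \<tau> by (auto simp: of_nat_diff algebra_simps)
    moreover have "\<phi> (real n * \<tau> - 2 * \<tau>) = (if n < 2 then 0 else \<phi> (real (n - 2) * \<tau>))"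
      using \<phi>0[of "real n * \<tau> - 2 * \<tau>"] \<tau> by (auto simp: of_nat_diff algebra_simps less_2_cases_iff)
    ultimately show ?thesis unfolding bdf bdf2_def by (simp add: Ff_def)
  qed
  have main: "fps_nth (fps_const (\<tau> powr (- \<alpha>)) * D * Uf) m = fps_nth (fps_const (1 / \<tau>) * (b * (bdf2_fps * Ff))) m" if "m \<le> N" for m
  proof (cases "m = 0")
    \<comment> \<open>The equations start at n = 1; at index 0 both sides vanish because
      \<open>U\<close> and \<open>\<phi>\<close> do.\<close>
    case True
    have "fps_nth Uf 0 = 0" "fps_nth Ff 0 = 0" using U0 \<phi>0 by (auto simp: Uf_def Ff_def)
    then show ?thesis using True by simp
  next
    case False
    have "fps_const (\<tau> powr (- \<alpha>)) * D * Uf = fps_const (\<tau> powr (- \<alpha>)) * (Abs_fps (cq_weight \<alpha>) * Uf) + fps_const la * (b * Uf)"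
    proof -
      have "\<tau> powr (- \<alpha>) * (la * \<tau> powr \<alpha>) = la" using \<tau> by (simp add: powr_minus field_simps)
      then have c: "fps_const (\<tau> powr (- \<alpha>)) * fps_const (la * \<tau> powr \<alpha>) = fps_const la" by (simp only: fps_const_mult)
      have "fps_const (\<tau> powr (- \<alpha>)) * D = fps_const (\<tau> powr (- \<alpha>)) * Abs_fps (cq_weight \<alpha>) + (fps_const (\<tau> powr (- \<alpha>)) * fps_const (la * \<tau> powr \<alpha>)) * b"
        by (simp only: D_def cq_den_fps_def b_def distrib_left mult.assoc)
      then show ?thesis unfolding c by (simp only: distrib_right mult.assoc)
    qed
    then have "fps_nth (fps_const (\<tau> powr (- \<alpha>)) * D * Uf) m = \<tau> powr (- \<alpha>) * fps_nth (Abs_fps (cq_weight \<alpha>) * Uf) m + la * fps_nth (b * Uf) m"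
      by simp
    also have "fps_nth (Abs_fps (cq_weight \<alpha>) * Uf) m = (\<Sum>j\<le>m. cq_weight \<alpha> j * U (int m - int j))"
      unfolding fps_mult_nth atMost_atLeast0 by (intro sum.cong) (auto simp: Uf_def of_nat_diff)
    also have "fps_nth (b * Uf) m = (1 - \<alpha>/2) * U (int m) + \<alpha>/2 * U (int m - 1)"
      unfolding avg using False by (simp add: Uf_def of_nat_diff)
    also have "\<tau> powr (- \<alpha>) * (\<Sum>j\<le>m. cq_weight \<alpha> j * U (int m - int j)) + la * ((1 - \<alpha>/2) * U (int m) + \<alpha>/2 * U (int m - 1))
       = (1 - \<alpha>/2) * bdf2 \<tau> \<phi> (real m * \<tau>) + \<alpha>/2 * bdf2 \<tau> \<phi> ((real m - 1) * \<tau>)"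
      by (rule eq) (use False that in auto)
    also have "real m - 1 = real (m - 1)" using False by (simp add: of_nat_diff)
    also have "(1 - \<alpha>/2) * bdf2 \<tau> \<phi> (real m * \<tau>) + \<alpha>/2 * bdf2 \<tau> \<phi> (real (m - 1) * \<tau>) = 1 / \<tau> * fps_nth (b * (bdf2_fps * Ff)) m"
      unfolding F1[symmetric] avg using False \<tau> by (simp add: field_simps)
    finally show ?thesis by simp
  qed
  have D0: "fps_nth D 0 \<noteq> 0"
  proof -
    have "0 \<le> la * \<tau> powr \<alpha> * (1 - \<alpha>/2)" using la \<alpha> by simp
    then show ?thesis unfolding D_def cq_den_fps_nth_0 by linarith
  qed
  have inv: "fps_nth Uf m = fps_nth (inverse (fps_const (\<tau> powr (- \<alpha>)) * D) * (fps_const (1 / \<tau>) * (b * (bdf2_fps * Ff)))) m" if "m \<le> N" for m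
    by (rule fps_nth_inverse_mult[OF main _ that]) (use D0 \<tau> in auto)
  let ?V = "inverse (fps_const (\<tau> powr (- \<alpha>)) * D) * (fps_const (1 / \<tau>) * (b * (bdf2_fps * Ff)))"
  have "1 / \<tau> * (3/2 * U (int n) - 2 * U (int n - 1) + 1/2 * U (int n - 2)) = 1 / \<tau> * fps_nth (bdf2_fps * Uf) n"
    by (simp only: U1)
  also have "fps_nth (bdf2_fps * Uf) n = fps_nth (bdf2_fps * ?V) n"
    unfolding fps_mult_nth[of bdf2_fps] by (intro sum.cong refl) (use inv n in simp)
  also have "1 / \<tau> * fps_nth (bdf2_fps * ?V) n = fps_nth (fps_const (1 / \<tau>) * (bdf2_fps * ?V)) n" by simp
  also have "fps_const (1 / \<tau>) * (bdf2_fps * ?V) = fps_const (\<tau> powr (\<alpha> - 2)) * ((bdf2_fps ^ 2 * b / D) * Ff)"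
  proof -
    have "inverse (fps_const (\<tau> powr (- \<alpha>)) * D) = fps_const (\<tau> powr \<alpha>) * inverse D"
      using \<tau> by (simp add: fps_inverse_mult fps_const_inverse[symmetric] powr_minus del: fps_const_inverse)
    moreover have "fps_const (1 / \<tau>) * fps_const (\<tau> powr \<alpha>) * fps_const (1 / \<tau>) = fps_const (\<tau> powr (\<alpha> - 2))"
      using \<tau> by (simp add: powr_diff powr_numeral power2_eq_square)
    moreover have "bdf2_fps ^ 2 * b / D = bdf2_fps ^ 2 * b * inverse D" using D0 by (simp add: fps_divide_unit)
    moreover have "c1 * (B * ((c2 * I) * (c1 * (b * (B * F))))) = (c1 * c2 * c1) * ((B ^ 2 * b * I) * F)" for c1 c2 B I b F :: "real fps"
      by (simp add: power2_eq_square algebra_simps)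
    ultimately show ?thesis by (simp only:)
  qed
  also have "fps_nth \<dots> n = \<tau> powr (\<alpha> - 2) * (\<Sum>i\<le>n. cq_response \<alpha> (la * \<tau> powr \<alpha>) i * \<phi> (real (n - i) * \<tau>))"
    unfolding fps_mult_left_const_nth fps_mult_nth[of _ Ff] atMost_atLeast0 by (simp add: cq_response_def b_def D_def Ff_def)
  finally show ?thesis by (simp add: sum_distrib_left mult.assoc)
qed

text \<open>The formula of Cauchy for repeated integration: exchanging the order over the triangle
  leaves the length t - s of the inner interval.\<close>

lemma double_integral_eq:
  fixes F :: "real => real"
  assumes "F absolutely_integrable_on {0..t}" "0 \<le> t"
  shows "integral {0..t} (\<lambda>\<xi>. integral {0..\<xi>} F) = integral {0..t} (\<lambda>s. (t - s) * F s)"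
proof -
  have 1: "integrable lborel (\<lambda>s. indicator {z<..<t} s * (1::real))" if "z < t" for z
    using integrable_real_indicator[of "{z<..<t}" lborel] that by simp
  have "integral {0..t} (\<lambda>s. integral {0..s} (\<lambda>z. 1 * F z)) = integral {0..t} (\<lambda>z. integral {z..t} (\<lambda>s. 1) * F z)"
  proof (rule triangle_Fubini(1)[OF assms(1), where M = t])
    show "(LINT s|lborel. \<bar>indicator {z<..<t} s * (1::real)\<bar>) \<le> t" if "0 < z" "z < t" for z
      using that by simp
  qed (use 1 in auto)
  also have "\<dots> = integral {0..t} (\<lambda>s. (t - s) * F s)" by (rule integral_cong) auto
  finally show ?thesis by simp
qed

text \<open>The double integral up to (n - i) \<open>\<tau>\<close> is the integral of
  \<open>F\<close> against a ramp that ends there; the ramps weighted with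
  \<open>cq_response\<close> add up to \<open>cq_kernel\<close>.\<close>

lemma discrete_duhamel:
  fixes F :: "real => real"
  assumes \<tau>: "0 < \<tau>" and F: "F absolutely_integrable_on {0..real n * \<tau>}"
  shows "(\<Sum>i\<le>n. \<tau> powr (\<alpha> - 2) * cq_response \<alpha> la i * integral {0..real (n - i) * \<tau>} (\<lambda>\<xi>. integral {0..\<xi>} F))
     = integral {0..real n * \<tau>} (\<lambda>s. \<tau> powr (\<alpha> - 1) * cq_kernel \<alpha> la ((real n * \<tau> - s) / \<tau>) * F s)"
    and "(\<lambda>s. \<tau> powr (\<alpha> - 1) * cq_kernel \<alpha> la ((real n * \<tau> - s) / \<tau>) * F s) integrable_on {0..real n * \<tau>}"
proof -
  let ?t = "real n * \<tau>"
  have t: "0 \<le> ?t" using \<tau> by simp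
  let ?m = "\<lambda>i s. max 0 (real (n - i) * \<tau> - s)"
  have mi: "(\<lambda>s. ?m i s * F s) integrable_on {0..?t}" for i
    by (rule set_lebesgue_integral_eq_integral(1)[OF absolutely_integrable_mult_continuous[OF _ F]]) (intro continuous_intros)
  have e: "integral {0..real (n - i) * \<tau>} (\<lambda>\<xi>. integral {0..\<xi>} F) = integral {0..?t} (\<lambda>s. ?m i s * F s)" for i
  proof -
    let ?r = "real (n - i) * \<tau>"
    have r: "0 \<le> ?r" "?r \<le> ?t" using \<tau> by auto
    have "F absolutely_integrable_on {0..?r}" by (rule set_integrable_subset[OF F]) (use r in auto)
    from double_integral_eq[OF this r(1)]
    have "integral {0..?r} (\<lambda>\<xi>. integral {0..\<xi>} F) = integral {0..?r} (\<lambda>s. ?m i s * F s)"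
      by (simp only:) (rule integral_cong, auto)
    moreover have "integral {?r..?t} (\<lambda>s. ?m i s * F s) = integral {?r..?t} (\<lambda>s. 0)"
      by (rule integral_cong) auto
    moreover have "integral {0..?r} (\<lambda>s. ?m i s * F s) + integral {?r..?t} (\<lambda>s. ?m i s * F s) = integral {0..?t} (\<lambda>s. ?m i s * F s)"
      by (rule Henstock_Kurzweil_Integration.integral_combine[OF r mi])
    ultimately show ?thesis by simp
  qed
  have k: "\<tau> powr (\<alpha> - 1) * cq_kernel \<alpha> la ((?t - s) / \<tau>) * F s = (\<Sum>i\<le>n. \<tau> powr (\<alpha> - 2) * cq_response \<alpha> la i * (?m i s * F s))"
    if s: "s \<in> {0..?t}" for s
  proof -
    have "(?t - s) / \<tau> \<le> real (Suc n)" using \<tau> s by (simp add: field_simps)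
    from cq_kernel_eq[OF this, of \<alpha> la]
    have "cq_kernel \<alpha> la ((?t - s) / \<tau>) = (\<Sum>i\<le>n. cq_response \<alpha> la i * max 0 ((?t - s) / \<tau> - real i))" by (simp only: lessThan_Suc_atMost)
    moreover have sc: "\<tau> powr (\<alpha> - 1) * max 0 ((?t - s) / \<tau> - real i) = \<tau> powr (\<alpha> - 2) * ?m i s" if "i \<le> n" for i
    proof -
      have "\<tau> powr (\<alpha> - 1) = \<tau> powr (\<alpha> - 2) * \<tau>" using powr_add[of \<tau> "\<alpha> - 2" 1] \<tau> by simp
      moreover have "\<tau> * max 0 ((?t - s) / \<tau> - real i) = ?m i s"
      proof -
        have "\<tau> * ((?t - s) / \<tau> - real i) = real (n - i) * \<tau> - s"
        proof -
          have "\<tau> * ((?t - s) / \<tau>) = ?t - s" using \<tau> by simp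
          then have "\<tau> * ((?t - s) / \<tau> - real i) = ?t - s - \<tau> * real i" by (simp only: right_diff_distrib[of \<tau> "(?t - s) / \<tau>"])
          then show ?thesis using that by (simp add: of_nat_diff left_diff_distrib right_diff_distrib mult.commute)
        qed
        then show ?thesis using \<tau> by (simp only: max_mult_distrib_left mult_zero_right) simp
      qed
      ultimately show ?thesis by (simp only: mult.assoc)
    qed
    then have tm: "\<tau> powr (\<alpha> - 1) * (cq_response \<alpha> la i * max 0 ((?t - s) / \<tau> - real i)) * F s = \<tau> powr (\<alpha> - 2) * cq_response \<alpha> la i * (?m i s * F s)" if "i \<le> n" for i
    proof -
      have "A * (c * m) * f = B * c * (M * f)" if "A * m = B * M" for A B c m M f :: real
      proof -
        have "A * (c * m) * f = (A * m) * (c * f)" by (simp only: mult_ac)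
        then show ?thesis unfolding that by (simp only: mult_ac)
      qed
      from this[OF sc[OF that]] show ?thesis .
    qed
    ultimately have "\<tau> powr (\<alpha> - 1) * cq_kernel \<alpha> la ((?t - s) / \<tau>) * F s = (\<Sum>i\<le>n. \<tau> powr (\<alpha> - 1) * (cq_response \<alpha> la i * max 0 ((?t - s) / \<tau> - real i)) * F s)"
      by (simp only: sum_distrib_left sum_distrib_right)
    also have "\<dots> = (\<Sum>i\<le>n. \<tau> powr (\<alpha> - 2) * cq_response \<alpha> la i * (?m i s * F s))"
      by (rule sum.cong[OF refl]) (rule tm, simp)
    finally show ?thesis .
  qed
  have H: "((\<lambda>s. \<Sum>i\<le>n. \<tau> powr (\<alpha> - 2) * cq_response \<alpha> la i * (?m i s * F s)) has_integral (\<Sum>i\<le>n. \<tau> powr (\<alpha> - 2) * cq_response \<alpha> la i * integral {0..?t} (\<lambda>s. ?m i s * F s))) {0..?t}"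
    by (intro has_integral_sum has_integral_mult_right integrable_integral mi) simp
  have H': "((\<lambda>s. \<tau> powr (\<alpha> - 1) * cq_kernel \<alpha> la ((?t - s) / \<tau>) * F s) has_integral (\<Sum>i\<le>n. \<tau> powr (\<alpha> - 2) * cq_response \<alpha> la i * integral {0..?t} (\<lambda>s. ?m i s * F s))) {0..?t}"
    by (rule has_integral_eq[OF _ H]) (rule k[symmetric])
  then show "(\<Sum>i\<le>n. \<tau> powr (\<alpha> - 2) * cq_response \<alpha> la i * integral {0..real (n - i) * \<tau>} (\<lambda>\<xi>. integral {0..\<xi>} F))
     = integral {0..?t} (\<lambda>s. \<tau> powr (\<alpha> - 1) * cq_kernel \<alpha> la ((?t - s) / \<tau>) * F s)"
    unfolding e by (simp add: integral_unique)
  show "(\<lambda>s. \<tau> powr (\<alpha> - 1) * cq_kernel \<alpha> la ((?t - s) / \<tau>) * F s) integrable_on {0..?t}" using H' by auto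
qed

text \<open>Taylor's formula turns the error functional into an integral against the second derivative.\<close>

lemma error_representation:
  fixes G G2 :: "real => real"
  assumes \<alpha>: "0 < \<alpha>" "\<alpha> < 1" and h: "0 < la" "0 < \<tau>" and \<mu>: "- 1 < \<mu>" and t: "0 < t"
    and G2: "G2 absolutely_integrable_on {0..t}"
    and G: "\<And>s. s \<in> {0..t} ==> G s = g0 + s * g1 + integral {0..s} (\<lambda>z. (s - z) * G2 z)"
  defines "Q \<equiv> \<lambda>z. integral {z..t} (\<lambda>s. err0 \<alpha> la \<tau> (t - s) * (s powr \<mu> * (s - z)))"
  shows "((\<lambda>s. err0 \<alpha> la \<tau> (t - s) * (s powr \<mu> * G s)) has_integral
     g0 * integral {0..t} (\<lambda>s. err0 \<alpha> la \<tau> (t - s) * s powr \<mu>) + g1 * integral {0..t} (\<lambda>s. err0 \<alpha> la \<tau> (t - s) * s powr (\<mu> + 1))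
      + integral {0..t} (\<lambda>z. Q z * G2 z)) {0..t}"
    and "(\<lambda>z. Q z * G2 z) absolutely_integrable_on {0..t}"
proof -
  let ?e = "\<lambda>s. err0 \<alpha> la \<tau> (t - s)"
  let ?c = "\<lambda>s z. ?e s * (s powr \<mu> * (s - z))"
  have ip: "(\<lambda>s. ?e s * s powr \<nu>) integrable_on {0..t}" if "- 1 < \<nu>" for \<nu>
    using integral_Icc_eq_lborel(1)[OF integrable_err0_power[OF \<alpha> h t that]] by (rule set_lebesgue_integral_eq_integral(1))
  have cm: "(\<lambda>(s, z). ?c s z) \<in> borel_measurable (borel \<Otimes>\<^sub>M borel)"
    unfolding case_prod_beta' by measurable
  let ?k = "\<lambda>s. indicator {0<..<t} s * (?e s * s powr \<mu>)"
  have k: "integrable lborel ?k" by (rule integrable_err0_power[OF \<alpha> h t \<mu>])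
  \<comment> \<open>A majorant independent of z, which bounds the inner integrals uniformly as the
    exchange of integrals over the triangle requires.\<close>
  have cb: "\<bar>indicator {z<..<t} s * ?c s z\<bar> \<le> t * \<bar>?k s\<bar>" if "0 < z" "z < t" for z s
  proof (cases "z < s \<and> s < t")
    case True
    then have "\<bar>?e s * s powr \<mu>\<bar> * (s - z) \<le> \<bar>?e s * s powr \<mu>\<bar> * t" using that by (intro mult_left_mono) auto
    then show ?thesis using True that by (simp add: abs_mult mult_ac)
  qed (use t in \<open>auto simp: indicator_def\<close>)
  have int: "integrable lborel (\<lambda>s. indicator {z<..<t} s * ?c s z)" if "0 < z" "z < t" for z
    by (rule integrable_dominated[OF integrable_mult_right[OF integrable_abs[OF k], of t] _ cb[OF that]]) measurable
  have le: "(LINT s|lborel. \<bar>indicator {z<..<t} s * ?c s z\<bar>) \<le> t * (LINT s|lborel. \<bar>?k s\<bar>)" if "0 < z" "z < t" for z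
  proof -
    have "(LINT s|lborel. \<bar>indicator {z<..<t} s * ?c s z\<bar>) \<le> (LINT s|lborel. t * \<bar>?k s\<bar>)"
      by (intro integral_mono integrable_abs int that integrable_mult_right k cb)
    then show ?thesis by simp
  qed
  have T1: "integral {0..t} (\<lambda>s. integral {0..s} (\<lambda>z. ?c s z * G2 z)) = integral {0..t} (\<lambda>z. Q z * G2 z)"
    unfolding Q_def by (rule triangle_Fubini(1)[OF G2 cm int le])
  have T2: "(\<lambda>s. integral {0..s} (\<lambda>z. ?c s z * G2 z)) absolutely_integrable_on {0..t}"
    by (rule triangle_Fubini(2)[OF G2 cm int le])
  show "(\<lambda>z. Q z * G2 z) absolutely_integrable_on {0..t}"
    unfolding Q_def by (rule triangle_Fubini(3)[OF G2 cm int le])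
  have "(\<lambda>s. integral {0..s} (\<lambda>z. ?c s z * G2 z)) integrable_on {0..t}" using T2 by (rule set_lebesgue_integral_eq_integral(1))
  then have i3: "((\<lambda>s. integral {0..s} (\<lambda>z. ?c s z * G2 z)) has_integral integral {0..t} (\<lambda>z. Q z * G2 z)) {0..t}"
    using T1 by (simp add: has_integral_integrable_integral)
  have H: "((\<lambda>s. g0 * (?e s * s powr \<mu>) + g1 * (?e s * s powr (\<mu> + 1)) + integral {0..s} (\<lambda>z. ?c s z * G2 z)) has_integral
      g0 * integral {0..t} (\<lambda>s. ?e s * s powr \<mu>) + g1 * integral {0..t} (\<lambda>s. ?e s * s powr (\<mu> + 1)) + integral {0..t} (\<lambda>z. Q z * G2 z)) {0..t}"
    using \<mu> by (intro has_integral_add has_integral_mult_right integrable_integral ip i3) auto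
  show "((\<lambda>s. ?e s * (s powr \<mu> * G s)) has_integral g0 * integral {0..t} (\<lambda>s. ?e s * s powr \<mu>) + g1 * integral {0..t} (\<lambda>s. ?e s * s powr (\<mu> + 1)) + integral {0..t} (\<lambda>z. Q z * G2 z)) {0..t}"
  proof (rule has_integral_eq[OF _ H])
    fix s assume s: "s \<in> {0..t}"
    have "integral {0..s} (\<lambda>z. ?c s z * G2 z) = integral {0..s} (\<lambda>z. (?e s * s powr \<mu>) * ((s - z) * G2 z))"
      by (simp add: mult_ac)
    also have "\<dots> = (?e s * s powr \<mu>) * integral {0..s} (\<lambda>z. (s - z) * G2 z)" by simp
    finally have "integral {0..s} (\<lambda>z. ?c s z * G2 z) = \<dots>" .
    moreover have "s powr (\<mu> + 1) = s powr \<mu> * s" using s by (simp add: powr_add)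
    ultimately show "g0 * (?e s * s powr \<mu>) + g1 * (?e s * s powr (\<mu> + 1)) + integral {0..s} (\<lambda>z. ?c s z * G2 z) = ?e s * (s powr \<mu> * G s)"
      unfolding G[OF s] by (simp add: algebra_simps)
  qed
qed

section \<open>Eigenbases in finite-dimensional function spaces\<close>

text \<open>The finite element space is a set of functions and not a type, so linear algebra is
  phrased for sets closed under linear combinations.\<close>

definition fun_space :: "('a => real) set => bool" where
  "fun_space V \<longleftrightarrow> (\<lambda>_. 0) \<in> V \<and> (\<forall>u\<in>V. \<forall>v\<in>V. \<forall>a b. (\<lambda>x. a * u x + b * v x) \<in> V)"

definition sym_form :: "('a => real) set => (('a => real) => ('a => real) => real) => bool" where
  "sym_form V B \<longleftrightarrow> (\<forall>u\<in>V. \<forall>v\<in>V. B u v = B v u) \<and>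
     (\<forall>u\<in>V. \<forall>v\<in>V. \<forall>w\<in>V. \<forall>a b. B (\<lambda>x. a * u x + b * v x) w = a * B u w + b * B v w)"

definition pos_form :: "('a => real) set => (('a => real) => ('a => real) => real) => bool" where
  "pos_form V B \<longleftrightarrow> sym_form V B \<and> (\<forall>v\<in>V. v \<noteq> (\<lambda>_. 0) \<longrightarrow> 0 < B v v)"

text \<open>A stand-in for finite dimension: evaluation at finitely many points is injective on
  \<open>V\<close>. For finite elements these points are the vertices.\<close>

definition determining :: "('a => real) set => 'a set => bool" where
  "determining V P \<longleftrightarrow> finite P \<and> (\<forall>v\<in>V. (\<forall>p\<in>P. v p = 0) \<longrightarrow> v = (\<lambda>_. 0))"

definition orthonormal :: "('a => real) set => (('a => real) => ('a => real) => real) => nat => (nat => 'a => real) => bool" where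
  "orthonormal V B m e \<longleftrightarrow> (\<forall>i<m. e i \<in> V) \<and> (\<forall>i<m. \<forall>j<m. B (e i) (e j) = (if i = j then 1 else 0))"

lemma fun_space_lin: "fun_space V ==> u \<in> V ==> v \<in> V ==> (\<lambda>x. a * u x + b * v x) \<in> V"
  by (simp add: fun_space_def)

lemma fun_space_scale: "fun_space V ==> u \<in> V ==> (\<lambda>x. a * u x) \<in> V"
  using fun_space_lin[of V u u a 0] by simp

lemma fun_space_sum:
  assumes "fun_space V" "finite I" "\<And>i. i \<in> I ==> e i \<in> V"
  shows "(\<lambda>x. \<Sum>i\<in>I. c i * e i x) \<in> V"
  using assms(2,3)
proof (induction I rule: finite_induct)
  case (insert j I)
  then show ?case using fun_space_lin[OF assms(1), of "e j" "\<lambda>x. \<Sum>i\<in>I. c i * e i x" "c j" 1] by simp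
qed (use assms(1) in \<open>simp add: fun_space_def\<close>)

lemma sym_formD:
  assumes "sym_form V B"
  shows "u \<in> V ==> v \<in> V ==> B u v = B v u"
    and "u \<in> V ==> v \<in> V ==> w \<in> V ==> B (\<lambda>x. a * u x + b * v x) w = a * B u w + b * B v w"
  using assms unfolding sym_form_def by blast+

lemma sym_form_scale: "sym_form V B ==> u \<in> V ==> w \<in> V ==> B (\<lambda>x. a * u x) w = a * B u w"
  using sym_formD(2)[of V B u u w a 0] by simp

lemma sym_form_sum:
  assumes "fun_space V" "sym_form V B" "finite I" "\<And>i. i \<in> I ==> e i \<in> V" "w \<in> V"
  shows "B (\<lambda>x. \<Sum>i\<in>I. c i * e i x) w = (\<Sum>i\<in>I. c i * B (e i) w)"
  using assms(3,4)
proof (induction I rule: finite_induct)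
  case empty
  have "(\<lambda>_. 0) \<in> V" using assms(1) by (simp add: fun_space_def)
  then show ?case using sym_form_scale[OF assms(2) _ assms(5), of "\<lambda>_. 0" 0] by simp
next
  case (insert j I)
  then show ?case
    using sym_formD(2)[OF assms(2), of "e j" "\<lambda>x. \<Sum>i\<in>I. c i * e i x" w "c j" 1] fun_space_sum[OF assms(1), of I e c] assms(5) by simp
qed

lemma sym_form_subset: "sym_form V B ==> W \<subseteq> V ==> sym_form W B"
  unfolding sym_form_def by blast

lemma pos_form_subset: "pos_form V B ==> W \<subseteq> V ==> pos_form W B"
  unfolding pos_form_def using sym_form_subset by blast

lemma determining_subset: "determining V P ==> W \<subseteq> V ==> determining W P"
  unfolding determining_def by blast

text \<open>A homogeneous linear system with fewer equations than unknowns, solved by Gaussian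
  elimination, one point at a time.\<close>

lemma exists_vanishing_combination:
  fixes f :: "nat => 'a => real"
  assumes "finite P" "finite I" "card P < card I"
  shows "\<exists>c. (\<exists>i\<in>I. c i \<noteq> 0) \<and> (\<forall>p\<in>P. (\<Sum>i\<in>I. c i * f i p) = 0)"
  using assms
proof (induction P arbitrary: I f rule: finite_induct)
  case empty
  then have "I \<noteq> {}" by auto
  then show ?case by (intro exI[of _ "\<lambda>_. 1"]) auto
next
  case (insert p P)
  show ?case
  proof (cases "\<forall>i\<in>I. f i p = 0")
    case True
    have "card P < card I" using insert by simp
    from insert.IH[OF insert.prems(1) this, of f] show ?thesis using True by auto
  next
    case False
    then obtain j where j: "j \<in> I" "f j p \<noteq> 0" by blast
    \<comment> \<open>Eliminates the values at \<open>p\<close>, with \<open>f j\<close> as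
      pivot.\<close>
    define g where "g = (\<lambda>i q. f i q - f i p / f j p * f j q)"
    have "card P < card (I - {j})" using insert j by simp
    from insert.IH[OF _ this, of g] insert.prems obtain c where c: "\<exists>i\<in>I - {j}. c i \<noteq> 0" "\<forall>q\<in>P. (\<Sum>i\<in>I - {j}. c i * g i q) = 0"
      by auto
    define d where "d = c(j := - (\<Sum>i\<in>I - {j}. c i * (f i p / f j p)))"
    have s: "(\<Sum>i\<in>I. d i * f i q) = (\<Sum>i\<in>I - {j}. c i * g i q)" for q
    proof -
      have "(\<Sum>i\<in>I. d i * f i q) = d j * f j q + (\<Sum>i\<in>I - {j}. d i * f i q)"
        by (rule sum.remove[OF insert.prems(1) j(1)])
      also have "(\<Sum>i\<in>I - {j}. d i * f i q) = (\<Sum>i\<in>I - {j}. c i * f i q)" by (rule sum.cong) (auto simp: d_def)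
      also have "d j * f j q = - (\<Sum>i\<in>I - {j}. c i * (f i p / f j p) * f j q)" by (simp add: d_def sum_distrib_right)
      finally show ?thesis by (simp add: g_def right_diff_distrib sum_subtractf mult.assoc)
    qed
    have "g i p = 0" for i using j by (simp add: g_def)
    then have "\<forall>q\<in>insert p P. (\<Sum>i\<in>I. d i * f i q) = 0" unfolding s using c(2) by simp
    moreover have "\<exists>i\<in>I. d i \<noteq> 0" using c(1) by (auto simp: d_def)
    ultimately show ?thesis by blast
  qed
qed

section \<open>Orthonormal families and eigenvectors\<close>

lemma orthonormal_sum:
  assumes "fun_space V" "sym_form V B" "orthonormal V B m e" "j < m"
  shows "B (\<lambda>x. \<Sum>i<m. c i * e i x) (e j) = c j"
proof -
  have "B (\<lambda>x. \<Sum>i<m. c i * e i x) (e j) = (\<Sum>i<m. c i * B (e i) (e j))"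
    using assms(3,4) by (intro sym_form_sum[OF assms(1,2)]) (auto simp: orthonormal_def)
  also have "\<dots> = (\<Sum>i<m. if i = j then c i else 0)"
    by (rule sum.cong) (use assms(3,4) in \<open>auto simp: orthonormal_def\<close>)
  finally show ?thesis using assms(4) by simp
qed

text \<open>A longer family would have a nontrivial combination vanishing on \<open>P\<close>, hence
  vanishing identically, which orthonormality excludes.\<close>

lemma orthonormal_card_le:
  assumes "fun_space V" "sym_form V B" "determining V P" "orthonormal V B m e"
  shows "m \<le> card P"
proof (rule ccontr)
  assume "\<not> m \<le> card P"
  then obtain c where c: "\<exists>i\<in>{..<m}. c i \<noteq> 0" "\<forall>p\<in>P. (\<Sum>i\<in>{..<m}. c i * e i p) = 0"
    using exists_vanishing_combination[of P "{..<m}" e] assms(3) by (auto simp: determining_def)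
  have v: "(\<lambda>x. \<Sum>i<m. c i * e i x) \<in> V" using assms(4) by (intro fun_space_sum[OF assms(1)]) (auto simp: orthonormal_def)
  then have z: "(\<lambda>x. \<Sum>i<m. c i * e i x) = (\<lambda>_. 0)" using assms(3) c(2) by (auto simp: determining_def)
  obtain j where j: "j < m" "c j \<noteq> 0" using c(1) by auto
  have "e j \<in> V" using assms(4) j by (simp add: orthonormal_def)
  moreover have "(\<lambda>_. 0) \<in> V" using assms(1) by (simp add: fun_space_def)
  ultimately have "B (\<lambda>_. 0) (e j) = 0" using sym_form_scale[OF assms(2), of "\<lambda>_. 0" "e j" 0] by simp
  then show False using orthonormal_sum[OF assms(1,2,4) j(1), of c] z j(2) by simp
qed

lemma orthonormal_residual:
  assumes "fun_space V" "sym_form V B" "orthonormal V B m e" "v \<in> V"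
  defines "r \<equiv> \<lambda>x. v x - (\<Sum>i<m. B v (e i) * e i x)"
  shows "r \<in> V" and "\<And>j. j < m ==> B r (e j) = 0"
proof -
  let ?s = "\<lambda>x. \<Sum>i<m. B v (e i) * e i x"
  have s: "?s \<in> V" using assms(3) by (intro fun_space_sum[OF assms(1)]) (auto simp: orthonormal_def)
  have r: "r = (\<lambda>x. 1 * v x + (- 1) * ?s x)" by (simp add: r_def)
  show "r \<in> V" unfolding r by (rule fun_space_lin[OF assms(1,4) s])
  fix j assume j: "j < m"
  then have "e j \<in> V" using assms(3) by (simp add: orthonormal_def)
  then have "B r (e j) = 1 * B v (e j) + (- 1) * B ?s (e j)" unfolding r by (intro sym_formD(2)[OF assms(2,4) s])
  then show "B r (e j) = 0" using orthonormal_sum[OF assms(1-3) j, of "\<lambda>i. B v (e i)"] by simp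
qed

lemma orthonormal_extend:
  assumes "fun_space V" "pos_form V B" "orthonormal V B m e" "r \<in> V" "r \<noteq> (\<lambda>_. 0)" "\<forall>j<m. B r (e j) = 0"
  shows "orthonormal V B (Suc m) (e(m := \<lambda>x. (1 / sqrt (B r r)) * r x))"
proof -
  define u where "u = (\<lambda>x. (1 / sqrt (B r r)) * r x)"
  have B: "sym_form V B" "0 < B r r" using assms(2,4,5) by (auto simp: pos_form_def)
  have u: "u \<in> V" unfolding u_def by (rule fun_space_scale[OF assms(1,4)])
  have uw: "B u w = (1 / sqrt (B r r)) * B r w" if "w \<in> V" for w
    unfolding u_def by (rule sym_form_scale[OF B(1) assms(4) that])
  have "B r u = (1 / sqrt (B r r)) * B r r" using sym_formD(1)[OF B(1) u assms(4)] uw[OF assms(4)] by simp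
  then have "B u u = (1 / sqrt (B r r)) * ((1 / sqrt (B r r)) * B r r)" using uw[OF u] by simp
  also have "\<dots> = B r r / (sqrt (B r r) * sqrt (B r r))" by simp
  also have "\<dots> = 1" using B(2) by (subst real_sqrt_mult_self) simp
  finally have uu: "B u u = 1" .
  have eV: "e j \<in> V" if "j < m" for j using assms(3) that by (simp add: orthonormal_def)
  have ue: "B u (e j) = 0" "B (e j) u = 0" if "j < m" for j
    using uw[OF eV[OF that]] assms(6) that sym_formD(1)[OF B(1) u eV[OF that]] by auto
  show ?thesis unfolding u_def[symmetric]
    using assms(3) u uu ue by (auto simp: orthonormal_def less_Suc_eq)
qed

text \<open>\<open>Q\<close> is kept abstract because the argument serves twice: for orthonormal
  families and for orthonormal families of eigenvectors.\<close>

lemma maximal_family: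
  assumes V: "fun_space V" "sym_form V B" "determining V P"
    and Q0: "Q 0 e0" and Q: "\<And>m e. Q m e ==> orthonormal V B m e"
  obtains m e where "Q m e" "\<And>e'. \<not> Q (Suc m) e'"
proof -
  have b: "\<forall>m. (\<exists>e. Q m e) \<longrightarrow> m \<le> card P" using orthonormal_card_le[OF V Q] by blast
  define m where "m = (GREATEST m. \<exists>e. Q m e)"
  have "\<exists>e. Q m e" unfolding m_def using GreatestI_nat[of "\<lambda>m. \<exists>e. Q m e" 0 "card P"] Q0 b by blast
  then obtain e where e: "Q m e" by blast
  have "\<not> Q (Suc m) e'" for e'
    using Greatest_le_nat[of "\<lambda>m. \<exists>e. Q m e" "Suc m" "card P"] b unfolding m_def[symmetric] by auto
  with e show ?thesis using that by blast
qed

lemma orthonormal_basis_exists: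
  assumes "fun_space V" "pos_form V B" "determining V P"
  obtains m e where "orthonormal V B m e" "\<And>v. v \<in> V ==> v = (\<lambda>x. \<Sum>i<m. B v (e i) * e i x)"
proof -
  have s: "sym_form V B" using assms(2) by (simp add: pos_form_def)
  obtain m e where me: "orthonormal V B m e" "\<And>e'. \<not> orthonormal V B (Suc m) e'"
    by (rule maximal_family[OF assms(1) s assms(3), of "orthonormal V B" "\<lambda>_ _. 0"]) (auto simp: orthonormal_def)
  show ?thesis
  proof (rule that[OF me(1)])
    fix v assume v: "v \<in> V"
    note r = orthonormal_residual[OF assms(1) s me(1) v]
    have "\<forall>j<m. B (\<lambda>x. v x - (\<Sum>i<m. B v (e i) * e i x)) (e j) = 0" using r(2) by blast
    then have "(\<lambda>x. v x - (\<Sum>i<m. B v (e i) * e i x)) = (\<lambda>_. 0)"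
      using orthonormal_extend[OF assms(1,2) me(1) r(1)] me(2) by (rule_tac ccontr) blast
    then show "v = (\<lambda>x. \<Sum>i<m. B v (e i) * e i x)" by (auto simp: fun_eq_iff)
  qed
qed

lemma orthonormal_expansion_form:
  assumes "fun_space V" "sym_form V B" "orthonormal V B m e"
  shows "B (\<lambda>x. \<Sum>i<m. c i * e i x) (\<lambda>x. \<Sum>i<m. d i * e i x) = (\<Sum>i<m. c i * d i)"
proof -
  have e: "\<And>i. i \<in> {..<m} ==> e i \<in> V" using assms(3) by (simp add: orthonormal_def)
  have d: "(\<lambda>x. \<Sum>i<m. d i * e i x) \<in> V" by (intro fun_space_sum[OF assms(1)] e) auto
  have "B (\<lambda>x. \<Sum>i<m. c i * e i x) (\<lambda>x. \<Sum>i<m. d i * e i x) = (\<Sum>i<m. c i * B (e i) (\<lambda>x. \<Sum>i<m. d i * e i x))"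
    by (intro sym_form_sum[OF assms(1,2)] e d) auto
  also have "\<dots> = (\<Sum>i<m. c i * d i)"
  proof (rule sum.cong[OF refl])
    fix i assume i: "i \<in> {..<m}"
    have "B (e i) (\<lambda>x. \<Sum>i<m. d i * e i x) = B (\<lambda>x. \<Sum>i<m. d i * e i x) (e i)" by (rule sym_formD(1)[OF assms(2) e[OF i] d])
    then show "c i * B (e i) (\<lambda>x. \<Sum>i<m. d i * e i x) = c i * d i" using orthonormal_sum[OF assms(1-3), of i d] i by simp
  qed
  finally show ?thesis .
qed

text \<open>The number of coordinates \<open>m\<close> is a variable, so coordinate vectors are
  sequences that vanish from \<open>m\<close> on. The sphere is a closed subset of a product of
  compact intervals, which is compact by the theorem of Tychonoff.\<close>

lemma compact_unit_sphere_nat: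
  "compact {x::nat => real. (\<forall>i. m \<le> i \<longrightarrow> x i = 0) \<and> (\<Sum>i<m. (x i)\<^sup>2) = 1}"
proof -
  define K where "K = PiE UNIV (\<lambda>i. if i < m then {-1..1} else {0::real})"
  have "compactin (product_topology (\<lambda>i::nat. euclidean :: real topology) UNIV) K"
    unfolding K_def compactin_PiE by (auto simp: compactin_euclidean_iff)
  then have K: "compact K" by (simp add: euclidean_product_topology compactin_euclidean_iff)
  have cl: "closed {x::nat => real. (\<Sum>i<m. (x i)\<^sup>2) = 1}"
    by (intro closed_Collect_eq continuous_intros continuous_on_product_coordinates)
  have "x i \<in> {-1..1}" if "(\<Sum>i<m. (x i)\<^sup>2) = 1" "i < m" for x :: "nat => real" and i
  proof -
    have "(x i)\<^sup>2 \<le> (\<Sum>i<m. (x i)\<^sup>2)" using that(2) by (intro member_le_sum) auto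
    then have "\<bar>x i\<bar> \<le> 1" using that(1) by (simp add: abs_square_le_1)
    then show ?thesis by (simp add: abs_le_iff)
  qed
  then have "{x::nat => real. (\<forall>i. m \<le> i \<longrightarrow> x i = 0) \<and> (\<Sum>i<m. (x i)\<^sup>2) = 1} = K \<inter> {x. (\<Sum>i<m. (x i)\<^sup>2) = 1}"
    unfolding K_def by (auto simp: PiE_def Pi_def)
  then show ?thesis using compact_Int_closed[OF K cl] by simp
qed

text \<open>The first-order condition at a maximum in algebraic form. The witness t satisfies t d =
  2 (|e| + 1) t^2, which exceeds e t^2 unless d = 0.\<close>

lemma linear_le_quadratic_imp_zero:
  fixes d e :: real
  assumes "\<And>t. t * d \<le> t\<^sup>2 * e"
  shows "d = 0"
proof (rule ccontr)
  assume "d \<noteq> 0"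
  define t where "t = d / (2 * (\<bar>e\<bar> + 1))"
  have "t * d = 2 * (\<bar>e\<bar> + 1) * t\<^sup>2" 
  proof -
    have "d = 2 * (\<bar>e\<bar> + 1) * t" unfolding t_def by (subst times_divide_eq_right) (simp add: add_pos_nonneg)
    then show ?thesis by (simp add: power2_eq_square mult.assoc mult.left_commute)
  qed
  then have "2 * (\<bar>e\<bar> + 1) * t\<^sup>2 \<le> t\<^sup>2 * e" using assms[of t] by simp
  moreover have "0 < t\<^sup>2" using \<open>d \<noteq> 0\<close> by (simp add: t_def)
  ultimately have "2 * (\<bar>e\<bar> + 1) \<le> e" by (simp add: mult.commute)
  then show False using abs_ge_self[of e] abs_ge_zero[of e] by argo
qed

text \<open>The maximum of the Rayleigh quotient is an eigenvalue.\<close>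

lemma eigenvector_exists:
  assumes V: "fun_space V" "pos_form V B" "determining V P" and A: "sym_form V A"
    and ne: "v0 \<in> V" "v0 \<noteq> (\<lambda>_. 0)"
  obtains v l where "v \<in> V" "v \<noteq> (\<lambda>_. 0)" "\<And>w. w \<in> V ==> A v w = l * B v w"
proof -
  have s: "sym_form V B" using V(2) by (simp add: pos_form_def)
  obtain m e where on: "orthonormal V B m e" and sp: "\<And>v. v \<in> V ==> v = (\<lambda>x. \<Sum>i<m. B v (e i) * e i x)"
    using orthonormal_basis_exists[OF V] by blast
  have eV: "e i \<in> V" if "i < m" for i using on that by (simp add: orthonormal_def)
  define S where "S = {x::nat => real. (\<forall>i. m \<le> i \<longrightarrow> x i = 0) \<and> (\<Sum>i<m. (x i)\<^sup>2) = 1}"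
  define vec where "vec = (\<lambda>(c::nat => real) x. \<Sum>i<m. c i * e i x)"
  have vV: "vec c \<in> V" for c unfolding vec_def using eV by (intro fun_space_sum[OF V(1)]) auto
  have vec: "vec c = (\<lambda>x. \<Sum>i<m. c i * e i x)" for c by (simp add: vec_def)
  have Av: "A (vec c) (vec d) = (\<Sum>i<m. c i * (\<Sum>j<m. d j * A (e j) (e i)))" for c d
  proof -
    have "A (vec c) (vec d) = (\<Sum>i<m. c i * A (e i) (vec d))" unfolding vec[of c] using eV vV by (intro sym_form_sum[OF V(1) A]) auto
    also have "\<dots> = (\<Sum>i<m. c i * (\<Sum>j<m. d j * A (e j) (e i)))"
    proof (rule sum.cong[OF refl])
      fix i assume i: "i \<in> {..<m}"
      have "A (e i) (vec d) = A (vec d) (e i)" using eV i vV by (intro sym_formD(1)[OF A]) auto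
      also have "\<dots> = (\<Sum>j<m. d j * A (e j) (e i))" unfolding vec_def using eV i by (intro sym_form_sum[OF V(1) A]) auto
      finally show "c i * A (e i) (vec d) = c i * (\<Sum>j<m. d j * A (e j) (e i))" by simp
    qed
    finally show ?thesis .
  qed
  have Bv: "B (vec c) (vec c) = (\<Sum>i<m. (c i)\<^sup>2)" for c
    unfolding vec_def using orthonormal_expansion_form[OF V(1) s on, of c c] by (simp add: power2_eq_square)
  have "0 < m"
  proof (rule ccontr)
    assume "\<not> 0 < m"
    then show False using sp[OF ne(1)] ne(2) by simp
  qed
  then have "(\<lambda>i. if i = 0 then 1 else 0) \<in> S" by (auto simp: S_def if_distrib[of "\<lambda>x. x\<^sup>2"] cong: if_cong)
  then have Sne: "S \<noteq> {}" by blast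
  have "compact S" unfolding S_def by (rule compact_unit_sphere_nat)
  moreover have "continuous_on S (\<lambda>c. A (vec c) (vec c))" unfolding Av by (intro continuous_intros continuous_on_subset[OF continuous_on_product_coordinates]) auto
  ultimately obtain c where c: "c \<in> S" and mx: "\<And>d. d \<in> S ==> A (vec d) (vec d) \<le> A (vec c) (vec c)"
    using continuous_attains_sup[OF _ Sne] by blast
  define v where "v = vec c"
  define l where "l = A v v"
  have Bvv: "B v v = 1" unfolding v_def Bv using c by (simp add: S_def)
  have z0: "A (\<lambda>_. 0) (\<lambda>_. 0) = 0" "B (\<lambda>_. 0) (\<lambda>_. 0) = 0"
    using sym_form_scale[OF A, of "\<lambda>_. 0" "\<lambda>_. 0" 0] sym_form_scale[OF s, of "\<lambda>_. 0" "\<lambda>_. 0" 0] V(1) by (auto simp: fun_space_def)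
  have le: "A w w \<le> l * B w w" if w: "w \<in> V" for w
  proof (cases "w = (\<lambda>_. 0)")
    case True
    then show ?thesis using z0 by simp
  next
    case False
    then have p: "0 < B w w" using V(2) w by (simp add: pos_form_def)
    \<comment> \<open>A general w is rescaled to the unit sphere, on which the maximum was
      taken.\<close>
    define q where "q = 1 / sqrt (B w w)"
    have q: "q * q * B w w = 1" using p by (simp add: q_def real_sqrt_mult_self field_simps)
    define d where "d = (\<lambda>i. if i < m then q * B w (e i) else 0)"
    have "vec d = (\<lambda>x. q * w x)"
    proof
      fix x
      have "vec d x = (\<Sum>i<m. q * (B w (e i) * e i x))" unfolding vec_def by (rule sum.cong) (auto simp: d_def)
      also have "\<dots> = q * w x" using fun_cong[OF sp[OF w], of x] by (simp add: sum_distrib_left)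
      finally show "vec d x = q * w x" .
    qed
    moreover have sc: "F (\<lambda>x. q * w x) (\<lambda>x. q * w x) = q * q * F w w" if F: "sym_form V F" for F
    proof -
      have qw: "(\<lambda>x. q * w x) \<in> V" by (rule fun_space_scale[OF V(1) w])
      show ?thesis using sym_form_scale[OF F w qw, of q] sym_formD(1)[OF F w qw] sym_form_scale[OF F w w, of q] by simp
    qed
    ultimately have "B (vec d) (vec d) = 1" "A (vec d) (vec d) = q * q * A w w" using sc[OF s] sc[OF A] q by auto
    then have "d \<in> S" "A (vec d) (vec d) = q * q * A w w" using Bv[of d] by (auto simp: S_def d_def)
    then have "q * q * A w w \<le> l" using mx[of d] by (simp add: l_def v_def)
    then have "(q * q * A w w) * B w w \<le> l * B w w" using p by (intro mult_right_mono) auto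
    moreover have "(q * q * A w w) * B w w = (q * q * B w w) * A w w" by (simp only: mult_ac)
    ultimately show ?thesis unfolding q by simp
  qed
  have vV': "v \<in> V" by (simp add: v_def vV)
  show ?thesis
  proof (rule that[OF vV'])
    show "v \<noteq> (\<lambda>_. 0)" using Bvv z0(2) by auto
    fix w assume w: "w \<in> V"
    have ex: "F (\<lambda>x. 1 * v x + t * w x) (\<lambda>x. 1 * v x + t * w x) = F v v + 2 * t * F v w + t\<^sup>2 * F w w" if F: "sym_form V F" for F t
    proof -
      let ?u = "\<lambda>x. 1 * v x + t * w x"
      have u: "?u \<in> V" by (rule fun_space_lin[OF V(1) vV' w])
      have "F ?u ?u = 1 * F v ?u + t * F w ?u" by (rule sym_formD(2)[OF F vV' w u])
      also have "F v ?u = F ?u v" by (rule sym_formD(1)[OF F vV' u])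
      also have "F ?u v = 1 * F v v + t * F w v" by (rule sym_formD(2)[OF F vV' w vV'])
      also have "F w ?u = F ?u w" by (rule sym_formD(1)[OF F w u])
      also have "F ?u w = 1 * F v w + t * F w w" by (rule sym_formD(2)[OF F vV' w w])
      also have "F w v = F v w" by (rule sym_formD(1)[OF F w vV'])
      finally show ?thesis by (simp add: power2_eq_square algebra_simps)
    qed
    \<comment> \<open>Comparing v + t w with the maximiser: the part linear in t is dominated by a
      quadratic one and has to vanish.\<close>
    have "t * (2 * (A v w - l * B v w)) \<le> t\<^sup>2 * (l * B w w - A w w)" for t
      using le[OF fun_space_lin[OF V(1) vV' w, of 1 t]] unfolding ex[OF A] ex[OF s] Bvv l_def[symmetric]
      by (simp add: algebra_simps)
    then have "2 * (A v w - l * B v w) = 0" by (rule linear_le_quadratic_imp_zero)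
    then show "A v w = l * B v w" by simp
  qed
qed

text \<open>A maximal orthonormal family of eigenvectors spans \<open>V\<close>: otherwise its
  orthogonal complement \<open>W\<close> is nonzero and contains an eigenvector of the restricted
  form, which extends the family.\<close>

lemma eigenbasis_exists:
  assumes V: "fun_space V" "pos_form V B" "determining V P" and A: "sym_form V A"
  obtains m e l where "orthonormal V B m e" "\<And>v. v \<in> V ==> v = (\<lambda>x. \<Sum>i<m. B v (e i) * e i x)"
    "\<And>i w. i < m ==> w \<in> V ==> A (e i) w = l i * B (e i) w"
proof -
  have s: "sym_form V B" using V(2) by (simp add: pos_form_def)
  define Q where "Q = (\<lambda>m e. orthonormal V B m e \<and> (\<forall>i<m. \<exists>l. \<forall>w\<in>V. A (e i) w = l * B (e i) w))"
  obtain m e where me: "Q m e" "\<And>e'. \<not> Q (Suc m) e'"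
    by (rule maximal_family[OF V(1) s V(3), of Q "\<lambda>_ _. 0"]) (auto simp: Q_def orthonormal_def)
  have on: "orthonormal V B m e" using me(1) by (simp add: Q_def)
  obtain l where l: "\<And>i w. i < m ==> w \<in> V ==> A (e i) w = l i * B (e i) w"
    using me(1) unfolding Q_def by metis
  have eV: "e i \<in> V" if "i < m" for i using on that by (simp add: orthonormal_def)
  define W where "W = {v \<in> V. \<forall>i<m. B v (e i) = 0}"
  have WV: "W \<subseteq> V" by (auto simp: W_def)
  have "(\<lambda>_. 0) \<in> V" using V(1) by (simp add: fun_space_def)
  moreover have "B (\<lambda>_. 0) (e i) = 0" if "i < m" for i
    using sym_form_scale[OF s \<open>(\<lambda>_. 0) \<in> V\<close> eV[OF that], of 0] by simp
  ultimately have fW: "fun_space W"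
    unfolding fun_space_def W_def using fun_space_lin[OF V(1)] sym_formD(2)[OF s] eV by auto
  have sp: "v = (\<lambda>x. \<Sum>i<m. B v (e i) * e i x)" if v: "v \<in> V" for v
  proof (rule ccontr)
    assume nv: "v \<noteq> (\<lambda>x. \<Sum>i<m. B v (e i) * e i x)"
    note r = orthonormal_residual[OF V(1) s on v]
    let ?r = "\<lambda>x. v x - (\<Sum>i<m. B v (e i) * e i x)"
    have "?r \<in> W" using r by (simp add: W_def)
    moreover have "?r \<noteq> (\<lambda>_. 0)" using nv by (auto simp: fun_eq_iff)
    ultimately obtain u k where u: "u \<in> W" "u \<noteq> (\<lambda>_. 0)" and k: "\<And>w. w \<in> W ==> A u w = k * B u w"
      using eigenvector_exists[OF fW pos_form_subset[OF V(2) WV] determining_subset[OF V(3) WV] sym_form_subset[OF A WV]] by blast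
    have uV: "u \<in> V" and ue: "\<forall>i<m. B u (e i) = 0" using u(1) by (auto simp: W_def)
    \<comment> \<open>The eigenvalue relation carries over from \<open>W\<close> to
      \<open>V\<close>: on each old eigenvector \<open>A\<close> is a multiple of \<open>B\<close>,
      and \<open>B\<close> vanishes between it and \<open>u\<close>.\<close>
    have ku: "A u w = k * B u w" if w: "w \<in> V" for w
    proof -
      note r = orthonormal_residual[OF V(1) s on w]
      let ?p = "\<lambda>x. w x - (\<Sum>i<m. B w (e i) * e i x)" and ?q = "\<lambda>x. \<Sum>i<m. B w (e i) * e i x"
      have p: "?p \<in> W" using r by (simp add: W_def)
      have q: "?q \<in> V" using eV by (intro fun_space_sum[OF V(1)]) auto
      have w': "w = (\<lambda>x. 1 * ?p x + 1 * ?q x)" by auto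
      have F: "F u w = F u ?p + (\<Sum>i<m. B w (e i) * F (e i) u)" if F: "sym_form V F" for F
      proof -
        have "F u w = F w u" by (rule sym_formD(1)[OF F uV w])
        also have "\<dots> = F (\<lambda>x. 1 * ?p x + 1 * ?q x) u" using w' by simp
        also have "\<dots> = 1 * F ?p u + 1 * F ?q u" by (rule sym_formD(2)[OF F r(1) q uV])
        also have "F ?p u = F u ?p" by (rule sym_formD(1)[OF F r(1) uV])
        also have "F ?q u = (\<Sum>i<m. B w (e i) * F (e i) u)" using eV uV by (intro sym_form_sum[OF V(1) F]) auto
        finally show ?thesis by simp
      qed
      have e0: "B (e i) u = 0" if "i < m" for i using ue that sym_formD(1)[OF s uV eV[OF that]] by simp
      have "(\<Sum>i<m. B w (e i) * A (e i) u) = 0" "(\<Sum>i<m. B w (e i) * B (e i) u) = 0"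
        using l[OF _ uV] e0 by auto
      then show ?thesis using F[OF A] F[OF s] k[OF p] by simp
    qed
    let ?u = "\<lambda>x. (1 / sqrt (B u u)) * u x"
    have x: "orthonormal V B (Suc m) (e(m := ?u))"
      by (rule orthonormal_extend[where V = V and B = B and r = u]) (fact V(1,2) on uV u(2) ue)+
    have "A ?u w = k * B ?u w" if w: "w \<in> V" for w
      using sym_form_scale[OF A uV w, of "1 / sqrt (B u u)"] sym_form_scale[OF s uV w, of "1 / sqrt (B u u)"] ku[OF w]
      by (metis mult.left_commute)
    then have 1: "\<exists>l. \<forall>w\<in>V. A ?u w = l * B ?u w" by blast
    have 2: "\<forall>i<m. \<exists>l. \<forall>w\<in>V. A (e i) w = l * B (e i) w" using l by blast
    have "\<forall>i<Suc m. \<exists>l. \<forall>w\<in>V. A ((e(m := ?u)) i) w = l * B ((e(m := ?u)) i) w"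
    proof (intro allI impI)
      fix i assume i: "i < Suc m"
      show "\<exists>l. \<forall>w\<in>V. A ((e(m := ?u)) i) w = l * B ((e(m := ?u)) i) w"
      proof (cases "i = m")
        case True
        have "(e(m := ?u)) i = ?u" unfolding True by (rule fun_upd_same)
        with 1 show ?thesis by (simp only:)
      next
        case False
        have "(e(m := ?u)) i = e i" by (rule fun_upd_other[OF False])
        with 2 False i show ?thesis by (simp only:)
      qed
    qed
    with x have "Q (Suc m) (e(m := ?u))" unfolding Q_def by (rule conjI)
    with me(2) show False by blast
  qed
  show ?thesis
  proof (rule that)
    show "orthonormal V B m e" by (rule on)
    show "v = (\<lambda>x. \<Sum>i<m. B v (e i) * e i x)" if "v \<in> V" for v by (rule sp[OF that])
    show "A (e i) w = l i * B (e i) w" if "i < m" "w \<in> V" for i w by (rule l[OF that])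
  qed
qed

section \<open>The space \<open>L\<^sup>2(\<Omega>)\<close>\<close>

lemma L2_mult_integrable:
  assumes "v \<in> L2 \<Omega>" "w \<in> L2 \<Omega>"
  shows "integrable (lebesgue_on \<Omega>) (\<lambda>x. v x * w x)"
proof (rule Bochner_Integration.integrable_bound)
  show "integrable (lebesgue_on \<Omega>) (\<lambda>x. (v x)\<^sup>2 + (w x)\<^sup>2)"
    using assms by (intro Bochner_Integration.integrable_add) (auto simp: L2_def)
  show "(\<lambda>x. v x * w x) \<in> borel_measurable (lebesgue_on \<Omega>)"
    using assms by (intro borel_measurable_times) (auto simp: L2_def)
  have "\<bar>s * t\<bar> \<le> s\<^sup>2 + t\<^sup>2" for s t :: real
  proof -
    have "2 * (\<bar>s\<bar> * \<bar>t\<bar>) \<le> s\<^sup>2 + t\<^sup>2" using zero_le_power2[of "\<bar>s\<bar> - \<bar>t\<bar>"] by (simp add: power2_diff)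
    moreover have "0 \<le> \<bar>s\<bar> * \<bar>t\<bar>" by simp
    ultimately show ?thesis unfolding abs_mult by linarith
  qed
  then show "AE x in lebesgue_on \<Omega>. norm (v x * w x) \<le> norm ((v x)\<^sup>2 + (w x)\<^sup>2)"
    by (intro AE_I2) simp
qed

lemma fun_space_L2:
  fixes \<Omega> :: "(real^'d) set"
  shows "fun_space (L2 \<Omega>)"
  unfolding fun_space_def
proof (intro conjI ballI allI)
  show "(\<lambda>_. 0) \<in> L2 \<Omega>" by (simp add: L2_def)
  fix u v :: "real^'d => real" and a b :: real assume uv: "u \<in> L2 \<Omega>" "v \<in> L2 \<Omega>"
  have "integrable (lebesgue_on \<Omega>) (\<lambda>x. a\<^sup>2 * (u x * u x) + (2 * a * b) * (u x * v x) + b\<^sup>2 * (v x * v x))"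
    by (intro Bochner_Integration.integrable_add integrable_mult_right L2_mult_integrable uv)
  then have "integrable (lebesgue_on \<Omega>) (\<lambda>x. (a * u x + b * v x)\<^sup>2)"
    by (simp add: power2_eq_square algebra_simps)
  moreover have "(\<lambda>x. a * u x + b * v x) \<in> borel_measurable (lebesgue_on \<Omega>)" using uv by (auto simp: L2_def)
  ultimately show "(\<lambda>x. a * u x + b * v x) \<in> L2 \<Omega>" by (simp add: L2_def)
qed

lemma sym_form_inner2:
  fixes \<Omega> :: "(real^'d) set"
  shows "sym_form (L2 \<Omega>) (inner2 \<Omega>)"
  unfolding sym_form_def
proof (intro conjI ballI allI)
  fix u v w :: "real^'d => real" and a b :: real assume uv: "u \<in> L2 \<Omega>" "v \<in> L2 \<Omega>" "w \<in> L2 \<Omega>"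
  have "inner2 \<Omega> (\<lambda>x. a * u x + b * v x) w = (LINT x|lebesgue_on \<Omega>. a * (u x * w x) + b * (v x * w x))"
    by (simp add: inner2_def algebra_simps)
  also have "\<dots> = a * inner2 \<Omega> u w + b * inner2 \<Omega> v w" unfolding inner2_def
    by (subst Bochner_Integration.integral_add) (auto intro!: integrable_mult_right L2_mult_integrable uv)
  finally show "inner2 \<Omega> (\<lambda>x. a * u x + b * v x) w = a * inner2 \<Omega> u w + b * inner2 \<Omega> v w" .
qed (simp add: inner2_def mult.commute)

lemma L2_lin: "v \<in> L2 \<Omega> ==> w \<in> L2 \<Omega> ==> (\<lambda>x. a * v x + b * w x) \<in> L2 \<Omega>"
  by (rule fun_space_lin[OF fun_space_L2])

lemma L2_diff: "v \<in> L2 \<Omega> ==> w \<in> L2 \<Omega> ==> (\<lambda>x. v x - w x) \<in> L2 \<Omega>"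
  using L2_lin[of v \<Omega> w 1 "-1"] by simp

lemma L2_scale: "v \<in> L2 \<Omega> ==> (\<lambda>x. a * v x) \<in> L2 \<Omega>"
  by (rule fun_space_scale[OF fun_space_L2])

lemma inner2_commute: "inner2 \<Omega> v w = inner2 \<Omega> w v"
  by (simp add: inner2_def mult.commute)

lemma inner2_lin:
  "u \<in> L2 \<Omega> ==> v \<in> L2 \<Omega> ==> w \<in> L2 \<Omega> ==> inner2 \<Omega> (\<lambda>x. a * u x + b * v x) w = a * inner2 \<Omega> u w + b * inner2 \<Omega> v w"
  by (rule sym_formD(2)[OF sym_form_inner2])

lemma inner2_diff:
  "u \<in> L2 \<Omega> ==> v \<in> L2 \<Omega> ==> w \<in> L2 \<Omega> ==> inner2 \<Omega> (\<lambda>x. u x - v x) w = inner2 \<Omega> u w - inner2 \<Omega> v w"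
  using inner2_lin[of u \<Omega> v w 1 "-1"] by simp

lemma inner2_scale: "inner2 \<Omega> (\<lambda>x. c * u x) w = c * inner2 \<Omega> u w"
  by (simp add: inner2_def mult.assoc)

lemma inner2_nonneg: "0 \<le> inner2 \<Omega> v v"
  by (simp add: inner2_def integral_nonneg_AE)

lemma norm2_nonneg [simp]: "0 \<le> norm2 \<Omega> v"
  by (simp add: norm2_def inner2_nonneg)

lemma norm2_square: "(norm2 \<Omega> v)\<^sup>2 = inner2 \<Omega> v v"
  by (simp add: norm2_def inner2_nonneg)

lemma norm2_scale: "norm2 \<Omega> (\<lambda>x. c * u x) = \<bar>c\<bar> * norm2 \<Omega> u"
proof -
  have "inner2 \<Omega> (\<lambda>x. c * u x) (\<lambda>x. c * u x) = c\<^sup>2 * inner2 \<Omega> u u"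
    by (subst inner2_scale, subst inner2_commute, subst inner2_scale) (simp add: power2_eq_square)
  then show ?thesis by (simp add: norm2_def real_sqrt_mult)
qed

lemma inner2_le_norm2:
  assumes "v \<in> L2 \<Omega>" "w \<in> L2 \<Omega>"
  shows "inner2 \<Omega> v w \<le> norm2 \<Omega> v * norm2 \<Omega> w"
proof -
  let ?a = "norm2 \<Omega> v" and ?b = "norm2 \<Omega> w"
  \<comment> \<open>Enlarging both norms by a positive number avoids division by a vanishing norm;
    the limit at 0 gives the Cauchy-Schwarz inequality.\<close>
  have "inner2 \<Omega> v w \<le> (?a + \<epsilon>) * (?b + \<epsilon>)" if e: "0 < \<epsilon>" for \<epsilon>
  proof -
    define p q where "p = ?a + \<epsilon>" and "q = ?b + \<epsilon>"
    have p: "0 < p" "?a \<le> p" "0 < q" "?b \<le> q" using e by (auto simp: p_def q_def add_nonneg_pos)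
    let ?u = "\<lambda>x. q * v x + (- p) * w x"
    have u: "?u \<in> L2 \<Omega>" by (rule L2_lin[OF assms])
    have "0 \<le> inner2 \<Omega> ?u ?u" by (rule inner2_nonneg)
    also have "\<dots> = q * inner2 \<Omega> v ?u + (- p) * inner2 \<Omega> w ?u" by (rule inner2_lin[OF assms u])
    also have "inner2 \<Omega> v ?u = q * ?a\<^sup>2 + (- p) * inner2 \<Omega> v w"
      unfolding norm2_square using inner2_lin[OF assms assms(1), of q "- p"] by (simp only: inner2_commute)
    also have "inner2 \<Omega> w ?u = q * inner2 \<Omega> v w + (- p) * ?b\<^sup>2"
      unfolding norm2_square using inner2_lin[OF assms assms(2), of q "- p"] by (simp only: inner2_commute)
    finally have "2 * (p * q) * inner2 \<Omega> v w \<le> q\<^sup>2 * ?a\<^sup>2 + p\<^sup>2 * ?b\<^sup>2"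
      by (simp add: power2_eq_square algebra_simps)
    also have "\<dots> \<le> q\<^sup>2 * p\<^sup>2 + p\<^sup>2 * q\<^sup>2" using p by (intro add_mono mult_left_mono power_mono) auto
    also have "\<dots> = 2 * (p * q) * (p * q)" by (simp add: power2_eq_square)
    finally show ?thesis unfolding p_def[symmetric] q_def[symmetric]
      using p(1,3) by (simp add: mult_le_cancel_left_pos)
  qed
  then have "\<forall>\<^sub>F \<epsilon> in at_right 0. inner2 \<Omega> v w \<le> (?a + \<epsilon>) * (?b + \<epsilon>)"
    by (auto simp: eventually_at_right[of 0 1] intro!: exI[of _ 1])
  moreover have "((\<lambda>\<epsilon>. (?a + \<epsilon>) * (?b + \<epsilon>)) \<longlongrightarrow> (?a + 0) * (?b + 0)) (at_right 0)" by (intro tendsto_intros)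
  ultimately show ?thesis using tendsto_lowerbound[of "\<lambda>\<epsilon>. (?a + \<epsilon>) * (?b + \<epsilon>)"] by simp
qed

lemma abs_inner2_le_norm2:
  assumes "v \<in> L2 \<Omega>" "w \<in> L2 \<Omega>"
  shows "\<bar>inner2 \<Omega> v w\<bar> \<le> norm2 \<Omega> v * norm2 \<Omega> w"
  using inner2_le_norm2[OF assms] inner2_le_norm2[OF L2_scale[OF assms(1), of "-1"] assms(2)]
  unfolding inner2_scale norm2_scale by simp

lemma norm2_triangle:
  assumes "v \<in> L2 \<Omega>" "w \<in> L2 \<Omega>"
  shows "norm2 \<Omega> (\<lambda>x. v x + w x) \<le> norm2 \<Omega> v + norm2 \<Omega> w"
proof (rule power2_le_imp_le)
  let ?u = "\<lambda>x. 1 * v x + 1 * w x"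
  have u: "?u \<in> L2 \<Omega>" by (rule L2_lin[OF assms])
  have "inner2 \<Omega> ?u ?u = inner2 \<Omega> v ?u + inner2 \<Omega> w ?u" using inner2_lin[OF assms u, of 1 1] by simp
  moreover have "inner2 \<Omega> v ?u = inner2 \<Omega> v v + inner2 \<Omega> v w"
    using inner2_lin[OF assms assms(1), of 1 1] by (simp only: inner2_commute mult_1)
  moreover have "inner2 \<Omega> w ?u = inner2 \<Omega> v w + inner2 \<Omega> w w"
    using inner2_lin[OF assms assms(2), of 1 1] by (simp only: inner2_commute mult_1)
  ultimately show "(norm2 \<Omega> (\<lambda>x. v x + w x))\<^sup>2 \<le> (norm2 \<Omega> v + norm2 \<Omega> w)\<^sup>2"
    using inner2_le_norm2[OF assms] by (simp add: norm2_square power2_sum)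
qed simp

lemma norm2_lin_le:
  assumes "v \<in> L2 \<Omega>" "w \<in> L2 \<Omega>"
  shows "norm2 \<Omega> (\<lambda>x. a * v x + b * w x) \<le> \<bar>a\<bar> * norm2 \<Omega> v + \<bar>b\<bar> * norm2 \<Omega> w"
  using norm2_triangle[OF L2_scale[OF assms(1), of a] L2_scale[OF assms(2), of b]] by (simp add: norm2_scale)

lemma tendsto_inner2:
  assumes "\<And>k. v k \<in> L2 \<Omega>" "u \<in> L2 \<Omega>" "w \<in> L2 \<Omega>" "(\<lambda>k. norm2 \<Omega> (\<lambda>x. v k x - u x)) \<longlonglongrightarrow> 0"
  shows "(\<lambda>k. inner2 \<Omega> (v k) w) \<longlonglongrightarrow> inner2 \<Omega> u w"
proof -
  have "norm (inner2 \<Omega> (v k) w - inner2 \<Omega> u w) \<le> norm2 \<Omega> (\<lambda>x. v k x - u x) * norm2 \<Omega> w" for k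
    using abs_inner2_le_norm2[OF L2_diff[OF assms(1,2), of k] assms(3)] inner2_diff[OF assms(1,2,3), of k] by simp
  moreover have "(\<lambda>k. norm2 \<Omega> (\<lambda>x. v k x - u x) * norm2 \<Omega> w) \<longlonglongrightarrow> 0"
    using tendsto_mult_right[OF assms(4), of "norm2 \<Omega> w"] by simp
  ultimately have "(\<lambda>k. inner2 \<Omega> (v k) w - inner2 \<Omega> u w) \<longlonglongrightarrow> 0"
    by (rule Lim_null_comparison[OF always_eventually[OF allI]])
  then show ?thesis by (rule LIM_zero_cancel)
qed

lemma inner2_self_eq_0_AE:
  assumes "v \<in> L2 \<Omega>" "inner2 \<Omega> v v = 0"
  shows "AE x in lebesgue_on \<Omega>. v x = 0"
proof -
  have "AE x in lebesgue_on \<Omega>. v x * v x = 0"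
    using assms by (subst integral_nonneg_eq_0_iff_AE[symmetric]) (auto simp: inner2_def intro: L2_mult_integrable)
  then show ?thesis by simp
qed

section \<open>Test functions and \<open>H\<^sub>0\<^sup>1(\<Omega>)\<close>\<close>

lemma partial_lin:
  assumes "\<phi> differentiable_on UNIV" "\<psi> differentiable_on UNIV"
  shows "partial i (\<lambda>x. a * \<phi> x + b * \<psi> x) = (\<lambda>x. a * partial i \<phi> x + b * partial i \<psi> x)"
proof
  fix x
  have d: "(\<phi> has_derivative frechet_derivative \<phi> (at x)) (at x)" "(\<psi> has_derivative frechet_derivative \<psi> (at x)) (at x)"
    using assms by (auto simp: differentiable_on_def frechet_derivative_works[symmetric])
  have "((\<lambda>x. a * \<phi> x + b * \<psi> x) has_derivative (\<lambda>h. a * frechet_derivative \<phi> (at x) h + b * frechet_derivative \<psi> (at x) h)) (at x)"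
    using d by (intro has_derivative_add has_derivative_mult_right)
  from frechet_derivative_at[OF this, symmetric]
  show "partial i (\<lambda>x. a * \<phi> x + b * \<psi> x) x = a * partial i \<phi> x + b * partial i \<psi> x" by (simp add: partial_def)
qed

lemma foldr_partial_lin:
  assumes "\<And>is. foldr partial is \<phi> differentiable_on UNIV" "\<And>is. foldr partial is \<psi> differentiable_on UNIV"
  shows "foldr partial is (\<lambda>x. a * \<phi> x + b * \<psi> x) = (\<lambda>x. a * foldr partial is \<phi> x + b * foldr partial is \<psi> x)"
  by (induction "is") (simp_all add: partial_lin assms)

lemma test_function_lin:
  assumes "test_function \<Omega> \<phi>" "test_function \<Omega> \<psi>"
  shows "test_function \<Omega> (\<lambda>x. a * \<phi> x + b * \<psi> x)"
proof -
  have d: "\<And>is. foldr partial is \<phi> differentiable_on UNIV" "\<And>is. foldr partial is \<psi> differentiable_on UNIV"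
    using assms by (auto simp: test_function_def)
  obtain K L where K: "compact K" "K \<subseteq> \<Omega>" "\<forall>x. x \<notin> K \<longrightarrow> \<phi> x = 0" and L: "compact L" "L \<subseteq> \<Omega>" "\<forall>x. x \<notin> L \<longrightarrow> \<psi> x = 0"
    using assms unfolding test_function_def by blast
  have "foldr partial is (\<lambda>x. a * \<phi> x + b * \<psi> x) differentiable_on UNIV" for "is"
    unfolding foldr_partial_lin[OF d] using d by (intro differentiable_on_add differentiable_on_mult) auto
  moreover have "compact (K \<union> L)" "K \<union> L \<subseteq> \<Omega>" "\<forall>x. x \<notin> K \<union> L \<longrightarrow> a * \<phi> x + b * \<psi> x = 0"
    using K L by (auto intro: compact_Un)
  ultimately show ?thesis unfolding test_function_def by blast
qed

lemma partial_eq_0_outside: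
  assumes "closed K" "\<And>x. x \<notin> K ==> \<phi> x = 0" "x \<notin> K"
  shows "partial i \<phi> x = 0"
proof -
  have "(\<phi> has_derivative (\<lambda>_. 0)) (at x)"
    by (rule has_derivative_transform_within_open[where f = "\<lambda>_. 0" and s = "- K"]) (use assms in auto)
  from frechet_derivative_at[OF this, symmetric] show ?thesis by (simp add: partial_def)
qed

lemma test_function_partial:
  assumes "test_function \<Omega> \<phi>"
  shows "test_function \<Omega> (partial i \<phi>)"
proof -
  obtain K where K: "compact K" "K \<subseteq> \<Omega>" "\<forall>x. x \<notin> K \<longrightarrow> \<phi> x = 0"
    using assms unfolding test_function_def by blast
  have "foldr partial is (partial i \<phi>) differentiable_on UNIV" for "is"
  proof -
    have "foldr partial (is @ [i]) \<phi> differentiable_on UNIV" using assms by (simp only: test_function_def)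
    then show ?thesis by simp
  qed
  moreover have "\<forall>x. x \<notin> K \<longrightarrow> partial i \<phi> x = 0"
    using partial_eq_0_outside[of K \<phi>] compact_imp_closed[OF K(1)] K(3) by blast
  ultimately show ?thesis unfolding test_function_def using K(1,2) by blast
qed

lemma test_functionD:
  assumes "test_function \<Omega> \<phi>"
  shows "\<phi> differentiable_on UNIV" and "continuous_on UNIV \<phi>"
    and "\<exists>K. compact K \<and> K \<subseteq> \<Omega> \<and> (\<forall>x. x \<notin> K \<longrightarrow> \<phi> x = 0)"
proof -
  have "foldr partial [] \<phi> differentiable_on UNIV" using assms by (simp only: test_function_def)
  then show "\<phi> differentiable_on UNIV" by simp
  then show "continuous_on UNIV \<phi>" by (rule differentiable_imp_continuous_on)
qed (use assms in \<open>simp add: test_function_def\<close>)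

lemma integrable_continuous_compact_support:
  fixes f :: "real^'d => real"
  assumes "continuous_on UNIV f" "compact K" "\<And>x. x \<notin> K ==> f x = 0"
  shows "integrable lborel f"
proof -
  have "integrable lborel (\<lambda>x. indicator K x *\<^sub>R f x)"
    by (rule borel_integrable_compact[OF assms(2)]) (rule continuous_on_subset[OF assms(1) subset_UNIV])
  moreover have "(\<lambda>x. indicator K x *\<^sub>R f x) = f" using assms(3) by (auto simp: fun_eq_iff indicator_def)
  ultimately show ?thesis by simp
qed

text \<open>Difference quotients have integral 0 by translation invariance of Lebesgue measure, and
  they converge dominatedly to the partial derivative.\<close>

lemma integral_partial_eq_0:
  fixes w :: "real^'d => real"
  assumes d: "w differentiable_on UNIV" and c: "continuous_on UNIV (partial i w)"
    and K: "compact K" "\<And>x. x \<notin> K ==> w x = 0"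
  shows "(LINT x|lborel. partial i w x) = 0"
proof -
  have cont: "continuous_on UNIV w" by (rule differentiable_imp_continuous_on[OF d])
  have int: "integrable lborel w" by (rule integrable_continuous_compact_support[OF cont K])
  let ?e = "axis i (1::real) :: real^'d"
  have p0: "partial i w x = 0" if "x \<notin> K" for x
    by (rule partial_eq_0_outside[OF compact_imp_closed[OF K(1)] K(2) that])
  have line: "((\<lambda>s. w (x + s *\<^sub>R ?e)) has_real_derivative partial i w (x + s *\<^sub>R ?e)) (at s)" for x s
  proof -
    have "(w has_derivative frechet_derivative w (at (x + s *\<^sub>R ?e))) (at (x + s *\<^sub>R ?e))"
      using d by (simp add: differentiable_on_def frechet_derivative_works[symmetric])
    then have "((\<lambda>s. w (x + s *\<^sub>R ?e)) has_derivative (\<lambda>h. frechet_derivative w (at (x + s *\<^sub>R ?e)) (h *\<^sub>R ?e))) (at s)"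
      by (rule has_derivative_compose[rotated]) (auto intro!: derivative_eq_intros)
    moreover have "linear (frechet_derivative w (at (x + s *\<^sub>R ?e)))"
      using d by (intro linear_frechet_derivative) (simp add: differentiable_on_def)
    then have "frechet_derivative w (at (x + s *\<^sub>R ?e)) (h *\<^sub>R ?e) = partial i w (x + s *\<^sub>R ?e) * h" for h
      by (simp add: linear_scale partial_def)
    ultimately show ?thesis by (simp add: has_field_derivative_def)
  qed
  have "compact (partial i w ` K)" by (rule compact_continuous_image[OF continuous_on_subset[OF c subset_UNIV] K(1)])
  then obtain C0 where C0: "\<And>x. x \<in> K ==> \<bar>partial i w x\<bar> \<le> C0"
    using compact_imp_bounded by (force simp: bounded_iff)
  define C where "C = max C0 0"
  have C: "\<bar>partial i w x\<bar> \<le> C" for x using C0[of x] p0[of x] by (cases "x \<in> K") (auto simp: C_def)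
  obtain r where r: "0 < r" "K \<subseteq> cball 0 r" using bounded_subset_ballD[OF compact_imp_bounded[OF K(1)], of 0] ball_subset_cball by blast
  define q where "q = (\<lambda>(n::nat) x. (w (x + (1 / real (Suc n)) *\<^sub>R ?e) - w x) / (1 / real (Suc n)))"
  \<comment> \<open>The shifts have length at most 1, so all quotients vanish outside the ball of
    radius r + 1; inside it the mean value theorem bounds them.\<close>
  have q_bound: "norm (q n x) \<le> C * indicator (cball 0 (r + 1)) x" for n x
  proof (cases "x \<in> cball 0 (r + 1)")
    case True
    let ?h = "1 / real (Suc n)"
    have "\<exists>z>0. z < ?h \<and> w (x + ?h *\<^sub>R ?e) - w (x + 0 *\<^sub>R ?e) = (?h - 0) * partial i w (x + z *\<^sub>R ?e)"
      by (rule MVT2) (auto intro: line)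
    then obtain z where "w (x + ?h *\<^sub>R ?e) - w x = ?h * partial i w (x + z *\<^sub>R ?e)" by auto
    then have "q n x = partial i w (x + z *\<^sub>R ?e)" by (simp add: q_def)
    then show ?thesis using C True by simp
  next
    case False
    have n1: "norm ((1 / real (Suc n)) *\<^sub>R ?e) \<le> 1" by (simp add: norm_axis_1 divide_le_eq)
    then have "norm (x + (1 / real (Suc n)) *\<^sub>R ?e) \<ge> norm x - 1"
      using norm_triangle_ineq4[of "x + (1 / real (Suc n)) *\<^sub>R ?e" "(1 / real (Suc n)) *\<^sub>R ?e"] n1
      unfolding add_diff_cancel_right' by linarith
    then have "x + (1 / real (Suc n)) *\<^sub>R ?e \<notin> K" "x \<notin> K" using False r by (auto simp: subset_iff)
    then show ?thesis using K(2) False by (simp add: q_def)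
  qed
  have "(\<lambda>n. LINT x|lborel. q n x) \<longlonglongrightarrow> (LINT x|lborel. partial i w x)"
  proof (rule integral_dominated_convergence)
    show "integrable lborel (\<lambda>x. C * indicator (cball 0 (r + 1)) x :: real)"
      by (intro integrable_mult_right integrable_real_indicator emeasure_lborel_cball_finite) auto
    show "partial i w \<in> borel_measurable lborel" using borel_measurable_continuous_onI[OF c] by simp
    have qc: "continuous_on UNIV (q n)" for n
      unfolding q_def by (intro continuous_intros continuous_on_compose2[OF cont]) auto
    show "q n \<in> borel_measurable lborel" for n using borel_measurable_continuous_onI[OF qc, of n] by simp
    show "AE x in lborel. norm (q n x) \<le> C * indicator (cball 0 (r + 1)) x" for n using q_bound by simp
    have "(\<lambda>n. q n x) \<longlonglongrightarrow> partial i w x" for x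
    proof -
      have "((\<lambda>h. (w (x + (0 + h) *\<^sub>R ?e) - w (x + 0 *\<^sub>R ?e)) / h) \<longlongrightarrow> partial i w (x + 0 *\<^sub>R ?e)) (at 0)"
        using line[of x 0] unfolding DERIV_def by simp
      moreover have "filterlim (\<lambda>n. 1 / real (Suc n)) (at 0) sequentially"
        unfolding filterlim_at using LIMSEQ_inverse_real_of_nat by (auto simp: inverse_eq_divide)
      ultimately have "(\<lambda>n. (w (x + (0 + 1 / real (Suc n)) *\<^sub>R ?e) - w (x + 0 *\<^sub>R ?e)) / (1 / real (Suc n))) \<longlonglongrightarrow> partial i w (x + 0 *\<^sub>R ?e)"
        by (rule filterlim_compose)
      then show ?thesis by (simp add: q_def)
    qed
    then show "AE x in lborel. (\<lambda>n. q n x) \<longlonglongrightarrow> partial i w x" by simp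
  qed
  moreover have "(LINT x|lborel. q n x) = 0" for n
  proof -
    let ?t = "(1 / real (Suc n)) *\<^sub>R ?e"
    have "distr lborel borel (\<lambda>x. ?t + x) = lborel" by (rule lborel_distr_plus)
    then have "integrable (distr lborel borel (\<lambda>x. ?t + x)) w" "(LINT x|distr lborel borel (\<lambda>x. ?t + x). w x) = (LINT x|lborel. w x)"
      using int by simp_all
    then have "integrable lborel (\<lambda>x. w (?t + x))" "(LINT x|lborel. w (?t + x)) = (LINT x|lborel. w x)"
      using borel_measurable_continuous_onI[OF cont] by (simp_all add: integrable_distr_eq integral_distr)
    then show ?thesis unfolding q_def using int by (simp add: add.commute)
  qed
  ultimately show ?thesis using LIMSEQ_unique[of "\<lambda>n. 0::real" 0] by simp
qed

lemma lint_lebesgue_on_eq_lborel: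
  fixes f :: "real^'d => real"
  assumes "\<Omega> \<in> sets lebesgue" "\<And>x. x \<notin> \<Omega> ==> f x = 0" "f \<in> borel_measurable borel"
  shows "(LINT x|lebesgue_on \<Omega>. f x) = (LINT x|lborel. f x)"
proof -
  have "(LINT x|lebesgue_on \<Omega>. f x) = (LINT x|lebesgue. indicator \<Omega> x *\<^sub>R f x)"
    using assms(1) by (simp add: integral_restrict_space)
  also have "(\<lambda>x. indicator \<Omega> x *\<^sub>R f x) = f" using assms(2) by (auto simp: fun_eq_iff indicator_def)
  finally show ?thesis using assms(3) by (simp add: integral_completion)
qed

lemma test_function_L2:
  assumes "\<Omega> \<in> sets lebesgue" "test_function \<Omega> \<phi>"
  shows "\<phi> \<in> L2 \<Omega>"
proof -
  obtain K where K: "compact K" "K \<subseteq> \<Omega>" "\<forall>x. x \<notin> K \<longrightarrow> \<phi> x = 0" using test_functionD(3)[OF assms(2)] by blast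
  note c = test_functionD(2)[OF assms(2)]
  have m: "\<phi> \<in> borel_measurable borel" by (rule borel_measurable_continuous_onI[OF c])
  have "integrable lborel (\<lambda>x. (\<phi> x)\<^sup>2)"
    by (rule integrable_continuous_compact_support[OF _ K(1)]) (use K(3) c in \<open>auto intro: continuous_intros\<close>)
  then have "integrable lebesgue (\<lambda>x. (\<phi> x)\<^sup>2)" by (rule integrable_completion[THEN iffD2, rotated]) (use m in simp)
  then have "integrable (lebesgue_on \<Omega>) (\<lambda>x. (\<phi> x)\<^sup>2)"
    using assms(1) integrable_mult_indicator[of \<Omega> lebesgue "\<lambda>x. (\<phi> x)\<^sup>2"] by (simp add: integrable_restrict_space)
  moreover have "\<phi> \<in> borel_measurable (lebesgue_on \<Omega>)"
    using m by (intro measurable_restrict_space1 measurable_completion) simp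
  ultimately show ?thesis by (simp add: L2_def)
qed

lemma inner2_partial:
  assumes "\<Omega> \<in> sets lebesgue" "test_function \<Omega> \<phi>" "test_function \<Omega> \<psi>"
  shows "inner2 \<Omega> (partial i \<phi>) \<psi> = - inner2 \<Omega> \<phi> (partial i \<psi>)"
proof -
  let ?t = "\<lambda>x. \<phi> x * \<psi> x" and ?g = "\<lambda>x. partial i \<phi> x * \<psi> x + \<phi> x * partial i \<psi> x"
  obtain K where K: "compact K" "K \<subseteq> \<Omega>" "\<forall>x. x \<notin> K \<longrightarrow> \<phi> x = 0" using test_functionD(3)[OF assms(2)] by blast
  note d = test_functionD(1)[OF assms(2)] test_functionD(1)[OF assms(3)]
  note c = test_functionD(2)[OF assms(2)] test_functionD(2)[OF assms(3)]
    test_functionD(2)[OF test_function_partial[OF assms(2)]] test_functionD(2)[OF test_function_partial[OF assms(3)]]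
  have p: "partial i ?t = ?g"
  proof
    fix x
    have "(\<phi> has_derivative frechet_derivative \<phi> (at x)) (at x)" "(\<psi> has_derivative frechet_derivative \<psi> (at x)) (at x)"
      using d by (auto simp: differentiable_on_def frechet_derivative_works[symmetric])
    from frechet_derivative_at[OF has_derivative_mult[OF this], symmetric] show "partial i ?t x = ?g x" by (simp add: partial_def)
  qed
  have cg: "continuous_on UNIV ?g" by (intro continuous_intros c)
  have "(LINT x|lborel. partial i ?t x) = 0"
    by (rule integral_partial_eq_0[of _ _ K]) (use d K cg p in \<open>auto intro: differentiable_on_mult\<close>)
  moreover have "?g x = 0" if "x \<notin> \<Omega>" for x
  proof -
    have x: "x \<notin> K" using K(2) that by blast
    have "partial i \<phi> x = 0" by (rule partial_eq_0_outside[OF compact_imp_closed[OF K(1)] _ x]) (use K(3) in blast)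
    then show ?thesis using K(3) x by simp
  qed
  then have "(LINT x|lebesgue_on \<Omega>. ?g x) = (LINT x|lborel. ?g x)"
    by (intro lint_lebesgue_on_eq_lborel[OF assms(1)] borel_measurable_continuous_onI[OF cg])
  ultimately have "(LINT x|lebesgue_on \<Omega>. ?g x) = 0" by (simp add: p)
  moreover have "(LINT x|lebesgue_on \<Omega>. ?g x) = inner2 \<Omega> (partial i \<phi>) \<psi> + inner2 \<Omega> \<phi> (partial i \<psi>)"
    unfolding inner2_def using assms
    by (intro Bochner_Integration.integral_add L2_mult_integrable test_function_L2 test_function_partial)
  ultimately show ?thesis by simp
qed

lemma has_H10_gradientD:
  fixes G :: "real^'d => real^'d"
  assumes "has_H10_gradient \<Omega> u G"
  shows "u \<in> L2 \<Omega>" and "\<And>i. (\<lambda>x. G x $ i) \<in> L2 \<Omega>"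
  using assms by (auto simp: has_H10_gradient_def)

lemma has_H10_gradient_lin:
  fixes G H :: "real^'d => real^'d"
  assumes "\<Omega> \<in> sets lebesgue" "has_H10_gradient \<Omega> u G" "has_H10_gradient \<Omega> v H"
  shows "has_H10_gradient \<Omega> (\<lambda>x. a * u x + b * v x) (\<lambda>x. a *\<^sub>R G x + b *\<^sub>R H x)"
proof -
  obtain \<phi> where p: "\<And>k::nat. test_function \<Omega> (\<phi> k)" "(\<lambda>k. norm2 \<Omega> (\<lambda>x. \<phi> k x - u x)) \<longlonglongrightarrow> 0"
    "\<And>i. (\<lambda>k. norm2 \<Omega> (\<lambda>x. partial i (\<phi> k) x - G x $ i)) \<longlonglongrightarrow> 0"
    using assms(2) unfolding has_H10_gradient_def by blast
  obtain \<psi> where q: "\<And>k::nat. test_function \<Omega> (\<psi> k)" "(\<lambda>k. norm2 \<Omega> (\<lambda>x. \<psi> k x - v x)) \<longlonglongrightarrow> 0"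
    "\<And>i. (\<lambda>k. norm2 \<Omega> (\<lambda>x. partial i (\<psi> k) x - H x $ i)) \<longlonglongrightarrow> 0"
    using assms(3) unfolding has_H10_gradient_def by blast
  note L = has_H10_gradientD[OF assms(2)] has_H10_gradientD[OF assms(3)]
  note T = test_function_L2[OF assms(1)] test_function_L2[OF assms(1) test_function_partial]
  have lim: "(\<lambda>k. norm2 \<Omega> (\<lambda>x. (a * f k x + b * g k x) - (a * fl x + b * gl x))) \<longlonglongrightarrow> 0"
    if "\<And>k. f k \<in> L2 \<Omega>" "\<And>k. g k \<in> L2 \<Omega>" "fl \<in> L2 \<Omega>" "gl \<in> L2 \<Omega>"
      "(\<lambda>k. norm2 \<Omega> (\<lambda>x. f k x - fl x)) \<longlonglongrightarrow> 0" "(\<lambda>k. norm2 \<Omega> (\<lambda>x. g k x - gl x)) \<longlonglongrightarrow> 0" for f g fl gl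
  proof (rule Lim_null_comparison[OF always_eventually[OF allI]])
    fix k
    have "norm2 \<Omega> (\<lambda>x. a * (f k x - fl x) + b * (g k x - gl x)) \<le> \<bar>a\<bar> * norm2 \<Omega> (\<lambda>x. f k x - fl x) + \<bar>b\<bar> * norm2 \<Omega> (\<lambda>x. g k x - gl x)"
      by (intro norm2_lin_le L2_diff that)
    then show "norm (norm2 \<Omega> (\<lambda>x. (a * f k x + b * g k x) - (a * fl x + b * gl x))) \<le> \<bar>a\<bar> * norm2 \<Omega> (\<lambda>x. f k x - fl x) + \<bar>b\<bar> * norm2 \<Omega> (\<lambda>x. g k x - gl x)"
      by (simp add: algebra_simps)
  next
    have "(\<lambda>k. \<bar>a\<bar> * norm2 \<Omega> (\<lambda>x. f k x - fl x) + \<bar>b\<bar> * norm2 \<Omega> (\<lambda>x. g k x - gl x)) \<longlonglongrightarrow> \<bar>a\<bar> * 0 + \<bar>b\<bar> * 0"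
      by (intro tendsto_intros that)
    then show "(\<lambda>k. \<bar>a\<bar> * norm2 \<Omega> (\<lambda>x. f k x - fl x) + \<bar>b\<bar> * norm2 \<Omega> (\<lambda>x. g k x - gl x)) \<longlonglongrightarrow> 0" by simp
  qed
  have pl: "partial i (\<lambda>x. a * \<phi> k x + b * \<psi> k x) = (\<lambda>x. a * partial i (\<phi> k) x + b * partial i (\<psi> k) x)" for i k
    by (rule partial_lin[OF test_functionD(1)[OF p(1)] test_functionD(1)[OF q(1)]])
  have 1: "\<forall>k. test_function \<Omega> (\<lambda>x. a * \<phi> k x + b * \<psi> k x)" using test_function_lin[OF p(1) q(1)] by blast
  have 2: "(\<lambda>k. norm2 \<Omega> (\<lambda>x. (a * \<phi> k x + b * \<psi> k x) - (a * u x + b * v x))) \<longlonglongrightarrow> 0"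
    by (rule lim[OF T(1)[OF p(1)] T(1)[OF q(1)] L(1,3) p(2) q(2)])
  have 3: "(\<lambda>k. norm2 \<Omega> (\<lambda>x. partial i (\<lambda>x. a * \<phi> k x + b * \<psi> k x) x - (a *\<^sub>R G x + b *\<^sub>R H x) $ i)) \<longlonglongrightarrow> 0" for i
    unfolding pl
    using lim[where f = "\<lambda>k. partial i (\<phi> k)" and g = "\<lambda>k. partial i (\<psi> k)" and fl = "\<lambda>x. G x $ i" and gl = "\<lambda>x. H x $ i",
        OF T(2)[OF p(1)] T(2)[OF q(1)] L(2) L(4) p(3) q(3)] by simp
  have 4: "(\<lambda>x. a * u x + b * v x) \<in> L2 \<Omega>" "\<forall>i. (\<lambda>x. (a *\<^sub>R G x + b *\<^sub>R H x) $ i) \<in> L2 \<Omega>"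
    using L2_lin[OF L(1,3)] L2_lin[OF L(2,4)] by auto
  show ?thesis unfolding has_H10_gradient_def
    using 1 2 3 4 by (intro conjI exI[of _ "\<lambda>k x. a * \<phi> k x + b * \<psi> k x"]) auto
qed

text \<open>The components of a gradient of 0 are orthogonal to all test functions, in particular to the
  partial derivatives by which they are approximated.\<close>

lemma has_H10_gradient_0:
  fixes D :: "real^'d => real^'d"
  assumes \<Omega>: "\<Omega> \<in> sets lebesgue" and "has_H10_gradient \<Omega> (\<lambda>_. 0) D"
  shows "AE x in lebesgue_on \<Omega>. D x $ i = 0"
proof -
  obtain \<phi> where p: "\<And>k::nat. test_function \<Omega> (\<phi> k)" "(\<lambda>k. norm2 \<Omega> (\<lambda>x. \<phi> k x - 0)) \<longlonglongrightarrow> 0"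
    "\<And>i. (\<lambda>k. norm2 \<Omega> (\<lambda>x. partial i (\<phi> k) x - D x $ i)) \<longlonglongrightarrow> 0"
    using assms(2) unfolding has_H10_gradient_def by blast
  note D = has_H10_gradientD(2)[OF assms(2), of i]
  note T = test_function_L2[OF \<Omega> p(1)] test_function_L2[OF \<Omega> test_function_partial[OF p(1)]]
  have orth: "inner2 \<Omega> (\<lambda>x. D x $ i) \<omega> = 0" if \<omega>: "test_function \<Omega> \<omega>" for \<omega>
  proof -
    have "(\<lambda>k. inner2 \<Omega> (partial i (\<phi> k)) \<omega>) \<longlonglongrightarrow> inner2 \<Omega> (\<lambda>x. D x $ i) \<omega>"
      by (rule tendsto_inner2[OF T(2) D test_function_L2[OF \<Omega> \<omega>] p(3)])
    moreover have "(\<lambda>k. - inner2 \<Omega> (\<phi> k) (partial i \<omega>)) \<longlonglongrightarrow> - inner2 \<Omega> (\<lambda>_. 0) (partial i \<omega>)"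
      by (intro tendsto_minus tendsto_inner2[OF T(1) has_H10_gradientD(1)[OF assms(2)] test_function_L2[OF \<Omega> test_function_partial[OF \<omega>]] p(2)])
    ultimately have "inner2 \<Omega> (\<lambda>x. D x $ i) \<omega> = - inner2 \<Omega> (\<lambda>_. 0) (partial i \<omega>)"
      unfolding inner2_partial[OF \<Omega> p(1) \<omega>] by (rule LIMSEQ_unique)
    then show ?thesis by (simp add: inner2_def)
  qed
  have "(\<lambda>k. inner2 \<Omega> (partial i (\<phi> k)) (\<lambda>x. D x $ i)) \<longlonglongrightarrow> inner2 \<Omega> (\<lambda>x. D x $ i) (\<lambda>x. D x $ i)"
    by (rule tendsto_inner2[OF T(2) D D p(3)])
  moreover have "inner2 \<Omega> (partial i (\<phi> k)) (\<lambda>x. D x $ i) = 0" for k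
    using orth[OF test_function_partial[OF p(1)]] by (simp only: inner2_commute)
  ultimately have "inner2 \<Omega> (\<lambda>x. D x $ i) (\<lambda>x. D x $ i) = 0"
    using LIMSEQ_unique[of "\<lambda>_. 0::real" 0] by simp
  then show ?thesis by (rule inner2_self_eq_0_AE[OF D])
qed

text \<open>\<open>grad\<close> merely selects some gradient. Uniqueness up to null sets makes it
  linear almost everywhere, which is what the bilinearity of \<open>bilin\<close> needs.\<close>

lemma has_H10_gradient_unique:
  fixes G H :: "real^'d => real^'d"
  assumes "\<Omega> \<in> sets lebesgue" "has_H10_gradient \<Omega> u G" "has_H10_gradient \<Omega> u H"
  shows "AE x in lebesgue_on \<Omega>. G x = H x"
proof -
  have "has_H10_gradient \<Omega> (\<lambda>x. 1 * u x + (- 1) * u x) (\<lambda>x. 1 *\<^sub>R G x + (- 1) *\<^sub>R H x)"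
    by (rule has_H10_gradient_lin[OF assms])
  then have "has_H10_gradient \<Omega> (\<lambda>_. 0) (\<lambda>x. G x - H x)" by simp
  from has_H10_gradient_0[OF assms(1) this]
  have "\<forall>i\<in>UNIV. AE x in lebesgue_on \<Omega>. (G x - H x) $ i = 0" by blast
  then have "AE x in lebesgue_on \<Omega>. \<forall>i\<in>UNIV. (G x - H x) $ i = 0" by (subst AE_ball_countable) auto
  then show ?thesis by (rule eventually_mono) (simp add: vec_eq_iff)
qed

lemma has_H10_gradient_grad: "u \<in> H10 \<Omega> ==> has_H10_gradient \<Omega> u (grad \<Omega> u)"
  unfolding grad_def by (rule someI_ex[of "has_H10_gradient \<Omega> u"]) (simp add: H10_def)

lemma grad_lin_AE:
  assumes "\<Omega> \<in> sets lebesgue" "u \<in> H10 \<Omega>" "v \<in> H10 \<Omega>"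
  shows "AE x in lebesgue_on \<Omega>. grad \<Omega> (\<lambda>x. a * u x + b * v x) x = a *\<^sub>R grad \<Omega> u x + b *\<^sub>R grad \<Omega> v x"
proof -
  have l: "has_H10_gradient \<Omega> (\<lambda>x. a * u x + b * v x) (\<lambda>x. a *\<^sub>R grad \<Omega> u x + b *\<^sub>R grad \<Omega> v x)"
    using assms by (intro has_H10_gradient_lin has_H10_gradient_grad)
  then have "(\<lambda>x. a * u x + b * v x) \<in> H10 \<Omega>" unfolding H10_def by blast
  then show ?thesis by (intro has_H10_gradient_unique[OF assms(1) _ l] has_H10_gradient_grad)
qed

lemma fun_space_H10:
  fixes \<Omega> :: "(real^'d) set"
  assumes "\<Omega> \<in> sets lebesgue"
  shows "fun_space (H10 \<Omega>)"
  unfolding fun_space_def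
proof (intro conjI ballI allI)
  have t: "test_function \<Omega> (\<lambda>_::real^'d. 0)"
  proof -
    have p: "partial i (\<lambda>_::real^'d. 0) = (\<lambda>_. 0)" for i
      using partial_eq_0_outside[of "{}" "\<lambda>_. 0"] by (auto simp: fun_eq_iff)
    have "foldr partial is (\<lambda>_::real^'d. 0) = (\<lambda>_. 0)" for "is" by (induction "is") (simp_all add: p)
    then show ?thesis unfolding test_function_def by (auto intro!: exI[of _ "{}"])
  qed
  have "partial i (\<lambda>_::real^'d. 0) x = 0" for i x using partial_eq_0_outside[of "{}" "\<lambda>_. 0"] by auto
  then have "has_H10_gradient \<Omega> (\<lambda>_. 0) (\<lambda>_. 0)"
    unfolding has_H10_gradient_def using t
    by (auto intro!: exI[of _ "\<lambda>_ _. 0"] simp: L2_def norm2_def inner2_def)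
  then show "(\<lambda>_. 0) \<in> H10 \<Omega>" unfolding H10_def by blast
  show "(\<lambda>x. a * u x + b * v x) \<in> H10 \<Omega>" if "u \<in> H10 \<Omega>" "v \<in> H10 \<Omega>" for u v a b
    using has_H10_gradient_lin[OF assms has_H10_gradient_grad[OF that(1)] has_H10_gradient_grad[OF that(2)]]
    unfolding H10_def by blast
qed

lemma H10_L2: "u \<in> H10 \<Omega> ==> u \<in> L2 \<Omega>"
  by (auto simp: H10_def has_H10_gradient_def)

lemma integrable_bounded_mult:
  fixes f g :: "'a => real"
  assumes "integrable M f" "g \<in> borel_measurable M" "\<And>x. x \<in> space M ==> \<bar>g x\<bar> \<le> C"
  shows "integrable M (\<lambda>x. g x * f x)"
proof (rule Bochner_Integration.integrable_bound)
  show "integrable M (\<lambda>x. C * f x)" by (rule integrable_mult_right[OF assms(1)])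
  show "(\<lambda>x. g x * f x) \<in> borel_measurable M" using assms by auto
  show "AE x in M. norm (g x * f x) \<le> norm (C * f x)"
    using assms(3) by (intro AE_I2) (force simp: abs_mult intro!: mult_right_mono)
qed

lemma bilin_integrable:
  fixes \<Omega> :: "(real^'d) set"
  assumes "\<Omega> \<in> sets lebesgue" "elliptic_operator \<Omega> a c0" "u \<in> H10 \<Omega>" "v \<in> H10 \<Omega>"
  shows "integrable (lebesgue_on \<Omega>) (\<lambda>x. (a x *v grad \<Omega> u x) \<bullet> grad \<Omega> v x + c0 x * u x * v x)"
proof -
  obtain M where M: "\<And>x i j. x \<in> \<Omega> ==> \<bar>a x $ i $ j\<bar> \<le> M" "\<And>x. x \<in> \<Omega> ==> \<bar>c0 x\<bar> \<le> M"
    and m: "\<And>i j. (\<lambda>x. a x $ i $ j) \<in> borel_measurable (lebesgue_on \<Omega>)" "c0 \<in> borel_measurable (lebesgue_on \<Omega>)"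
    using assms(2) unfolding elliptic_operator_def by blast
  note g = has_H10_gradientD(2)[OF has_H10_gradient_grad[OF assms(3)]] has_H10_gradientD(2)[OF has_H10_gradient_grad[OF assms(4)]]
  have sp: "space (lebesgue_on \<Omega>) = \<Omega>" using assms(1) by (simp add: space_restrict_space)
  have "integrable (lebesgue_on \<Omega>) (\<lambda>x. (\<Sum>i\<in>UNIV. \<Sum>j\<in>UNIV. a x $ i $ j * (grad \<Omega> u x $ j * grad \<Omega> v x $ i)) + c0 x * (u x * v x))"
    by (intro Bochner_Integration.integrable_add Bochner_Integration.integrable_sum integrable_bounded_mult[where C = M]
        L2_mult_integrable g H10_L2 assms(3,4) m) (use M sp in auto)
  then show ?thesis by (simp add: inner_vec_def matrix_vector_mult_def sum_distrib_right mult.assoc)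
qed

lemma sym_form_bilin:
  fixes \<Omega> :: "(real^'d) set"
  assumes \<Omega>: "\<Omega> \<in> sets lebesgue" and e: "elliptic_operator \<Omega> a c0"
  shows "sym_form (H10 \<Omega>) (bilin \<Omega> a c0)"
  unfolding sym_form_def
proof (intro conjI ballI allI)
  fix u v assume "u \<in> H10 \<Omega>" "v \<in> H10 \<Omega>"
  have t: "transpose (a x) = a x" if "x \<in> \<Omega>" for x using e that by (simp add: elliptic_operator_def)
  have "(a x *v p) \<bullet> q = (a x *v q) \<bullet> p" if "x \<in> \<Omega>" for x p q
    using dot_lmul_matrix[of p "a x" q] t[OF that] by (metis inner_commute transpose_matrix_vector)
  then show "bilin \<Omega> a c0 u v = bilin \<Omega> a c0 v u"
    unfolding bilin_def using \<Omega> by (intro Bochner_Integration.integral_cong) (auto simp: space_restrict_space)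
next
  fix u v w s t assume uv: "u \<in> H10 \<Omega>" "v \<in> H10 \<Omega>" "w \<in> H10 \<Omega>"
  let ?I = "\<lambda>u x. (a x *v grad \<Omega> u x) \<bullet> grad \<Omega> w x + c0 x * u x * w x"
  have l: "(\<lambda>x. s * u x + t * v x) \<in> H10 \<Omega>" by (rule fun_space_lin[OF fun_space_H10[OF \<Omega>] uv(1,2)])
  have "bilin \<Omega> a c0 (\<lambda>x. s * u x + t * v x) w = (LINT x|lebesgue_on \<Omega>. s * ?I u x + t * ?I v x)"
    unfolding bilin_def
  proof (rule integral_cong_AE)
    show "?I (\<lambda>x. s * u x + t * v x) \<in> borel_measurable (lebesgue_on \<Omega>)"
      using bilin_integrable[OF \<Omega> e l uv(3)] by (rule borel_measurable_integrable)
    show "(\<lambda>x. s * ?I u x + t * ?I v x) \<in> borel_measurable (lebesgue_on \<Omega>)"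
      by (rule borel_measurable_integrable[OF Bochner_Integration.integrable_add[OF integrable_mult_right[OF bilin_integrable[OF \<Omega> e uv(1,3)]]
            integrable_mult_right[OF bilin_integrable[OF \<Omega> e uv(2,3)]]]])
    show "AE x in lebesgue_on \<Omega>. ?I (\<lambda>x. s * u x + t * v x) x = s * ?I u x + t * ?I v x"
      using grad_lin_AE[OF \<Omega> uv(1,2), of s t]
      by (rule eventually_mono) (simp add: matrix_vector_right_distrib inner_add_left scaleR_matrix_vector_assoc[symmetric] matrix_vector_mult_scaleR algebra_simps)
  qed
  also have "\<dots> = s * bilin \<Omega> a c0 u w + t * bilin \<Omega> a c0 v w"
    unfolding bilin_def
    by (subst Bochner_Integration.integral_add[OF integrable_mult_right[OF bilin_integrable[OF \<Omega> e uv(1,3)]]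
          integrable_mult_right[OF bilin_integrable[OF \<Omega> e uv(2,3)]]]) (simp only: integral_mult_right_zero)
  finally show "bilin \<Omega> a c0 (\<lambda>x. s * u x + t * v x) w = s * bilin \<Omega> a c0 u w + t * bilin \<Omega> a c0 v w" .
qed

section \<open>The finite element space\<close>

lemma fun_space_fe_space:
  assumes "\<Omega> \<in> sets lebesgue"
  shows "fun_space (fe_space \<Omega> \<T>)"
  unfolding fun_space_def
proof (intro conjI ballI allI)
  show "(\<lambda>_. 0) \<in> fe_space \<Omega> \<T>"
    using fun_space_H10[OF assms] unfolding fe_space_def fun_space_def by (auto intro!: exI[of _ 0])
  fix u v a b assume uv: "u \<in> fe_space \<Omega> \<T>" "v \<in> fe_space \<Omega> \<T>"
  have "(\<lambda>x. a * u x + b * v x) \<in> H10 \<Omega>" using uv by (intro fun_space_lin[OF fun_space_H10[OF assms]]) (auto simp: fe_space_def)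
  moreover have "continuous_on UNIV (\<lambda>x. a * u x + b * v x)" using uv by (auto simp: fe_space_def intro!: continuous_intros)
  moreover have "\<exists>p q. \<forall>x\<in>K. a * u x + b * v x = p + q \<bullet> x" if K: "K \<in> \<T>" for K
  proof -
    obtain p q where "\<forall>x\<in>K. u x = p + q \<bullet> x" using uv(1) K unfolding fe_space_def by blast
    moreover obtain p' q' where "\<forall>x\<in>K. v x = p' + q' \<bullet> x" using uv(2) K unfolding fe_space_def by blast
    ultimately have "\<forall>x\<in>K. a * u x + b * v x = (a * p + b * p') + (a *\<^sub>R q + b *\<^sub>R q') \<bullet> x"
      by (simp add: inner_add_left algebra_simps)
    then show ?thesis by blast
  qed
  ultimately show "(\<lambda>x. a * u x + b * v x) \<in> fe_space \<Omega> \<T>" using uv by (auto simp: fe_space_def)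
qed

lemma fe_space_H10: "fe_space \<Omega> \<T> \<subseteq> H10 \<Omega>"
  by (auto simp: fe_space_def)

lemma fe_space_L2: "v \<in> fe_space \<Omega> \<T> ==> v \<in> L2 \<Omega>"
  by (intro H10_L2) (simp add: fe_space_def)

text \<open>Elements are continuous and vanish outside the domain. If the norm is 0, the open set of
  nonzero values is negligible and hence empty, so the element is the zero function and not only
  zero almost everywhere.\<close>

lemma pos_form_fe_space:
  fixes \<Omega> :: "(real^'d) set"
  assumes "open \<Omega>"
  shows "pos_form (fe_space \<Omega> \<T>) (inner2 \<Omega>)"
  unfolding pos_form_def
proof (intro conjI ballI impI)
  show "sym_form (fe_space \<Omega> \<T>) (inner2 \<Omega>)"
    by (rule sym_form_subset[OF sym_form_inner2]) (auto intro: fe_space_L2)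
  fix v assume v: "v \<in> fe_space \<Omega> \<T>" "v \<noteq> (\<lambda>_. 0)"
  then obtain x0 where x0: "v x0 \<noteq> 0" by auto
  have c: "continuous_on UNIV v" and z: "\<And>x. x \<notin> \<Omega> ==> v x = 0" using v by (auto simp: fe_space_def)
  have x0\<Omega>: "x0 \<in> \<Omega>" using z x0 by blast
  have op: "open {x. v x \<noteq> 0}" by (intro open_Collect_neq c continuous_intros)
  show "0 < inner2 \<Omega> v v"
  proof (rule ccontr)
    assume "\<not> 0 < inner2 \<Omega> v v"
    then have "inner2 \<Omega> v v = 0" using inner2_nonneg[of \<Omega> v] by simp
    then have "AE x in lebesgue_on \<Omega>. v x = 0" by (rule inner2_self_eq_0_AE[OF fe_space_L2[OF v(1)]])
    then have "AE x in lebesgue. x \<in> \<Omega> \<longrightarrow> v x = 0"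
      using assms by (subst (asm) AE_restrict_space_iff) auto
    then have "AE x in lebesgue. v x = 0" by (rule eventually_mono) (use z in blast)
    then have "negligible {x. v x \<noteq> 0}"
      unfolding negligible_iff_null_sets using AE_iff_null_sets[of "{x. v x \<noteq> 0}" lebesgue] op by (auto simp: eventually_ae_filter null_sets_def)
    then show False using open_not_negligible[of "{x. v x \<noteq> 0}"] op x0 by auto
  qed
qed

definition vertices :: "(real^'d) set set => (real^'d) set" where
  "vertices \<T> = \<Union>((\<lambda>K. SOME C. \<not> affine_dependent C \<and> K = convex hull C) ` \<T>)"

text \<open>On a simplex an element is affine, and its zero set there is cut out by an affine
  equation. That set is convex and contains the vertices, hence the whole simplex; outside the
  domain the element is 0 by construction.\<close>

lemma determining_fe_space:
  fixes \<Omega> :: "(real^'d) set"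
  assumes "regular_triangulation \<kappa> \<Omega> h \<T>"
  shows "determining (fe_space \<Omega> \<T>) (vertices \<T>)"
proof -
  have fin: "finite \<T>" and U: "\<Union>\<T> = closure \<Omega>"
    using assms by (auto simp: regular_triangulation_def triangulation_def)
  let ?C = "\<lambda>K::(real^'d) set. SOME C. \<not> affine_dependent C \<and> K = convex hull C"
  have C: "\<not> affine_dependent (?C K) \<and> K = convex hull (?C K)" if "K \<in> \<T>" for K
  proof (rule someI_ex)
    have "int CARD('d) simplex K" using assms that by (simp add: regular_triangulation_def)
    then show "\<exists>C. \<not> affine_dependent C \<and> K = convex hull C" unfolding simplex_def by blast
  qed
  have "finite (vertices \<T>)" unfolding vertices_def using fin C aff_independent_finite by blast
  moreover have "v x = 0" if v: "v \<in> fe_space \<Omega> \<T>" and z: "\<forall>p\<in>vertices \<T>. v p = 0" for v x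
  proof (cases "x \<in> \<Omega>")
    case True
    then obtain K where K: "K \<in> \<T>" "x \<in> K" using U closure_subset by blast
    obtain p q where pq: "\<forall>x\<in>K. v x = p + q \<bullet> x" using v K(1) unfolding fe_space_def by blast
    have s: "?C K \<subseteq> K" using C[OF K(1)] hull_subset by metis
    have "convex {x. q \<bullet> x = - p}" by (rule convex_hyperplane)
    moreover have "?C K \<subseteq> {x. q \<bullet> x = - p}"
    proof
      fix y assume y: "y \<in> ?C K"
      then have "v y = 0" using z K(1) unfolding vertices_def by blast
      then show "y \<in> {x. q \<bullet> x = - p}" using pq s y by auto
    qed
    ultimately have "convex hull (?C K) \<subseteq> {x. q \<bullet> x = - p}" by (rule hull_minimal[rotated])
    then have "q \<bullet> x = - p" using K C[OF K(1)] by blast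
    then show ?thesis using pq K(2) by simp
  next
    case False
    then show ?thesis using v by (simp add: fe_space_def)
  qed
  ultimately show ?thesis unfolding determining_def by blast
qed

section \<open>Spectral decomposition of the discrete problem\<close>

text \<open>Collects what the remaining argument uses about \<open>X\<close> and \<open>Ah\<close>,
  so that it no longer refers to meshes. The last conjunct retains finite determination, which is
  needed to express coordinates by point values.\<close>

definition eigenbasis ::
  "(real^'d) set => (real^'d => real) set => ((real^'d => real) => real^'d => real) =>
   nat => (nat => real^'d => real) => (nat => real) => bool" where
  "eigenbasis \<Omega> X Ah m e l \<longleftrightarrow> fun_space X \<and> X \<subseteq> L2 \<Omega> \<and> pos_form X (inner2 \<Omega>) \<and> orthonormal X (inner2 \<Omega>) m e \<and>
     (\<forall>v\<in>X. v = (\<lambda>x. \<Sum>i<m. inner2 \<Omega> v (e i) * e i x)) \<and> (\<forall>i<m. 0 < l i) \<and>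
     (\<forall>v\<in>X. Ah v = (\<lambda>x. \<Sum>i<m. l i * inner2 \<Omega> v (e i) * e i x)) \<and> (\<exists>P. determining X P)"

text \<open>Evaluates in coordinates the definite descriptions by which \<open>L2_proj\<close> and
  \<open>discrete_op\<close> are defined.\<close>

lemma riesz_representative:
  assumes V: "fun_space V" "pos_form V B" "orthonormal V B m e" and sp: "\<And>v. v \<in> V ==> v = (\<lambda>x. \<Sum>i<m. B v (e i) * e i x)"
    and L: "\<And>v. v \<in> V ==> L v = (\<Sum>i<m. B v (e i) * L (e i))"
  shows "(THE w. w \<in> V \<and> (\<forall>v\<in>V. B w v = L v)) = (\<lambda>x. \<Sum>i<m. L (e i) * e i x)"
proof (rule the_equality)
  have s: "sym_form V B" using V(2) by (simp add: pos_form_def)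
  have eV: "e i \<in> V" if "i < m" for i using V(3) that by (simp add: orthonormal_def)
  let ?w = "\<lambda>x. \<Sum>i<m. L (e i) * e i x"
  have w: "?w \<in> V" using eV by (intro fun_space_sum[OF V(1)]) auto
  moreover have "B ?w v = L v" if v: "v \<in> V" for v
  proof -
    have "B ?w v = (\<Sum>i<m. L (e i) * B (e i) v)" using eV v by (intro sym_form_sum[OF V(1) s]) auto
    also have "\<dots> = (\<Sum>i<m. B v (e i) * L (e i))" using sym_formD(1)[OF s v eV] by (intro sum.cong) auto
    finally show ?thesis using L[OF v] by simp
  qed
  ultimately show "?w \<in> V \<and> (\<forall>v\<in>V. B ?w v = L v)" by blast
  fix w' assume w': "w' \<in> V \<and> (\<forall>v\<in>V. B w' v = L v)"
  have "w' x = ?w x" for x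
  proof -
    have "w' x = (\<Sum>i<m. B w' (e i) * e i x)" using fun_cong[OF sp[of w'], of x] w' by simp
    also have "\<dots> = ?w x" using w' eV by (intro sum.cong) auto
    finally show ?thesis .
  qed
  then show "w' = ?w" by blast
qed

lemma fe_eigenbasis_exists:
  fixes \<Omega> :: "(real^'d) set"
  assumes \<Omega>: "open \<Omega>" and ell: "elliptic_operator \<Omega> a c0" and tri: "regular_triangulation \<kappa> \<Omega> h \<T>"
  obtains m e l where "eigenbasis \<Omega> (fe_space \<Omega> \<T>) (discrete_op \<Omega> a c0 (fe_space \<Omega> \<T>)) m e l"
proof -
  let ?X = "fe_space \<Omega> \<T>" and ?A = "bilin \<Omega> a c0"
  have m\<Omega>: "\<Omega> \<in> sets lebesgue" using \<Omega> by auto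
  note V = fun_space_fe_space[OF m\<Omega>, of \<T>] pos_form_fe_space[OF \<Omega>, of \<T>] determining_fe_space[OF tri]
  have A: "sym_form ?X ?A" by (rule sym_form_subset[OF sym_form_bilin[OF m\<Omega> ell] fe_space_H10])
  have s: "sym_form ?X (inner2 \<Omega>)" using V(2) by (simp add: pos_form_def)
  obtain m e l where on: "orthonormal ?X (inner2 \<Omega>) m e"
    and sp: "\<And>v. v \<in> ?X ==> v = (\<lambda>x. \<Sum>i<m. inner2 \<Omega> v (e i) * e i x)"
    and l: "\<And>i w. i < m ==> w \<in> ?X ==> ?A (e i) w = l i * inner2 \<Omega> (e i) w"
    by (rule eigenbasis_exists[OF V A]) blast
  have eX: "e i \<in> ?X" "inner2 \<Omega> (e i) (e i) = 1" if "i < m" for i using on that by (auto simp: orthonormal_def)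
  obtain \<gamma> where \<gamma>: "0 < \<gamma>" "\<And>v. v \<in> H10 \<Omega> ==> \<gamma> * (norm2 \<Omega> v)\<^sup>2 \<le> ?A v v"
    using ell unfolding elliptic_operator_def by blast
  \<comment> \<open>Coercivity of the bilinear form on a normalised eigenvector bounds its
    eigenvalue below by a positive constant.\<close>
  have "0 < l i" if i: "i < m" for i
  proof -
    have "\<gamma> * (norm2 \<Omega> (e i))\<^sup>2 \<le> ?A (e i) (e i)" using \<gamma>(2) eX(1)[OF i] fe_space_H10 by blast
    then show ?thesis using l[OF i eX(1)[OF i]] eX(2)[OF i] \<gamma>(1) by (simp add: norm2_square)
  qed
  moreover have "discrete_op \<Omega> a c0 ?X v = (\<lambda>x. \<Sum>i<m. l i * inner2 \<Omega> v (e i) * e i x)" if v: "v \<in> ?X" for v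
  proof -
    have Av: "?A v w = (\<Sum>i<m. inner2 \<Omega> w (e i) * ?A v (e i))" if w: "w \<in> ?X" for w
    proof -
      have "?A v w = ?A w v" by (rule sym_formD(1)[OF A v w])
      also have "\<dots> = ?A (\<lambda>x. \<Sum>i<m. inner2 \<Omega> w (e i) * e i x) v" using arg_cong[OF sp[OF w], of "\<lambda>w. ?A w v"] .
      also have "\<dots> = (\<Sum>i<m. inner2 \<Omega> w (e i) * ?A (e i) v)" using eX v by (intro sym_form_sum[OF V(1) A]) auto
      also have "\<dots> = (\<Sum>i<m. inner2 \<Omega> w (e i) * ?A v (e i))" using sym_formD(1)[OF A v eX(1)] by (intro sum.cong) auto
      finally show ?thesis .
    qed
    have "discrete_op \<Omega> a c0 ?X v = (\<lambda>x. \<Sum>i<m. ?A v (e i) * e i x)"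
      unfolding discrete_op_def by (rule riesz_representative[OF V(1,2) on sp Av])
    moreover have "?A v (e i) = l i * inner2 \<Omega> v (e i)" if "i < m" for i
      using sym_formD(1)[OF A v eX(1)[OF that]] l[OF that v] by (simp add: inner2_commute)
    ultimately show ?thesis by simp
  qed
  ultimately have "eigenbasis \<Omega> ?X (discrete_op \<Omega> a c0 ?X) m e l"
    unfolding eigenbasis_def using V on sp fe_space_L2 by blast
  then show ?thesis by (rule that)
qed

section \<open>Discrete operators in the eigenbasis\<close>

context
  fixes \<Omega> :: "(real^'d) set" and X Ah m e l
  assumes eb: "eigenbasis \<Omega> X Ah m e l"
begin

lemma eigenbasis_facts:
  shows "fun_space X" and "X \<subseteq> L2 \<Omega>" and "pos_form X (inner2 \<Omega>)" and "sym_form X (inner2 \<Omega>)" and "orthonormal X (inner2 \<Omega>) m e"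
    and "\<And>v. v \<in> X ==> v = (\<lambda>x. \<Sum>i<m. inner2 \<Omega> v (e i) * e i x)" and "\<And>i. i < m ==> 0 < l i"
    and "\<And>v. v \<in> X ==> Ah v = (\<lambda>x. \<Sum>i<m. l i * inner2 \<Omega> v (e i) * e i x)"
    and "\<And>i. i < m ==> e i \<in> X" and "\<And>i. i < m ==> e i \<in> L2 \<Omega>" and "\<exists>P. determining X P"
  using eb unfolding eigenbasis_def by (auto simp: pos_form_def orthonormal_def)

lemma expansion_in: "(\<lambda>x. \<Sum>i<m. c i * e i x) \<in> X"
  using eigenbasis_facts(9) by (intro fun_space_sum[OF eigenbasis_facts(1)]) auto

lemma coefficient_expansion: "i < m ==> inner2 \<Omega> (\<lambda>x. \<Sum>i<m. c i * e i x) (e i) = c i"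
  by (rule orthonormal_sum[OF eigenbasis_facts(1,4,5)])

lemma expansion_unique:
  assumes "\<And>x. (\<Sum>i<m. c i * e i x) = (\<Sum>i<m. d i * e i x)" "i < m"
  shows "c i = d i"
  using coefficient_expansion[OF assms(2), of c] coefficient_expansion[OF assms(2), of d] assms(1) by simp

lemma expansion_unique_complex:
  fixes c d :: "nat => complex"
  assumes "\<And>x. (\<Sum>i<m. c i * of_real (e i x)) = (\<Sum>i<m. d i * of_real (e i x))" "i < m"
  shows "c i = d i"
proof (rule complex_eqI)
  have "(\<Sum>i<m. Re (c i) * e i x) = (\<Sum>i<m. Re (d i) * e i x)" for x using arg_cong[OF assms(1)[of x], of Re] by simp
  then show "Re (c i) = Re (d i)" by (rule expansion_unique[OF _ assms(2)])
  have "(\<Sum>i<m. Im (c i) * e i x) = (\<Sum>i<m. Im (d i) * e i x)" for x using arg_cong[OF assms(1)[of x], of Im] by simp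
  then show "Im (c i) = Im (d i)" by (rule expansion_unique[OF _ assms(2)])
qed

lemma Ah_expansion: "Ah (\<lambda>x. \<Sum>i<m. c i * e i x) = (\<lambda>x. \<Sum>i<m. l i * c i * e i x)"
  unfolding eigenbasis_facts(8)[OF expansion_in] by (rule ext, rule sum.cong) (auto simp: coefficient_expansion)

lemma L2_proj_expansion:
  assumes "v \<in> L2 \<Omega>"
  shows "L2_proj \<Omega> X v = (\<lambda>x. \<Sum>i<m. inner2 \<Omega> v (e i) * e i x)"
  unfolding L2_proj_def
proof (rule riesz_representative[OF eigenbasis_facts(1,3,5,6)])
  fix w assume w: "w \<in> X"
  have "inner2 \<Omega> v w = inner2 \<Omega> w v" by (rule inner2_commute)
  also have "\<dots> = inner2 \<Omega> (\<lambda>x. \<Sum>i<m. inner2 \<Omega> w (e i) * e i x) v"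
    using arg_cong[OF eigenbasis_facts(6)[OF w], of "\<lambda>w. inner2 \<Omega> w v"] .
  also have "\<dots> = (\<Sum>i<m. inner2 \<Omega> w (e i) * inner2 \<Omega> (e i) v)"
    using eigenbasis_facts(10) assms by (intro sym_form_sum[OF fun_space_L2 sym_form_inner2]) auto
  also have "\<dots> = (\<Sum>i<m. inner2 \<Omega> w (e i) * inner2 \<Omega> v (e i))" by (simp only: inner2_commute[of \<Omega> v])
  finally show "inner2 \<Omega> v w = (\<Sum>i<m. inner2 \<Omega> w (e i) * inner2 \<Omega> v (e i))" .
qed

text \<open>The complexified equation decouples into (z + l i) r i = c i. Positive eigenvalues and
  Re z > 0 keep the factors away from 0, which gives both existence and uniqueness in the definite
  description.\<close>

lemma resolvent_expansion:
  assumes "0 < Re z"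
  shows "resolvent X Ah z (\<lambda>x. \<Sum>i<m. c i * e i x) = (\<lambda>x. \<Sum>i<m. of_real (c i) / (z + of_real (l i)) * of_real (e i x))"
  unfolding resolvent_def
proof (rule the_equality)
  have nz: "z + of_real (l i) \<noteq> 0" if "i < m" for i
  proof
    assume "z + of_real (l i) = 0"
    then have "Re z + l i = 0" by (metis plus_complex.sel(1) Re_complex_of_real zero_complex.sel(1))
    then show False using assms eigenbasis_facts(7)[OF that] by simp
  qed
  have cA: "Complex (Ah (\<lambda>x. \<Sum>i<m. Re (r i) * e i x) x) (Ah (\<lambda>x. \<Sum>i<m. Im (r i) * e i x) x)
      = (\<Sum>i<m. of_real (l i) * r i * of_real (e i x))" for r x
    unfolding Ah_expansion by (rule complex_eqI) simp_all
  let ?r = "\<lambda>i. of_real (c i) / (z + of_real (l i))"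
  let ?w = "\<lambda>x. \<Sum>i<m. ?r i * of_real (e i x)"
  have ReIm: "(\<lambda>x. Re (\<Sum>i<m. r i * of_real (e i x))) = (\<lambda>x. \<Sum>i<m. Re (r i) * e i x)"
    "(\<lambda>x. Im (\<Sum>i<m. r i * of_real (e i x))) = (\<lambda>x. \<Sum>i<m. Im (r i) * e i x)" for r by auto
  have E: "z * ?w x + Complex (Ah (\<lambda>x. Re (?w x)) x) (Ah (\<lambda>x. Im (?w x)) x) = of_real (\<Sum>i<m. c i * e i x)" for x
  proof -
    have "z * ?w x + Complex (Ah (\<lambda>x. Re (?w x)) x) (Ah (\<lambda>x. Im (?w x)) x) = (\<Sum>i<m. z * (?r i * of_real (e i x)) + of_real (l i) * ?r i * of_real (e i x))"
      unfolding ReIm cA by (simp only: sum_distrib_left sum.distrib)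
    also have "\<dots> = (\<Sum>i<m. of_real (c i) * of_real (e i x))"
    proof (rule sum.cong[OF refl])
      fix i assume "i \<in> {..<m}"
      then have "(z + of_real (l i)) * ?r i = of_real (c i)" using nz[of i] by simp
      then show "z * (?r i * of_real (e i x)) + of_real (l i) * ?r i * of_real (e i x) = of_real (c i) * of_real (e i x)"
        by (metis distrib_right mult.assoc)
    qed
    finally show ?thesis by simp
  qed
  show "(\<lambda>x. Re (?w x)) \<in> X \<and> (\<lambda>x. Im (?w x)) \<in> X \<and>
     (\<forall>x. z * ?w x + Complex (Ah (\<lambda>x. Re (?w x)) x) (Ah (\<lambda>x. Im (?w x)) x) = of_real (\<Sum>i<m. c i * e i x))"
    unfolding ReIm by (rule conjI[OF expansion_in conjI[OF expansion_in allI]]) (rule E[unfolded ReIm])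
  fix w assume w: "(\<lambda>x. Re (w x)) \<in> X \<and> (\<lambda>x. Im (w x)) \<in> X \<and>
     (\<forall>x. z * w x + Complex (Ah (\<lambda>x. Re (w x)) x) (Ah (\<lambda>x. Im (w x)) x) = of_real (\<Sum>i<m. c i * e i x))"
  define r where "r = (\<lambda>i. Complex (inner2 \<Omega> (\<lambda>x. Re (w x)) (e i)) (inner2 \<Omega> (\<lambda>x. Im (w x)) (e i)))"
  have re: "(\<lambda>x. Re (w x)) = (\<lambda>x. \<Sum>i<m. Re (r i) * e i x)" "(\<lambda>x. Im (w x)) = (\<lambda>x. \<Sum>i<m. Im (r i) * e i x)"
    unfolding r_def complex.sel using eigenbasis_facts(6) w by blast+
  have wr: "w x = (\<Sum>i<m. r i * of_real (e i x))" for x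
    using fun_cong[OF re(1), of x] fun_cong[OF re(2), of x] by (intro complex_eqI) simp_all
  have "(\<Sum>i<m. ((z + of_real (l i)) * r i) * of_real (e i x)) = (\<Sum>i<m. of_real (c i) * of_real (e i x))" for x
  proof -
    have "(\<Sum>i<m. ((z + of_real (l i)) * r i) * of_real (e i x)) = z * w x + Complex (Ah (\<lambda>x. Re (w x)) x) (Ah (\<lambda>x. Im (w x)) x)"
      unfolding re cA unfolding wr by (simp add: sum_distrib_left sum.distrib[symmetric] algebra_simps)
    also have "\<dots> = of_real (\<Sum>i<m. c i * e i x)" using w by blast
    finally show ?thesis by simp
  qed
  then have "(z + of_real (l i)) * r i = of_real (c i)" if "i < m" for i by (rule expansion_unique_complex[OF _ that])
  then have "r i = ?r i" if "i < m" for i using nz[OF that] that by (simp add: eq_divide_eq mult.commute)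
  then show "w = ?w" using wr by (intro ext) simp
qed

lemma E_op_expansion:
  assumes \<alpha>: "0 < \<alpha>" "\<alpha> < 1" and t: "0 < t" and \<sigma>: "0 < \<sigma>"
  shows "E_op X Ah \<alpha> \<sigma> t (\<lambda>x. \<Sum>i<m. c i * e i x) x = (\<Sum>i<m. ml_kernel \<alpha> (l i) t * c i * e i x)"
proof -
  let ?path = "\<lambda>R. linepath (Complex \<sigma> (- R)) (Complex \<sigma> R)"
  let ?k = "\<lambda>i s. exp (s * of_real t) * (1 / (s powr of_real \<alpha> + of_real (l i)))"
  have path: "Re s = \<sigma>" if sp: "s \<in> path_image (?path R)" for s R
  proof -
    obtain u where "s = (1 - u) *\<^sub>R Complex \<sigma> (- R) + u *\<^sub>R Complex \<sigma> R" using sp[unfolded path_image_linepath closed_segment_def] by blast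
    then show ?thesis by (simp add: left_diff_distrib)
  qed
  \<comment> \<open>On the vertical line s^\<alpha> stays in the open right half-plane, so the
    expansion of the resolvent applies to it.\<close>
  have pos: "0 < Re (s powr of_real \<alpha>)" if "Re s = \<sigma>" for s
  proof -
    have s: "s \<noteq> 0" using that \<sigma> by auto
    have "0 < cos (\<alpha> * pi / 2) * norm (s powr of_real \<alpha>)" using cos_half_pos[OF \<alpha>] s by simp
    also have "\<dots> \<le> Re (s powr of_real \<alpha>)" using that \<sigma> by (intro Re_powr_right_half_plane_ge \<alpha>) simp
    finally show ?thesis .
  qed
  have ci: "?k i contour_integrable_on ?path R" if i: "i < m" for i R
  proof (rule contour_integrable_continuous_linepath)
    have "s powr of_real \<alpha> + of_real (l i) \<noteq> 0" if "Re s = \<sigma>" for s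
    proof
      assume "s powr of_real \<alpha> + of_real (l i) = 0"
      then have "Re (s powr of_real \<alpha>) + l i = 0" by (metis plus_complex.sel(1) Re_complex_of_real zero_complex.sel(1))
      then show False using pos[OF that] eigenbasis_facts(7)[OF i] by simp
    qed
    moreover have "s \<notin> \<real>\<^sub>\<le>\<^sub>0" if "Re s = \<sigma>" for s using that \<sigma> by (auto simp: complex_nonpos_Reals_iff)
    ultimately show "continuous_on (closed_segment (Complex \<sigma> (- R)) (Complex \<sigma> R)) (?k i)"
      using path[of _ R] \<alpha> \<sigma> by (intro continuous_intros) auto
  qed
  have "contour_integral (?path R) (\<lambda>s. exp (s * of_real t) * resolvent X Ah (s powr of_real \<alpha>) (\<lambda>x. \<Sum>i<m. c i * e i x) x)
      = (\<Sum>i<m. of_real (c i * e i x) * contour_integral (?path R) (?k i))" for R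
  proof -
    have "contour_integral (?path R) (\<lambda>s. exp (s * of_real t) * resolvent X Ah (s powr of_real \<alpha>) (\<lambda>x. \<Sum>i<m. c i * e i x) x)
        = contour_integral (?path R) (\<lambda>s. \<Sum>i<m. of_real (c i * e i x) * ?k i s)"
    proof (rule contour_integral_eq)
      fix s assume "s \<in> path_image (?path R)"
      then have "0 < Re (s powr of_real \<alpha>)" by (intro pos path)
      from fun_cong[OF resolvent_expansion[OF this, of c], of x]
      show "exp (s * of_real t) * resolvent X Ah (s powr of_real \<alpha>) (\<lambda>x. \<Sum>i<m. c i * e i x) x = (\<Sum>i<m. of_real (c i * e i x) * ?k i s)"
        by (simp add: sum_distrib_left divide_inverse mult_ac)
    qed
    also have "\<dots> = (\<Sum>i<m. contour_integral (?path R) (\<lambda>s. of_real (c i * e i x) * ?k i s))"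
      using ci by (intro contour_integral_sum contour_integrable_lmul) auto
    also have "\<dots> = (\<Sum>i<m. of_real (c i * e i x) * contour_integral (?path R) (?k i))"
      using ci by (intro sum.cong contour_integral_lmul) auto
    finally show ?thesis .
  qed
  moreover have "((\<lambda>R. \<Sum>i<m. of_real (c i * e i x) * contour_integral (?path R) (?k i)) \<longlongrightarrow>
      (\<Sum>i<m. of_real (c i * e i x) * ((2 * of_real pi * \<i>) * of_real (ml_kernel \<alpha> (l i) t)))) at_top"
  proof (intro tendsto_sum tendsto_mult tendsto_const)
    fix i assume i: "i \<in> {..<m}"
    have "((\<lambda>R. (2 * of_real pi * \<i>) * (1 / (2 * of_real pi * \<i>) * contour_integral (?path R) (?k i))) \<longlongrightarrow> (2 * of_real pi * \<i>) * of_real (ml_kernel \<alpha> (l i) t)) at_top"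
      using i by (intro tendsto_mult tendsto_const bromwich_ml_kernel \<alpha> eigenbasis_facts(7) t \<sigma>) auto
    then show "((\<lambda>R. contour_integral (?path R) (?k i)) \<longlongrightarrow> (2 * of_real pi * \<i>) * of_real (ml_kernel \<alpha> (l i) t)) at_top"
      by (simp add: mult.assoc[symmetric])
  qed
  ultimately have "Lim at_top (\<lambda>R. contour_integral (?path R) (\<lambda>s. exp (s * of_real t) * resolvent X Ah (s powr of_real \<alpha>) (\<lambda>x. \<Sum>i<m. c i * e i x) x))
      = (\<Sum>i<m. of_real (c i * e i x) * ((2 * of_real pi * \<i>) * of_real (ml_kernel \<alpha> (l i) t)))"
    by (intro tendsto_Lim) simp_all
  also have "\<dots> = (2 * of_real pi * \<i>) * of_real (\<Sum>i<m. ml_kernel \<alpha> (l i) t * c i * e i x)"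
    by (simp add: sum_distrib_left mult_ac)
  finally show ?thesis unfolding E_op_def by (simp add: mult.assoc[symmetric] del: of_real_sum)
qed

text \<open>Coordinates are finite combinations of point values, so that the pointwise formulation of the
  Caputo equation passes to the modes.\<close>

lemma coefficient_point_values:
  "\<exists>P w. finite P \<and> (\<forall>v\<in>X. inner2 \<Omega> v (e i) = (\<Sum>p\<in>P. w p * v p))" if i: "i < m"
proof -
  obtain P where P: "determining X P" using eigenbasis_facts(11) by blast
  have fP: "finite P" using P by (simp add: determining_def)
  \<comment> \<open>The Euclidean product of point values is positive definite on \<open>X\<close>.
    Expansion in a basis orthonormal for it therefore uses nothing but the values at
    \<open>P\<close>.\<close>
  define D where "D = (\<lambda>v w. \<Sum>p\<in>P. v p * w p :: real)"
  have sD: "sym_form X D" unfolding sym_form_def D_def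
    by (simp add: mult.commute sum_distrib_left sum.distrib[symmetric] algebra_simps)
  have "pos_form X D" unfolding pos_form_def
  proof (intro conjI sD ballI impI)
    fix v assume v: "v \<in> X" "v \<noteq> (\<lambda>_. 0)"
    then obtain p where p: "p \<in> P" "v p \<noteq> 0" using P unfolding determining_def by blast
    have "0 < v p * v p" using p(2) by (metis not_square_less_zero less_linear mult_eq_0_iff)
    also have "\<dots> \<le> D v v" unfolding D_def using fP p(1) by (intro member_le_sum[of p P "\<lambda>p. v p * v p"]) auto
    finally show "0 < D v v" .
  qed
  then obtain n f where on: "orthonormal X D n f" and sp: "\<And>v. v \<in> X ==> v = (\<lambda>x. \<Sum>j<n. D v (f j) * f j x)"
    using orthonormal_basis_exists[OF eigenbasis_facts(1) _ P] by blast
  have "inner2 \<Omega> v (e i) = (\<Sum>p\<in>P. (\<Sum>j<n. f j p * inner2 \<Omega> (f j) (e i)) * v p)" if v: "v \<in> X" for v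
  proof -
    have "inner2 \<Omega> v (e i) = inner2 \<Omega> (\<lambda>x. \<Sum>j<n. D v (f j) * f j x) (e i)"
      using arg_cong[OF sp[OF v], of "\<lambda>v. inner2 \<Omega> v (e i)"] .
    also have "\<dots> = (\<Sum>j<n. D v (f j) * inner2 \<Omega> (f j) (e i))"
      using on eigenbasis_facts(9)[OF i] by (intro sym_form_sum[OF eigenbasis_facts(1,4)]) (auto simp: orthonormal_def)
    also have "\<dots> = (\<Sum>j<n. \<Sum>p\<in>P. f j p * inner2 \<Omega> (f j) (e i) * v p)"
      unfolding D_def by (simp add: sum_distrib_left sum_distrib_right mult_ac)
    also have "\<dots> = (\<Sum>p\<in>P. (\<Sum>j<n. f j p * inner2 \<Omega> (f j) (e i)) * v p)"
      unfolding sum_distrib_right by (rule sum.swap)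
    finally show ?thesis .
  qed
  then show ?thesis using fP by (intro exI[of _ P] exI[of _ "\<lambda>p. \<Sum>j<n. f j p * inner2 \<Omega> (f j) (e i)"]) blast
qed

end

section \<open>Modes of the semidiscrete and the fully discrete solution\<close>

context
  fixes \<Omega> :: "(real^'d) set" and X Ah m e l and \<alpha> T :: real
    and F :: "nat => real => real" and fh :: "real => real^'d => real"
  assumes eb: "eigenbasis \<Omega> X Ah m e l" and \<alpha>: "0 < \<alpha>" "\<alpha> < 1"
    and fh: "\<And>s. 0 \<le> s ==> s \<le> T ==> fh s = (\<lambda>x. \<Sum>i<m. F i s * e i x)"
begin

lemma caputo_modes:
  assumes u: "caputo_solution X Ah \<alpha> T fh (\<lambda>_. 0) u" and i: "i < m" and t: "0 < t" "t \<le> T"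
  shows "inner2 \<Omega> (u t) (e i) = integral {0..t} (\<lambda>s. ml_kernel \<alpha> (l i) (t - s) * F i s)"
proof -
  obtain P w where P: "finite P" and w: "\<And>v. v \<in> X ==> inner2 \<Omega> v (e i) = (\<Sum>p\<in>P. w p * v p)"
    using coefficient_point_values[OF eb i] by blast
  have uX: "\<And>t. t \<in> {0..T} ==> u t \<in> X" and u0: "u 0 = (\<lambda>_. 0)" and uc: "\<And>x. continuous_on {0..T} (\<lambda>t. u t x)"
    and ud: "\<And>x t. t \<in> {0<..<T} ==> (\<lambda>t. u t x) differentiable (at t)"
    and ui: "\<And>x t. t \<in> {0<..T} ==> (\<lambda>z. (t - z) powr (- \<alpha>) * deriv (\<lambda>t. u t x) z) absolutely_integrable_on {0..t}"
    and ue: "\<And>x t. t \<in> {0<..T} ==> caputo \<alpha> (\<lambda>t. u t x) t + Ah (u t) x = fh t x"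
    using u unfolding caputo_solution_def by blast+
  define y where "y = (\<lambda>t. \<Sum>p\<in>P. w p * u t p)"
  have y: "inner2 \<Omega> (u t) (e i) = y t" if "t \<in> {0..T}" for t using w[OF uX[OF that]] by (simp add: y_def)
  have yd: "(y has_real_derivative (\<Sum>p\<in>P. w p * deriv (\<lambda>t. u t p) s)) (at s)" if "s \<in> {0<..<T}" for s
    unfolding y_def using ud[OF that] by (intro DERIV_sum DERIV_cmult) (simp add: DERIV_deriv_iff_real_differentiable)
  \<comment> \<open>Differentiability is known only inside (0, T); the end points are two
    exceptional points that do not affect the integrals.\<close>
  have spike: "(r - s) powr (- \<alpha>) * deriv y s = (\<Sum>p\<in>P. w p * ((r - s) powr (- \<alpha>) * deriv (\<lambda>t. u t p) s))"
    if "s \<in> {0..r} - {0, T}" "r \<le> T" for r s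
  proof -
    have "s \<in> {0<..<T}" using that by auto
    from DERIV_imp_deriv[OF yd[OF this]] show ?thesis by (simp add: sum_distrib_left mult_ac)
  qed
  have ai: "(\<lambda>s. \<Sum>p\<in>P. w p * ((r - s) powr (- \<alpha>) * deriv (\<lambda>t. u t p) s)) absolutely_integrable_on {0..r}" if "r \<in> {0<..T}" for r
    using ui[OF that] by (intro absolutely_integrable_sum P set_integrable_mult_right) auto
  have "y t = integral {0..t} (\<lambda>s. ml_kernel \<alpha> (l i) (t - s) * F i s)"
  proof (rule caputo_scalar[OF \<alpha> eigenbasis_facts(7)[OF eb i] _ _ _ _ _ t])
    show "continuous_on {0..T} y" unfolding y_def by (intro continuous_intros uc)
    show "y 0 = 0" by (simp add: y_def u0)
    show "y differentiable (at s)" if "0 < s" "s < T" for s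
      using yd[of s] that unfolding real_differentiable_def by auto
    fix r assume r: "0 < r" "r \<le> T"
    show "(\<lambda>s. (r - s) powr (- \<alpha>) * deriv y s) absolutely_integrable_on {0..r}"
      by (rule absolutely_integrable_spike[OF ai, of _ "{0, T}"]) (use r spike in auto)
    have "integral {0..r} (\<lambda>s. (r - s) powr (- \<alpha>) * deriv y s) = integral {0..r} (\<lambda>s. \<Sum>p\<in>P. w p * ((r - s) powr (- \<alpha>) * deriv (\<lambda>t. u t p) s))"
      by (rule integral_spike[of "{0, T}"]) (use spike r in auto)
    also have "\<dots> = (\<Sum>p\<in>P. integral {0..r} (\<lambda>s. w p * ((r - s) powr (- \<alpha>) * deriv (\<lambda>t. u t p) s)))"
      using ui[of r] r by (intro Henstock_Kurzweil_Integration.integral_sum P integrable_on_mult_right) (auto simp: absolutely_integrable_on_def)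
    also have "\<dots> = (\<Sum>p\<in>P. w p * integral {0..r} (\<lambda>s. (r - s) powr (- \<alpha>) * deriv (\<lambda>t. u t p) s))" by simp
    finally have "caputo \<alpha> y r = (\<Sum>p\<in>P. w p * caputo \<alpha> (\<lambda>t. u t p) r)"
      unfolding caputo_def by (simp add: sum_distrib_left mult_ac)
    also have "\<dots> = (\<Sum>p\<in>P. w p * (fh r p - Ah (u r) p))"
      using ue[of r] r by (intro sum.cong refl arg_cong2[where f = "(*)"]) (auto simp: eq_diff_eq)
    also have "\<dots> = (\<Sum>p\<in>P. w p * fh r p) - (\<Sum>p\<in>P. w p * Ah (u r) p)" by (simp add: right_diff_distrib sum_subtractf)
    also have "(\<Sum>p\<in>P. w p * fh r p) = F i r"
      using w[OF expansion_in[OF eb], of "\<lambda>i. F i r"] coefficient_expansion[OF eb i, of "\<lambda>i. F i r"] fh[of r] r by simp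
    also have "(\<Sum>p\<in>P. w p * Ah (u r) p) = l i * y r"
    proof -
      have ur: "u r \<in> X" using uX r by simp
      have "(\<Sum>p\<in>P. w p * Ah (u r) p) = inner2 \<Omega> (\<lambda>x. \<Sum>i<m. (l i * inner2 \<Omega> (u r) (e i)) * e i x) (e i)"
        unfolding eigenbasis_facts(8)[OF eb ur] by (rule w[OF expansion_in[OF eb], symmetric])
      also have "\<dots> = l i * inner2 \<Omega> (u r) (e i)" by (rule coefficient_expansion[OF eb i])
      finally show ?thesis using y[of r] r by simp
    qed
    finally show "caputo \<alpha> y r + l i * y r = F i r" by simp
  qed
  then show ?thesis using y[of t] t by simp
qed

lemma duhamel_modes:
  assumes u: "duhamel_solution X Ah \<alpha> T fh u" and t: "0 < t" "t \<le> T"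
    and int: "\<And>i. i < m ==> (\<lambda>s. ml_kernel \<alpha> (l i) (t - s) * F i s) integrable_on {0..t}"
  shows "u t = (\<lambda>x. \<Sum>i<m. integral {0..t} (\<lambda>s. ml_kernel \<alpha> (l i) (t - s) * F i s) * e i x)"
proof
  fix x
  obtain \<sigma> where \<sigma>: "0 < \<sigma>" and ut: "u t x = integral {0..t} (\<lambda>s. E_op X Ah \<alpha> \<sigma> (t - s) (fh s) x)"
    using u t unfolding duhamel_solution_def by auto
  note ut
  also have "integral {0..t} (\<lambda>s. E_op X Ah \<alpha> \<sigma> (t - s) (fh s) x) = integral {0..t} (\<lambda>s. \<Sum>i<m. ml_kernel \<alpha> (l i) (t - s) * F i s * e i x)"
  \<comment> \<open>At s = t the operator is taken at time 0, which the expansion formula does not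
    cover; one point is negligible.\<close>
  proof (rule integral_spike[of "{t}"])
    fix s assume "s \<in> {0..t} - {t}"
    then have s: "0 < t - s" "fh s = (\<lambda>x. \<Sum>i<m. F i s * e i x)" using fh[of s] t by auto
    show "(\<Sum>i<m. ml_kernel \<alpha> (l i) (t - s) * F i s * e i x) = E_op X Ah \<alpha> \<sigma> (t - s) (fh s) x"
      unfolding s(2) by (rule E_op_expansion[OF eb \<alpha> s(1) \<sigma>, symmetric])
  qed simp
  also have "\<dots> = (\<Sum>i<m. integral {0..t} (\<lambda>s. ml_kernel \<alpha> (l i) (t - s) * F i s * e i x))"
    using int by (intro Henstock_Kurzweil_Integration.integral_sum integrable_on_mult_left) auto
  finally show "u t x = (\<Sum>i<m. integral {0..t} (\<lambda>s. ml_kernel \<alpha> (l i) (t - s) * F i s) * e i x)" by simp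
qed

lemma semidiscrete_modes:
  assumes u: "semidiscrete_solution X Ah \<alpha> T fh (\<lambda>_. 0) u" and t: "0 < t" "t \<le> T"
    and int: "\<And>i. i < m ==> (\<lambda>s. ml_kernel \<alpha> (l i) (t - s) * F i s) integrable_on {0..t}"
  shows "u t = (\<lambda>x. \<Sum>i<m. integral {0..t} (\<lambda>s. ml_kernel \<alpha> (l i) (t - s) * F i s) * e i x)"
  using u unfolding semidiscrete_solution_def
proof
  assume c: "caputo_solution X Ah \<alpha> T fh (\<lambda>_. 0) u"
  then have "u t \<in> X" using t by (simp add: caputo_solution_def)
  from eigenbasis_facts(6)[OF eb this] show ?thesis using caputo_modes[OF c _ t] by simp
next
  assume "(\<lambda>_. 0) = (\<lambda>_. 0) \<and> duhamel_solution X Ah \<alpha> T fh u"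
  then show ?thesis using duhamel_modes[OF _ t int] by blast
qed

text \<open>Projection, double integral and difference operators act coordinatewise, so comparing
  coefficients yields the scalar scheme for every eigenvalue.\<close>

lemma cn2_scheme_modes:
  assumes sch: "cn2_scheme X Ah \<alpha> \<tau> N fh (\<lambda>_. 0) U un" and \<tau>: "0 < \<tau>" "real N * \<tau> \<le> T" and n: "1 \<le> n" "n \<le> N"
    and F: "\<And>i. i < m ==> F i absolutely_integrable_on {0..T}"
  shows "un n = (\<lambda>x. \<Sum>i<m. integral {0..real n * \<tau>} (\<lambda>s. \<tau> powr (\<alpha> - 1) * cq_kernel \<alpha> (l i * \<tau> powr \<alpha>) ((real n * \<tau> - s) / \<tau>) * F i s) * e i x)"
proof -
  define \<phi> where "\<phi> = (\<lambda>i t. integral {0..t} (\<lambda>\<xi>. integral {0..\<xi>} (F i)))"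
  have di: "double_integral fh x t = (\<Sum>i<m. \<phi> i t * e i x)" if t: "t \<le> T" for x t
  proof -
    have Fi: "F i integrable_on {0..\<xi>}" if "i < m" "\<xi> \<le> T" for i \<xi>
      using F[OF that(1)] that(2) by (auto simp: absolutely_integrable_on_def intro: integrable_subinterval_real)
    have Fc: "(\<lambda>\<xi>. integral {0..\<xi>} (F i)) integrable_on {0..t}" if "i < m" for i
      by (rule integrable_continuous_real) (use indefinite_integral_continuous_1[OF Fi[OF that t]] in simp)
    have "double_integral fh x t = integral {0..t} (\<lambda>\<xi>. \<Sum>i<m. integral {0..\<xi>} (F i) * e i x)"
      unfolding double_integral_def
    proof (rule Henstock_Kurzweil_Integration.integral_cong)
      fix \<xi> assume \<xi>: "\<xi> \<in> {0..t}"
      have "integral {0..\<xi>} (\<lambda>s. fh s x) = integral {0..\<xi>} (\<lambda>s. \<Sum>i<m. F i s * e i x)"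
        using fh \<xi> t by (intro Henstock_Kurzweil_Integration.integral_cong) auto
      also have "\<dots> = (\<Sum>i<m. integral {0..\<xi>} (\<lambda>s. F i s * e i x))"
        using Fi \<xi> t by (intro Henstock_Kurzweil_Integration.integral_sum integrable_on_mult_left) auto
      finally show "integral {0..\<xi>} (\<lambda>s. fh s x) = (\<Sum>i<m. integral {0..\<xi>} (F i) * e i x)" by simp
    qed
    also have "\<dots> = (\<Sum>i<m. integral {0..t} (\<lambda>\<xi>. integral {0..\<xi>} (F i) * e i x))"
      using Fc by (intro Henstock_Kurzweil_Integration.integral_sum integrable_on_mult_left) auto
    finally show ?thesis by (simp add: \<phi>_def)
  qed
  have bd: "bdf2 \<tau> (double_integral fh x) t = (\<Sum>i<m. bdf2 \<tau> (\<phi> i) t * e i x)" if "t \<le> T" for x t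
    using that \<tau> unfolding bdf2_def
    by (simp add: di sum_distrib_left sum_distrib_right sum.distrib[symmetric] sum_subtractf[symmetric] algebra_simps)
  define V where "V = (\<lambda>i k. inner2 \<Omega> (U k) (e i))"
  have U0: "U k = (\<lambda>_. 0)" if "k \<le> 0" for k using sch that by (simp add: cn2_scheme_def)
  have V0: "V i k = 0" if "k \<le> 0" for i k using U0[OF that] by (simp add: V_def inner2_def)
  \<comment> \<open>The scheme places \<open>U\<close> in \<open>X\<close> only for indices up to N,
    and the values at nonpositive indices are prescribed; beyond N nothing is known.\<close>
  have UV: "U k = (\<lambda>x. \<Sum>i<m. V i k * e i x)" if k: "k \<le> int N" for k
  proof (cases "k \<le> 0")
    case True
    then show ?thesis using U0 V0 by simp
  next
    case False
    then have "k = int (nat k)" "nat k \<in> {1..N}" using k by auto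
    then have "U k \<in> X" using sch unfolding cn2_scheme_def by metis
    then show ?thesis unfolding V_def by (rule eigenbasis_facts(6)[OF eb])
  qed
  have eq: "\<tau> powr (- \<alpha>) * (\<Sum>j\<le>k. cq_weight \<alpha> j * V i (int k - int j)) + l i * ((1 - \<alpha>/2) * V i (int k) + \<alpha>/2 * V i (int k - 1))
      = (1 - \<alpha>/2) * bdf2 \<tau> (\<phi> i) (real k * \<tau>) + \<alpha>/2 * bdf2 \<tau> (\<phi> i) ((real k - 1) * \<tau>)"
    if k: "1 \<le> k" "k \<le> N" and i: "i < m" for k i
  proof (rule expansion_unique[OF eb _ i])
    fix x
    have tk: "real k * \<tau> \<le> T" "(real k - 1) * \<tau> \<le> T"
    proof -
      have "real k * \<tau> \<le> real N * \<tau>" using k \<tau> by (intro mult_right_mono) auto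
      from order_trans[OF this \<tau>(2)] show "real k * \<tau> \<le> T" .
      moreover have "(real k - 1) * \<tau> \<le> real k * \<tau>" using \<tau> by (intro mult_right_mono) auto
      ultimately show "(real k - 1) * \<tau> \<le> T" by simp
    qed
    have s: "(\<Sum>j\<le>k. cq_weight \<alpha> j * U (int k - int j) x) = (\<Sum>i<m. (\<Sum>j\<le>k. cq_weight \<alpha> j * V i (int k - int j)) * e i x)"
    proof -
      have "(\<Sum>j\<le>k. cq_weight \<alpha> j * U (int k - int j) x) = (\<Sum>j\<le>k. \<Sum>i<m. cq_weight \<alpha> j * V i (int k - int j) * e i x)"
      proof (rule sum.cong[OF refl])
        fix j assume "j \<in> {..k}"
        then have "int k - int j \<le> int N" using k by auto
        from fun_cong[OF UV[OF this], of x]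
        show "cq_weight \<alpha> j * U (int k - int j) x = (\<Sum>i<m. cq_weight \<alpha> j * V i (int k - int j) * e i x)"
          by (simp add: sum_distrib_left mult.assoc)
      qed
      also have "\<dots> = (\<Sum>i<m. \<Sum>j\<le>k. cq_weight \<alpha> j * V i (int k - int j) * e i x)" by (rule sum.swap)
      finally show ?thesis by (simp add: sum_distrib_right)
    qed
    define W where "W = (\<lambda>i. \<Sum>j\<le>k. cq_weight \<alpha> j * V i (int k - int j))"
    have W: "(\<Sum>j\<le>k. cq_weight \<alpha> j * V i (int k - int j)) = W i" for i by (simp add: W_def)
    have A: "Ah (U k') x = (\<Sum>i<m. l i * V i k' * e i x)" if "k' \<le> int N" for k'
      unfolding UV[OF that] Ah_expansion[OF eb] by simp
    have "k \<in> {1..N}" using k by simp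
    then have "\<tau> powr (- \<alpha>) * (\<Sum>j\<le>k. cq_weight \<alpha> j * U (int k - int j) x) + (1 - \<alpha>/2) * Ah (U (int k)) x + \<alpha>/2 * Ah (U (int k - 1)) x
          = (1 - \<alpha>/2) * bdf2 \<tau> (double_integral fh x) (real k * \<tau>) + \<alpha>/2 * bdf2 \<tau> (double_integral fh x) ((real k - 1) * \<tau>)"
      using sch unfolding cn2_scheme_def by auto
    moreover have "Ah (U (int k)) x = (\<Sum>i<m. l i * V i (int k) * e i x)" "Ah (U (int k - 1)) x = (\<Sum>i<m. l i * V i (int k - 1) * e i x)"
      using k by (auto intro!: A)
    ultimately show "(\<Sum>i<m. (\<tau> powr (- \<alpha>) * (\<Sum>j\<le>k. cq_weight \<alpha> j * V i (int k - int j)) + l i * ((1 - \<alpha>/2) * V i (int k) + \<alpha>/2 * V i (int k - 1))) * e i x)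
      = (\<Sum>i<m. ((1 - \<alpha>/2) * bdf2 \<tau> (\<phi> i) (real k * \<tau>) + \<alpha>/2 * bdf2 \<tau> (\<phi> i) ((real k - 1) * \<tau>)) * e i x)"
      unfolding s bd[OF tk(1)] bd[OF tk(2)] W
      by (simp only: sum_distrib_left distrib_right distrib_left sum.distrib mult.assoc mult.left_commute[of "l _"] add.assoc)
  qed
  have nT: "real n * \<tau> \<le> T"
  proof -
    have "real n * \<tau> \<le> real N * \<tau>" using n \<tau> by (intro mult_right_mono) auto
    from order_trans[OF this \<tau>(2)] show ?thesis .
  qed
  have \<phi>0: "\<phi> i t = 0" if "t \<le> 0" for i t using that unfolding \<phi>_def by (cases "t = 0") auto
  have mode: "1 / \<tau> * (3/2 * V i (int n) - 2 * V i (int n - 1) + 1/2 * V i (int n - 2))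
      = integral {0..real n * \<tau>} (\<lambda>s. \<tau> powr (\<alpha> - 1) * cq_kernel \<alpha> (l i * \<tau> powr \<alpha>) ((real n * \<tau> - s) / \<tau>) * F i s)" if i: "i < m" for i
  proof -
    have "1 / \<tau> * (3/2 * V i (int n) - 2 * V i (int n - 1) + 1/2 * V i (int n - 2))
        = (\<Sum>k\<le>n. \<tau> powr (\<alpha> - 2) * cq_response \<alpha> (l i * \<tau> powr \<alpha>) k * \<phi> i (real (n - k) * \<tau>))"
      by (rule cn2_scheme_scalar[OF \<alpha> _ \<tau>(1) _ _ eq[OF _ _ i] n])
        (use eigenbasis_facts(7)[OF eb i] V0 \<phi>0 in \<open>auto simp: less_le\<close>)
    also have "\<dots> = integral {0..real n * \<tau>} (\<lambda>s. \<tau> powr (\<alpha> - 1) * cq_kernel \<alpha> (l i * \<tau> powr \<alpha>) ((real n * \<tau> - s) / \<tau>) * F i s)"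
      unfolding \<phi>_def by (rule discrete_duhamel(1)[OF \<tau>(1)]) (rule absolutely_integrable_on_subinterval[OF F[OF i]], use nT in auto)
    finally show ?thesis .
  qed
  show ?thesis
  proof
    fix x
    have nN: "int n \<le> int N" "int n - 1 \<le> int N" "int n - 2 \<le> int N" using n by auto
    have "n \<in> {1..N}" using n by simp
    then have "un n x = 1 / \<tau> * (3/2 * U (int n) x - 2 * U (int n - 1) x + 1/2 * U (int n - 2) x)"
      using sch unfolding cn2_scheme_def by blast
    also have "\<dots> = (\<Sum>i<m. 1 / \<tau> * (3/2 * V i (int n) - 2 * V i (int n - 1) + 1/2 * V i (int n - 2)) * e i x)"
      unfolding UV[OF nN(1)] UV[OF nN(2)] UV[OF nN(3)]
      by (simp add: sum_distrib_left sum.distrib[symmetric] sum_subtractf[symmetric] algebra_simps)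
    also have "\<dots> = (\<Sum>i<m. integral {0..real n * \<tau>} (\<lambda>s. \<tau> powr (\<alpha> - 1) * cq_kernel \<alpha> (l i * \<tau> powr \<alpha>) ((real n * \<tau> - s) / \<tau>) * F i s) * e i x)"
      by (rule sum.cong[OF refl], simp only: mode lessThan_iff)
    finally show "un n x = \<dots>" .
  qed
qed

end

section \<open>Coordinates of \<open>L\<^sup>2(\<Omega>)\<close>-valued functions\<close>

lemma L2_simple_inner2:
  fixes \<Omega> :: "(real^'d) set"
  assumes s: "L2_simple \<Omega> a b s" and \<psi>: "\<psi> \<in> L2 \<Omega>"
  shows "((\<lambda>t. inner2 \<Omega> (s t) \<psi>) has_integral inner2 \<Omega> (L2_simple_integral a b s) \<psi>) {a..b}"
    and "L2_simple_integral a b s \<in> L2 \<Omega>"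
proof -
  let ?Y = "s ` {a..b}" and ?A = "\<lambda>y. {t \<in> {a..b}. s t = y}"
  have Y: "finite ?Y" "?Y \<subseteq> L2 \<Omega>" and A: "\<And>y. ?A y \<in> sets lebesgue" using s by (auto simp: L2_simple_def)
  have ind: "((\<lambda>t. indicator (?A y) t :: real) has_integral measure lebesgue (?A y)) {a..b}" for y
  proof -
    have "bounded (?A y)" by (rule bounded_subset[of "{a..b}"]) auto
    then have "?A y \<in> lmeasurable" using A by (rule bounded_set_imp_lmeasurable)
    then have "(indicator (?A y) has_integral measure lebesgue (?A y)) UNIV" by (simp add: lmeasurable_iff_has_integral)
    also have "indicator (?A y) = (\<lambda>t. if t \<in> {a..b} then indicator (?A y) t else (0::real))" by (auto simp: fun_eq_iff indicator_def)
    finally show ?thesis by (simp only: has_integral_restrict_UNIV)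
  qed
  have h: "((\<lambda>t. \<Sum>y\<in>?Y. indicator (?A y) t * inner2 \<Omega> y \<psi>) has_integral (\<Sum>y\<in>?Y. measure lebesgue (?A y) * inner2 \<Omega> y \<psi>)) {a..b}"
    by (intro has_integral_sum Y has_integral_mult_left ind)
  have e1: "(\<Sum>y\<in>?Y. indicator (?A y) t * inner2 \<Omega> y \<psi>) = inner2 \<Omega> (s t) \<psi>" if t: "t \<in> {a..b}" for t
  proof -
    have "(\<Sum>y\<in>?Y. indicator (?A y) t * inner2 \<Omega> y \<psi>) = (\<Sum>y\<in>?Y. if s t = y then inner2 \<Omega> y \<psi> else 0)"
      using t by (intro sum.cong refl) (auto simp: indicator_def)
    then show ?thesis using Y(1) t by simp
  qed
  have e2: "(\<Sum>y\<in>?Y. measure lebesgue (?A y) * inner2 \<Omega> y \<psi>) = inner2 \<Omega> (L2_simple_integral a b s) \<psi>"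
    unfolding L2_simple_integral_def[abs_def] using Y \<psi> by (intro sym_form_sum[OF fun_space_L2 sym_form_inner2, symmetric]) auto
  show "((\<lambda>t. inner2 \<Omega> (s t) \<psi>) has_integral inner2 \<Omega> (L2_simple_integral a b s) \<psi>) {a..b}"
    unfolding e2[symmetric] by (rule has_integral_eq[OF e1 h])
  show "L2_simple_integral a b s \<in> L2 \<Omega>"
    unfolding L2_simple_integral_def[abs_def] using Y by (intro fun_space_sum[OF fun_space_L2]) auto
qed

text \<open>Testing with \<open>\<psi>\<close> reduces the Bochner integral to a scalar one: inner
  products with the approximating simple functions differ from the desired one by at most the norm
  of the error times that of \<open>\<psi>\<close>.\<close>

lemma has_L2_integral_inner2:
  fixes \<Omega> :: "(real^'d) set"
  assumes w: "has_L2_integral \<Omega> w a b v" and \<psi>: "\<psi> \<in> L2 \<Omega>"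
  shows "(\<lambda>t. inner2 \<Omega> (w t) \<psi>) absolutely_integrable_on {a..b}"
    and "integral {a..b} (\<lambda>t. inner2 \<Omega> (w t) \<psi>) = inner2 \<Omega> v \<psi>"
proof -
  obtain s where s: "\<And>k::nat. L2_simple \<Omega> a b (s k)"
    and d: "\<And>k. (\<lambda>t. norm2 \<Omega> (\<lambda>x. w t x - s k t x)) absolutely_integrable_on {a..b}"
    and d0: "(\<lambda>k. integral {a..b} (\<lambda>t. norm2 \<Omega> (\<lambda>x. w t x - s k t x))) \<longlonglongrightarrow> 0"
    and v0: "(\<lambda>k. norm2 \<Omega> (\<lambda>x. L2_simple_integral a b (s k) x - v x)) \<longlonglongrightarrow> 0"
    and wL: "\<And>t. t \<in> {a..b} ==> w t \<in> L2 \<Omega>" and vL: "v \<in> L2 \<Omega>"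
    using w unfolding has_L2_integral_def by blast
  let ?d = "\<lambda>k t. norm2 \<Omega> (\<lambda>x. w t x - s k t x) * norm2 \<Omega> \<psi>"
  let ?f = "\<lambda>t. inner2 \<Omega> (w t) \<psi>" and ?I = "\<lambda>k. inner2 \<Omega> (L2_simple_integral a b (s k)) \<psi>"
  define \<delta> where "\<delta> = (\<lambda>k. integral {a..b} (\<lambda>t. norm2 \<Omega> (\<lambda>x. w t x - s k t x)) * norm2 \<Omega> \<psi>)"
  have \<delta>: "\<delta> \<longlonglongrightarrow> 0" unfolding \<delta>_def using tendsto_mult_right[OF d0, of "norm2 \<Omega> \<psi>"] by simp
  have di: "(?d k has_integral \<delta> k) {a..b}" for k
    unfolding \<delta>_def using d[of k] by (intro has_integral_mult_left integrable_integral) (simp add: absolutely_integrable_on_def)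
  note fi = L2_simple_inner2(1)[OF s \<psi>]
  have b: "\<bar>?f t - inner2 \<Omega> (s k t) \<psi>\<bar> \<le> ?d k t" if t: "t \<in> {a..b}" for t k
  proof -
    have sL: "s k t \<in> L2 \<Omega>" using s[of k] t unfolding L2_simple_def by blast
    show ?thesis using abs_inner2_le_norm2[OF L2_diff[OF wL[OF t] sL] \<psi>] inner2_diff[OF wL[OF t] sL \<psi>] by simp
  qed
  \<comment> \<open>Integrability is obtained by squeezing between integrable functions with
    arbitrarily close integrals, which needs no separate proof of measurability.\<close>
  have int: "?f integrable_on {a..b}"
  proof (rule integrable_straddle)
    fix \<epsilon> :: real assume "0 < \<epsilon>"
    then have "\<forall>\<^sub>F k in sequentially. \<bar>\<delta> k\<bar> < \<epsilon> / 2" using tendstoD[OF \<delta>, of "\<epsilon> / 2"] by simp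
    then obtain k where k: "\<bar>\<delta> k\<bar> < \<epsilon> / 2" using eventually_happens'[OF sequentially_bot] by blast
    show "\<exists>g h i j. (g has_integral i) {a..b} \<and> (h has_integral j) {a..b} \<and> \<bar>i - j\<bar> < \<epsilon> \<and> (\<forall>x\<in>{a..b}. g x \<le> ?f x \<and> ?f x \<le> h x)"
    proof (intro exI conjI ballI)
      show "((\<lambda>t. inner2 \<Omega> (s k t) \<psi> - ?d k t) has_integral ?I k - \<delta> k) {a..b}" by (rule has_integral_diff[OF fi di])
      show "((\<lambda>t. inner2 \<Omega> (s k t) \<psi> + ?d k t) has_integral ?I k + \<delta> k) {a..b}" by (rule has_integral_add[OF fi di])
      show "\<bar>(?I k - \<delta> k) - (?I k + \<delta> k)\<bar> < \<epsilon>" using k by simp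
      fix t assume t: "t \<in> {a..b}"
      show "inner2 \<Omega> (s k t) \<psi> - ?d k t \<le> ?f t" "?f t \<le> inner2 \<Omega> (s k t) \<psi> + ?d k t" using b[OF t, of k] by linarith+
    qed
  qed
  have sa: "(\<lambda>t. inner2 \<Omega> (s 0 t) \<psi>) absolutely_integrable_on {a..b}"
  proof -
    have Y: "finite (s 0 ` {a..b})" using s[of 0] by (simp add: L2_simple_def)
    define M where "M = Max (insert 0 ((\<lambda>y. \<bar>inner2 \<Omega> y \<psi>\<bar>) ` (s 0 ` {a..b})))"
    have "norm (inner2 \<Omega> (s 0 t) \<psi>) \<le> M" if "t \<in> {a..b}" for t unfolding M_def using Y that by (intro Max_ge) auto
    then show ?thesis by (rule absolutely_integrable_integrable_bound) (use fi in \<open>auto simp: has_integral_iff\<close>)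
  qed
  show "?f absolutely_integrable_on {a..b}"
  proof (rule absolutely_integrable_integrable_bound[OF _ int])
    show "norm (?f t) \<le> \<bar>inner2 \<Omega> (s 0 t) \<psi>\<bar> + ?d 0 t" if "t \<in> {a..b}" for t using b[OF that, of 0] unfolding real_norm_def by linarith
    show "(\<lambda>t. \<bar>inner2 \<Omega> (s 0 t) \<psi>\<bar> + ?d 0 t) integrable_on {a..b}"
      using sa di[of 0] by (intro Henstock_Kurzweil_Integration.integrable_add) (auto simp: absolutely_integrable_on_def has_integral_iff)
  qed
  have "\<bar>integral {a..b} ?f - ?I k\<bar> \<le> \<delta> k" for k
  proof -
    have h: "((\<lambda>t. ?f t - inner2 \<Omega> (s k t) \<psi>) has_integral integral {a..b} ?f - ?I k) {a..b}"
      by (intro has_integral_diff integrable_integral int fi)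
    have "norm (integral {a..b} (\<lambda>t. ?f t - inner2 \<Omega> (s k t) \<psi>)) \<le> integral {a..b} (?d k)"
      by (rule Henstock_Kurzweil_Integration.integral_norm_bound_integral)
        (use h di[of k] b[of _ k] in \<open>auto simp: has_integral_iff\<close>)
    then show ?thesis using h di[of k] by (simp add: has_integral_iff)
  qed
  then have "(\<lambda>k. integral {a..b} ?f - ?I k) \<longlonglongrightarrow> 0"
    by (intro Lim_null_comparison[OF always_eventually[OF allI] \<delta>]) simp
  from tendsto_diff[OF tendsto_const[of "integral {a..b} ?f"] this] have "?I \<longlonglongrightarrow> integral {a..b} ?f" by simp
  moreover have "?I \<longlonglongrightarrow> inner2 \<Omega> v \<psi>" by (rule tendsto_inner2[OF L2_simple_inner2(2)[OF s \<psi>] vL \<psi> v0])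
  ultimately show "integral {a..b} ?f = inner2 \<Omega> v \<psi>" by (rule LIMSEQ_unique)
qed

lemma L2_time_deriv_inner2:
  fixes \<Omega> :: "(real^'d) set"
  assumes w: "L2_time_deriv \<Omega> T w w'" and \<psi>: "\<psi> \<in> L2 \<Omega>" and t: "t \<in> {0..T}"
  shows "(\<lambda>t. inner2 \<Omega> (w' t) \<psi>) absolutely_integrable_on {0..t}"
    and "inner2 \<Omega> (w t) \<psi> = inner2 \<Omega> (w 0) \<psi> + integral {0..t} (\<lambda>t. inner2 \<Omega> (w' t) \<psi>)"
proof -
  have h: "has_L2_integral \<Omega> w' 0 t (\<lambda>x. w t x - w 0 x)" and L: "w t \<in> L2 \<Omega>" "w 0 \<in> L2 \<Omega>"
    using w t unfolding L2_time_deriv_def by auto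
  show "(\<lambda>t. inner2 \<Omega> (w' t) \<psi>) absolutely_integrable_on {0..t}" by (rule has_L2_integral_inner2(1)[OF h \<psi>])
  show "inner2 \<Omega> (w t) \<psi> = inner2 \<Omega> (w 0) \<psi> + integral {0..t} (\<lambda>t. inner2 \<Omega> (w' t) \<psi>)"
    using has_L2_integral_inner2(2)[OF h \<psi>] inner2_diff[OF L \<psi>] by simp
qed

text \<open>Both weak derivatives integrate coordinatewise, and the formula for repeated integration
  turns the iterated integral of the second derivative into the Taylor remainder.\<close>

lemma taylor_inner2:
  fixes \<Omega> :: "(real^'d) set"
  assumes g: "L2_time_deriv \<Omega> T g g'" "L2_time_deriv \<Omega> T g' g''" and \<psi>: "\<psi> \<in> L2 \<Omega>" and t: "t \<in> {0..T}"
  shows "inner2 \<Omega> (g t) \<psi> = inner2 \<Omega> (g 0) \<psi> + t * inner2 \<Omega> (g' 0) \<psi> + integral {0..t} (\<lambda>z. (t - z) * inner2 \<Omega> (g'' z) \<psi>)"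
proof -
  let ?G2 = "\<lambda>t. inner2 \<Omega> (g'' t) \<psi>"
  note a = L2_time_deriv_inner2(1)[OF g(2) \<psi> t]
  have c: "(\<lambda>s. integral {0..s} ?G2) integrable_on {0..t}"
    by (rule integrable_continuous_real, rule indefinite_integral_continuous_1) (use a in \<open>simp add: absolutely_integrable_on_def\<close>)
  have "integral {0..t} (\<lambda>s. inner2 \<Omega> (g' s) \<psi>) = integral {0..t} (\<lambda>s. inner2 \<Omega> (g' 0) \<psi> + integral {0..s} ?G2)"
    using t by (intro Henstock_Kurzweil_Integration.integral_cong L2_time_deriv_inner2(2)[OF g(2) \<psi>]) auto
  also have "\<dots> = t * inner2 \<Omega> (g' 0) \<psi> + integral {0..t} (\<lambda>s. integral {0..s} ?G2)"
    using t by (subst Henstock_Kurzweil_Integration.integral_add[OF _ c]) auto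
  also have "integral {0..t} (\<lambda>s. integral {0..s} ?G2) = integral {0..t} (\<lambda>z. (t - z) * ?G2 z)"
    by (rule double_integral_eq[OF a]) (use t in simp)
  finally show ?thesis using L2_time_deriv_inner2(2)[OF g(1) \<psi> t] by simp
qed

lemma continuous_on_inner2:
  fixes \<Omega> :: "(real^'d) set"
  assumes w: "L2_time_deriv \<Omega> T w w'" and \<psi>: "\<psi> \<in> L2 \<Omega>" and T: "0 \<le> T"
  shows "continuous_on {0..T} (\<lambda>t. inner2 \<Omega> (w t) \<psi>)"
proof -
  have "continuous_on {0..T} (\<lambda>t. inner2 \<Omega> (w 0) \<psi> + integral {0..t} (\<lambda>t. inner2 \<Omega> (w' t) \<psi>))"
    using L2_time_deriv_inner2(1)[OF w \<psi>, of T] T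
    by (intro continuous_intros indefinite_integral_continuous_1) (simp add: absolutely_integrable_on_def)
  then show ?thesis by (rule continuous_on_eq) (rule L2_time_deriv_inner2(2)[OF w \<psi>, symmetric])
qed

section \<open>The error estimate\<close>

text \<open>Multipliers bounded by \<open>A\<close> act in the eigenbasis as an operator of norm at
  most \<open>A\<close>; this is where the uniformity of the scalar bounds in the eigenvalue becomes
  a bound in the norm.\<close>

lemma norm2_expansion_le:
  fixes \<Omega> :: "(real^'d) set"
  assumes eb: "eigenbasis \<Omega> X Ah m e l" and p: "p \<in> L2 \<Omega>" and I: "\<And>i. i < m ==> \<bar>I i\<bar> \<le> A" and A: "0 \<le> A"
  shows "(\<Sum>i<m. d i * (I i * inner2 \<Omega> p (e i))) \<le> A * norm2 \<Omega> p * norm2 \<Omega> (\<lambda>x. \<Sum>i<m. d i * e i x)"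
proof -
  let ?v = "\<lambda>x. \<Sum>i<m. d i * I i * e i x" and ?w = "\<lambda>x. \<Sum>i<m. d i * e i x"
  have n: "(norm2 \<Omega> (\<lambda>x. \<Sum>i<m. c i * e i x))\<^sup>2 = (\<Sum>i<m. (c i)\<^sup>2)" for c
    unfolding norm2_square using orthonormal_expansion_form[OF eigenbasis_facts(1,4,5)[OF eb], of c c] by (simp add: power2_eq_square)
  have v: "?v \<in> L2 \<Omega>" by (rule subsetD[OF eigenbasis_facts(2)[OF eb] expansion_in[OF eb]])
  have "(\<Sum>i<m. d i * (I i * inner2 \<Omega> p (e i))) = (\<Sum>i<m. d i * I i * inner2 \<Omega> (e i) p)"
    by (simp only: mult.assoc inner2_commute[of \<Omega> p])
  also have "\<dots> = inner2 \<Omega> ?v p"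
    using eigenbasis_facts(10)[OF eb] p by (intro sym_form_sum[OF fun_space_L2 sym_form_inner2, symmetric]) auto
  also have "\<dots> \<le> norm2 \<Omega> ?v * norm2 \<Omega> p" by (rule inner2_le_norm2[OF v p])
  also have "norm2 \<Omega> ?v \<le> A * norm2 \<Omega> ?w"
  proof (rule power2_le_imp_le)
    have "(d i * I i)\<^sup>2 \<le> A\<^sup>2 * (d i)\<^sup>2" if "i < m" for i
    proof -
      have "(I i)\<^sup>2 \<le> A\<^sup>2" using I[OF that] A by (simp add: abs_le_square_iff[symmetric])
      then show ?thesis unfolding power_mult_distrib mult.commute[of "(d i)\<^sup>2"] by (rule mult_right_mono) simp
    qed
    then show "(norm2 \<Omega> ?v)\<^sup>2 \<le> (A * norm2 \<Omega> ?w)\<^sup>2"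
      unfolding power_mult_distrib n by (auto simp: sum_distrib_left intro!: sum_mono)
  qed (use A in simp)
  finally show ?thesis by (simp add: mult_ac mult_right_mono)
qed

text \<open>Testing the error with itself avoids the norm of a Bochner integral.\<close>

lemma norm2_error_le:
  fixes \<Omega> :: "(real^'d) set" and t :: real
  assumes eb: "eigenbasis \<Omega> X Ah m e l" and p: "p0 \<in> L2 \<Omega>" "p1 \<in> L2 \<Omega>" "\<And>\<zeta>. \<zeta> \<in> {0..t} ==> p2 \<zeta> \<in> L2 \<Omega>"
    and I: "\<And>i. i < m ==> \<bar>I0 i\<bar> \<le> A0" "\<And>i. i < m ==> \<bar>I1 i\<bar> \<le> A1" and A: "0 \<le> A0" "0 \<le> A1"
    and Q: "\<And>i \<zeta>. i < m ==> 0 < \<zeta> ==> \<zeta> < t ==> \<bar>Q i \<zeta>\<bar> \<le> q \<zeta>" and q0: "\<And>\<zeta>. \<zeta> \<in> {0..t} ==> 0 \<le> q \<zeta>"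
    and qi: "(\<lambda>\<zeta>. q \<zeta> * norm2 \<Omega> (p2 \<zeta>)) integrable_on {0..t}"
    and Qi: "\<And>i. i < m ==> (\<lambda>\<zeta>. Q i \<zeta> * inner2 \<Omega> (p2 \<zeta>) (e i)) integrable_on {0..t}"
    and d: "\<And>i. i < m ==> d i = inner2 \<Omega> p0 (e i) * I0 i + inner2 \<Omega> p1 (e i) * I1 i + integral {0..t} (\<lambda>\<zeta>. Q i \<zeta> * inner2 \<Omega> (p2 \<zeta>) (e i))"
  shows "norm2 \<Omega> (\<lambda>x. \<Sum>i<m. d i * e i x) \<le> A0 * norm2 \<Omega> p0 + A1 * norm2 \<Omega> p1 + integral {0..t} (\<lambda>\<zeta>. q \<zeta> * norm2 \<Omega> (p2 \<zeta>))"
proof -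
  let ?R = "norm2 \<Omega> (\<lambda>x. \<Sum>i<m. d i * e i x)" and ?J = "integral {0..t} (\<lambda>\<zeta>. q \<zeta> * norm2 \<Omega> (p2 \<zeta>))"
  have J0: "0 \<le> ?J" using q0 by (intro Henstock_Kurzweil_Integration.integral_nonneg qi) simp
  have "?R\<^sup>2 = (\<Sum>i<m. d i * d i)"
    unfolding norm2_square by (rule orthonormal_expansion_form[OF eigenbasis_facts(1,4,5)[OF eb]])
  also have "\<dots> = (\<Sum>i<m. d i * (I0 i * inner2 \<Omega> p0 (e i)) + d i * (I1 i * inner2 \<Omega> p1 (e i)) + d i * integral {0..t} (\<lambda>\<zeta>. Q i \<zeta> * inner2 \<Omega> (p2 \<zeta>) (e i)))"
  proof (rule sum.cong[OF refl])
    fix i assume "i \<in> {..<m}"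
    then have D: "d i = inner2 \<Omega> p0 (e i) * I0 i + inner2 \<Omega> p1 (e i) * I1 i + integral {0..t} (\<lambda>\<zeta>. Q i \<zeta> * inner2 \<Omega> (p2 \<zeta>) (e i))" by (intro d) simp
    show "d i * d i = d i * (I0 i * inner2 \<Omega> p0 (e i)) + d i * (I1 i * inner2 \<Omega> p1 (e i)) + d i * integral {0..t} (\<lambda>\<zeta>. Q i \<zeta> * inner2 \<Omega> (p2 \<zeta>) (e i))"
      using arg_cong[OF D, of "(*) (d i)"]
      by (simp only: distrib_left mult.commute[of "inner2 \<Omega> p0 (e i)" "I0 i"] mult.commute[of "inner2 \<Omega> p1 (e i)" "I1 i"])
  qed
  also have "\<dots> = (\<Sum>i<m. d i * (I0 i * inner2 \<Omega> p0 (e i))) + (\<Sum>i<m. d i * (I1 i * inner2 \<Omega> p1 (e i)))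
      + (\<Sum>i<m. d i * integral {0..t} (\<lambda>\<zeta>. Q i \<zeta> * inner2 \<Omega> (p2 \<zeta>) (e i)))" by (simp only: sum.distrib)
  also have "\<dots> \<le> A0 * norm2 \<Omega> p0 * ?R + A1 * norm2 \<Omega> p1 * ?R + ?J * ?R"
  proof (intro add_mono norm2_expansion_le[OF eb p(1) I(1) A(1)] norm2_expansion_le[OF eb p(2) I(2) A(2)])
    let ?h = "\<lambda>\<zeta>. \<Sum>i<m. d i * (Q i \<zeta> * inner2 \<Omega> (p2 \<zeta>) (e i))"
    have hi: "?h integrable_on {0..t}" using Qi by (intro integrable_sum integrable_on_mult_right) auto
    have "(\<Sum>i<m. d i * integral {0..t} (\<lambda>\<zeta>. Q i \<zeta> * inner2 \<Omega> (p2 \<zeta>) (e i))) = (\<Sum>i<m. integral {0..t} (\<lambda>\<zeta>. d i * (Q i \<zeta> * inner2 \<Omega> (p2 \<zeta>) (e i))))" by simp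
    also have "\<dots> = integral {0..t} ?h" using Qi by (intro Henstock_Kurzweil_Integration.integral_sum[symmetric] integrable_on_mult_right) auto
    \<comment> \<open>The bound on \<open>Q\<close> is available only in the open interval, so the
      integrand is set to 0 at the end points before the comparison.\<close>
    also have "\<dots> = integral {0..t} (\<lambda>\<zeta>. if \<zeta> \<in> {0, t} then 0 else ?h \<zeta>)" by (rule integral_spike[of "{0, t}"]) auto
    also have "\<dots> \<le> integral {0..t} (\<lambda>\<zeta>. q \<zeta> * norm2 \<Omega> (p2 \<zeta>) * ?R)"
    proof (rule Henstock_Kurzweil_Integration.integral_le)
      show "(\<lambda>\<zeta>. if \<zeta> \<in> {0, t} then 0 else ?h \<zeta>) integrable_on {0..t}"
        by (rule integrable_spike[OF hi, of "{0, t}"]) auto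
      show "(\<lambda>\<zeta>. q \<zeta> * norm2 \<Omega> (p2 \<zeta>) * ?R) integrable_on {0..t}" by (rule integrable_on_mult_left[OF qi])
      fix \<zeta> assume z: "\<zeta> \<in> {0..t}"
      show "(if \<zeta> \<in> {0, t} then 0 else ?h \<zeta>) \<le> q \<zeta> * norm2 \<Omega> (p2 \<zeta>) * ?R"
      proof (cases "\<zeta> \<in> {0, t}")
        case True
        then show ?thesis using q0[OF z] by auto
      next
        case False
        then have "0 < \<zeta>" "\<zeta> < t" using z by auto
        then have "\<bar>Q i \<zeta>\<bar> \<le> q \<zeta>" if "i < m" for i by (rule Q[OF that])
        from norm2_expansion_le[OF eb p(3)[OF z] this q0[OF z]] show ?thesis using False by simp
      qed
    qed
    also have "\<dots> = ?J * ?R" by simp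
    finally show "(\<Sum>i<m. d i * integral {0..t} (\<lambda>\<zeta>. Q i \<zeta> * inner2 \<Omega> (p2 \<zeta>) (e i))) \<le> ?J * ?R" .
  qed
  also have "\<dots> = (A0 * norm2 \<Omega> p0 + A1 * norm2 \<Omega> p1 + ?J) * ?R" by (simp add: distrib_right)
  finally have "?R * ?R \<le> (A0 * norm2 \<Omega> p0 + A1 * norm2 \<Omega> p1 + ?J) * ?R" by (simp add: power2_eq_square)
  then show ?thesis
  proof (cases "?R = 0")
    case True
    then show ?thesis using A J0 by simp
  next
    case False
    then have "0 < ?R" using norm2_nonneg[of \<Omega> "\<lambda>x. \<Sum>i<m. d i * e i x"] by linarith
    then show ?thesis using \<open>?R * ?R \<le> _\<close> by (simp add: mult_le_cancel_right_pos)
  qed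
qed

text \<open>The scalar bounds enter as hypotheses so that their constants are fixed before mesh,
  step size and data are chosen.\<close>

lemma cn2_error_estimate:
  fixes \<Omega> :: "(real^'d) set" and g g' g'' :: "real => real^'d => real"
  assumes \<Omega>: "open \<Omega>" "elliptic_operator \<Omega> a c0" "regular_triangulation \<kappa> \<Omega> h \<T>"
    and \<alpha>: "0 < \<alpha>" "\<alpha> < 1" and T: "0 < T" and \<mu>: "- 1 < \<mu>" "\<mu> < 0"
    and C: "0 < C0" "0 < C1" "0 < C2"
    and b0: "\<And>la \<tau> t. 0 < la ==> 0 < \<tau> ==> 0 < t ==>
      \<bar>integral {0..t} (\<lambda>s. err0 \<alpha> la \<tau> (t - s) * s powr \<mu>)\<bar> \<le> C0 * \<tau>\<^sup>2 * t powr (\<alpha> + \<mu> - 2)"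
    and b1: "\<And>la \<tau> t. 0 < la ==> 0 < \<tau> ==> 0 < t ==>
      \<bar>integral {0..t} (\<lambda>s. err0 \<alpha> la \<tau> (t - s) * s powr (\<mu> + 1))\<bar> \<le> C1 * \<tau>\<^sup>2 * t powr (\<alpha> + (\<mu> + 1) - 2)"
    and b2: "\<And>la \<tau> z t. 0 < la ==> 0 < \<tau> ==> 0 < z ==> z < t ==>
      \<bar>integral {z..t} (\<lambda>s. err0 \<alpha> la \<tau> (t - s) * (s powr \<mu> * (s - z)))\<bar>
        \<le> C2 * \<tau>\<^sup>2 * ((t - z) powr (\<alpha> - 1) * z powr \<mu> + t powr (\<alpha> + (\<mu> - 1) / 2) * z powr ((\<mu> - 1) / 2))"
    and g: "L2_time_deriv \<Omega> T g g'" "L2_time_deriv \<Omega> T g' g''"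
    and w1: "\<And>t. t \<in> {0<..T} ==> (\<lambda>z. (t - z) powr (\<alpha> - 1) * z powr \<mu> * norm2 \<Omega> (g'' z)) absolutely_integrable_on {0..t}"
    and w2: "\<And>t. t \<in> {0<..T} ==> (\<lambda>z. z powr ((\<mu> - 1) / 2) * norm2 \<Omega> (g'' z)) absolutely_integrable_on {0..t}"
    and X: "X = fe_space \<Omega> \<T>" "Ah = discrete_op \<Omega> a c0 X" "fh = (\<lambda>t. L2_proj \<Omega> X (\<lambda>x. t powr \<mu> * g t x))"
    and uh0: "uh0 = L2_proj \<Omega> X (\<lambda>_. 0)" and uh: "semidiscrete_solution X Ah \<alpha> T fh uh0 uh"
    and N: "1 \<le> N" "\<tau> = T / real N" and un: "cn2_scheme X Ah \<alpha> \<tau> N fh uh0 U un" and n: "1 \<le> n" "n \<le> N"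
    and t: "t = real n * \<tau>"
  shows "norm2 \<Omega> (\<lambda>x. uh t x - un n x) \<le> (C0 + C1 + C2) * \<tau>\<^sup>2 *
        (t powr (\<alpha> + \<mu> - 2) * norm2 \<Omega> (g 0) + t powr (\<alpha> + \<mu> - 1) * norm2 \<Omega> (g' 0)
         + integral {0..t} (\<lambda>z. (t - z) powr (\<alpha> - 1) * z powr \<mu> * norm2 \<Omega> (g'' z))
         + t powr (\<alpha> + (\<mu> - 1) / 2) * integral {0..t} (\<lambda>z. z powr ((\<mu> - 1) / 2) * norm2 \<Omega> (g'' z)))"
proof -
  obtain m e l where eb: "eigenbasis \<Omega> X Ah m e l"
    unfolding X(2) unfolding X(1) by (rule fe_eigenbasis_exists[OF \<Omega>])
  note eL = eigenbasis_facts(10)[OF eb] and lp = eigenbasis_facts(7)[OF eb]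
  have gL: "g s \<in> L2 \<Omega>" "g' s \<in> L2 \<Omega>" if "s \<in> {0..T}" for s using g that by (auto simp: L2_time_deriv_def)
  have g2L: "g'' s \<in> L2 \<Omega>" if "s \<in> {0..T}" for s
    using g(2) that T unfolding L2_time_deriv_def has_L2_integral_def by (meson atLeastAtMost_iff order_refl less_imp_le)
  define F where "F = (\<lambda>i s. s powr \<mu> * inner2 \<Omega> (g s) (e i))"
  have fh: "fh s = (\<lambda>x. \<Sum>i<m. F i s * e i x)" if "0 \<le> s" "s \<le> T" for s
    unfolding X(3) using L2_proj_expansion[OF eb L2_scale[OF gL(1)], of s "s powr \<mu>"] that by (simp add: F_def inner2_scale)
  have "(\<lambda>_. 0) \<in> L2 \<Omega>" by (simp add: L2_def)
  from L2_proj_expansion[OF eb this] have uh00: "uh0 = (\<lambda>_. 0)" unfolding uh0 by (simp add: inner2_def)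
  have Fi: "F i absolutely_integrable_on {0..T}" if i: "i < m" for i
  proof -
    have "(\<lambda>s. s powr \<mu>) absolutely_integrable_on {0..T}"
      using \<mu> T by (intro nonnegative_absolutely_integrable_1 integrable_on_powr_from_0) auto
    from absolutely_integrable_mult_continuous[OF continuous_on_inner2[OF g(1) eL[OF i]] this] T
    show ?thesis by (simp add: F_def[abs_def] mult.commute)
  qed
  have \<tau>: "0 < \<tau>" "real N * \<tau> \<le> T" using N T by auto
  have "real n * \<tau> \<le> real N * \<tau>" using n \<tau> by (intro mult_right_mono) auto
  then have tT: "0 < t" "t \<le> T" using \<tau> n order_trans[OF _ \<tau>(2)] by (auto simp: t)
  have sub: "f absolutely_integrable_on {0..t}" if "f absolutely_integrable_on {0..T}" for f :: "real => real"
    using that by (rule absolutely_integrable_on_subinterval) (use tT in auto)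
  let ?ml = "\<lambda>i s. ml_kernel \<alpha> (l i) (t - s) * F i s"
  let ?cq = "\<lambda>i s. \<tau> powr (\<alpha> - 1) * cq_kernel \<alpha> (l i * \<tau> powr \<alpha>) ((t - s) / \<tau>) * F i s"
  let ?er = "\<lambda>i s. err0 \<alpha> (l i) \<tau> (t - s) * (s powr \<mu> * inner2 \<Omega> (g s) (e i))"
  define I0 where "I0 = (\<lambda>i. integral {0..t} (\<lambda>s. err0 \<alpha> (l i) \<tau> (t - s) * s powr \<mu>))"
  define I1 where "I1 = (\<lambda>i. integral {0..t} (\<lambda>s. err0 \<alpha> (l i) \<tau> (t - s) * s powr (\<mu> + 1)))"
  define Q where "Q = (\<lambda>i z. integral {z..t} (\<lambda>s. err0 \<alpha> (l i) \<tau> (t - s) * (s powr \<mu> * (s - z))))"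
  define d where "d = (\<lambda>i. inner2 \<Omega> (g 0) (e i) * I0 i + inner2 \<Omega> (g' 0) (e i) * I1 i + integral {0..t} (\<lambda>z. Q i z * inner2 \<Omega> (g'' z) (e i)))"
  have er: "(?er i has_integral d i) {0..t}" "(\<lambda>z. Q i z * inner2 \<Omega> (g'' z) (e i)) absolutely_integrable_on {0..t}" if i: "i < m" for i
  proof -
    have G2: "(\<lambda>z. inner2 \<Omega> (g'' z) (e i)) absolutely_integrable_on {0..t}"
      using tT by (intro L2_time_deriv_inner2(1)[OF g(2) eL[OF i]]) auto
    have G: "inner2 \<Omega> (g s) (e i) = inner2 \<Omega> (g 0) (e i) + s * inner2 \<Omega> (g' 0) (e i) + integral {0..s} (\<lambda>z. (s - z) * inner2 \<Omega> (g'' z) (e i))"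
      if "s \<in> {0..t}" for s using that tT by (intro taylor_inner2[OF g eL[OF i]]) auto
    note r = error_representation[OF \<alpha> lp[OF i] \<tau>(1) \<mu>(1) tT(1) G2, OF G]
    show "(?er i has_integral d i) {0..t}" unfolding d_def I0_def I1_def Q_def by (rule r(1))
    show "(\<lambda>z. Q i z * inner2 \<Omega> (g'' z) (e i)) absolutely_integrable_on {0..t}" unfolding Q_def by (rule r(2))
  qed
  have cqi: "?cq i integrable_on {0..t}" if "i < m" for i
    using discrete_duhamel(2)[OF \<tau>(1), where F = "F i" and n = n and \<alpha> = \<alpha> and la = "l i * \<tau> powr \<alpha>"] sub[OF Fi[OF that]] by (simp add: t)
  \<comment> \<open>Scaling puts both kernels at step size 1, where their difference is
    \<open>kernel_error\<close>; thus the continuous convolution is the discrete one plus the error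
    term.\<close>
  have split: "?ml i s = ?er i s + ?cq i s" for i s
  proof -
    have "ml_kernel \<alpha> (l i) (t - s) = \<tau> powr (\<alpha> - 1) * ml_kernel \<alpha> (l i * \<tau> powr \<alpha>) ((t - s) / \<tau>)"
      unfolding ml_kernel_scale[OF \<tau>(1) \<alpha>(1), symmetric] using \<tau>(1) by simp
    then show ?thesis by (simp add: err0_def kernel_error_def F_def algebra_simps)
  qed
  have ml: "(?ml i has_integral d i + integral {0..t} (?cq i)) {0..t}" if "i < m" for i
    unfolding split by (intro has_integral_add er integrable_integral cqi that)
  have "uh t x - un n x = (\<Sum>i<m. d i * e i x)" for x
  proof -
    have "uh t = (\<lambda>x. \<Sum>i<m. integral {0..t} (?ml i) * e i x)"
      by (rule semidiscrete_modes[OF eb \<alpha> fh uh[unfolded uh00] tT]) (use ml in \<open>auto simp: has_integral_iff\<close>)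
    moreover have "un n = (\<lambda>x. \<Sum>i<m. integral {0..t} (?cq i) * e i x)"
      unfolding t by (rule cn2_scheme_modes[OF eb \<alpha> fh un[unfolded uh00] \<tau> n Fi])
    moreover have "integral {0..t} (?ml i) = d i + integral {0..t} (?cq i)" if "i < m" for i using ml[OF that] by (rule integral_unique)
    ultimately show ?thesis by (simp add: distrib_right sum.distrib)
  qed
  then have diff: "(\<lambda>x. uh t x - un n x) = (\<lambda>x. \<Sum>i<m. d i * e i x)" by blast
  let ?W1 = "\<lambda>z. (t - z) powr (\<alpha> - 1) * z powr \<mu> * norm2 \<Omega> (g'' z)" and ?W2 = "\<lambda>z. z powr ((\<mu> - 1) / 2) * norm2 \<Omega> (g'' z)"
  let ?p = "t powr (\<alpha> + (\<mu> - 1) / 2)"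
  let ?S = "t powr (\<alpha> + \<mu> - 2) * norm2 \<Omega> (g 0) + t powr (\<alpha> + \<mu> - 1) * norm2 \<Omega> (g' 0) + integral {0..t} ?W1 + ?p * integral {0..t} ?W2"
  let ?q = "\<lambda>z. C2 * \<tau>\<^sup>2 * ((t - z) powr (\<alpha> - 1) * z powr \<mu> + ?p * z powr ((\<mu> - 1) / 2))"
  have W: "?W1 integrable_on {0..t}" "?W2 integrable_on {0..t}"
    using w1[of t] w2[of t] tT by (auto simp: absolutely_integrable_on_def)
  have q: "((\<lambda>z. ?q z * norm2 \<Omega> (g'' z)) has_integral C2 * \<tau>\<^sup>2 * (integral {0..t} ?W1 + ?p * integral {0..t} ?W2)) {0..t}"
  proof -
    have "((\<lambda>z. C2 * \<tau>\<^sup>2 * (?W1 z + ?p * ?W2 z)) has_integral C2 * \<tau>\<^sup>2 * (integral {0..t} ?W1 + ?p * integral {0..t} ?W2)) {0..t}"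
      by (intro has_integral_mult_right has_integral_add integrable_integral W)
    moreover have "C2 * \<tau>\<^sup>2 * (?W1 z + ?p * ?W2 z) = ?q z * norm2 \<Omega> (g'' z)" for z
      by (simp only: distrib_right distrib_left mult.assoc)
    ultimately show ?thesis by simp
  qed
  have "norm2 \<Omega> (\<lambda>x. \<Sum>i<m. d i * e i x) \<le> (C0 * \<tau>\<^sup>2 * t powr (\<alpha> + \<mu> - 2)) * norm2 \<Omega> (g 0)
      + (C1 * \<tau>\<^sup>2 * t powr (\<alpha> + (\<mu> + 1) - 2)) * norm2 \<Omega> (g' 0) + integral {0..t} (\<lambda>z. ?q z * norm2 \<Omega> (g'' z))"
  proof (rule norm2_error_le[OF eb, where Q = Q and ?I0.0 = I0 and ?I1.0 = I1])
    show "\<bar>I0 i\<bar> \<le> C0 * \<tau>\<^sup>2 * t powr (\<alpha> + \<mu> - 2)" if "i < m" for i unfolding I0_def by (rule b0[OF lp[OF that] \<tau>(1) tT(1)])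
    show "\<bar>I1 i\<bar> \<le> C1 * \<tau>\<^sup>2 * t powr (\<alpha> + (\<mu> + 1) - 2)" if "i < m" for i unfolding I1_def by (rule b1[OF lp[OF that] \<tau>(1) tT(1)])
    show "\<bar>Q i z\<bar> \<le> ?q z" if "i < m" "0 < z" "z < t" for i z unfolding Q_def by (rule b2[OF lp[OF that(1)] \<tau>(1) that(2,3)])
    show "(\<lambda>z. ?q z * norm2 \<Omega> (g'' z)) integrable_on {0..t}" using q by (rule has_integral_integrable)
    show "(\<lambda>z. Q i z * inner2 \<Omega> (g'' z) (e i)) integrable_on {0..t}" if "i < m" for i
      using er(2)[OF that] by (simp add: absolutely_integrable_on_def)
    show "d i = inner2 \<Omega> (g 0) (e i) * I0 i + inner2 \<Omega> (g' 0) (e i) * I1 i + integral {0..t} (\<lambda>z. Q i z * inner2 \<Omega> (g'' z) (e i))" if "i < m" for i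
      by (simp add: d_def)
  qed (use gL[of 0] g2L T tT C in \<open>auto intro!: mult_nonneg_nonneg add_nonneg_nonneg\<close>)
  also have "\<dots> = (C0 * \<tau>\<^sup>2) * (t powr (\<alpha> + \<mu> - 2) * norm2 \<Omega> (g 0)) + (C1 * \<tau>\<^sup>2) * (t powr (\<alpha> + \<mu> - 1) * norm2 \<Omega> (g' 0))
      + (C2 * \<tau>\<^sup>2) * (integral {0..t} ?W1 + ?p * integral {0..t} ?W2)"
  proof -
    have "\<alpha> + (\<mu> + 1) - 2 = \<alpha> + \<mu> - 1" by simp
    then show ?thesis unfolding integral_unique[OF q] by (simp only: mult.assoc)
  qed
  \<comment> \<open>Each of the three contributions is bounded by its own constant times the full
    bracket, all terms of which are nonnegative; this leads to the sum of the constants.\<close>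
  also have "\<dots> \<le> (C0 * \<tau>\<^sup>2) * ?S
      + (C1 * \<tau>\<^sup>2) * ?S
      + (C2 * \<tau>\<^sup>2) * ?S"
  proof -
    have "0 \<le> integral {0..t} ?W1" "0 \<le> integral {0..t} ?W2"
      by (intro Henstock_Kurzweil_Integration.integral_nonneg W; simp)+
    then have "0 \<le> integral {0..t} ?W1" "0 \<le> ?p * integral {0..t} ?W2" by simp_all
    moreover have "0 \<le> t powr (\<alpha> + \<mu> - 2) * norm2 \<Omega> (g 0)" "0 \<le> t powr (\<alpha> + \<mu> - 1) * norm2 \<Omega> (g' 0)" by simp_all
    ultimately show ?thesis using C by (intro add_mono mult_left_mono) (linarith | simp)+
  qed
  also have "\<dots> = (C0 + C1 + C2) * \<tau>\<^sup>2 * ?S"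
    by (simp only: distrib_right)
  finally show ?thesis unfolding diff .
qed

theorem theorem4p2:
  fixes \<Omega> :: "(real^'d) set"
    and a :: "real^'d \<Rightarrow> real^'d^'d"
    and c0 :: "real^'d \<Rightarrow> real"
    and \<alpha> \<mu> T \<kappa> :: real
  assumes "CARD('d) = 1 \<or> CARD('d) = 2"
    and "open \<Omega>" "connected \<Omega>" "\<Omega> \<noteq> {}" "bounded \<Omega>"
    and "elliptic_operator \<Omega> a c0"
    and "0 < \<alpha>" "\<alpha> < 1" "0 < T" "- 1 < \<mu>" "\<mu> < 0"
  shows "\<exists>c>0. \<forall>(h::real) (\<T>::(real^'d) set set) (N::nat)
      (g::real \<Rightarrow> real^'d \<Rightarrow> real) (g'::real \<Rightarrow> real^'d \<Rightarrow> real) (g''::real \<Rightarrow> real^'d \<Rightarrow> real)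
      (u0::real^'d \<Rightarrow> real) (f::real \<Rightarrow> real^'d \<Rightarrow> real)
      X Ah fh uh0 (uh::real \<Rightarrow> real^'d \<Rightarrow> real) (\<tau>::real) U un.
    regular_triangulation \<kappa> \<Omega> h \<T> \<and>
    W1inf \<Omega> T g g' \<and> L2_time_deriv \<Omega> T g' g'' \<and>
    (\<forall>t\<in>{0<..T}. (\<lambda>\<zeta>. (t - \<zeta>) powr (\<alpha> - 1) * \<zeta> powr \<mu> * norm2 \<Omega> (g'' \<zeta>))
        absolutely_integrable_on {0..t}) \<and>
    (\<forall>t\<in>{0<..T}. (\<lambda>\<zeta>. \<zeta> powr ((\<mu> - 1) / 2) * norm2 \<Omega> (g'' \<zeta>))
        absolutely_integrable_on {0..t}) \<and>
    u0 = (\<lambda>_. 0) \<and> f = (\<lambda>t x. t powr \<mu> * g t x) \<and>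
    X = fe_space \<Omega> \<T> \<and> Ah = discrete_op \<Omega> a c0 X \<and>
    fh = (\<lambda>t. L2_proj \<Omega> X (f t)) \<and> uh0 = L2_proj \<Omega> X u0 \<and>
    semidiscrete_solution X Ah \<alpha> T fh uh0 uh \<and>
    1 \<le> N \<and> \<tau> = T / real N \<and>
    cn2_scheme X Ah \<alpha> \<tau> N fh uh0 U un \<longrightarrow>
    (\<forall>n\<in>{1..N}. let t\<^sub>n = real n * \<tau> in
      norm2 \<Omega> (\<lambda>x. uh t\<^sub>n x - un n x) \<le> c * \<tau>\<^sup>2 *
        (t\<^sub>n powr (\<alpha> + \<mu> - 2) * norm2 \<Omega> (g 0)
         + t\<^sub>n powr (\<alpha> + \<mu> - 1) * norm2 \<Omega> (g' 0)
         + integral {0..t\<^sub>n} (\<lambda>\<zeta>. (t\<^sub>n - \<zeta>) powr (\<alpha> - 1) * \<zeta> powr \<mu> * norm2 \<Omega> (g'' \<zeta>))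
         + t\<^sub>n powr (\<alpha> + (\<mu> - 1) / 2) *
           integral {0..t\<^sub>n} (\<lambda>\<zeta>. \<zeta> powr ((\<mu> - 1) / 2) * norm2 \<Omega> (g'' \<zeta>))))"
proof -
  have \<mu>: "\<mu> \<le> 1" "- 1 < \<mu> + 1" "\<mu> + 1 \<le> 1" using assms(10,11) by simp_all
  obtain C0 where C0: "0 < C0" and b0: "\<And>la \<tau> t. 0 < la ==> 0 < \<tau> ==> 0 < t ==>
      \<bar>integral {0..t} (\<lambda>s. err0 \<alpha> la \<tau> (t - s) * s powr \<mu>)\<bar> \<le> C0 * \<tau>\<^sup>2 * t powr (\<alpha> + \<mu> - 2)"
    by (rule err0_power_bound[OF assms(7,8,10) \<mu>(1)]) blast
  \<comment> \<open>The exponent \<open>\<mu> + 1\<close> belongs to the linear term of the Taylor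
    expansion multiplied by t^\<mu>.\<close>
  obtain C1 where C1: "0 < C1" and b1: "\<And>la \<tau> t. 0 < la ==> 0 < \<tau> ==> 0 < t ==>
      \<bar>integral {0..t} (\<lambda>s. err0 \<alpha> la \<tau> (t - s) * s powr (\<mu> + 1))\<bar> \<le> C1 * \<tau>\<^sup>2 * t powr (\<alpha> + (\<mu> + 1) - 2)"
    by (rule err0_power_bound[OF assms(7,8) \<mu>(2,3)]) blast
  obtain C2 where C2: "0 < C2" and b2: "\<And>la \<tau> \<zeta> t. 0 < la ==> 0 < \<tau> ==> 0 < \<zeta> ==> \<zeta> < t ==>
      \<bar>integral {\<zeta>..t} (\<lambda>s. err0 \<alpha> la \<tau> (t - s) * (s powr \<mu> * (s - \<zeta>)))\<bar>
        \<le> C2 * \<tau>\<^sup>2 * ((t - \<zeta>) powr (\<alpha> - 1) * \<zeta> powr \<mu> + t powr (\<alpha> + (\<mu> - 1) / 2) * \<zeta> powr ((\<mu> - 1) / 2))"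
    by (rule err0_ramp_bound[OF assms(7,8,10,11)]) blast
  show ?thesis unfolding Let_def
  proof (intro exI[of _ "C0 + C1 + C2"] conjI allI impI ballI, goal_cases)
    case 1
    show ?case using C0 C1 C2 by simp
  next
    case (2 h \<T> N g g' g'' u0 f X Ah fh uh0 uh \<tau> U un n)
    then show ?case
      by (intro cn2_error_estimate[where \<kappa> = \<kappa> and h = h and \<T> = \<T> and g' = g' and X = X and Ah = Ah and fh = fh and N = N and U = U and ?uh0.0 = uh0,
            OF assms(2,6) _ assms(7-11) C0 C1 C2 b0 b1 b2])
        (auto simp: W1inf_def)
  qed
qed

end
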